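(* Let $\mathcal{D}=(G,\chi,g,0)$ be a group datum of nilpotent type with $n\ge 2$ the order of $\chi(g)$ and $H=H_{\mathcal D}$ the associated pointed rank one Hopf algebra. Let $r(\mathbb{K}G)$ be the Green ring of the group algebra $\mathbb{K}G$, $a=[V_{\chi^{-1}}]\in r(\mathbb{K}G)$, and $r(\mathbb{K}G)[z]$ the polynomial ring in the variable $z$ over $r(\mathbb{K}G)$. Then the Green ring $r(H)$ is isomorphic to $r(\mathbb{K}G)[z]/I$, where $I$ is the ideal of $r(\mathbb{K}G)[z]$ generated by the element $(1+a-z)F_n(a,z)$, with $F_n$ the Dickson polynomial defined in the context.
   Context: $\mathbb{K}$ is an algebraically closed field of characteristic zero; modules are finite dimensional left modules; $\otimes=\otimes_{\mathbb K}$. Group datum: $G$ is a finite group, $g$ an element of the center of $G$, $\chi:G\to\mathbb{K}^\times$ a linear character, $q=\chi(g)$ has order $n\ge 2$. $H=H_{\mathcal D}$ is the $\mathbb K$-algebra generated by $y$ and the elements $h\in G$, containing $\mathbb{K}G$ as a subalgebra, with relations $y^n=0$ and $yh=\chi(h)hy$ for $h\in G$; it has basis $\{y^ih\mid h\in G,\ 0\le i\le n-1\}$. It is a Hopf algebra with $\Delta(y)=y\otimes g+1\otimes y$, $\varepsilon(y)=0$, $S(y)=-yg^{-1}$, and $\Delta(h)=h\otimes h$, $\varepsilon(h)=1$, $S(h)=h^{-1}$ for $h\in G$. $V_{\chi^{-1}}$ is the one-dimensional $\mathbb{K}G$-module with character $\chi^{-1}$. The Green ring $r(A)$ of a Hopf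 algebra $A$ is the free abelian group on isomorphism classes $[V]$ of finite dimensional $A$-modules modulo $[M\oplus N]=[M]+[N]$, with product $[M][N]=[M\otimes N]$ and identity the class of the trivial module. The Dickson polynomials (of the second type) are defined by $F_1(y,z)=1$, $F_2(y,z)=z$, $F_i(y,z)=zF_{i-1}(y,z)-yF_{i-2}(y,z)$ for $i\ge 3$. *)

theory Defs
  imports
    "HOL-Algebra.Algebra"
    "HOL-Library.Indicator_Function"
    "HOL-Computational_Algebra.Polynomial"
    "Jordan_Normal_Form.Matrix"
begin

section \<open>Finite dimensional Hopf algebras in coordinates\<close>

text \<open>
  An algebra with a chosen finite basis \<open>B\<close> is given by its structure constants. Its elements are
  the functions \<open>x :: 'b \<Rightarrow> 'k\<close> vanishing outside \<open>B\<close>, where \<open>x\<close> stands for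
  \<open>\<Sum>b\<in>B. x b \<cdot> b\<close>; the basis vector \<open>b\<close> is \<open>indicator {b}\<close>.
  \<open>table A b c\<close> is the product of the basis vectors \<open>b\<close> and \<open>c\<close>. An element of \<open>A \<otimes> A\<close> is in the
  same way a function on \<open>B \<times> B\<close>. The comultiplication, counit and antipode are given by their
  values on basis vectors.
\<close>

record ('b, 'k) alg =
  basis :: "'b set"
  table :: "'b \<Rightarrow> 'b \<Rightarrow> 'b \<Rightarrow> 'k"
  alg_unit :: "'b \<Rightarrow> 'k"

record ('b, 'k) hopf = "('b, 'k) alg" +
  comult :: "'b \<Rightarrow> 'b \<times> 'b \<Rightarrow> 'k"
  counit :: "'b \<Rightarrow> 'k"
  antipode :: "'b \<Rightarrow> 'b \<Rightarrow> 'k"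

definition alg_elems :: "('b, 'k::field, 'm) alg_scheme \<Rightarrow> ('b \<Rightarrow> 'k) set"
  where "alg_elems A = {x. \<forall>b. b \<notin> basis A \<longrightarrow> x b = 0}"

definition alg_times :: "('b, 'k::field, 'm) alg_scheme \<Rightarrow> ('b \<Rightarrow> 'k) \<Rightarrow> ('b \<Rightarrow> 'k) \<Rightarrow> 'b \<Rightarrow> 'k"
  where "alg_times A x y = (\<lambda>d. \<Sum>b\<in>basis A. \<Sum>c\<in>basis A. x b * y c * table A b c d)"

primrec alg_pow :: "('b, 'k::field, 'm) alg_scheme \<Rightarrow> ('b \<Rightarrow> 'k) \<Rightarrow> nat \<Rightarrow> 'b \<Rightarrow> 'k"
  where
    "alg_pow A x 0 = alg_unit A"
  | "alg_pow A x (Suc i) = alg_times A (alg_pow A x i) x"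

definition tensor_square :: "('b, 'k::field, 'm) alg_scheme \<Rightarrow> ('b \<times> 'b, 'k) alg"
  where "tensor_square A =
    \<lparr>basis = basis A \<times> basis A,
     table = (\<lambda>(b, b') (c, c') (d, d'). table A b c d * table A b' c' d'),
     alg_unit = (\<lambda>(b, b'). alg_unit A b * alg_unit A b')\<rparr>"


section \<open>Finite dimensional modules\<close>

text \<open>
  A pair \<open>(d, \<rho>)\<close> is the \<open>d\<close>-dimensional column space on which the basis vector \<open>b\<close> acts by the
  matrix \<open>\<rho> b\<close>. Every finite dimensional module is isomorphic to one of this form, so isomorphism
  classes can be taken inside this type. Values of \<open>\<rho>\<close> outside the basis are irrelevant.
\<close>

type_synonym ('b, 'k) rep = "nat \<times> ('b \<Rightarrow> 'k mat)"

definition act :: "('b, 'k::field, 'm) alg_scheme \<Rightarrow> ('b, 'k) rep \<Rightarrow> ('b \<Rightarrow> 'k) \<Rightarrow> 'k mat"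
  where "act A M x = mat (fst M) (fst M) (\<lambda>(i, j). \<Sum>b\<in>basis A. x b * snd M b $$ (i, j))"

definition is_module :: "('b, 'k::field, 'm) alg_scheme \<Rightarrow> ('b, 'k) rep \<Rightarrow> bool"
  where "is_module A M \<longleftrightarrow>
    (\<forall>b\<in>basis A. snd M b \<in> carrier_mat (fst M) (fst M)) \<and>
    act A M (alg_unit A) = 1\<^sub>m (fst M) \<and>
    (\<forall>x\<in>alg_elems A. \<forall>y\<in>alg_elems A. act A M (alg_times A x y) = act A M x * act A M y)"

definition module_iso :: "('b, 'k::field, 'm) alg_scheme \<Rightarrow> ('b, 'k) rep \<Rightarrow> ('b, 'k) rep \<Rightarrow> bool"
  where "module_iso A M N \<longleftrightarrow>
    (\<exists>P\<in>carrier_mat (fst N) (fst M). invertible_mat P \<and>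
      (\<forall>x\<in>alg_elems A. P * act A M x = act A N x * P))"

definition direct_sum :: "('b, 'k::field) rep \<Rightarrow> ('b, 'k) rep \<Rightarrow> ('b, 'k) rep"
  where "direct_sum M N =
    (fst M + fst N,
     \<lambda>b. four_block_mat (snd M b) (0\<^sub>m (fst M) (fst N)) (0\<^sub>m (fst N) (fst M)) (snd N b))"

definition kronecker :: "'k::field mat \<Rightarrow> 'k mat \<Rightarrow> 'k mat"
  where "kronecker P Q = mat (dim_row P * dim_row Q) (dim_col P * dim_col Q)
    (\<lambda>(i, j). P $$ (i div dim_row Q, j div dim_col Q) * Q $$ (i mod dim_row Q, j mod dim_col Q))"

definition tensor :: "('b, 'k::field, 'm) hopf_scheme \<Rightarrow> ('b, 'k) rep \<Rightarrow> ('b, 'k) rep \<Rightarrow> ('b, 'k) rep"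
  where "tensor A M N =
    (fst M * fst N,
     \<lambda>b. mat (fst M * fst N) (fst M * fst N) (\<lambda>(i, j).
       \<Sum>(c, d)\<in>basis A \<times> basis A. comult A b (c, d) * kronecker (snd M c) (snd N d) $$ (i, j)))"

definition trivial_module :: "('b, 'k::field, 'm) hopf_scheme \<Rightarrow> ('b, 'k) rep"
  where "trivial_module A = (1, \<lambda>b. mat 1 1 (\<lambda>_. counit A b))"


section \<open>The Green ring\<close>

definition iso_class :: "('b, 'k::field, 'm) alg_scheme \<Rightarrow> ('b, 'k) rep \<Rightarrow> ('b, 'k) rep set"
  where "iso_class A M = {N. is_module A N \<and> module_iso A M N}"

definition iso_classes :: "('b, 'k::field, 'm) alg_scheme \<Rightarrow> ('b, 'k) rep set set"
  where "iso_classes A = {iso_class A M |M. is_module A M}"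

definition class_tensor ::
    "('b, 'k::field, 'm) hopf_scheme \<Rightarrow> ('b, 'k) rep set \<Rightarrow> ('b, 'k) rep set \<Rightarrow> ('b, 'k) rep set"
  where "class_tensor A C D = (\<Union>M\<in>C. \<Union>N\<in>D. iso_class A (tensor A M N))"

text \<open>The free abelian group on all isomorphism classes, with the bilinear extension of the
  tensor product of classes.\<close>

definition free_green_ring :: "('b, 'k::field, 'm) hopf_scheme \<Rightarrow> (('b, 'k) rep set \<Rightarrow>\<^sub>0 int) ring"
  where "free_green_ring A =
    \<lparr>carrier = {f. Poly_Mapping.keys f \<subseteq> iso_classes A},
     monoid.mult = (\<lambda>f f'. \<Sum>C\<in>Poly_Mapping.keys f. \<Sum>D\<in>Poly_Mapping.keys f'.
       Poly_Mapping.single (class_tensor A C D) (Poly_Mapping.lookup f C * Poly_Mapping.lookup f' D)),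
     monoid.one = Poly_Mapping.single (iso_class A (trivial_module A)) 1,
     ring.zero = 0,
     ring.add = (+)\<rparr>"

definition free_class ::
    "('b, 'k::field, 'm) alg_scheme \<Rightarrow> ('b, 'k) rep \<Rightarrow> ('b, 'k) rep set \<Rightarrow>\<^sub>0 int"
  where "free_class A M = Poly_Mapping.single (iso_class A M) 1"

definition green_relations :: "('b, 'k::field, 'm) hopf_scheme \<Rightarrow> (('b, 'k) rep set \<Rightarrow>\<^sub>0 int) set"
  where "green_relations A = generate (add_monoid (free_green_ring A))
    {free_class A (direct_sum M N) - (free_class A M + free_class A N) |M N.
       is_module A M \<and> is_module A N}"

text \<open>The additive subgroup \<^const>\<open>green_relations\<close> is an ideal, since the tensor product
  distributes over direct sums; hence the quotient by it is the quotient ring.\<close>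

definition green_ring :: "('b, 'k::field, 'm) hopf_scheme \<Rightarrow> (('b, 'k) rep set \<Rightarrow>\<^sub>0 int) set ring"
  where "green_ring A = free_green_ring A Quot green_relations A"

definition green_class ::
    "('b, 'k::field, 'm) hopf_scheme \<Rightarrow> ('b, 'k) rep \<Rightarrow> (('b, 'k) rep set \<Rightarrow>\<^sub>0 int) set"
  where "green_class A M = green_relations A +>\<^bsub>free_green_ring A\<^esub> free_class A M"


section \<open>The group algebra and the pointed rank one Hopf algebra\<close>

definition has_mult_order :: "'k::field \<Rightarrow> nat \<Rightarrow> bool"
  where "has_mult_order q n \<longleftrightarrow> 0 < n \<and> q ^ n = 1 \<and> (\<forall>m. 0 < m \<and> m < n \<longrightarrow> q ^ m \<noteq> 1)"

locale group_datum = group G for G (structure) +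
  fixes \<chi> :: "'a \<Rightarrow> 'k::field" and g :: 'a
  assumes finite_carrier: "finite (carrier G)"
    and g_closed: "g \<in> carrier G"
    and g_central: "h \<in> carrier G \<Longrightarrow> g \<otimes> h = h \<otimes> g"
    and character_nonzero: "h \<in> carrier G \<Longrightarrow> \<chi> h \<noteq> 0"
    and character_mult: "h \<in> carrier G \<Longrightarrow> k \<in> carrier G \<Longrightarrow> \<chi> (h \<otimes> k) = \<chi> h * \<chi> k"

definition group_hopf :: "('g, 'm) monoid_scheme \<Rightarrow> ('g, 'k::field) hopf"
  where "group_hopf G =
    \<lparr>basis = carrier G,
     table = (\<lambda>h k. indicator {h \<otimes>\<^bsub>G\<^esub> k}),
     alg_unit = indicator {\<one>\<^bsub>G\<^esub>},
     comult = (\<lambda>h. indicator {(h, h)}),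
     counit = (\<lambda>h. 1),
     antipode = (\<lambda>h. indicator {inv\<^bsub>G\<^esub> h})\<rparr>"

text \<open>The one-dimensional module on which \<open>h\<close> acts by the scalar \<open>\<psi> h\<close>.\<close>

definition character_module :: "('g \<Rightarrow> 'k::field) \<Rightarrow> ('g, 'k) rep"
  where "character_module \<psi> = (1, \<lambda>h. mat 1 1 (\<lambda>_. \<psi> h))"

text \<open>
  The pair \<open>(i, h)\<close> with \<open>i < n\<close> is the basis vector \<open>y\<^sup>i h\<close>. The relation \<open>y h = \<chi>(h) h y\<close> gives
  \<open>h y\<^sup>j = \<chi>(h)\<^bsup>-j\<^esup> y\<^sup>j h\<close>, whence the multiplication table; the comultiplication and the antipode are
  the (anti-)multiplicative extensions of their values on \<open>y\<close> and on \<open>G\<close>.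
\<close>

definition rank_one_alg ::
    "('g, 'm) monoid_scheme \<Rightarrow> ('g \<Rightarrow> 'k::field) \<Rightarrow> nat \<Rightarrow> (nat \<times> 'g, 'k) alg"
  where "rank_one_alg G \<chi> n =
    \<lparr>basis = {..<n} \<times> carrier G,
     table = (\<lambda>(i, h) (j, k) b.
       if i + j < n then inverse (\<chi> h ^ j) * indicator {(i + j, h \<otimes>\<^bsub>G\<^esub> k)} b else 0),
     alg_unit = indicator {(0, \<one>\<^bsub>G\<^esub>)}\<rparr>"

definition comult_y :: "('g, 'm) monoid_scheme \<Rightarrow> 'g \<Rightarrow> (nat \<times> 'g) \<times> (nat \<times> 'g) \<Rightarrow> 'k::field"
  where "comult_y G g =
    (\<lambda>b. indicator {((1, \<one>\<^bsub>G\<^esub>), (0, g))} b + indicator {((0, \<one>\<^bsub>G\<^esub>), (1, \<one>\<^bsub>G\<^esub>))} b)"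

definition antipode_y :: "('g, 'm) monoid_scheme \<Rightarrow> 'g \<Rightarrow> nat \<times> 'g \<Rightarrow> 'k::field"
  where "antipode_y G g = (\<lambda>b. - indicator {(1, inv\<^bsub>G\<^esub> g)} b)"

definition rank_one_hopf ::
    "('g, 'm) monoid_scheme \<Rightarrow> ('g \<Rightarrow> 'k::field) \<Rightarrow> 'g \<Rightarrow> nat \<Rightarrow> (nat \<times> 'g, 'k) hopf"
  where "rank_one_hopf G \<chi> g n =
    \<lparr>basis = basis (rank_one_alg G \<chi> n),
     table = table (rank_one_alg G \<chi> n),
     alg_unit = alg_unit (rank_one_alg G \<chi> n),
     comult = (\<lambda>(i, h). alg_times (tensor_square (rank_one_alg G \<chi> n))
       (alg_pow (tensor_square (rank_one_alg G \<chi> n)) (comult_y G g) i)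
       (indicator {((0, h), (0, h))})),
     counit = (\<lambda>(i, h). if i = 0 then 1 else 0),
     antipode = (\<lambda>(i, h). alg_times (rank_one_alg G \<chi> n)
       (indicator {(0, inv\<^bsub>G\<^esub> h)})
       (alg_pow (rank_one_alg G \<chi> n) (antipode_y G g) i))\<rparr>"


section \<open>Dickson polynomials of the second type\<close>

text \<open>\<open>dickson R y z i\<close> is the value of \<open>F\<^sub>i(y, z)\<close> in \<open>R\<close>; the index \<open>0\<close> does not occur.\<close>

fun dickson :: "('r, 'm) ring_scheme \<Rightarrow> 'r \<Rightarrow> 'r \<Rightarrow> nat \<Rightarrow> 'r"
  where
    "dickson R y z 0 = \<zero>\<^bsub>R\<^esub>"
  | "dickson R y z (Suc 0) = \<one>\<^bsub>R\<^esub>"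
  | "dickson R y z (Suc (Suc 0)) = z"
  | "dickson R y z (Suc (Suc (Suc i))) =
      z \<otimes>\<^bsub>R\<^esub> dickson R y z (Suc (Suc i)) \<ominus>\<^bsub>R\<^esub> y \<otimes>\<^bsub>R\<^esub> dickson R y z (Suc i)"


section \<open>The defining relations of the rank one Hopf algebra\<close>

lemma alg_times_indicator:
  assumes "finite (basis A)" "b \<in> basis A" "c \<in> basis A"
  shows "alg_times A (indicator {b}) (indicator {c}) = table A b c"
proof
  fix d
  have "alg_times A (indicator {b}) (indicator {c}) d
      = (\<Sum>b'\<in>basis A. if b' = b then (\<Sum>c'\<in>basis A. if c' = c then table A b c d else 0) else 0)"
    unfolding alg_times_def by (intro sum.cong refl) (auto simp: indicator_def intro!: sum.cong)
  then show "alg_times A (indicator {b}) (indicator {c}) d = table A b c d"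
    using assms by simp
qed

lemma alg_times_add_left:
  "alg_times A (\<lambda>b. x b + x' b) y d = alg_times A x y d + alg_times A x' y d"
  by (simp add: alg_times_def ring_distribs sum.distrib)

lemma alg_times_minus_right: "alg_times A x (\<lambda>b. - y b) = (\<lambda>d. - alg_times A x y d)"
  by (simp add: alg_times_def sum_negf)

lemma alg_times_rank_one_hopf [simp]:
  "alg_times (rank_one_hopf G \<chi> g n) = alg_times (rank_one_alg G \<chi> n)"
  by (intro ext) (simp add: alg_times_def rank_one_hopf_def)

lemma alg_unit_rank_one_hopf [simp]:
  "alg_unit (rank_one_hopf G \<chi> g n) = alg_unit (rank_one_alg G \<chi> n)"
  by (simp add: rank_one_hopf_def)

lemma alg_pow_rank_one_hopf [simp]:
  "alg_pow (rank_one_hopf G \<chi> g n) x i = alg_pow (rank_one_alg G \<chi> n) x i"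
  by (induction i) simp_all

context group_datum
begin

abbreviation "H n \<equiv> rank_one_hopf G \<chi> g n"

lemma finite_basis: "finite (basis (rank_one_alg G \<chi> n))"
  using finite_carrier by (simp add: rank_one_alg_def)

lemma character_one: "\<chi> \<one> = 1"
  using character_mult[of \<one> \<one>] character_nonzero[of \<one>] by simp

lemma times_basis:
  assumes "i < n" "j < n" "h \<in> carrier G" "k \<in> carrier G"
  shows "alg_times (H n) (indicator {(i, h)}) (indicator {(j, k)}) =
    (\<lambda>b. if i + j < n then inverse (\<chi> h ^ j) * indicator {(i + j, h \<otimes> k)} b else 0)"
proof -
  have "(i, h) \<in> basis (rank_one_alg G \<chi> n)" "(j, k) \<in> basis (rank_one_alg G \<chi> n)"
    using assms by (simp_all add: rank_one_alg_def)
  from alg_times_indicator[OF finite_basis this] show ?thesis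
    by (simp add: rank_one_alg_def)
qed

lemma group_subalgebra:
  assumes "0 < n" "h \<in> carrier G" "k \<in> carrier G"
  shows "alg_times (H n) (indicator {(0, h)}) (indicator {(0, k)}) = indicator {(0, h \<otimes> k)}"
  using assms by (simp only: times_basis) simp

lemma y_group_relation:
  assumes "2 \<le> n" "h \<in> carrier G"
  shows "alg_times (H n) (indicator {(1, \<one>)}) (indicator {(0, h)}) =
    (\<lambda>b. \<chi> h * alg_times (H n) (indicator {(0, h)}) (indicator {(1, \<one>)}) b)"
proof -
  have "\<chi> h * (inverse (\<chi> h) * x) = x" for x
    using character_nonzero[OF assms(2)] by simp
  then show ?thesis
    using assms times_basis[of 1 n 0 \<one> h] times_basis[of 0 n 1 h \<one>]
    by (auto simp: fun_eq_iff)
qed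

lemma power_y:
  assumes "2 \<le> n" "i < n"
  shows "alg_pow (H n) (indicator {(1, \<one>)}) i = indicator {(i, \<one>)}"
  using assms(2)
proof (induction i)
  case 0
  then show ?case by (simp add: rank_one_alg_def)
next
  case (Suc i)
  have "alg_pow (H n) (indicator {(1, \<one>)}) (Suc i)
      = alg_times (H n) (indicator {(i, \<one>)}) (indicator {(1, \<one>)})"
    using Suc by simp
  then show ?case
    using Suc.prems assms(1) times_basis[of i n 1 \<one> \<one>] by (simp add: character_one)
qed

lemma y_nilpotent:
  assumes "2 \<le> n"
  shows "alg_pow (H n) (indicator {(1, \<one>)}) n = (\<lambda>b. 0)"
proof -
  obtain m where m: "n = Suc m" "m < n"
    using assms by (cases n) auto
  have "alg_pow (H n) (indicator {(1, \<one>)}) (Suc m)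
      = alg_times (H n) (indicator {(m, \<one>)}) (indicator {(1, \<one>)})"
    using power_y[OF assms m(2)] by simp
  also have "\<dots> = (\<lambda>b. 0)"
    using times_basis[of m n 1 \<one> \<one>] m assms by simp
  finally show ?thesis
    using m by simp
qed

lemma basis_vector:
  assumes "2 \<le> n" "i < n" "h \<in> carrier G"
  shows "alg_times (H n) (alg_pow (H n) (indicator {(1, \<one>)}) i) (indicator {(0, h)}) =
    indicator {(i, h)}"
  using times_basis[of i n 0 \<one> h] power_y assms by simp

lemma comult_group:
  assumes "0 < n" "h \<in> carrier G"
  shows "comult (H n) (0, h) = indicator {((0, h), (0, h))}"
proof -
  let ?T = "tensor_square (rank_one_alg G \<chi> n)"
  have "alg_unit ?T = indicator {((0, \<one>), (0, \<one>))}"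
    by (auto simp: tensor_square_def rank_one_alg_def indicator_def fun_eq_iff)
  moreover have "finite (basis ?T)" "((0, \<one>), (0, \<one>)) \<in> basis ?T" "((0, h), (0, h)) \<in> basis ?T"
    using assms finite_basis by (auto simp: tensor_square_def rank_one_alg_def)
  ultimately have "comult (H n) (0, h) = table ?T ((0, \<one>), (0, \<one>)) ((0, h), (0, h))"
    by (simp add: rank_one_hopf_def alg_times_indicator)
  then show ?thesis
    using assms by (auto simp: tensor_square_def rank_one_alg_def indicator_def fun_eq_iff)
qed

lemma comult_generator:
  assumes "2 \<le> n"
  shows "comult (H n) (1, \<one>) = comult_y G g"
proof -
  let ?T = "tensor_square (rank_one_alg G \<chi> n)"
  let ?u = "((0, \<one>), (0, \<one>))" and ?p = "((1, \<one>), (0, g))" and ?q = "((0, \<one>), (1, \<one>))"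
  have unit: "alg_unit ?T = indicator {?u}"
    by (auto simp: tensor_square_def rank_one_alg_def indicator_def fun_eq_iff)
  have fin: "finite (basis ?T)"
    using finite_basis by (simp add: tensor_square_def)
  have mem: "?u \<in> basis ?T" "?p \<in> basis ?T" "?q \<in> basis ?T"
    using assms g_closed by (auto simp: tensor_square_def rank_one_alg_def)
  have left: "alg_times ?T (indicator {?u}) x = x" if "x \<in> alg_elems ?T" for x
  proof
    fix d :: "(nat \<times> 'a) \<times> nat \<times> 'a"
    obtain d1 h1 d2 h2 where d: "d = ((d1, h1), (d2, h2))"
      by (metis surj_pair)
    have "alg_times ?T (indicator {?u}) x d = (\<Sum>b\<in>basis ?T. if b = ?u then
        (\<Sum>c\<in>basis ?T. if c = d then x d else 0) else 0)"
      unfolding alg_times_def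
      by (intro sum.cong refl)
        (auto simp: d indicator_def tensor_square_def rank_one_alg_def character_one intro!: sum.cong)
    then show "alg_times ?T (indicator {?u}) x d = x d"
      using fin mem(1) that by (auto simp: alg_elems_def d)
  qed
  have "comult_y G g \<in> alg_elems ?T"
    using mem by (auto simp: comult_y_def alg_elems_def indicator_def)
  then have "comult (H n) (1, \<one>) = alg_times ?T (comult_y G g) (indicator {?u})"
    by (simp add: rank_one_hopf_def unit left)
  also have "\<dots> = (\<lambda>b. table ?T ?p ?u b + table ?T ?q ?u b)"
    unfolding comult_y_def
    by (rule ext) (simp only: alg_times_add_left alg_times_indicator[OF fin mem(2) mem(1)]
        alg_times_indicator[OF fin mem(3) mem(1)])
  also have "\<dots> = comult_y G g"
    using assms g_closed
    by (auto simp: comult_y_def tensor_square_def rank_one_alg_def indicator_def fun_eq_iff)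
  finally show ?thesis .
qed

lemma antipode_group:
  assumes "0 < n" "h \<in> carrier G"
  shows "antipode (H n) (0, h) = indicator {(0, inv h)}"
proof -
  have "antipode (H n) (0, h)
      = alg_times (H n) (indicator {(0, inv h)}) (indicator {(0, \<one>)})"
    by (simp add: rank_one_hopf_def alg_times_def rank_one_alg_def)
  also have "\<dots> = indicator {(0, inv h)}"
    using group_subalgebra[of n "inv h" \<one>] assms by simp
  finally show ?thesis .
qed

lemma antipode_generator:
  assumes "2 \<le> n"
  shows "antipode (H n) (1, \<one>) =
    (\<lambda>b. - alg_times (H n) (indicator {(1, \<one>)}) (indicator {(0, inv g)}) b)"
proof -
  have *: "alg_times (H n) (indicator {(0, \<one>)}) (indicator {(1, inv g)}) =
      indicator {(1, inv g)}"
    using times_basis[of 0 n 1 \<one> "inv g"] assms g_closed by (simp add: character_one)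
  have "antipode (H n) (1, \<one>) = alg_times (H n) (indicator {(0, \<one>)})
      (alg_times (H n) (indicator {(0, \<one>)}) (antipode_y G g))"
    by (simp add: rank_one_hopf_def alg_times_def rank_one_alg_def)
  also have "\<dots> = (\<lambda>b. - indicator {(1, inv g)} b)"
    unfolding antipode_y_def using * by (simp add: alg_times_minus_right)
  also have "indicator {(1, inv g)} =
      alg_times (H n) (indicator {(1, \<one>)}) (indicator {(0, inv g)})"
    using times_basis[of 1 n 0 \<one> "inv g"] assms g_closed by simp
  finally show ?thesis .
qed

end

end

theory Submission
  imports Defs "HOL-Library.Function_Algebras" "HOL-Algebra.Free_Abelian_Groups"
begin

section \<open>Finite-dimensional linear algebra on finitely supported functions\<close>

section \<open>Linear operators on coordinate functions\<close>

text \<open>An \<open>H\<close>-module is a \<open>KG\<close>-module with an operator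
  \<open>y\<close> such that \<open>y^n = 0\<close> and \<open>y h = \<chi>(h) h y\<close>. Let
  \<open>U_j\<close> (\<open>uniserial j\<close>) be the module with basis 1, y, ..., y^(j-1) and
  trivial top, so that \<open>h\<close> acts on y^i by \<chi>(h)^(-i), and regard a
  \<open>KG\<close>-module V as an \<open>H\<close>-module with y = 0. The proof shows that r(H) is
  a free r(KG)-module on [U_1], ..., [U_n] and that [U_j] is the value of F_j at a and [U_2].

  Generation: if y^(k+1) = 0 on M, Maschke's theorem (\<open>complement\<close>) gives a G-stable
  complement W of the kernel of y^k. It generates a copy of W \<otimes> U_(k+1), which is a direct
  summand and leaves a module with y^k = 0 (\<open>split_uniserial\<close>). Iteration gives
  \<open>uniserial_span\<close>.

  Independence: the image y^i M, with its action twisted by \<chi>^i, is a G-module that depends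
  additively on M. It is V for V \<otimes> U_(i+1) and zero for V \<otimes> U_j with j \<le> i.
  These coefficient maps (\<open>coefficient_map\<close>) and downward induction on the index give
  \<open>uniserial_independent\<close>.

  Multiplication: with c_i = 1 + q^(-1) + ... + q^(-(i-1)), where q = \<chi>(g), the vector y^i (u_0
  v_0) in U_2 \<otimes> U_j is u_0 v_i + c_i u_1 v_(i-1). For j < n the number c_j is nonzero and
  U_2 \<otimes> U_j is the sum of U_(j+1) and a copy of U_(j-1) tensored with the character
  \<chi>^(-1) (\<open>uniserial_two_tensor\<close>). For j = n it is zero, and U_2 \<otimes> U_n is
  the sum of U_n and U_n tensored with that character (\<open>uniserial_two_tensor_top\<close>). The
  first rule is the Dickson recursion, hence \<open>cu_dickson\<close>. The second says that (1 + a
  - z) F_n(a, z) vanishes at z = [U_2].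

  Commutativity of r(H) is not formal, since \<open>H\<close> is not cocommutative. As g is central,
  the flip corrected by powers of g identifies V \<otimes> U_j with U_j \<otimes> V
  (\<open>gtensor_uniserial_comm\<close>). So [U_2] commutes with r(KG), and both together generate
  r(H) (\<open>cring_H\<close>).

  Conclusion: z is sent to [U_2] by a ring homomorphism from r(KG)[z] onto r(H). Modulo I every
  polynomial is an r(KG)-combination of F_1, ..., F_n, and their images are independent, so the
  kernel is I (\<open>presentation_by_dickson\<close>).

  All of this is done with linear operators on functions. The locale \<open>green_model\<close>
  isolates what is needed to carry it over to the matrix representations in which Green rings are
  defined. It is instantiated for the group algebra with nilpotency degree 1 and for
  \<open>H\<close> with degree n.\<close>

definition vecs :: "'i set \<Rightarrow> ('i \<Rightarrow> 'k::field) set"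
  where "vecs I = {f. \<forall>i. i \<notin> I \<longrightarrow> f i = 0}"

definition delta_fun :: "'i \<Rightarrow> 'i \<Rightarrow> 'k::field"
  where "delta_fun i = (\<lambda>j. if j = i then 1 else 0)"

text \<open>Operators are total on all functions, although only their values on some
  \<open>vecs I\<close> matter. Linearity is asked everywhere so that compositions and powers need
  no carrier set.\<close>

definition lin :: "(('i \<Rightarrow> 'k::field) \<Rightarrow> 'j \<Rightarrow> 'k) \<Rightarrow> bool"
  where "lin P \<longleftrightarrow> (\<forall>f f'. P (\<lambda>i. f i + f' i) = (\<lambda>j. P f j + P f' j)) \<and>
    (\<forall>c f. P (\<lambda>i. c * f i) = (\<lambda>j. c * P f j))"

definition subsp :: "('i \<Rightarrow> 'k::field) set \<Rightarrow> bool"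
  where "subsp U \<longleftrightarrow> (\<lambda>_. 0) \<in> U \<and> (\<forall>f\<in>U. \<forall>f'\<in>U. (\<lambda>i. f i + f' i) \<in> U) \<and>
    (\<forall>c. \<forall>f\<in>U. (\<lambda>i. c * f i) \<in> U)"

lemma vecsI: "(\<And>i. i \<notin> I \<Longrightarrow> f i = 0) \<Longrightarrow> f \<in> vecs I"
  and vecsD: "f \<in> vecs I \<Longrightarrow> i \<notin> I \<Longrightarrow> f i = 0"
  by (auto simp: vecs_def)

lemma linI:
  assumes "\<And>f f' j. P (\<lambda>i. f i + f' i) j = P f j + P f' j"
    and "\<And>c f j. P (\<lambda>i. c * f i) j = c * P f j"
  shows "lin P"
  using assms by (auto simp: lin_def)

lemma lin_add: "lin P \<Longrightarrow> P (\<lambda>i. f i + f' i) = (\<lambda>j. P f j + P f' j)"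
  and lin_scale: "lin P \<Longrightarrow> P (\<lambda>i. c * f i) = (\<lambda>j. c * P f j)"
  by (auto simp: lin_def)

lemma lin_zero: "lin P \<Longrightarrow> P (\<lambda>_. 0) = (\<lambda>_. 0)"
  using lin_scale[of P 0 "\<lambda>_. 0"] by simp

lemma lin_minus: "lin P \<Longrightarrow> P (\<lambda>i. - f i) = (\<lambda>j. - P f j)"
  using lin_scale[of P "-1" f] by simp

lemma lin_diff: "lin P \<Longrightarrow> P (\<lambda>i. f i - f' i) = (\<lambda>j. P f j - P f' j)"
  using lin_add[of P f "\<lambda>i. - f' i"] by (simp add: lin_minus)

lemma lin_sum: "lin P \<Longrightarrow> P (\<lambda>i. \<Sum>s\<in>S. F s i) = (\<lambda>j. \<Sum>s\<in>S. P (F s) j)"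
proof (induction S rule: infinite_finite_induct)
  case (insert x S)
  then show ?case using lin_add[of P "F x" "\<lambda>i. \<Sum>s\<in>S. F s i"] by simp
qed (simp_all add: lin_zero)

lemma lin_comp: "lin P \<Longrightarrow> lin Q \<Longrightarrow> lin (\<lambda>f. P (Q f))"
  by (simp add: lin_def)

lemma lin_id: "lin (\<lambda>f. f)"
  by (simp add: lin_def)

lemma lin_pow:
  fixes P :: "('i \<Rightarrow> 'k::field) \<Rightarrow> 'i \<Rightarrow> 'k"
  shows "lin P \<Longrightarrow> lin (P ^^ m)"
proof (induction m)
  case 0
  then show ?case by (simp add: lin_def)
next
  case (Suc m)
  then show ?case using lin_comp[of P "P ^^ m"] by (simp add: comp_def)
qed

lemma vecs_expand:
  assumes "finite I" "f \<in> vecs I"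
  shows "f = (\<lambda>j. \<Sum>i\<in>I. f i * delta_fun i j)"
proof
  fix j
  have "(\<Sum>i\<in>I. f i * delta_fun i j) = (\<Sum>i\<in>I. if i = j then f j else 0)"
    by (intro sum.cong) (auto simp: delta_fun_def)
  then show "f j = (\<Sum>i\<in>I. f i * delta_fun i j)"
    using assms by (auto simp: vecs_def)
qed

lemma lin_expand:
  assumes "finite I" "f \<in> vecs I" "lin P"
  shows "P f j = (\<Sum>i\<in>I. f i * P (delta_fun i) j)"
proof -
  have "P f = P (\<lambda>j. \<Sum>i\<in>I. f i * delta_fun i j)"
    using vecs_expand[OF assms(1,2)] by simp
  then show ?thesis
    by (simp add: lin_sum[OF assms(3)] lin_scale[OF assms(3)])
qed

lemma delta_fun_vecs: "i \<in> I \<Longrightarrow> delta_fun i \<in> vecs I"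
  by (auto simp: vecs_def delta_fun_def)

lemma vecs_zero: "(\<lambda>_. 0) \<in> vecs I"
  by (simp add: vecs_def)

lemma vecs_add: "f \<in> vecs I \<Longrightarrow> f' \<in> vecs I \<Longrightarrow> (\<lambda>i. f i + f' i) \<in> vecs I"
  and vecs_diff: "f \<in> vecs I \<Longrightarrow> f' \<in> vecs I \<Longrightarrow> (\<lambda>i. f i - f' i) \<in> vecs I"
  and vecs_scale: "f \<in> vecs I \<Longrightarrow> (\<lambda>i. c * f i) \<in> vecs I"
  by (auto simp: vecs_def)

lemma vecs_sum: "(\<And>s. s \<in> S \<Longrightarrow> F s \<in> vecs I) \<Longrightarrow> (\<lambda>i. \<Sum>s\<in>S. F s i) \<in> vecs I"
  by (auto simp: vecs_def intro!: sum.neutral)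

lemma subsp_vecs: "subsp (vecs I)"
  by (simp add: subsp_def vecs_zero vecs_add vecs_scale)

lemma subsp_diff: "subsp U \<Longrightarrow> f \<in> U \<Longrightarrow> f' \<in> U \<Longrightarrow> (\<lambda>i. f i - f' i) \<in> U"
proof -
  assume U: "subsp U" "f \<in> U" "f' \<in> U"
  then have "(\<lambda>i. - 1 * f' i) \<in> U" by (metis subsp_def)
  moreover have "(\<lambda>i. f i + u i) \<in> U" if "u \<in> U" for u
    using U that by (simp add: subsp_def)
  ultimately have "(\<lambda>i. f i + (- 1 * f' i)) \<in> U" by blast
  then show ?thesis by simp
qed

lemma subsp_image: "lin P \<Longrightarrow> subsp U \<Longrightarrow> subsp (P ` U)"
  unfolding subsp_def
proof (intro conjI ballI allI)
  assume P: "lin P" and U: "(\<lambda>_. 0) \<in> U \<and> (\<forall>f\<in>U. \<forall>f'\<in>U. (\<lambda>i. f i + f' i) \<in> U) \<and>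
    (\<forall>c. \<forall>f\<in>U. (\<lambda>i. c * f i) \<in> U)"
  show "(\<lambda>_. 0) \<in> P ` U" using U lin_zero[OF P] by (metis image_eqI)
  show "(\<lambda>i. f i + f' i) \<in> P ` U" if "f \<in> P ` U" "f' \<in> P ` U" for f f'
    using that U lin_add[OF P] by (auto simp: image_iff) metis
  show "(\<lambda>i. c * f i) \<in> P ` U" if "f \<in> P ` U" for c f
    using that U lin_scale[OF P] by (auto simp: image_iff) metis
qed

lemma subsp_ker: "lin P \<Longrightarrow> subsp U \<Longrightarrow> subsp {f \<in> U. P f = (\<lambda>_. 0)}"
  by (auto simp: subsp_def lin_zero lin_add lin_scale)

abbreviation (input) fscale :: "'k::field \<Rightarrow> ('i \<Rightarrow> 'k) \<Rightarrow> 'i \<Rightarrow> 'k"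
  where "fscale c f \<equiv> \<lambda>i. c * f i"

lemma vector_space_fun: "vector_space (fscale :: 'k::field \<Rightarrow> ('i \<Rightarrow> 'k) \<Rightarrow> _)"
  by standard (auto simp: fun_eq_iff algebra_simps)

lemma linear_iff_lin:
  fixes P :: "('a \<Rightarrow> 'b::field) \<Rightarrow> 'c \<Rightarrow> 'b"
  shows "Vector_Spaces.linear fscale fscale P \<longleftrightarrow> lin P"
  unfolding Vector_Spaces.linear_iff lin_def
  by (simp add: plus_fun_def fun_eq_iff vector_space_pair_def vector_space_fun)

lemma subspace_iff_subsp:
  fixes U :: "('a \<Rightarrow> 'b::field) set"
  shows "module.subspace fscale U \<longleftrightarrow> subsp U"
proof -
  interpret v: vector_space "fscale :: 'b \<Rightarrow> ('a \<Rightarrow> 'b) \<Rightarrow> _" by (rule vector_space_fun)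
  show ?thesis
    unfolding v.subspace_def subsp_def by (simp add: plus_fun_def zero_fun_def)
qed

text \<open>The left inverse of an injective linear map on a subspace, taken over from abstract
  vector spaces. Projections onto subspaces and retractions of embeddings come from it.\<close>

lemma lin_left_inverse:
  fixes P :: "('a \<Rightarrow> 'b::field) \<Rightarrow> 'c \<Rightarrow> 'b"
  assumes "lin P" "subsp U" "inj_on P U"
  shows "\<exists>Q. lin Q \<and> range Q \<subseteq> U \<and> (\<forall>f\<in>U. Q (P f) = f)"
proof -
  interpret vp: vector_space_pair "fscale :: 'b \<Rightarrow> ('a \<Rightarrow> 'b) \<Rightarrow> _" "fscale :: 'b \<Rightarrow> ('c \<Rightarrow> 'b) \<Rightarrow> _"
    by (intro vector_space_pair.intro vector_space_fun)
  show ?thesis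
    using vp.linear_exists_left_inverse_on[of P U] assms
    by (simp add: linear_iff_lin subspace_iff_subsp) blast
qed

text \<open>A maximal independent subset of \<open>U\<close> spans \<open>U\<close> and is finite,
  because the functions \<open>delta_fun i\<close> with i in I span the surrounding space.
  Enumerating it identifies \<open>U\<close> with \<open>vecs {..<r}\<close>; in this way submodules
  become modules indexed by natural numbers.\<close>

lemma subsp_coordinates:
  fixes U :: "('i \<Rightarrow> 'k::field) set"
  assumes "finite I" "subsp U" "U \<subseteq> vecs I"
  obtains r :: nat and L :: "(nat \<Rightarrow> 'k) \<Rightarrow> 'i \<Rightarrow> 'k" and Q :: "('i \<Rightarrow> 'k) \<Rightarrow> nat \<Rightarrow> 'k"
  where "lin L" "lin Q" "L ` vecs {..<r} \<subseteq> U" "Q ` U \<subseteq> vecs {..<r}"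
    "\<And>w. w \<in> vecs {..<r} \<Longrightarrow> Q (L w) = w" "\<And>f. f \<in> U \<Longrightarrow> L (Q f) = f"
proof -
  interpret v: vector_space "fscale :: 'k \<Rightarrow> ('i \<Rightarrow> 'k) \<Rightarrow> _" by (rule vector_space_fun)
  obtain B where B: "B \<subseteq> U" "v.independent B" "U \<subseteq> v.span B"
    using v.maximal_independent_subset by blast
  have sumfun: "(\<Sum>s\<in>S. F s) = (\<lambda>i. \<Sum>s\<in>S. F s i)" for S and F :: "'s \<Rightarrow> 'i \<Rightarrow> 'k"
    by (induction S rule: infinite_finite_induct) (auto simp: fun_eq_iff)
  have "vecs I \<subseteq> v.span (delta_fun ` I)"
  proof
    fix f :: "'i \<Rightarrow> 'k" assume f: "f \<in> vecs I"
    have "(\<Sum>i\<in>I. fscale (f i) (delta_fun i)) \<in> v.span (delta_fun ` I)"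
      by (intro v.span_sum v.span_scale v.span_base) auto
    moreover have "(\<Sum>i\<in>I. fscale (f i) (delta_fun i)) = f"
      using vecs_expand[OF assms(1) f] unfolding sumfun by simp
    ultimately show "f \<in> v.span (delta_fun ` I)" by simp
  qed
  then have fin: "finite B"
    using v.independent_span_bound[of "delta_fun ` I" B] B assms by auto
  then obtain e where e: "bij_betw e {..<card B} B"
    using ex_bij_betw_nat_finite[of B] by (auto simp: atLeast0LessThan)
  define L where "L w = (\<lambda>i. \<Sum>s<card B. w s * e s i)" for w
  have L: "lin L"
    by (rule linI) (simp_all add: L_def distrib_right sum.distrib sum_distrib_left mult.assoc)
  have LB: "L w = (\<Sum>b\<in>B. fscale (w (the_inv_into {..<card B} e b)) b)" for w
  proof -
    have "(\<Sum>b\<in>B. fscale (w (the_inv_into {..<card B} e b)) b)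
        = (\<Sum>s<card B. fscale (w (the_inv_into {..<card B} e (e s))) (e s))"
      by (rule sum.reindex_bij_betw[OF e, of
          "\<lambda>b. fscale (w (the_inv_into {..<card B} e b)) b", symmetric])
    also have "\<dots> = (\<Sum>s<card B. fscale (w s) (e s))"
      using e by (intro sum.cong) (auto simp: bij_betw_def the_inv_into_f_f)
    finally show ?thesis by (simp add: L_def sumfun)
  qed
  have LU: "L ` vecs {..<card B} \<subseteq> U"
  proof (intro image_subsetI)
    fix w
    have "v.subspace U" using assms(2) by (simp add: subspace_iff_subsp)
    then show "L w \<in> U"
      unfolding LB using B(1) by (intro v.subspace_sum v.subspace_scale) auto
  qed
  have inj: "inj_on L (vecs {..<card B})"
  proof (rule inj_onI)
    fix w w' :: "nat \<Rightarrow> 'k" assume w: "w \<in> vecs {..<card B}" "w' \<in> vecs {..<card B}" "L w = L w'"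
    define u where "u = (\<lambda>s. w s - w' s)"
    have "L u = 0" using w(3) lin_diff[OF L, of w w'] by (simp add: u_def zero_fun_def)
    then have *: "u (the_inv_into {..<card B} e b) = 0" if "b \<in> B" for b
      using that unfolding LB
      by (rule v.independentD[OF B(2) fin subset_refl, of "\<lambda>b. u (the_inv_into {..<card B} e b)"])
    have "u s = 0" if "s < card B" for s
    proof -
      have "e s \<in> B" using e that by (auto simp: bij_betw_def)
      moreover have "the_inv_into {..<card B} e (e s) = s"
        using e that by (auto simp: bij_betw_def the_inv_into_f_f)
      ultimately show ?thesis using * by metis
    qed
    then show "w = w'"
      using w(1,2) by (auto simp: u_def vecs_def fun_eq_iff) (metis eq_iff_diff_eq_0)
  qed
  obtain Q where Q: "lin Q" "range Q \<subseteq> vecs {..<card B}" "\<forall>f\<in>vecs {..<card B}. Q (L f) = f"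
    using lin_left_inverse[OF L subsp_vecs inj] by blast
  have LQ: "L (Q f) = f" if f: "f \<in> U" for f
  proof -
    obtain u where u: "f = (\<Sum>b\<in>B. fscale (u b) b)"
      using B(3) f unfolding v.span_finite[OF fin] by blast
    define w where "w = (\<lambda>s. if s < card B then u (e s) else 0)"
    have w: "w \<in> vecs {..<card B}" by (auto simp: w_def vecs_def)
    have Lw: "L w = (\<Sum>s<card B. fscale (u (e s)) (e s))"
      by (simp add: L_def w_def sumfun)
    have "L w = f"
      unfolding Lw unfolding u by (rule sum.reindex_bij_betw[OF e, of "\<lambda>b. fscale (u b) b"])
    with bspec[OF Q(3) w] have "Q f = w" by metis
    with \<open>L w = f\<close> show ?thesis by metis
  qed
  show thesis
  proof (rule that[OF L Q(1) LU _ _ LQ])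
    show "Q ` U \<subseteq> vecs {..<card B}" using Q(2) by blast
    show "Q (L w) = w" if "w \<in> vecs {..<card B}" for w using Q(3) that by blast
  qed
qed

lemma subsp_projection:
  assumes "subsp U"
  shows "\<exists>Q. lin Q \<and> range Q \<subseteq> U \<and> (\<forall>f\<in>U. Q f = f)"
  using lin_left_inverse[OF lin_id assms] by simp

section \<open>Gaussian binomials at a root of unity and the q-binomial theorem\<close>

section \<open>Gaussian binomial coefficients\<close>

definition qnum :: "'k::field \<Rightarrow> nat \<Rightarrow> 'k"
  where "qnum q m = (\<Sum>l<m. q ^ l)"

definition qfact :: "'k::field \<Rightarrow> nat \<Rightarrow> 'k"
  where "qfact q m = (\<Prod>l<m. qnum q (Suc l))"

text \<open>\<open>qbin q i j\<close> is the Gaussian binomial coefficient of \<open>i + j\<close> over \<open>i\<close>.\<close>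

fun qbin :: "'k::field \<Rightarrow> nat \<Rightarrow> nat \<Rightarrow> 'k"
  where
    "qbin q 0 j = 1"
  | "qbin q (Suc i) 0 = 1"
  | "qbin q (Suc i) (Suc j) = qbin q i (Suc j) + q ^ Suc i * qbin q (Suc i) j"

lemma qnum_add: "qnum q (i + j) = qnum q i + q ^ i * qnum q j"
  by (induction j) (simp_all add: qnum_def power_add algebra_simps)

text \<open>The quotient of q-factorials [i+j]! / ([i]! [j]!), by induction along the Pascal rule
  and \<open>[i] + q^i [j] = [i+j]\<close>. Written without division it remains valid when
  factorials vanish.\<close>

lemma qbin_qfact: "qbin q i j * (qfact q i * qfact q j) = qfact q (i + j)"
proof (induction q i j rule: qbin.induct)
  case (3 q i j)
  have "qbin q (Suc i) (Suc j) * (qfact q (Suc i) * qfact q (Suc j)) =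
      (qbin q i (Suc j) * (qfact q i * qfact q (Suc j))) * qnum q (Suc i) +
      q ^ Suc i * (qbin q (Suc i) j * (qfact q (Suc i) * qfact q j)) * qnum q (Suc j)"
    by (simp add: qfact_def algebra_simps)
  also have "\<dots> = qfact q (Suc (i + j)) * (qnum q (Suc i) + q ^ Suc i * qnum q (Suc j))"
    using 3 by (simp add: algebra_simps)
  also have "\<dots> = qfact q (Suc i + Suc j)"
    using qnum_add[of q "Suc i" "Suc j"] by (simp add: qfact_def)
  finally show ?case .
qed (simp_all add: qfact_def)

lemma qnum_mult: "(q - 1) * qnum q m = q ^ m - 1"
  by (induction m) (simp_all add: qnum_def algebra_simps)

lemma qnum_nonzero:
  fixes q :: "'k::field"
  assumes "has_mult_order q n" "0 < l" "l < n"
  shows "qnum q l \<noteq> 0"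
  using qnum_mult[of q l] assms by (auto simp: has_mult_order_def)

text \<open>\<open>(q - 1) [n] = q^n - 1 = 0\<close>, and q differs from 1 because its order is at
  least 2.\<close>

lemma qnum_order:
  fixes q :: "'k::field"
  assumes "has_mult_order q n" "2 \<le> n"
  shows "qnum q n = 0"
proof -
  have "q \<noteq> 1" using assms(1,2) unfolding has_mult_order_def
    by (metis One_nat_def Suc_1 lessI less_le_trans power_one_right zero_less_one)
  then show ?thesis
    using qnum_mult[of q n] assms(1) by (simp add: has_mult_order_def)
qed

text \<open>\<open>[n]! = 0\<close> whereas \<open>[i]!\<close> and \<open>[j]!\<close> are nonzero
  for i, j < n, so the product formula forces the coefficient to vanish. This is why
  \<open>y\<close> keeps its nilpotency degree on tensor products.\<close>

lemma qbin_order: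
  fixes q :: "'k::field"
  assumes "has_mult_order q n" "0 < i" "0 < j" "i + j = n"
  shows "qbin q i j = 0"
proof -
  have nz: "qfact q l \<noteq> 0" if "l < n" for l
    using that qnum_nonzero[OF assms(1)] by (auto simp: qfact_def)
  obtain m where m: "n = Suc m"
    using assms by (cases n) auto
  have "qfact q n = 0"
    using qnum_order[OF assms(1)] assms m by (simp add: qfact_def)
  then show ?thesis
    using qbin_qfact[of q i j] nz[of i] nz[of j] assms by auto
qed

text \<open>The \<open>q\<close>-binomial theorem for operators with \<open>B A = q A B\<close>.\<close>

lemma q_binomial:
  fixes A B :: "('i \<Rightarrow> 'k::field) \<Rightarrow> 'i \<Rightarrow> 'k"
  assumes lA: "lin A" and lB: "lin B"
    and closed: "\<And>f. f \<in> U \<Longrightarrow> A f \<in> U" "\<And>f. f \<in> U \<Longrightarrow> B f \<in> U"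
    and comm: "\<And>f. f \<in> U \<Longrightarrow> B (A f) = (\<lambda>i. q * A (B f) i)"
    and f: "f \<in> U"
  shows "((\<lambda>f i. A f i + B f i) ^^ m) f =
    (\<lambda>i. \<Sum>s\<le>m. qbin q s (m - s) * (A ^^ s) ((B ^^ (m - s)) f) i)"
proof (induction m)
  case 0
  then show ?case by simp
next
  case (Suc m)
  have BU: "(B ^^ t) f \<in> U" for t
    by (induction t) (use f closed in auto)
  have AU: "(A ^^ s) u \<in> U" if "u \<in> U" for s u
    by (induction s) (use that closed in auto)
  have BA: "B ((A ^^ s) u) = (\<lambda>i. q ^ s * (A ^^ s) (B u) i)" if "u \<in> U" for s u
  proof (induction s)
    case (Suc s)
    have "B ((A ^^ Suc s) u) = (\<lambda>i. q * A (B ((A ^^ s) u)) i)"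
      using comm[OF AU[OF that]] by simp
    then show ?case
      by (simp add: Suc lin_scale[OF lA] mult.assoc)
  qed simp
  define T where "T s = (A ^^ s) ((B ^^ (Suc m - s)) f)" for s
  have "((\<lambda>f i. A f i + B f i) ^^ Suc m) f i =
      (\<Sum>s\<le>m. qbin q s (m - s) * T (Suc s) i) + (\<Sum>s\<le>m. q ^ s * qbin q s (m - s) * T s i)" for i
  proof -
    have "B (\<lambda>i. qbin q s (m - s) * (A ^^ s) ((B ^^ (m - s)) f) i) i =
        q ^ s * qbin q s (m - s) * T s i" if "s \<le> m" for s
      using that BA[OF BU, of s "m - s"] by (simp add: lin_scale[OF lB] T_def Suc_diff_le)
    then show ?thesis
      by (simp add: Suc lin_sum[OF lA] lin_sum[OF lB] lin_scale[OF lA] T_def)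
  qed
  also have "\<dots> i = (\<Sum>s\<le>Suc m. qbin q s (Suc m - s) * T s i)" for i
  proof -
    \<comment> \<open>Pascal's rule. For \<open>s = m\<close> the second index of the coefficient is
      0 and the last term is absent, hence the case distinction.\<close>
    have *: "qbin q (Suc s) (m - s) * T (Suc s) i = qbin q s (m - s) * T (Suc s) i +
        (if s < m then q ^ Suc s * qbin q (Suc s) (m - Suc s) * T (Suc s) i else 0)"
      if "s \<le> m" for s
    proof (cases "s = m")
      case True
      then show ?thesis by (cases m) auto
    next
      case False
      then have "s < m" using that by simp
      then obtain t where "m = Suc (s + t)"
        using less_imp_Suc_add by blast
      then have "m - s = Suc t" "m - Suc s = t" "s < m" by auto
      then show ?thesis by (simp add: algebra_simps)
    qed
    have "(\<Sum>s\<le>m. q ^ s * qbin q s (m - s) * T s i) =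
        T 0 i + (\<Sum>s<m. q ^ Suc s * qbin q (Suc s) (m - Suc s) * T (Suc s) i)"
      unfolding lessThan_Suc_atMost[symmetric] sum.lessThan_Suc_shift by simp
    also have "(\<Sum>s<m. q ^ Suc s * qbin q (Suc s) (m - Suc s) * T (Suc s) i) =
        (\<Sum>s\<le>m. if s < m then q ^ Suc s * qbin q (Suc s) (m - Suc s) * T (Suc s) i else 0)"
      unfolding lessThan_Suc_atMost[symmetric] by simp
    finally have **: "(\<Sum>s\<le>m. q ^ s * qbin q s (m - s) * T s i) = T 0 i +
        (\<Sum>s\<le>m. if s < m then q ^ Suc s * qbin q (Suc s) (m - Suc s) * T (Suc s) i else 0)" .
    have "(\<Sum>s\<le>Suc m. qbin q s (Suc m - s) * T s i) =
        T 0 i + (\<Sum>s\<le>m. qbin q (Suc s) (m - s) * T (Suc s) i)"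
      unfolding sum.atMost_Suc_shift by simp
    also have "(\<Sum>s\<le>m. qbin q (Suc s) (m - s) * T (Suc s) i) =
        (\<Sum>s\<le>m. qbin q s (m - s) * T (Suc s) i) +
        (\<Sum>s\<le>m. if s < m then q ^ Suc s * qbin q (Suc s) (m - Suc s) * T (Suc s) i else 0)"
      unfolding sum.distrib[symmetric] by (intro sum.cong refl *) simp
    finally show ?thesis using ** by (simp add: algebra_simps)
  qed
  finally show ?case by (simp add: T_def fun_eq_iff)
qed

section \<open>Operators on one tensor factor and on direct sums\<close>

section \<open>Operators on tensor products and direct sums\<close>

text \<open>\<open>A\<close> tensored with the identity: a tensor is a function on pairs, and
  \<open>A\<close> acts on each slice with fixed second coordinate.\<close>

definition left_op :: "(('i \<Rightarrow> 'k::field) \<Rightarrow> 'i' \<Rightarrow> 'k) \<Rightarrow> ('i \<times> 'j \<Rightarrow> 'k) \<Rightarrow> 'i' \<times> 'j \<Rightarrow> 'k"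
  where "left_op A f = (\<lambda>p. A (\<lambda>i. f (i, snd p)) (fst p))"

definition right_op :: "(('j \<Rightarrow> 'k::field) \<Rightarrow> 'j' \<Rightarrow> 'k) \<Rightarrow> ('i \<times> 'j \<Rightarrow> 'k) \<Rightarrow> 'i \<times> 'j' \<Rightarrow> 'k"
  where "right_op B f = (\<lambda>p. B (\<lambda>j. f (fst p, j)) (snd p))"

definition sum_op :: "(('i \<Rightarrow> 'k::field) \<Rightarrow> 'i' \<Rightarrow> 'k) \<Rightarrow> (('j \<Rightarrow> 'k) \<Rightarrow> 'j' \<Rightarrow> 'k) \<Rightarrow>
    ('i + 'j \<Rightarrow> 'k) \<Rightarrow> 'i' + 'j' \<Rightarrow> 'k"
  where "sum_op A B f = case_sum (A (\<lambda>i. f (Inl i))) (B (\<lambda>j. f (Inr j)))"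

lemma left_op_apply: "left_op A f (i, j) = A (\<lambda>i'. f (i', j)) i"
  by (simp add: left_op_def)

lemma right_op_apply: "right_op B f (i, j) = B (\<lambda>j'. f (i, j')) j"
  by (simp add: right_op_def)

lemma sum_op_apply [simp]: "sum_op A B f (Inl i) = A (\<lambda>i. f (Inl i)) i"
    "sum_op A B f (Inr j) = B (\<lambda>j. f (Inr j)) j"
  by (simp_all add: sum_op_def)

lemma lin_left_op: "lin A \<Longrightarrow> lin (left_op A)"
  unfolding lin_def left_op_def by simp

lemma lin_right_op: "lin A \<Longrightarrow> lin (right_op A)"
  unfolding lin_def right_op_def by simp

lemma lin_sum_op: "lin A \<Longrightarrow> lin B \<Longrightarrow> lin (sum_op A B)"
  unfolding lin_def sum_op_def by (simp add: fun_eq_iff split: sum.split)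

lemma vecs_slices:
  assumes "f \<in> vecs (I \<times> J)"
  shows "(\<lambda>i. f (i, j)) \<in> vecs I" "(\<lambda>j. f (i, j)) \<in> vecs J"
    "j \<notin> J \<Longrightarrow> (\<lambda>i. f (i, j)) = (\<lambda>_. 0)" "i \<notin> I \<Longrightarrow> (\<lambda>j. f (i, j)) = (\<lambda>_. 0)"
  using assms by (auto simp: vecs_def)

lemma vecs_summands:
  assumes "f \<in> vecs (Sum_Type.Plus I J)"
  shows "(\<lambda>i. f (Inl i)) \<in> vecs I" "(\<lambda>j. f (Inr j)) \<in> vecs J"
  using assms by (auto simp: vecs_def)

lemma left_op_vecs:
  assumes "lin A" "A ` vecs I \<subseteq> vecs I'" "f \<in> vecs (I \<times> J)"
  shows "left_op A f \<in> vecs (I' \<times> J)"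
proof (rule vecsI)
  fix p assume p: "p \<notin> I' \<times> J"
  obtain i j where ij: "p = (i, j)" by force
  show "left_op A f p = 0"
  proof (cases "j \<in> J")
    case True
    then have "A (\<lambda>i. f (i, j)) \<in> vecs I'" "i \<notin> I'"
      using vecs_slices(1)[OF assms(3)] assms(2) p ij by auto
    from vecsD[OF this] show ?thesis by (simp add: ij left_op_apply)
  next
    case False
    then show ?thesis
      using vecs_slices(3)[OF assms(3), of j] by (simp add: ij left_op_apply lin_zero[OF assms(1)])
  qed
qed

lemma right_op_vecs:
  assumes "lin A" "A ` vecs J \<subseteq> vecs J'" "f \<in> vecs (I \<times> J)"
  shows "right_op A f \<in> vecs (I \<times> J')"
proof (rule vecsI)
  fix p assume p: "p \<notin> I \<times> J'"
  obtain i j where ij: "p = (i, j)" by force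
  show "right_op A f p = 0"
  proof (cases "i \<in> I")
    case True
    then have "A (\<lambda>j. f (i, j)) \<in> vecs J'" "j \<notin> J'"
      using vecs_slices(2)[OF assms(3)] assms(2) p ij by auto
    from vecsD[OF this] show ?thesis by (simp add: ij right_op_apply)
  next
    case False
    then show ?thesis
      using vecs_slices(4)[OF assms(3), of i] by (simp add: ij right_op_apply lin_zero[OF assms(1)])
  qed
qed

lemma sum_op_vecs:
  assumes "A ` vecs I \<subseteq> vecs I'" "B ` vecs J \<subseteq> vecs J'" "f \<in> vecs (Sum_Type.Plus I J)"
  shows "sum_op A B f \<in> vecs (Sum_Type.Plus I' J')"
proof (rule vecsI)
  fix p assume p: "p \<notin> Sum_Type.Plus I' J'"
  have "A (\<lambda>i. f (Inl i)) \<in> vecs I'" "B (\<lambda>i. f (Inr i)) \<in> vecs J'"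
    using vecs_summands[OF assms(3)] assms by auto
  then show "sum_op A B f p = 0"
    using p by (cases p) (auto simp: vecs_def)
qed

text \<open>Expanding along the functions \<open>delta_fun j\<close> with j in the finite set
  \<open>J\<close> turns the action of \<open>B\<close> into a finite sum, and \<open>A\<close>
  passes through it by linearity.\<close>

lemma left_right_commute:
  fixes A :: "('i \<Rightarrow> 'k::field) \<Rightarrow> 'i' \<Rightarrow> 'k" and B :: "('j \<Rightarrow> 'k) \<Rightarrow> 'j' \<Rightarrow> 'k"
  assumes "finite J" "lin A" "lin B" "f \<in> vecs (I \<times> J)"
  shows "right_op B (left_op A f) = left_op A (right_op B f)"
proof
  fix p :: "'i' \<times> 'j'"
  obtain x y where p: "p = (x, y)" by force
  have "(\<lambda>j. A (\<lambda>i. f (i, j)) x) \<in> vecs J"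
    using vecs_slices(3)[OF assms(4)] by (auto simp: vecs_def lin_zero[OF assms(2)])
  from lin_expand[OF assms(1) this assms(3)]
  have "right_op B (left_op A f) p = (\<Sum>j\<in>J. A (\<lambda>i. f (i, j)) x * B (delta_fun j) y)"
    by (simp add: p left_op_def right_op_def)
  moreover have "B (\<lambda>j. f (i, j)) y = (\<Sum>j\<in>J. B (delta_fun j) y * f (i, j))" for i
    using lin_expand[OF assms(1) vecs_slices(2)[OF assms(4)] assms(3)] by (simp add: mult.commute)
  then have "left_op A (right_op B f) p = A (\<lambda>i. \<Sum>j\<in>J. B (delta_fun j) y * f (i, j)) x"
    by (simp add: p left_op_def right_op_def)
  ultimately show "right_op B (left_op A f) p = left_op A (right_op B f) p"
    by (simp add: lin_sum[OF assms(2)] lin_scale[OF assms(2)] mult.commute)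
qed

text \<open>Module laws are known only on \<open>vecs I\<close>. The slices of a function supported
  on \<open>I \<times> J\<close> lie there, so the laws extend to tensors.\<close>

lemma left_op_cong:
  assumes "\<And>u. u \<in> vecs I \<Longrightarrow> A u = B u" "f \<in> vecs (I \<times> J)"
  shows "left_op A f = left_op B f"
  using assms(1)[OF vecs_slices(1)[OF assms(2)]] by (simp add: left_op_def)

lemma right_op_cong:
  assumes "\<And>u. u \<in> vecs J \<Longrightarrow> A u = B u" "f \<in> vecs (I \<times> J)"
  shows "right_op A f = right_op B f"
  using assms(1)[OF vecs_slices(2)[OF assms(2)]] by (simp add: right_op_def)

lemma left_op_left_op: "left_op A (left_op B f) = left_op (\<lambda>u. A (B u)) f"
  and right_op_right_op: "right_op A' (right_op B' f) = right_op (\<lambda>u. A' (B' u)) f"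
  by (simp_all add: left_op_def right_op_def)

lemma right_op_pow:
  fixes B :: "('j \<Rightarrow> 'k::field) \<Rightarrow> 'j \<Rightarrow> 'k"
  shows "(right_op B ^^ m) f = right_op (B ^^ m) f"
  by (induction m) (simp_all add: right_op_def)

section \<open>Operator modules, their homomorphisms, sums and tensor products\<close>

section \<open>Modules as linear operators on coordinate functions\<close>

text \<open>The vectors of a module are the functions supported on the finite set \<open>idx\<close>; \<open>gop h\<close> and
  \<open>yop\<close> are the actions of \<open>h\<close> and of the skew-primitive generator \<open>y\<close>. Modules over the group
  algebra are those with \<open>y = 0\<close>.\<close>

record ('g, 'i, 'k) gmod =
  idx :: "'i set"
  gop :: "'g \<Rightarrow> ('i \<Rightarrow> 'k) \<Rightarrow> 'i \<Rightarrow> 'k"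
  yop :: "('i \<Rightarrow> 'k) \<Rightarrow> 'i \<Rightarrow> 'k"

abbreviation gvecs :: "('g, 'i, 'k::field) gmod \<Rightarrow> ('i \<Rightarrow> 'k) set"
  where "gvecs M \<equiv> vecs (idx M)"

definition gsum :: "('g, 'i, 'k::field) gmod \<Rightarrow> ('g, 'j, 'k) gmod \<Rightarrow> ('g, 'i + 'j, 'k) gmod"
  where "gsum M M' = \<lparr>idx = Sum_Type.Plus (idx M) (idx M'), gop = (\<lambda>h. sum_op (gop M h) (gop M' h)),
    yop = sum_op (yop M) (yop M')\<rparr>"

definition gchar :: "('g \<Rightarrow> 'k::field) \<Rightarrow> ('g, nat, 'k) gmod"
  where "gchar \<psi> = \<lparr>idx = {0}, gop = (\<lambda>h f i. \<psi> h * f i), yop = (\<lambda>f i. 0)\<rparr>"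

context group_datum
begin

text \<open>The number \<open>m\<close> bounds the nilpotency of \<open>y\<close>: degree 1 gives
  modules over the group algebra, the order of \<open>\<chi> g\<close> (if at least 2) those over
  \<open>H\<close>, and intermediate degrees occur when a module is decomposed. Apart from
  linearity, the laws are imposed only on the vectors of \<open>M\<close>.\<close>

definition gmodule :: "nat \<Rightarrow> ('a, 'i, 'k) gmod \<Rightarrow> bool"
  where "gmodule m M \<longleftrightarrow> finite (idx M) \<and>
    (\<forall>h\<in>carrier G. lin (gop M h) \<and> gop M h ` gvecs M \<subseteq> gvecs M) \<and>
    lin (yop M) \<and> yop M ` gvecs M \<subseteq> gvecs M \<and>
    (\<forall>f\<in>gvecs M. gop M \<one> f = f \<and>
      (\<forall>h\<in>carrier G. \<forall>k\<in>carrier G. gop M (h \<otimes> k) f = gop M h (gop M k f)) \<and>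
      (\<forall>h\<in>carrier G. yop M (gop M h f) = (\<lambda>i. \<chi> h * gop M h (yop M f) i)) \<and>
      (yop M ^^ m) f = (\<lambda>_. 0))"

definition ghom :: "('a, 'i, 'k) gmod \<Rightarrow> ('a, 'j, 'k) gmod \<Rightarrow> (('i \<Rightarrow> 'k) \<Rightarrow> 'j \<Rightarrow> 'k) \<Rightarrow> bool"
  where "ghom M M' P \<longleftrightarrow> lin P \<and> P ` gvecs M \<subseteq> gvecs M' \<and>
    (\<forall>f\<in>gvecs M. (\<forall>h\<in>carrier G. P (gop M h f) = gop M' h (P f)) \<and> P (yop M f) = yop M' (P f))"

definition giso :: "('a, 'i, 'k) gmod \<Rightarrow> ('a, 'j, 'k) gmod \<Rightarrow> bool"
  where "giso M M' \<longleftrightarrow> (\<exists>P Q. ghom M M' P \<and> ghom M' M Q \<and>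
    (\<forall>f\<in>gvecs M. Q (P f) = f) \<and> (\<forall>f\<in>gvecs M'. P (Q f) = f))"

text \<open>The action through \<Delta>(h) = h \<otimes> h and \<Delta>(y) = y \<otimes> g + 1
  \<otimes> y.\<close>

definition gtensor :: "('a, 'i, 'k) gmod \<Rightarrow> ('a, 'j, 'k) gmod \<Rightarrow> ('a, 'i \<times> 'j, 'k) gmod"
  where "gtensor M M' = \<lparr>idx = idx M \<times> idx M',
    gop = (\<lambda>h f. left_op (gop M h) (right_op (gop M' h) f)),
    yop = (\<lambda>f p. left_op (yop M) (right_op (gop M' g) f) p + right_op (yop M') f p)\<rparr>"

text \<open>The uniserial module with basis \<open>1, y, \<dots>, y\<^bsup>j-1\<^esup>\<close> and trivial top.\<close>

definition uniserial :: "nat \<Rightarrow> ('a, nat, 'k) gmod"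
  where "uniserial j = \<lparr>idx = {..<j}, gop = (\<lambda>h f i. inverse (\<chi> h) ^ i * f i),
    yop = (\<lambda>f i. if 0 < i \<and> i < j then f (i - 1) else 0)\<rparr>"

lemma gmoduleI:
  assumes "finite (idx M)" "\<And>h. h \<in> carrier G \<Longrightarrow> lin (gop M h)" "lin (yop M)"
    and "\<And>h f. h \<in> carrier G \<Longrightarrow> f \<in> gvecs M \<Longrightarrow> gop M h f \<in> gvecs M"
    and "\<And>f. f \<in> gvecs M \<Longrightarrow> yop M f \<in> gvecs M"
    and "\<And>f. f \<in> gvecs M \<Longrightarrow> gop M \<one> f = f"
    and "\<And>h k f. h \<in> carrier G \<Longrightarrow> k \<in> carrier G \<Longrightarrow> f \<in> gvecs M \<Longrightarrow>
      gop M (h \<otimes> k) f = gop M h (gop M k f)"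
    and "\<And>h f. h \<in> carrier G \<Longrightarrow> f \<in> gvecs M \<Longrightarrow>
      yop M (gop M h f) = (\<lambda>i. \<chi> h * gop M h (yop M f) i)"
    and "\<And>f. f \<in> gvecs M \<Longrightarrow> (yop M ^^ m) f = (\<lambda>_. 0)"
  shows "gmodule m M"
  using assms by (simp add: gmodule_def image_subset_iff)

lemma gmoduleD:
  assumes "gmodule m M"
  shows gm_finite: "finite (idx M)"
    and gm_lin: "h \<in> carrier G \<Longrightarrow> lin (gop M h)"
    and gm_ylin: "lin (yop M)"
    and gm_closed: "h \<in> carrier G \<Longrightarrow> f \<in> gvecs M \<Longrightarrow> gop M h f \<in> gvecs M"
    and gm_yclosed: "f \<in> gvecs M \<Longrightarrow> yop M f \<in> gvecs M"
    and gm_one: "f \<in> gvecs M \<Longrightarrow> gop M \<one> f = f"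
    and gm_mult: "h \<in> carrier G \<Longrightarrow> k \<in> carrier G \<Longrightarrow> f \<in> gvecs M \<Longrightarrow>
      gop M (h \<otimes> k) f = gop M h (gop M k f)"
    and gm_rel: "h \<in> carrier G \<Longrightarrow> f \<in> gvecs M \<Longrightarrow>
      yop M (gop M h f) = (\<lambda>i. \<chi> h * gop M h (yop M f) i)"
    and gm_nil: "f \<in> gvecs M \<Longrightarrow> (yop M ^^ m) f = (\<lambda>_. 0)"
  using assms by (auto simp: gmodule_def)

lemma gm_image: "gmodule m M \<Longrightarrow> h \<in> carrier G \<Longrightarrow> gop M h ` gvecs M \<subseteq> gvecs M"
  and gm_yimage: "gmodule m M \<Longrightarrow> yop M ` gvecs M \<subseteq> gvecs M"
  by (auto simp: gmodule_def)

lemma gm_inv: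
  assumes "gmodule m M" "h \<in> carrier G" "f \<in> gvecs M"
  shows "gop M h (gop M (inv h) f) = f" "gop M (inv h) (gop M h f) = f"
  using gm_mult[OF assms(1), of h "inv h" f] gm_mult[OF assms(1), of "inv h" h f] gm_one[OF assms(1)]
    assms by simp_all

lemma gm_ypow_closed: "gmodule m M \<Longrightarrow> f \<in> gvecs M \<Longrightarrow> (yop M ^^ i) f \<in> gvecs M"
  by (induction i) (auto simp: gm_yclosed)

lemma gm_rel_pow:
  assumes "gmodule m M" "h \<in> carrier G" "f \<in> gvecs M"
  shows "(yop M ^^ i) (gop M h f) = (\<lambda>x. \<chi> h ^ i * gop M h ((yop M ^^ i) f) x)"
proof (induction i)
  case (Suc i)
  then show ?case
    using gm_rel[OF assms(1,2) gm_ypow_closed[OF assms(1,3)], of i]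
    by (simp add: lin_scale[OF gm_ylin[OF assms(1)]] mult_ac)
qed simp

lemma gmodule_mono:
  assumes "gmodule m M" "m \<le> m'"
  shows "gmodule m' M"
proof -
  have "(yop M ^^ m') f = (\<lambda>_. 0)" if f: "f \<in> gvecs M" for f
    using gm_nil[OF assms(1) gm_ypow_closed[OF assms(1) f], of "m' - m"] assms(2)
      funpow_add[of m "m' - m" "yop M"] by simp
  then show ?thesis
    using assms(1) by (auto simp: gmodule_def)
qed

lemma gm_yzero: "gmodule 1 M \<Longrightarrow> f \<in> gvecs M \<Longrightarrow> yop M f = (\<lambda>_. 0)"
  using gm_nil[of 1 M f] by simp

lemma ghomD:
  assumes "ghom M M' P"
  shows ghom_lin: "lin P"
    and ghom_closed: "f \<in> gvecs M \<Longrightarrow> P f \<in> gvecs M'"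
    and ghom_gop: "f \<in> gvecs M \<Longrightarrow> h \<in> carrier G \<Longrightarrow> P (gop M h f) = gop M' h (P f)"
    and ghom_yop: "f \<in> gvecs M \<Longrightarrow> P (yop M f) = yop M' (P f)"
  using assms by (auto simp: ghom_def)

lemma ghomI:
  assumes "lin P" "\<And>f. f \<in> gvecs M \<Longrightarrow> P f \<in> gvecs M'"
    "\<And>f h. f \<in> gvecs M \<Longrightarrow> h \<in> carrier G \<Longrightarrow> P (gop M h f) = gop M' h (P f)"
    "\<And>f. f \<in> gvecs M \<Longrightarrow> P (yop M f) = yop M' (P f)"
  shows "ghom M M' P"
  using assms by (auto simp: ghom_def)

lemma ghom_image: "ghom M M' P \<Longrightarrow> P ` gvecs M \<subseteq> gvecs M'"
  by (auto simp: ghom_def)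

lemma ghom_ypow: "gmodule m M \<Longrightarrow> ghom M M' P \<Longrightarrow> f \<in> gvecs M \<Longrightarrow>
    P ((yop M ^^ i) f) = (yop M' ^^ i) (P f)"
  by (induction i) (simp_all add: ghom_yop gm_ypow_closed)

lemma giso_refl: "giso M M"
  unfolding giso_def ghom_def using lin_id by blast

lemma giso_sym: "giso M M' \<Longrightarrow> giso M' M"
  unfolding giso_def by blast

lemma ghom_comp:
  assumes "ghom M M' P" "ghom M' M'' P'"
  shows "ghom M M'' (\<lambda>f. P' (P f))"
proof (rule ghomI)
  show "lin (\<lambda>f. P' (P f))"
    by (rule lin_comp[OF ghom_lin[OF assms(2)] ghom_lin[OF assms(1)]])
qed (simp_all add: ghom_closed[OF assms(1)] ghom_closed[OF assms(2)] ghom_gop[OF assms(1)]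
    ghom_gop[OF assms(2)] ghom_yop[OF assms(1)] ghom_yop[OF assms(2)])

lemma giso_trans:
  assumes "giso M M'" "giso M' M''"
  shows "giso M M''"
proof -
  obtain P Q where P: "ghom M M' P" "ghom M' M Q"
    "\<forall>f\<in>gvecs M. Q (P f) = f" "\<forall>f\<in>gvecs M'. P (Q f) = f"
    using assms(1) unfolding giso_def by blast
  obtain P' Q' where P': "ghom M' M'' P'" "ghom M'' M' Q'"
    "\<forall>f\<in>gvecs M'. Q' (P' f) = f" "\<forall>f\<in>gvecs M''. P' (Q' f) = f"
    using assms(2) unfolding giso_def by blast
  show ?thesis
    unfolding giso_def
  proof (intro exI conjI)
    show "ghom M M'' (\<lambda>f. P' (P f))" "ghom M'' M (\<lambda>f. Q (Q' f))"
      using P P' ghom_comp by blast+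
    show "\<forall>f\<in>gvecs M. Q (Q' (P' (P f))) = f" "\<forall>f\<in>gvecs M''. P' (P (Q (Q' f))) = f"
      using P P' ghom_closed[OF P(1)] ghom_closed[OF P'(2)] by simp_all
  qed
qed

text \<open>The inverse of a bijective homomorphism is a homomorphism, so for \<open>Q\<close> only
  linearity and the range have to be supplied.\<close>

lemma gisoI:
  assumes M: "gmodule m M" and P: "ghom M M' P" and Q: "lin Q" "\<And>f. f \<in> gvecs M' \<Longrightarrow> Q f \<in> gvecs M"
    and inv: "\<And>f. f \<in> gvecs M \<Longrightarrow> Q (P f) = f" "\<And>f. f \<in> gvecs M' \<Longrightarrow> P (Q f) = f"
  shows "giso M M'"
proof -
  have "ghom M' M Q"
  proof (rule ghomI)
    fix f assume f: "f \<in> gvecs M'"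
    show "Q (yop M' f) = yop M (Q f)"
      using ghom_yop[OF P Q(2)[OF f]] inv(1)[OF gm_yclosed[OF M Q(2)[OF f]]] inv(2)[OF f] by simp
    fix h assume h: "h \<in> carrier G"
    show "Q (gop M' h f) = gop M h (Q f)"
      using ghom_gop[OF P Q(2)[OF f] h] inv(1)[OF gm_closed[OF M h Q(2)[OF f]]] inv(2)[OF f] by simp
  qed (use Q in auto)
  then show ?thesis
    unfolding giso_def using P inv by blast
qed

lemma gsum_simps [simp]:
  "idx (gsum M M') = Sum_Type.Plus (idx M) (idx M')"
  "gop (gsum M M') h = sum_op (gop M h) (gop M' h)"
  "yop (gsum M M') = sum_op (yop M) (yop M')"
  by (simp_all add: gsum_def)

lemma gtensor_simps [simp]:
  "idx (gtensor M M') = idx M \<times> idx M'"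
  "gop (gtensor M M') h f = left_op (gop M h) (right_op (gop M' h) f)"
  "yop (gtensor M M') f = (\<lambda>p. left_op (yop M) (right_op (gop M' g) f) p + right_op (yop M') f p)"
  by (simp_all add: gtensor_def)

lemma gmodule_gsum:
  fixes M :: "('a, 'i, 'k) gmod" and M' :: "('a, 'j, 'k) gmod"
  assumes M: "gmodule m M" and M': "gmodule m M'"
  shows "gmodule m (gsum M M')"
proof (rule gmoduleI)
  show "finite (idx (gsum M M'))"
    using M M' by (simp add: gm_finite)
  show "lin (gop (gsum M M') h)" if "h \<in> carrier G" for h
    using that M M' by (simp add: gm_lin lin_sum_op)
  show "lin (yop (gsum M M'))"
    using M M' by (simp add: gm_ylin lin_sum_op)
  fix f assume f: "f \<in> gvecs (gsum M M')"
  note ff = vecs_summands[OF f[simplified]]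
  show "gop (gsum M M') h f \<in> gvecs (gsum M M')" if "h \<in> carrier G" for h
    using sum_op_vecs[OF gm_image[OF M that] gm_image[OF M' that]] f by simp
  show "yop (gsum M M') f \<in> gvecs (gsum M M')"
    using sum_op_vecs[OF gm_yimage[OF M] gm_yimage[OF M']] f by simp
  show "gop (gsum M M') \<one> f = f"
    by (auto simp: sum_op_def fun_eq_iff gm_one[OF M ff(1)] gm_one[OF M' ff(2)] split: sum.split)
  show "gop (gsum M M') (h \<otimes> k) f = gop (gsum M M') h (gop (gsum M M') k f)"
    if "h \<in> carrier G" "k \<in> carrier G" for h k
    by (auto simp: sum_op_def fun_eq_iff gm_mult[OF M that ff(1)] gm_mult[OF M' that ff(2)]
        split: sum.split)
  show "yop (gsum M M') (gop (gsum M M') h f) =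
      (\<lambda>i. \<chi> h * gop (gsum M M') h (yop (gsum M M') f) i)"
    if "h \<in> carrier G" for h
    by (auto simp: sum_op_def fun_eq_iff gm_rel[OF M that ff(1)] gm_rel[OF M' that ff(2)]
        split: sum.split)
  have "(sum_op A B ^^ m) f = sum_op (A ^^ m) (B ^^ m) f"
    for A :: "('i \<Rightarrow> 'k) \<Rightarrow> 'i \<Rightarrow> 'k" and B :: "('j \<Rightarrow> 'k) \<Rightarrow> 'j \<Rightarrow> 'k" and m
    by (induction m) (auto simp: sum_op_def fun_eq_iff split: sum.split)
  then show "(yop (gsum M M') ^^ m) f = (\<lambda>_. 0)"
    by (auto simp: sum_op_def fun_eq_iff gm_nil[OF M ff(1)] gm_nil[OF M' ff(2)] split: sum.split)
qed

text \<open>The only law that is not formal is nilpotency. On the tensor product \<open>y\<close> is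
  A + B with A = y \<otimes> g, B = 1 \<otimes> y and B A = \<chi>(g) A B. In the q-binomial
  expansion of (A + B)^m the inner coefficients vanish because \<chi>(g) has order m, and the two
  outer terms vanish because A^m = B^m = 0.\<close>

lemma gmodule_gtensor:
  fixes M :: "('a, 'i, 'k) gmod" and M' :: "('a, 'j, 'k) gmod"
  assumes M: "gmodule m M" and M': "gmodule m M'" and m: "m = 1 \<or> has_mult_order (\<chi> g) m"
  shows "gmodule m (gtensor M M')"
proof -
  let ?W = "vecs (idx M \<times> idx M')"
  have L: "left_op (gop M h) f \<in> ?W" if "h \<in> carrier G" "f \<in> ?W" for h f
    by (rule left_op_vecs[OF gm_lin[OF M that(1)] gm_image[OF M that(1)] that(2)])
  have R: "right_op (gop M' h) f \<in> ?W" if "h \<in> carrier G" "f \<in> ?W" for h f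
    by (rule right_op_vecs[OF gm_lin[OF M' that(1)] gm_image[OF M' that(1)] that(2)])
  have LY: "left_op (yop M) f \<in> ?W" if "f \<in> ?W" for f
    by (rule left_op_vecs[OF gm_ylin[OF M] gm_yimage[OF M] that])
  have RY: "right_op (yop M') f \<in> ?W" if "f \<in> ?W" for f
    by (rule right_op_vecs[OF gm_ylin[OF M'] gm_yimage[OF M'] that])
  note comm = left_right_commute[OF gm_finite[OF M']]
  have cL: "right_op (gop M' k) (left_op (gop M h) f) = left_op (gop M h) (right_op (gop M' k) f)"
    if "h \<in> carrier G" "k \<in> carrier G" "f \<in> ?W" for h k f
    by (rule comm[OF gm_lin[OF M that(1)] gm_lin[OF M' that(2)] that(3)])
  have cLY: "right_op (gop M' k) (left_op (yop M) f) = left_op (yop M) (right_op (gop M' k) f)"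
    if "k \<in> carrier G" "f \<in> ?W" for k f
    by (rule comm[OF gm_ylin[OF M] gm_lin[OF M' that(1)] that(2)])
  have cYL: "right_op (yop M') (left_op (gop M h) f) = left_op (gop M h) (right_op (yop M') f)"
    if "h \<in> carrier G" "f \<in> ?W" for h f
    by (rule comm[OF gm_lin[OF M that(1)] gm_ylin[OF M'] that(2)])
  have cYY: "right_op (yop M') (left_op (yop M) f) = left_op (yop M) (right_op (yop M') f)"
    if "f \<in> ?W" for f
    by (rule comm[OF gm_ylin[OF M] gm_ylin[OF M'] that])
  have multL: "left_op (gop M (h \<otimes> k)) f = left_op (gop M h) (left_op (gop M k) f)"
    if "h \<in> carrier G" "k \<in> carrier G" "f \<in> ?W" for h k f
    unfolding left_op_left_op by (rule left_op_cong[OF gm_mult[OF M that(1,2)] that(3)])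
  have multR: "right_op (gop M' (h \<otimes> k)) f = right_op (gop M' h) (right_op (gop M' k) f)"
    if "h \<in> carrier G" "k \<in> carrier G" "f \<in> ?W" for h k f
    unfolding right_op_right_op by (rule right_op_cong[OF gm_mult[OF M' that(1,2)] that(3)])
  have relL: "left_op (yop M) (left_op (gop M h) f) = (\<lambda>p. \<chi> h * left_op (gop M h) (left_op (yop M) f) p)"
    if "h \<in> carrier G" "f \<in> ?W" for h f
  proof -
    have "left_op (yop M) (left_op (gop M h) f) = left_op (\<lambda>u i. \<chi> h * gop M h (yop M u) i) f"
      unfolding left_op_left_op by (rule left_op_cong[OF gm_rel[OF M that(1)] that(2)])
    then show ?thesis by (simp add: left_op_def)
  qed
  have relR: "right_op (yop M') (right_op (gop M' h) f) =
      (\<lambda>p. \<chi> h * right_op (gop M' h) (right_op (yop M') f) p)"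
    if "h \<in> carrier G" "f \<in> ?W" for h f
  proof -
    have "right_op (yop M') (right_op (gop M' h) f) = right_op (\<lambda>u i. \<chi> h * gop M' h (yop M' u) i) f"
      unfolding right_op_right_op by (rule right_op_cong[OF gm_rel[OF M' that(1)] that(2)])
    then show ?thesis by (simp add: right_op_def)
  qed
  define A where "A f = left_op (yop M) (right_op (gop M' g) f)" for f :: "'i \<times> 'j \<Rightarrow> 'k"
  define B :: "('i \<times> 'j \<Rightarrow> 'k) \<Rightarrow> 'i \<times> 'j \<Rightarrow> 'k" where "B = right_op (yop M')"
  have linA: "lin A"
    unfolding A_def
    by (rule lin_comp[OF lin_left_op[OF gm_ylin[OF M]] lin_right_op[OF gm_lin[OF M' g_closed]]])
  have linB: "lin B"
    unfolding B_def by (intro lin_right_op gm_ylin[OF M'])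
  have AW: "A f \<in> ?W" and BW: "B f \<in> ?W" if "f \<in> ?W" for f
    using that LY R[OF g_closed] RY by (simp_all add: A_def B_def)
  show ?thesis
  proof (rule gmoduleI)
    show "finite (idx (gtensor M M'))"
      using M M' by (simp add: gm_finite)
    show "lin (gop (gtensor M M') h)" if "h \<in> carrier G" for h
      unfolding gtensor_def gmod.simps
      by (rule lin_comp[OF lin_left_op[OF gm_lin[OF M that]] lin_right_op[OF gm_lin[OF M' that]]])
    show "lin (yop (gtensor M M'))"
    proof -
      have "yop (gtensor M M') = (\<lambda>f p. A f p + B f p)"
        by (simp add: gtensor_def A_def B_def)
      moreover have "lin (\<lambda>f p. A f p + B f p)"
        by (rule linI) (simp_all add: lin_add[OF linA] lin_add[OF linB] lin_scale[OF linA]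
            lin_scale[OF linB] algebra_simps)
      ultimately show ?thesis by simp
    qed
    fix f assume "f \<in> gvecs (gtensor M M')"
    then have f: "f \<in> ?W" by simp
    show "gop (gtensor M M') h f \<in> gvecs (gtensor M M')" if "h \<in> carrier G" for h
      using L R f that by simp
    show "yop (gtensor M M') f \<in> gvecs (gtensor M M')"
      using vecs_add[OF AW[OF f] BW[OF f]] by (simp add: A_def B_def)
    have "left_op (gop M \<one>) f = f" "right_op (gop M' \<one>) f = f"
      using left_op_cong[where A = "gop M \<one>" and B = "\<lambda>u. u", OF gm_one[OF M] f]
        right_op_cong[where A = "gop M' \<one>" and B = "\<lambda>u. u", OF gm_one[OF M'] f]
      by (simp_all add: left_op_def right_op_def)
    then show "gop (gtensor M M') \<one> f = f" by simp
    show "gop (gtensor M M') (h \<otimes> k) f = gop (gtensor M M') h (gop (gtensor M M') k f)"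
      if "h \<in> carrier G" "k \<in> carrier G" for h k
      using that f by (simp add: multL multR L R cL)
    show "yop (gtensor M M') (gop (gtensor M M') h f) =
        (\<lambda>i. \<chi> h * gop (gtensor M M') h (yop (gtensor M M') f) i)" if h: "h \<in> carrier G" for h
    proof -
      \<comment> \<open>Centrality of \<open>g\<close> is what lets y \<otimes> g satisfy the
        relation with h \<otimes> h.\<close>
      have gR: "right_op (gop M' g) (right_op (gop M' h) f) = right_op (gop M' h) (right_op (gop M' g) f)"
        using multR[OF g_closed h f] multR[OF h g_closed f] g_central[OF h] by simp
      have "left_op (yop M) (right_op (gop M' g) (left_op (gop M h) (right_op (gop M' h) f))) =
          (\<lambda>p. \<chi> h * left_op (gop M h) (right_op (gop M' h) (A f)) p)"
        using h f by (simp add: cL R g_closed gR relL cLY A_def)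
      moreover have "right_op (yop M') (left_op (gop M h) (right_op (gop M' h) f)) =
          (\<lambda>p. \<chi> h * left_op (gop M h) (right_op (gop M' h) (B f)) p)"
        using h f by (simp add: cYL R relR B_def lin_scale[OF lin_left_op[OF gm_lin[OF M h]]])
      moreover have "left_op (gop M h) (right_op (gop M' h) (\<lambda>p. A f p + B f p)) =
          (\<lambda>p. left_op (gop M h) (right_op (gop M' h) (A f)) p +
            left_op (gop M h) (right_op (gop M' h) (B f)) p)"
        by (simp add: lin_add[OF lin_left_op[OF gm_lin[OF M h]]]
            lin_add[OF lin_right_op[OF gm_lin[OF M' h]]])
      ultimately show ?thesis
        by (simp add: A_def B_def algebra_simps)
    qed
    \<comment> \<open>Moving \<open>y\<close> past \<open>g\<close> in the second factor costs the
      scalar \<chi>(g).\<close>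
    have BA: "B (A u) = (\<lambda>i. \<chi> g * A (B u) i)" if "u \<in> ?W" for u
      unfolding A_def B_def using that
      by (simp add: cYY R g_closed relR lin_scale[OF lin_left_op[OF gm_ylin[OF M]]])
    have Apow: "(A ^^ s) f = left_op (yop M ^^ s) (right_op (gop M' g ^^ s) f)" for s
    proof (induction s)
      case (Suc s)
      have Rs: "right_op (gop M' g ^^ s) f \<in> ?W"
        unfolding right_op_pow[symmetric] by (induction s) (simp_all add: f R g_closed)
      have "right_op (gop M' g) (left_op (yop M ^^ s) (right_op (gop M' g ^^ s) f)) =
          left_op (yop M ^^ s) (right_op (gop M' g) (right_op (gop M' g ^^ s) f))"
        by (rule comm[OF lin_pow[OF gm_ylin[OF M]] gm_lin[OF M' g_closed] Rs])
      moreover have "(A ^^ Suc s) f =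
          left_op (yop M) (right_op (gop M' g) (left_op (yop M ^^ s) (right_op (gop M' g ^^ s) f)))"
        unfolding funpow.simps comp_def Suc by (rule A_def)
      ultimately show ?case
        by (simp add: left_op_left_op right_op_right_op comp_def)
    qed (simp add: left_op_def right_op_def)
    have Am: "(A ^^ m) f = (\<lambda>_. 0)"
    proof -
      have "right_op (gop M' g ^^ m) f \<in> ?W"
        unfolding right_op_pow[symmetric] by (induction m) (simp_all add: f R g_closed)
      from left_op_cong[where A = "yop M ^^ m" and B = "\<lambda>_ _. 0", OF gm_nil[OF M] this] show ?thesis
        by (simp add: Apow left_op_def)
    qed
    have Bm: "(B ^^ m) f = (\<lambda>_. 0)"
      using right_op_cong[where A = "yop M' ^^ m" and B = "\<lambda>_ _. 0", OF gm_nil[OF M'] f]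
      by (simp add: B_def right_op_pow right_op_def)
    have "(yop (gtensor M M') ^^ m) f = ((\<lambda>f p. A f p + B f p) ^^ m) f"
      by (simp add: gtensor_def A_def B_def)
    also have "\<dots> = (\<lambda>i. \<Sum>s\<le>m. qbin (\<chi> g) s (m - s) * (A ^^ s) ((B ^^ (m - s)) f) i)"
      by (rule q_binomial[OF linA linB AW BW BA f])
    also have "\<dots> = (\<lambda>_. 0)"
    proof -
      \<comment> \<open>For m = 1 there are only the outer terms s = 0 and s = m; the order of
        \<chi>(g) is needed only for the inner ones.\<close>
      have "qbin (\<chi> g) s (m - s) * (A ^^ s) ((B ^^ (m - s)) f) i = 0" if "s \<le> m" for s i
      proof (cases "s = 0 \<or> s = m")
        case True
        then show ?thesis
          using Am Bm by auto
      next
        case False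
        then have "m \<noteq> 1" "0 < s" "0 < m - s" using that by auto
        then show ?thesis
          using qbin_order[of "\<chi> g" m s "m - s"] m that by simp
      qed
      then show ?thesis by (intro ext sum.neutral ballI) (simp only: atMost_iff)
    qed
    finally show "(yop (gtensor M M') ^^ m) f = (\<lambda>_. 0)" .
  qed
qed

end

section \<open>Functoriality, associativity, distributivity and commutation of tensor
  products\<close>

section \<open>Isomorphisms between tensor products and direct sums\<close>

lemma vecs_support: "f \<in> vecs I \<Longrightarrow> f i \<noteq> 0 \<Longrightarrow> i \<in> I"
  by (auto simp: vecs_def)

context group_datum
begin

lemma uniserial_simps [simp]:
  "idx (uniserial j) = {..<j}"
  "gop (uniserial j) h f = (\<lambda>i. inverse (\<chi> h) ^ i * f i)"
  "yop (uniserial j) f = (\<lambda>i. if 0 < i \<and> i < j then f (i - 1) else 0)"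
  by (simp_all add: uniserial_def)

lemma uniserial_ypow:
  "f \<in> vecs {..<j} \<Longrightarrow> (yop (uniserial j) ^^ m) f = (\<lambda>i. if m \<le> i \<and> i < j then f (i - m) else 0)"
proof (induction m)
  case 0
  then show ?case by (auto simp: vecs_def fun_eq_iff)
next
  case (Suc m)
  then show ?case by (auto simp: fun_eq_iff)
qed

lemma gmodule_uniserial:
  assumes "j \<le> m"
  shows "gmodule m (uniserial j)"
proof (rule gmoduleI)
  show "yop (uniserial j) (gop (uniserial j) h f) =
      (\<lambda>i. \<chi> h * gop (uniserial j) h (yop (uniserial j) f) i)" if "h \<in> carrier G" for h f
    using character_nonzero[OF that] by (auto simp: fun_eq_iff power_eq_if)
  show "(yop (uniserial j) ^^ m) f = (\<lambda>_. 0)" if "f \<in> gvecs (uniserial j)" for f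
    using that assms uniserial_ypow[of f j m] by (auto simp: fun_eq_iff)
  show "lin (yop (uniserial j))" "\<And>h. lin (gop (uniserial j) h)"
    by (auto intro!: linI simp: algebra_simps)
qed (auto simp: vecs_def character_one character_mult power_mult_distrib fun_eq_iff)

lemma gchar_simps [simp]:
  "idx (gchar \<psi>) = {0}" "gop (gchar \<psi>) h f = (\<lambda>i. \<psi> h * f i)" "yop (gchar \<psi>) f = (\<lambda>i. 0)"
  by (simp_all add: gchar_def)

lemma gmodule_gchar:
  assumes "\<psi> \<one> = 1" "\<And>h k. h \<in> carrier G \<Longrightarrow> k \<in> carrier G \<Longrightarrow> \<psi> (h \<otimes> k) = \<psi> h * \<psi> k"
  shows "gmodule 1 (gchar \<psi>)"
proof (rule gmoduleI)
  show "lin (yop (gchar \<psi>))" "\<And>h. lin (gop (gchar \<psi>) h)"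
    by (auto intro!: linI simp: algebra_simps)
qed (auto simp: assms vecs_def fun_eq_iff)

lemma gtensor_cong_left:
  fixes M :: "('a, 'i, 'k) gmod" and M' :: "('a, 'j, 'k) gmod" and N :: "('a, 'l, 'k) gmod"
  assumes "giso M M'" "gmodule m M" "gmodule m M'" "gmodule m N"
  shows "giso (gtensor M N) (gtensor M' N)"
proof -
  \<comment> \<open>Kept general in source and target, since it is applied to \<open>P\<close> and
    to its inverse.\<close>
  have hom: "ghom (gtensor M N) (gtensor M' N) (left_op P)"
    if P: "ghom M M' P" and M: "gmodule m M" and M': "gmodule m M'"
    for P and M :: "('a, 'x, 'k) gmod" and M' :: "('a, 'y, 'k) gmod"
  proof (rule ghomI)
    show "lin (left_op P)" by (rule lin_left_op[OF ghom_lin[OF P]])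
    fix f assume "f \<in> gvecs (gtensor M N)"
    then have f: "f \<in> vecs (idx M \<times> idx N)" by simp
    show "left_op P f \<in> gvecs (gtensor M' N)"
      using left_op_vecs[OF ghom_lin[OF P] ghom_image[OF P] f] by simp
    note comm = left_right_commute[OF gm_finite[OF assms(4)] ghom_lin[OF P] gm_lin[OF assms(4)] f]
    have R: "right_op (gop N h) f \<in> vecs (idx M \<times> idx N)" if "h \<in> carrier G" for h
      by (rule right_op_vecs[OF gm_lin[OF assms(4) that] gm_image[OF assms(4) that] f])
    have L: "left_op P (left_op (gop M h) u) = left_op (gop M' h) (left_op P u)"
      if "h \<in> carrier G" "u \<in> vecs (idx M \<times> idx N)" for h u
      unfolding left_op_left_op by (rule left_op_cong[OF ghom_gop[OF P _ that(1)] that(2)])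
    have LY: "left_op P (left_op (yop M) u) = left_op (yop M') (left_op P u)"
      if "u \<in> vecs (idx M \<times> idx N)" for u
      unfolding left_op_left_op by (rule left_op_cong[OF ghom_yop[OF P] that])
    show "left_op P (gop (gtensor M N) h f) = gop (gtensor M' N) h (left_op P f)"
      if "h \<in> carrier G" for h
      using that by (simp add: L R comm)
    show "left_op P (yop (gtensor M N) f) = yop (gtensor M' N) (left_op P f)"
      using left_right_commute[OF gm_finite[OF assms(4)] ghom_lin[OF P] gm_ylin[OF assms(4)] f]
      by (simp add: LY R g_closed comm lin_add[OF lin_left_op[OF ghom_lin[OF P]]])
  qed
  obtain P Q where P: "ghom M M' P" "ghom M' M Q"
    and inv: "\<And>f. f \<in> gvecs M \<Longrightarrow> Q (P f) = f" "\<And>f. f \<in> gvecs M' \<Longrightarrow> P (Q f) = f"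
    using assms(1) unfolding giso_def by blast
  show ?thesis
    unfolding giso_def
  proof (intro exI conjI ballI)
    show "ghom (gtensor M N) (gtensor M' N) (left_op P)" "ghom (gtensor M' N) (gtensor M N) (left_op Q)"
      using hom P assms by blast+
    show "left_op Q (left_op P f) = f" if "f \<in> gvecs (gtensor M N)" for f
      using left_op_cong[where A = "\<lambda>u. Q (P u)" and B = "\<lambda>u. u", OF inv(1)] that
      unfolding left_op_left_op by (simp add: left_op_def)
    show "left_op P (left_op Q f) = f" if "f \<in> gvecs (gtensor M' N)" for f
      using left_op_cong[where A = "\<lambda>u. P (Q u)" and B = "\<lambda>u. u", OF inv(2)] that
      unfolding left_op_left_op by (simp add: left_op_def)
  qed
qed

lemma gtensor_cong_right:
  fixes M :: "('a, 'i, 'k) gmod" and M' :: "('a, 'j, 'k) gmod" and N :: "('a, 'l, 'k) gmod"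
  assumes "giso M M'" "gmodule m M" "gmodule m M'" "gmodule m N"
  shows "giso (gtensor N M) (gtensor N M')"
proof -
  have hom: "ghom (gtensor N M) (gtensor N M') (right_op P)"
    if P: "ghom M M' P" and M: "gmodule m M" and M': "gmodule m M'"
    for P and M :: "('a, 'x, 'k) gmod" and M' :: "('a, 'y, 'k) gmod"
  proof (rule ghomI)
    show "lin (right_op P)" by (rule lin_right_op[OF ghom_lin[OF P]])
    fix f assume "f \<in> gvecs (gtensor N M)"
    then have f: "f \<in> vecs (idx N \<times> idx M)" by simp
    show "right_op P f \<in> gvecs (gtensor N M')"
      using right_op_vecs[OF ghom_lin[OF P] ghom_image[OF P] f] by simp
    have R: "right_op (gop M h) f \<in> vecs (idx N \<times> idx M)" if "h \<in> carrier G" for h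
      by (rule right_op_vecs[OF gm_lin[OF M that] gm_image[OF M that] f])
    have comm: "right_op P (left_op (gop N h) u) = left_op (gop N h) (right_op P u)"
      if "h \<in> carrier G" "u \<in> vecs (idx N \<times> idx M)" for h u
      by (rule left_right_commute[OF gm_finite[OF M] gm_lin[OF assms(4) that(1)] ghom_lin[OF P] that(2)])
    have commY: "right_op P (left_op (yop N) u) = left_op (yop N) (right_op P u)"
      if "u \<in> vecs (idx N \<times> idx M)" for u
      by (rule left_right_commute[OF gm_finite[OF M] gm_ylin[OF assms(4)] ghom_lin[OF P] that])
    have L: "right_op P (right_op (gop M h) f) = right_op (gop M' h) (right_op P f)"
      if "h \<in> carrier G" for h
      unfolding right_op_right_op by (rule right_op_cong[OF ghom_gop[OF P _ that] f])
    have LY: "right_op P (right_op (yop M) f) = right_op (yop M') (right_op P f)"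
      unfolding right_op_right_op by (rule right_op_cong[OF ghom_yop[OF P] f])
    show "right_op P (gop (gtensor N M) h f) = gop (gtensor N M') h (right_op P f)"
      if "h \<in> carrier G" for h
      using that by (simp add: L R comm)
    show "right_op P (yop (gtensor N M) f) = yop (gtensor N M') (right_op P f)"
      by (simp add: L LY R g_closed commY lin_add[OF lin_right_op[OF ghom_lin[OF P]]])
  qed
  obtain P Q where P: "ghom M M' P" "ghom M' M Q"
    and inv: "\<And>f. f \<in> gvecs M \<Longrightarrow> Q (P f) = f" "\<And>f. f \<in> gvecs M' \<Longrightarrow> P (Q f) = f"
    using assms(1) unfolding giso_def by blast
  show ?thesis
    unfolding giso_def
  proof (intro exI conjI ballI)
    show "ghom (gtensor N M) (gtensor N M') (right_op P)" "ghom (gtensor N M') (gtensor N M) (right_op Q)"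
      using hom P assms by blast+
    show "right_op Q (right_op P f) = f" if "f \<in> gvecs (gtensor N M)" for f
      using right_op_cong[where A = "\<lambda>u. Q (P u)" and B = "\<lambda>u. u", OF inv(1)] that
      unfolding right_op_right_op by (simp add: right_op_def)
    show "right_op P (right_op Q f) = f" if "f \<in> gvecs (gtensor N M')" for f
      using right_op_cong[where A = "\<lambda>u. P (Q u)" and B = "\<lambda>u. u", OF inv(2)] that
      unfolding right_op_right_op by (simp add: right_op_def)
  qed
qed

lemma gsum_cong:
  fixes M :: "('a, 'i, 'k) gmod" and M' :: "('a, 'j, 'k) gmod"
    and N :: "('a, 'l, 'k) gmod" and N' :: "('a, 'p, 'k) gmod"
  assumes "giso M M'" "giso N N'"
  shows "giso (gsum M N) (gsum M' N')"
proof -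
  obtain P Q where P: "ghom M M' P" "ghom M' M Q"
    and inv: "\<And>f. f \<in> gvecs M \<Longrightarrow> Q (P f) = f" "\<And>f. f \<in> gvecs M' \<Longrightarrow> P (Q f) = f"
    using assms(1) unfolding giso_def by blast
  obtain P' Q' where P': "ghom N N' P'" "ghom N' N Q'"
    and inv': "\<And>f. f \<in> gvecs N \<Longrightarrow> Q' (P' f) = f" "\<And>f. f \<in> gvecs N' \<Longrightarrow> P' (Q' f) = f"
    using assms(2) unfolding giso_def by blast
  have hom: "ghom (gsum M N) (gsum M' N') (sum_op P P')" if P: "ghom M M' P" "ghom N N' P'"
    for P P' and M :: "('a, 'x, 'k) gmod" and M' :: "('a, 'y, 'k) gmod"
      and N :: "('a, 'z, 'k) gmod" and N' :: "('a, 'w, 'k) gmod"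
  proof (rule ghomI)
    show "lin (sum_op P P')" using P by (simp add: lin_sum_op ghom_lin)
    fix f assume f: "f \<in> gvecs (gsum M N)"
    note ff = vecs_summands[OF f[simplified]]
    show "sum_op P P' f \<in> gvecs (gsum M' N')"
      using sum_op_vecs[OF ghom_image[OF P(1)] ghom_image[OF P(2)]] f by simp
    show "sum_op P P' (gop (gsum M N) h f) = gop (gsum M' N') h (sum_op P P' f)"
      if "h \<in> carrier G" for h
      by (auto simp: sum_op_def fun_eq_iff ghom_gop[OF P(1) ff(1) that] ghom_gop[OF P(2) ff(2) that]
          split: sum.split)
    show "sum_op P P' (yop (gsum M N) f) = yop (gsum M' N') (sum_op P P' f)"
      by (auto simp: sum_op_def fun_eq_iff ghom_yop[OF P(1) ff(1)] ghom_yop[OF P(2) ff(2)]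
          split: sum.split)
  qed
  show ?thesis
    unfolding giso_def
  proof (intro exI conjI ballI)
    show "ghom (gsum M N) (gsum M' N') (sum_op P P')" "ghom (gsum M' N') (gsum M N) (sum_op Q Q')"
      using hom P P' by blast+
    show "sum_op Q Q' (sum_op P P' f) = f" if "f \<in> gvecs (gsum M N)" for f
      using inv(1)[OF vecs_summands(1)[OF that[simplified]]]
        inv'(1)[OF vecs_summands(2)[OF that[simplified]]]
      by (auto simp: sum_op_def fun_eq_iff split: sum.split)
    show "sum_op P P' (sum_op Q Q' f) = f" if "f \<in> gvecs (gsum M' N')" for f
      using inv(2)[OF vecs_summands(1)[OF that[simplified]]]
        inv'(2)[OF vecs_summands(2)[OF that[simplified]]]
      by (auto simp: sum_op_def fun_eq_iff split: sum.split)
  qed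
qed

text \<open>Coassociativity: on both sides \<open>y\<close> acts by y \<otimes> g \<otimes> g + 1
  \<otimes> y \<otimes> g + 1 \<otimes> 1 \<otimes> y, so regrouping the indices is an
  isomorphism.\<close>

lemma gtensor_assoc:
  assumes "gmodule m M" "gmodule m M'" "gmodule m M''" "m = 1 \<or> has_mult_order (\<chi> g) m"
  shows "giso (gtensor (gtensor M M') M'') (gtensor M (gtensor M' M''))"
proof (rule gisoI[where P = "\<lambda>f (i, j, k). f ((i, j), k)" and Q = "\<lambda>f ((i, j), k). f (i, j, k)"])
  show "gmodule m (gtensor (gtensor M M') M'')"
    using assms by (simp add: gmodule_gtensor)
  show "ghom (gtensor (gtensor M M') M'') (gtensor M (gtensor M' M'')) (\<lambda>f (i, j, k). f ((i, j), k))"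
  proof (rule ghomI)
    show "(\<lambda>(i, j, k). yop (gtensor (gtensor M M') M'') f ((i, j), k)) =
        yop (gtensor M (gtensor M' M'')) (\<lambda>(i, j, k). f ((i, j), k))" for f
      by (auto simp: fun_eq_iff left_op_def right_op_def
          lin_add[OF gm_ylin[OF assms(2)]])
  qed (auto simp: lin_def fun_eq_iff vecs_def left_op_def right_op_def)
qed (auto simp: lin_def fun_eq_iff vecs_def)

lemma gtensor_unit_left:
  assumes "gmodule m M"
  shows "giso (gtensor (uniserial 1) M) M"
proof (rule giso_sym, rule gisoI[OF assms, where P = "\<lambda>f p. if fst p = 0 then f (snd p) else 0"
      and Q = "\<lambda>f i. f (0, i)"])
  show "ghom M (gtensor (uniserial 1) M) (\<lambda>f p. if fst p = 0 then f (snd p) else 0)"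
    by (rule ghomI) (auto simp: lin_def fun_eq_iff vecs_def left_op_def right_op_def
        lin_zero[OF gm_lin[OF assms]] lin_zero[OF gm_ylin[OF assms]])
qed (auto simp: lin_def fun_eq_iff vecs_def)

lemma gtensor_unit_right:
  assumes "gmodule m M"
  shows "giso (gtensor M (uniserial 1)) M"
proof (rule giso_sym, rule gisoI[OF assms, where P = "\<lambda>f p. if snd p = 0 then f (fst p) else 0"
      and Q = "\<lambda>f i. f (i, 0)"])
  show "ghom M (gtensor M (uniserial 1)) (\<lambda>f p. if snd p = 0 then f (fst p) else 0)"
    by (rule ghomI) (auto simp: lin_def fun_eq_iff vecs_def left_op_def right_op_def
        lin_zero[OF gm_lin[OF assms]] lin_zero[OF gm_ylin[OF assms]])
qed (auto simp: lin_def fun_eq_iff vecs_def)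

lemma gtensor_gsum_left:
  assumes "gmodule m M" "gmodule m M'" "gmodule m N" "m = 1 \<or> has_mult_order (\<chi> g) m"
  shows "giso (gtensor (gsum M M') N) (gsum (gtensor M N) (gtensor M' N))"
proof (rule gisoI[where P = "\<lambda>f. case_sum (\<lambda>(i, k). f (Inl i, k)) (\<lambda>(j, k). f (Inr j, k))"
      and Q = "\<lambda>f (x, k). case x of Inl i \<Rightarrow> f (Inl (i, k)) | Inr j \<Rightarrow> f (Inr (j, k))"])
  show "gmodule m (gtensor (gsum M M') N)"
    using assms by (simp add: gmodule_gtensor gmodule_gsum)
  show "ghom (gtensor (gsum M M') N) (gsum (gtensor M N) (gtensor M' N))
      (\<lambda>f. case_sum (\<lambda>(i, k). f (Inl i, k)) (\<lambda>(j, k). f (Inr j, k)))"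
    by (rule ghomI) (auto simp: lin_def fun_eq_iff vecs_def left_op_def right_op_def sum_op_def
        split: sum.split)
  show "(\<lambda>(x, k). case x of Inl i \<Rightarrow> f (Inl (i, k)) | Inr j \<Rightarrow> f (Inr (j, k))) \<in> gvecs (gtensor (gsum M M') N)"
    if "f \<in> gvecs (gsum (gtensor M N) (gtensor M' N))" for f
    using that by (intro vecsI) (auto split: sum.splits dest: vecs_support)
qed (auto simp: lin_def fun_eq_iff split: sum.split)

lemma gtensor_gsum_right:
  assumes "gmodule m M" "gmodule m M'" "gmodule m N" "m = 1 \<or> has_mult_order (\<chi> g) m"
  shows "giso (gtensor N (gsum M M')) (gsum (gtensor N M) (gtensor N M'))"
proof (rule gisoI[where P = "\<lambda>f. case_sum (\<lambda>(k, i). f (k, Inl i)) (\<lambda>(k, j). f (k, Inr j))"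
      and Q = "\<lambda>f (k, x). case x of Inl i \<Rightarrow> f (Inl (k, i)) | Inr j \<Rightarrow> f (Inr (k, j))"])
  show "gmodule m (gtensor N (gsum M M'))"
    using assms by (simp add: gmodule_gtensor gmodule_gsum)
  show "ghom (gtensor N (gsum M M')) (gsum (gtensor N M) (gtensor N M'))
      (\<lambda>f. case_sum (\<lambda>(k, i). f (k, Inl i)) (\<lambda>(k, j). f (k, Inr j)))"
    by (rule ghomI) (auto simp: lin_def fun_eq_iff vecs_def left_op_def right_op_def sum_op_def
        split: sum.split)
  show "(\<lambda>(k, x). case x of Inl i \<Rightarrow> f (Inl (k, i)) | Inr j \<Rightarrow> f (Inr (k, j))) \<in> gvecs (gtensor N (gsum M M'))"
    if "f \<in> gvecs (gsum (gtensor N M) (gtensor N M'))" for f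
    using that by (intro vecsI) (auto split: sum.splits dest: vecs_support)
qed (auto simp: lin_def fun_eq_iff split: sum.split)

text \<open>The flip of the two factors. In degree 1 the operator \<open>y\<close> is zero on both
  tensor products, which leaves only the symmetric action of h \<otimes> h to compare.\<close>

lemma gtensor_comm:
  assumes "gmodule 1 M" "gmodule 1 M'"
  shows "giso (gtensor M M') (gtensor M' M)"
proof (rule gisoI[where P = "\<lambda>f (j, i). f (i, j)" and Q = "\<lambda>f (i, j). f (j, i)"])
  show MM': "gmodule 1 (gtensor M M')"
    using assms by (simp add: gmodule_gtensor)
  have M'M: "gmodule 1 (gtensor M' M)"
    using assms by (simp add: gmodule_gtensor)
  show "ghom (gtensor M M') (gtensor M' M) (\<lambda>f (j, i). f (i, j))"
  proof (rule ghomI)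
    fix f assume f: "f \<in> gvecs (gtensor M M')"
    then have f': "f \<in> vecs (idx M \<times> idx M')" by simp
    then show sw: "(\<lambda>(j, i). f (i, j)) \<in> gvecs (gtensor M' M)"
      by (auto simp: vecs_def)
    show "(\<lambda>(j, i). yop (gtensor M M') f (i, j)) = yop (gtensor M' M) (\<lambda>(j, i). f (i, j))"
      using gm_yzero[OF M'M sw] gm_yzero[OF MM' f] by auto
    show "(\<lambda>(j, i). gop (gtensor M M') h f (i, j)) = gop (gtensor M' M) h (\<lambda>(j, i). f (i, j))"
      if "h \<in> carrier G" for h
      using left_right_commute[OF gm_finite[OF assms(2)] gm_lin[OF assms(1) that]
          gm_lin[OF assms(2) that] f']
      by (auto simp: left_op_def right_op_def fun_eq_iff)
  qed (auto simp: lin_def fun_eq_iff)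
qed (auto simp: lin_def fun_eq_iff vecs_def)

text \<open>The flip has to be corrected by \<open>g\<^sup>i\<close> on the degree \<open>i\<close> part of the uniserial factor.\<close>

lemma gtensor_uniserial_comm:
  assumes V: "gmodule 1 V" and j: "j \<le> m" and m: "1 \<le> m" "m = 1 \<or> has_mult_order (\<chi> g) m"
  shows "giso (gtensor V (uniserial j)) (gtensor (uniserial j) V)"
proof (rule gisoI[where P = "\<lambda>f (i, v). gop V (g [^] i) (\<lambda>v. f (v, i)) v"
      and Q = "\<lambda>f (v, i). gop V (inv (g [^] i)) (\<lambda>v. f (i, v)) v"])
  have gi: "g [^] i \<in> carrier G" for i :: nat
    by (simp add: g_closed)
  have central: "g [^] i \<otimes> h = h \<otimes> g [^] i" if "h \<in> carrier G" for i :: nat and h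
  proof (induction i)
    case (Suc i)
    then show ?case
      using that g_central[OF that] gi by (simp add: m_assoc g_closed) (metis g_closed gi m_assoc)
  qed (use that in simp)
  show "gmodule m (gtensor V (uniserial j))"
    using gmodule_mono[OF V m(1)] j m(2) by (simp add: gmodule_gtensor gmodule_uniserial)
  note simps = fun_eq_iff left_op_def right_op_def lin_scale[OF gm_lin[OF V]]
    lin_add[OF gm_lin[OF V]] lin_zero[OF gm_lin[OF V]]
  show "ghom (gtensor V (uniserial j)) (gtensor (uniserial j) V)
      (\<lambda>f (i, v). gop V (g [^] i) (\<lambda>v. f (v, i)) v)"
  proof (rule ghomI)
    fix f assume "f \<in> gvecs (gtensor V (uniserial j))"
    then have f: "f \<in> vecs (idx V \<times> {..<j})" by simp
    note fs = vecs_slices(1)[OF f]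
    have z: "(\<lambda>v. f (v, i)) = (\<lambda>_. 0)" if "\<not> i < j" for i
      using vecs_slices(3)[OF f] that by simp
    show "(\<lambda>(i, v). gop V (g [^] i) (\<lambda>v. f (v, i)) v) \<in> gvecs (gtensor (uniserial j) V)"
      using gm_closed[OF V gi fs] z lin_zero[OF gm_lin[OF V gi]]
      by (fastforce simp: vecs_def)
    show "(\<lambda>(i, v). gop V (g [^] i) (\<lambda>v. gop (gtensor V (uniserial j)) h f (v, i)) v) =
        gop (gtensor (uniserial j) V) h (\<lambda>(i, v). gop V (g [^] i) (\<lambda>v. f (v, i)) v)"
      if h: "h \<in> carrier G" for h
    proof -
      have "gop V (g [^] i) (gop V h (\<lambda>v. f (v, i))) = gop V h (gop V (g [^] i) (\<lambda>v. f (v, i)))" for i :: nat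
        by (simp add: gm_mult[OF V gi h fs, symmetric] gm_mult[OF V h gi fs, symmetric] central[OF h])
      then show ?thesis
        using gi h by (simp add: simps)
    qed
    show "(\<lambda>(i, v). gop V (g [^] i) (\<lambda>v. yop (gtensor V (uniserial j)) f (v, i)) v) =
        yop (gtensor (uniserial j) V) (\<lambda>(i, v). gop V (g [^] i) (\<lambda>v. f (v, i)) v)"
    proof -
      have Y0: "yop V (\<lambda>v. c * f (v, i)) = (\<lambda>_. 0)" for c i
        by (rule gm_yzero[OF V vecs_scale[OF fs]])
      have Y0': "yop V (gop V (g [^] i) (\<lambda>v. f (v, i))) = (\<lambda>_. 0)" for i :: nat
        by (rule gm_yzero[OF V gm_closed[OF V gi fs]])
      \<comment> \<open>The factor \<open>g\<close> in \<Delta>(y) raises the correction from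
        g^(i-1) to g^i, which is the correction used in degree i.\<close>
      have "gop V (g [^] i) (\<lambda>v. f (v, i - Suc 0)) = gop V g (gop V (g [^] (i - Suc 0)) (\<lambda>v. f (v, i - Suc 0)))"
        if "0 < i" for i :: nat
        using gm_mult[OF V g_closed gi fs, of "i - Suc 0" "i - Suc 0"] central[OF g_closed, of "i - Suc 0"]
          nat_pow_Suc[of g "i - Suc 0"] that by (cases i) auto
      then show ?thesis
        using gi g_closed Y0' by (auto simp: simps Y0)
    qed
  qed (auto simp: lin_def simps gi)
  show "lin (\<lambda>f (v, i :: nat). gop V (inv (g [^] i)) (\<lambda>v. f (i, v)) v)"
    using gi by (auto simp: lin_def simps lin_add[OF gm_lin[OF V inv_closed[OF gi]]]
        lin_scale[OF gm_lin[OF V inv_closed[OF gi]]])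
  show "(\<lambda>(v, i). gop V (inv (g [^] i)) (\<lambda>v. f (i, v)) v) \<in> gvecs (gtensor V (uniserial j))"
    if "f \<in> gvecs (gtensor (uniserial j) V)" for f
  proof -
    have f: "f \<in> vecs ({..<j} \<times> idx V)" using that by simp
    show ?thesis
      using gm_closed[OF V inv_closed[OF gi] vecs_slices(2)[OF f]] vecs_slices(4)[OF f]
        lin_zero[OF gm_lin[OF V inv_closed[OF gi]]]
      by (fastforce simp: vecs_def)
  qed
  show "(\<lambda>(v, i). gop V (inv (g [^] i)) (\<lambda>v. case (i, v) of
      (i, v) \<Rightarrow> gop V (g [^] i) (\<lambda>v. f (v, i)) v) v) = f"
    if "f \<in> gvecs (gtensor V (uniserial j))" for f
    using gm_inv(2)[OF V gi vecs_slices(1)[OF that[simplified]]] by (simp add: fun_eq_iff)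
  show "(\<lambda>(i, v). gop V (g [^] i) (\<lambda>v. case (v, i) of
      (v, i) \<Rightarrow> gop V (inv (g [^] i)) (\<lambda>v. f (i, v)) v) v) = f"
    if "f \<in> gvecs (gtensor (uniserial j) V)" for f
    using gm_inv(1)[OF V gi vecs_slices(2)[OF that[simplified]]] by (simp add: fun_eq_iff)
qed

end

section \<open>Tensor products with the uniserial module of length two\<close>

lemma has_mult_order_inverse: "has_mult_order q n \<Longrightarrow> has_mult_order (inverse q) n" for q :: "'k::field"
  by (simp add: has_mult_order_def power_inverse)

lemma Inl_in_Plus [simp]: "Inl i \<in> Sum_Type.Plus I J \<longleftrightarrow> i \<in> I"
  and Inr_in_Plus [simp]: "Inr j \<in> Sum_Type.Plus I J \<longleftrightarrow> j \<in> J"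
  by auto

lemma qnum_Suc: "qnum q (Suc t) = qnum q t + q ^ t"
  by (simp add: qnum_def)

lemma qnum_0: "qnum q 0 = 0"
  by (simp add: qnum_def)

context group_datum
begin

lemma inverse_character:
  shows "inverse (\<chi> \<one>) = 1"
    "h \<in> carrier G \<Longrightarrow> k \<in> carrier G \<Longrightarrow> inverse (\<chi> (h \<otimes> k)) = inverse (\<chi> h) * inverse (\<chi> k)"
  by (simp_all add: character_one character_mult)

abbreviation inv_char :: "('a, nat, 'k) gmod"
  where "inv_char \<equiv> gchar (\<lambda>h. inverse (\<chi> h))"

lemma gmodule_inv_char: "gmodule 1 inv_char"
  by (rule gmodule_gchar) (simp_all add: inverse_character)

text \<open>Write \<open>u\<^sub>0, u\<^sub>1\<close> and \<open>v\<^sub>0, v\<^sub>1, \<dots>\<close> for the bases of the two uniserial factors and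
  \<open>c\<^sub>i = 1 + q\<^sup>-\<^sup>1 + \<dots> + q\<^bsup>-(i-1)\<^esup>\<close>. The two summands are spanned by
  \<open>y\<^sup>i (u\<^sub>0 v\<^sub>0) = u\<^sub>0 v\<^sub>i + c\<^sub>i u\<^sub>1 v\<^bsub>i-1\<^esub>\<close> and by
  \<open>- u\<^sub>0 v\<^bsub>t+1\<^esub> + (c\<^sub>j - c\<^bsub>t+1\<^esub>) u\<^sub>1 v\<^sub>t\<close>; the change of basis has determinant \<open>c\<^sub>j\<close> in each degree.\<close>

lemma uniserial_two_tensor:
  assumes ord: "has_mult_order (\<chi> g) n" and j: "1 \<le> j" "j < n"
  shows "giso (gtensor (uniserial 2) (uniserial j))
    (gsum (uniserial (Suc j)) (gtensor inv_char (uniserial (j - 1))))"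
proof -
  define c where "c i = qnum (inverse (\<chi> g)) i" for i
  \<comment> \<open>The inverse of \<chi>(g) also has order n, and 0 < j < n. All divisions below
    are by this number.\<close>
  have cj: "c j \<noteq> 0"
    using qnum_nonzero[OF has_mult_order_inverse[OF ord], of j] j by (simp add: c_def)
  have c_Suc: "c (Suc t) = c t + inverse (\<chi> g) ^ t" for t
    by (simp add: c_def qnum_Suc)
  have c0: "c 0 = 0"
    by (simp add: c_def qnum_0)
  let ?S = "gsum (uniserial (Suc j)) (gtensor inv_char (uniserial (j - 1)))"
  let ?T = "gtensor (uniserial 2) (uniserial j)"
  define P :: "(nat + nat \<times> nat \<Rightarrow> 'k) \<Rightarrow> nat \<times> nat \<Rightarrow> 'k" where
    "P x = (\<lambda>(s, t). if s = 0 \<and> t < j then x (Inl t) - (if t = 0 then 0 else x (Inr (0, t - 1)))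
      else if s = 1 then c (Suc t) * x (Inl (Suc t)) + (c j - c (Suc t)) * x (Inr (0, t)) else 0)" for x
  \<comment> \<open>Cramer's rule: degree d couples the coordinates \<open>Inl d\<close> and
    \<open>Inr (0, d - 1)\<close> with \<open>(0, d)\<close> and \<open>(1, d - 1)\<close>, with
    determinant c_d + (c_j - c_d) = c_j.\<close>
  define Q :: "(nat \<times> nat \<Rightarrow> 'k) \<Rightarrow> nat + nat \<times> nat \<Rightarrow> 'k" where
    "Q f = case_sum (\<lambda>d. ((c j - c d) * f (0, d) + (if d = 0 then 0 else f (1, d - 1))) / c j)
      (\<lambda>(s, t). if s = 0 \<and> t < j - 1 then (f (1, t) - c (Suc t) * f (0, Suc t)) / c j else 0)" for f
  have n: "2 \<le> n" using j by simp
  have S: "gmodule n ?S"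
    using j n ord gmodule_mono[OF gmodule_inv_char, of n]
    by (intro gmodule_gsum gmodule_gtensor gmodule_uniserial) auto
  have "giso ?S ?T"
  proof (rule gisoI[OF S, where P = P and Q = Q])
    show "ghom ?S ?T P"
    proof (rule ghomI)
      show "lin P" by (rule linI) (auto simp: P_def algebra_simps split: prod.split)
      fix x assume "x \<in> gvecs ?S"
      then have x: "x \<in> vecs (Sum_Type.Plus {..<Suc j} ({0} \<times> {..<j - 1}))" by simp
      have xl: "x (Inl d) = 0" if "j < d" for d
        using vecsD[OF x, of "Inl d"] that by auto
      have xr: "x (Inr (0, t)) = 0" if "j \<le> Suc t" for t
        using vecsD[OF x, of "Inr (0, t)"] that by auto
      show "P x \<in> gvecs ?T"
        unfolding vecs_def by (simp add: P_def xl xr split: prod.split)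
      show "P (gop ?S h x) = gop ?T h (P x)" if "h \<in> carrier G" for h
      proof (rule ext, clarify)
        fix s t :: nat
        show "P (gop ?S h x) (s, t) = gop ?T h (P x) (s, t)"
          by (cases t) (auto simp: P_def left_op_def right_op_def algebra_simps)
      qed
      show "P (yop ?S x) = yop ?T (P x)"
      proof (rule ext, clarify)
        fix s t :: nat
        \<comment> \<open>In the row s = 1 the first index, the interior, the last index t = j - 1
          and the indices beyond the support behave differently.\<close>
        have "s = 0 \<or> s = 1 \<or> 2 \<le> s" "t = 0 \<or> (\<exists>d. t = Suc d)"
          "Suc t < j \<or> Suc t = j \<or> j \<le> t"
          by (auto intro: not0_implies_Suc)
        then consider "s = 0" | "s = 1" "t = 0" | d where "s = 1" "t = Suc d" "Suc t < j"
          | d where "s = 1" "t = Suc d" "Suc t = j" | "s = 1" "t \<noteq> 0" "j \<le> t" | "2 \<le> s"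
          by blast
        then show "P (yop ?S x) (s, t) = yop ?T (P x) (s, t)"
        proof cases
          case 1
          then show ?thesis
            by (auto simp: P_def left_op_def right_op_def)
        next
          case 2
          then show ?thesis
            using j by (auto simp: P_def left_op_def right_op_def c_Suc c0)
        next
          case (3 d)
          then show ?thesis
            by (auto simp: P_def left_op_def right_op_def c_Suc[of "Suc d"] algebra_simps)
        next
          case (4 d)
          then show ?thesis
            by (auto simp: P_def left_op_def right_op_def c_Suc[of "Suc d"] algebra_simps)
        next
          case 5
          then show ?thesis
            by (auto simp: P_def left_op_def right_op_def xl xr)
        next
          case 6
          then show ?thesis
            by (auto simp: P_def left_op_def right_op_def)
        qed
      qed
    qed
    show "lin Q"
      by (rule linI) (use cj in \<open>auto simp: Q_def field_simps split: sum.split\<close>)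
    show "Q f \<in> gvecs ?S" if "f \<in> gvecs ?T" for f
    proof (rule vecsI)
      fix p assume p: "p \<notin> idx ?S"
      have f: "f (s, t) = 0" if "j \<le> t" for s t
        using vecsD[OF \<open>f \<in> gvecs ?T\<close>, of "(s, t)"] that by auto
      show "Q f p = 0"
        using p f by (auto simp: Q_def split: sum.split)
    qed
    show "Q (P x) = x" if "x \<in> gvecs ?S" for x
    proof
      fix p
      have x: "x \<in> vecs (Sum_Type.Plus {..<Suc j} ({0} \<times> {..<j - 1}))" using that by simp
      have xl: "x (Inl d) = 0" if "j < d" for d
        using vecsD[OF x, of "Inl d"] that by auto
      have xr: "x (Inr (0, t)) = 0" if "j \<le> Suc t" for t
        using vecsD[OF x, of "Inr (0, t)"] that by auto
      show "Q (P x) p = x p"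
      proof (cases p)
        case (Inl d)
        have "d = 0 \<or> (\<exists>e. d = Suc e)" "d < j \<or> d = j \<or> j < d"
          by (auto intro: not0_implies_Suc)
        then consider "d = 0" | e where "d = Suc e" "d < j" | e where "d = Suc e" "d = j"
          | e where "d = Suc e" "j < d"
          by blast
        then show ?thesis
          using j cj by cases (auto simp: Inl Q_def P_def c0 xl xr field_simps)
      next
        case (Inr r)
        obtain s t where r: "r = (s, t)" by force
        show ?thesis
        proof (cases "s = 0 \<and> t < j - 1")
          case True
          then show ?thesis
            using cj by (auto simp: Inr r Q_def P_def field_simps)
        next
          case False
          then have "x p = 0" using vecsD[OF x, of p] by (auto simp: Inr r)
          then show ?thesis using False by (auto simp: Inr r Q_def)
        qed
      qed
    qed
    show "P (Q f) = f" if "f \<in> gvecs ?T" for f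
    proof (rule ext, clarify)
      fix s t :: nat
      have f: "f (s, t) = 0" if "j \<le> t \<or> 2 \<le> s" for s t
        using vecsD[OF \<open>f \<in> gvecs ?T\<close>, of "(s, t)"] that by auto
      have "s = 0 \<or> s = 1 \<or> 2 \<le> s" "t = 0 \<or> (\<exists>d. t = Suc d)"
          "Suc t < j \<or> Suc t = j \<or> j \<le> t" "t < j \<or> j \<le> t"
        by (auto intro: not0_implies_Suc)
      then consider "s = 0" "t = 0" | d where "s = 0" "t = Suc d" "t < j" | "s = 0" "j \<le> t"
          | "s = 1" "Suc t < j" | "s = 1" "Suc t = j" | "s = 1" "j \<le> t" | "2 \<le> s"
        by blast
      then show "P (Q f) (s, t) = f (s, t)"
        using j cj by cases (auto simp: P_def Q_def c0 f field_simps)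
    qed
  qed
  then show ?thesis by (rule giso_sym)
qed

text \<open>Since c_n = 0, the vector y^n (u_0 v_0) = c_n u_1 v_(n-1) is zero, so u_0 v_0 generates
  a copy of U_n. The vectors u_1 v_t span a complementary submodule, which is U_n tensored with
  \<chi>^(-1). The change of basis is unitriangular, so nothing has to be inverted.\<close>

lemma uniserial_two_tensor_top:
  assumes ord: "has_mult_order (\<chi> g) n" and n: "2 \<le> n"
  shows "giso (gtensor (uniserial 2) (uniserial n))
    (gsum (uniserial n) (gtensor inv_char (uniserial n)))"
proof -
  define c where "c i = qnum (inverse (\<chi> g)) i" for i
  have cn: "c n = 0"
    using qnum_order[OF has_mult_order_inverse[OF ord]] n by (simp add: c_def)
  have c_Suc: "c (Suc t) = c t + inverse (\<chi> g) ^ t" for t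
    by (simp add: c_def qnum_Suc)
  have c0: "c 0 = 0"
    by (simp add: c_def qnum_0)
  let ?S = "gsum (uniserial n) (gtensor inv_char (uniserial n))"
  let ?T = "gtensor (uniserial 2) (uniserial n)"
  define P :: "(nat + nat \<times> nat \<Rightarrow> 'k) \<Rightarrow> nat \<times> nat \<Rightarrow> 'k" where
    "P x = (\<lambda>(s, t). if s = 0 then x (Inl t)
      else if s = 1 then c (Suc t) * x (Inl (Suc t)) + x (Inr (0, t)) else 0)" for x
  define Q :: "(nat \<times> nat \<Rightarrow> 'k) \<Rightarrow> nat + nat \<times> nat \<Rightarrow> 'k" where
    "Q f = case_sum (\<lambda>d. f (0, d))
      (\<lambda>(s, t). if s = 0 then f (1, t) - c (Suc t) * f (0, Suc t) else 0)" for f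
  have S: "gmodule n ?S"
    using n ord gmodule_mono[OF gmodule_inv_char, of n]
    by (intro gmodule_gsum gmodule_gtensor gmodule_uniserial) auto
  have "giso ?S ?T"
  proof (rule gisoI[OF S, where P = P and Q = Q])
    show "ghom ?S ?T P"
    proof (rule ghomI)
      show "lin P" by (rule linI) (auto simp: P_def algebra_simps split: prod.split)
      fix x assume "x \<in> gvecs ?S"
      then have x: "x \<in> vecs (Sum_Type.Plus {..<n} ({0} \<times> {..<n}))" by simp
      have xl: "x (Inl d) = 0" if "n \<le> d" for d
        using vecsD[OF x, of "Inl d"] that by auto
      have xr: "x (Inr (0, t)) = 0" if "n \<le> t" for t
        using vecsD[OF x, of "Inr (0, t)"] that by auto
      show "P x \<in> gvecs ?T"
        unfolding vecs_def by (simp add: P_def xl xr split: prod.split)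
      show "P (gop ?S h x) = gop ?T h (P x)" if "h \<in> carrier G" for h
      proof (rule ext, clarify)
        fix s t :: nat
        show "P (gop ?S h x) (s, t) = gop ?T h (P x) (s, t)"
          by (cases t) (auto simp: P_def left_op_def right_op_def algebra_simps)
      qed
      show "P (yop ?S x) = yop ?T (P x)"
      proof (rule ext, clarify)
        fix s t :: nat
        have "s = 0 \<or> s = 1 \<or> 2 \<le> s" "t = 0 \<or> (\<exists>d. t = Suc d)"
          "Suc t < n \<or> Suc t = n \<or> n \<le> t"
          by (auto intro: not0_implies_Suc)
        then consider "s = 0" | "s = 1" "t = 0" | d where "s = 1" "t = Suc d" "Suc t < n"
          | d where "s = 1" "t = Suc d" "Suc t = n" | "s = 1" "t \<noteq> 0" "n \<le> t" | "2 \<le> s"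
          by blast
        then show "P (yop ?S x) (s, t) = yop ?T (P x) (s, t)"
        proof cases
          case (3 d)
          then show ?thesis
            by (auto simp: P_def left_op_def right_op_def c_Suc[of "Suc d"] algebra_simps)
        next
          case (4 d)
          \<comment> \<open>This is c_n = 0, the coefficient with which \<open>y\<close> would send
            the last vector of U_n to u_1 v_(n-1).\<close>
          have "c (Suc d) + inverse (\<chi> g) ^ Suc d = 0"
            using c_Suc[of "Suc d"] cn 4 by simp
          then have "c (Suc d) * x (Inl (Suc d)) + inverse (\<chi> g) ^ Suc d * x (Inl (Suc d)) = 0"
            by (metis distrib_right mult_zero_left)
          then show ?thesis
            using 4 cn by (simp add: P_def left_op_def right_op_def algebra_simps)
        qed (use n in \<open>auto simp: P_def left_op_def right_op_def xl xr c_Suc c0\<close>)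
      qed
    qed
    show "lin Q"
      by (rule linI) (auto simp: Q_def field_simps split: sum.split)
    show "Q f \<in> gvecs ?S" if "f \<in> gvecs ?T" for f
    proof (rule vecsI)
      fix p assume p: "p \<notin> idx ?S"
      have f: "f (s, t) = 0" if "n \<le> t" for s t
        using vecsD[OF \<open>f \<in> gvecs ?T\<close>, of "(s, t)"] that by auto
      show "Q f p = 0"
      proof (cases p)
        case (Inl d)
        then have "n \<le> d" using p by simp
        then show ?thesis by (simp add: Inl Q_def f)
      next
        case (Inr r)
        obtain s t where r: "r = (s, t)" by force
        have "s \<noteq> 0 \<or> n \<le> t" using p by (auto simp: Inr r)
        then show ?thesis by (auto simp: Inr r Q_def f)
      qed
    qed
    show "Q (P x) = x" if "x \<in> gvecs ?S" for x
    proof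
      fix p
      have x: "x \<in> vecs (Sum_Type.Plus {..<n} ({0} \<times> {..<n}))" using that by simp
      have "x (Inr (s, t)) = 0" if "s \<noteq> 0" for s t
        using vecsD[OF x, of "Inr (s, t)"] that by auto
      then show "Q (P x) p = x p"
        by (auto simp: Q_def P_def split: sum.split)
    qed
    show "P (Q f) = f" if "f \<in> gvecs ?T" for f
    proof (rule ext, clarify)
      fix s t :: nat
      have "f (s, t) = 0" if "2 \<le> s" for s t
        using vecsD[OF \<open>f \<in> gvecs ?T\<close>, of "(s, t)"] that by auto
      then show "P (Q f) (s, t) = f (s, t)"
        by (auto simp: P_def Q_def)
    qed
  qed
  then show ?thesis by (rule giso_sym)
qed

end

section \<open>Submodules realized on natural number indices\<close>

section \<open>Submodules\<close>

text \<open>Only the group action survives. With \<psi> = 1 this restricts a module to the group;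
  with \<psi> = \<chi>^i it is the action for which y^i becomes a G-homomorphism.\<close>

definition gtwist_by :: "('g \<Rightarrow> 'k::field) \<Rightarrow> ('g, 'i, 'k) gmod \<Rightarrow> ('g, 'i, 'k) gmod"
  where "gtwist_by \<psi> M = \<lparr>idx = idx M, gop = (\<lambda>h f i. \<psi> h * gop M h f i), yop = (\<lambda>f i. 0)\<rparr>"

context group_datum
begin

text \<open>\<open>gsub M U W\<close>: the module \<open>W\<close> is isomorphic to the submodule \<open>U\<close> of \<open>M\<close>.\<close>

definition gsub :: "('a, 'i, 'k) gmod \<Rightarrow> ('i \<Rightarrow> 'k) set \<Rightarrow> ('a, 'j, 'k) gmod \<Rightarrow> bool"
  where "gsub M U W \<longleftrightarrow> (\<exists>L Q. ghom W M L \<and> lin Q \<and> L ` gvecs W \<subseteq> U \<and> Q ` U \<subseteq> gvecs W \<and>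
    (\<forall>w\<in>gvecs W. Q (L w) = w) \<and> (\<forall>f\<in>U. L (Q f) = f))"

lemma gsubE:
  assumes "gsub M U W"
  obtains L Q where "ghom W M L" "lin Q" "\<And>w. w \<in> gvecs W \<Longrightarrow> L w \<in> U" "\<And>f. f \<in> U \<Longrightarrow> Q f \<in> gvecs W"
    "\<And>w. w \<in> gvecs W \<Longrightarrow> Q (L w) = w" "\<And>f. f \<in> U \<Longrightarrow> L (Q f) = f"
proof -
  obtain L Q where "ghom W M L" "lin Q" "L ` gvecs W \<subseteq> U" "Q ` U \<subseteq> gvecs W"
      "\<forall>w\<in>gvecs W. Q (L w) = w" "\<forall>f\<in>U. L (Q f) = f"
    using assms unfolding gsub_def by blast
  then show thesis by (intro that[of L Q]) auto
qed

text \<open>A subspace has no index set of its own, so a basis is chosen and the action is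
  transported along the coordinate maps. The nilpotency degree \<open>m'\<close> of the submodule
  may be smaller than that of \<open>M\<close>; this drives the decomposition. The index set
  \<open>{..<r}\<close> is what matrices need later.\<close>

lemma gsub_exists_initial:
  fixes M :: "('a, 'i, 'k) gmod"
  assumes M: "gmodule m M" and U: "subsp U" "U \<subseteq> gvecs M"
    and stable: "\<And>h f. h \<in> carrier G \<Longrightarrow> f \<in> U \<Longrightarrow> gop M h f \<in> U" "\<And>f. f \<in> U \<Longrightarrow> yop M f \<in> U"
    and nil: "\<And>f. f \<in> U \<Longrightarrow> (yop M ^^ m') f = (\<lambda>_. 0)"
  shows "\<exists>W :: ('a, nat, 'k) gmod. gmodule m' W \<and> gsub M U W \<and> (\<exists>r. idx W = {..<r})"
proof -
  obtain r :: nat and L :: "(nat \<Rightarrow> 'k) \<Rightarrow> 'i \<Rightarrow> 'k" and Q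
    where L: "lin L" "lin Q" "L ` vecs {..<r} \<subseteq> U" "Q ` U \<subseteq> vecs {..<r}"
      and QL: "\<And>w. w \<in> vecs {..<r} \<Longrightarrow> Q (L w) = w" and LQ: "\<And>f. f \<in> U \<Longrightarrow> L (Q f) = f"
    by (rule subsp_coordinates[OF gm_finite[OF M] U]) (rule that, assumption+)
  have LU: "L w \<in> U" if "w \<in> vecs {..<r}" for w using that L by auto
  have QU: "Q f \<in> vecs {..<r}" if "f \<in> U" for f using that L by auto
  have UM: "f \<in> gvecs M" if "f \<in> U" for f using that U by auto
  define W where "W = \<lparr>idx = {..<r}, gop = (\<lambda>h w. Q (gop M h (L w))), yop = (\<lambda>w. Q (yop M (L w)))\<rparr>"
  have Ws: "idx W = {..<r}" "gop W h w = Q (gop M h (L w))" "yop W w = Q (yop M (L w))" for h w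
    by (simp_all add: W_def)
  have pow: "(yop W ^^ i) w \<in> vecs {..<r} \<and> L ((yop W ^^ i) w) = (yop M ^^ i) (L w)"
    if "w \<in> vecs {..<r}" for w i
  proof (induction i)
    case (Suc i)
    then have *: "yop M (L ((yop W ^^ i) w)) \<in> U"
      by (intro stable(2) LU) (rule conjunct1)
    have **: "(yop W ^^ Suc i) w = Q (yop M (L ((yop W ^^ i) w)))"
      unfolding funpow.simps comp_apply by (rule Ws(3))
    show ?case
      unfolding ** using QU[OF *] LQ[OF *] Suc by simp
  qed (use that in simp)
  note Ws [simp]
  have "gmodule m' W"
  proof (rule gmoduleI)
    show "lin (gop W h)" if "h \<in> carrier G" for h
    proof -
      have "gop W h = (\<lambda>w. Q (gop M h (L w)))" by (simp add: W_def)
      then show ?thesis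
        using lin_comp[OF L(2) lin_comp[OF gm_lin[OF M that] L(1)]] by simp
    qed
    show "lin (yop W)"
    proof -
      have "yop W = (\<lambda>w. Q (yop M (L w)))" by (simp add: W_def)
      then show ?thesis
        using lin_comp[OF L(2) lin_comp[OF gm_ylin[OF M] L(1)]] by simp
    qed
    fix w assume "w \<in> gvecs W"
    then have w: "w \<in> vecs {..<r}" by simp
    note Lw = LU[OF w] note LwM = UM[OF Lw]
    show "gop W h w \<in> gvecs W" if "h \<in> carrier G" for h
      using that w by (simp add: QU stable LU)
    show "yop W w \<in> gvecs W"
      using w by (simp add: QU stable LU)
    show "gop W \<one> w = w"
      using w by (simp add: gm_one[OF M LwM] QL)
    show "gop W (h \<otimes> k) w = gop W h (gop W k w)" if "h \<in> carrier G" "k \<in> carrier G" for h k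
      using that w by (simp add: gm_mult[OF M that LwM] LQ stable LU)
    show "yop W (gop W h w) = (\<lambda>i. \<chi> h * gop W h (yop W w) i)" if "h \<in> carrier G" for h
      using that w by (simp add: gm_rel[OF M that LwM] LQ stable LU lin_scale[OF L(2)])
    show "(yop W ^^ m') w = (\<lambda>_. 0)"
      using pow[OF w, of m'] nil[OF Lw] QL lin_zero[OF L(2)] by metis
  qed simp
  moreover have "gsub M U W"
    unfolding gsub_def
  proof (intro exI conjI)
    show "ghom W M L"
    proof (rule ghomI)
      show "L w \<in> gvecs M" "L (yop W w) = yop M (L w)" if "w \<in> gvecs W" for w
        using that by (simp_all add: UM LU LQ stable)
      show "L (gop W h w) = gop M h (L w)" if "w \<in> gvecs W" "h \<in> carrier G" for w h
        using that by (simp add: LU LQ stable)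
    qed (rule L(1))
  qed (use L QL LQ in auto)
  moreover have "\<exists>r. idx W = {..<r}" by auto
  ultimately show ?thesis by blast
qed

lemma gsub_exists:
  fixes M :: "('a, 'i, 'k) gmod"
  assumes "gmodule m M" "subsp U" "U \<subseteq> gvecs M"
    and "\<And>h f. h \<in> carrier G \<Longrightarrow> f \<in> U \<Longrightarrow> gop M h f \<in> U" "\<And>f. f \<in> U \<Longrightarrow> yop M f \<in> U"
    and "\<And>f. f \<in> U \<Longrightarrow> (yop M ^^ m') f = (\<lambda>_. 0)"
  shows "\<exists>W :: ('a, nat, 'k) gmod. gmodule m' W \<and> gsub M U W"
proof -
  have "\<exists>W :: ('a, nat, 'k) gmod. gmodule m' W \<and> gsub M U W \<and> (\<exists>r. idx W = {..<r})"
    by (rule gsub_exists_initial[OF assms])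
  then show ?thesis by blast
qed

text \<open>\<open>P\<close> is conjugated by the two coordinate maps. It only has to respect the
  actions on \<open>U\<close>, so it need not come from a homomorphism of the ambient
  modules.\<close>

lemma gsub_unique:
  assumes W: "gmodule m W" "gsub M U W" and W': "gmodule m' W'" "gsub M' U' W'"
    and UM: "U \<subseteq> gvecs M" "U' \<subseteq> gvecs M'"
    and P: "lin P" "\<And>f. f \<in> U \<Longrightarrow> P f \<in> U'" and P': "lin P'" "\<And>f. f \<in> U' \<Longrightarrow> P' f \<in> U"
    and inv: "\<And>f. f \<in> U \<Longrightarrow> P' (P f) = f" "\<And>f. f \<in> U' \<Longrightarrow> P (P' f) = f"
    and eq: "\<And>h f. h \<in> carrier G \<Longrightarrow> f \<in> U \<Longrightarrow> P (gop M h f) = gop M' h (P f)"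
      "\<And>f. f \<in> U \<Longrightarrow> P (yop M f) = yop M' (P f)"
  shows "giso W W'"
proof -
  obtain L Q where L: "ghom W M L" "lin Q" and LU: "\<And>w. w \<in> gvecs W \<Longrightarrow> L w \<in> U"
    and QU: "\<And>f. f \<in> U \<Longrightarrow> Q f \<in> gvecs W"
    and QL: "\<And>w. w \<in> gvecs W \<Longrightarrow> Q (L w) = w" and LQ: "\<And>f. f \<in> U \<Longrightarrow> L (Q f) = f"
    by (rule gsubE[OF W(2)]) (rule that, assumption+)
  obtain L' Q' where L': "ghom W' M' L'" "lin Q'" and LU': "\<And>w. w \<in> gvecs W' \<Longrightarrow> L' w \<in> U'"
    and QU': "\<And>f. f \<in> U' \<Longrightarrow> Q' f \<in> gvecs W'"
    and QL': "\<And>w. w \<in> gvecs W' \<Longrightarrow> Q' (L' w) = w" and LQ': "\<And>f. f \<in> U' \<Longrightarrow> L' (Q' f) = f"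
    by (rule gsubE[OF W'(2)]) (rule that, assumption+)
  show ?thesis
  proof (rule gisoI[OF W(1), where P = "\<lambda>w. Q' (P (L w))" and Q = "\<lambda>w. Q (P' (L' w))"])
    show "ghom W W' (\<lambda>w. Q' (P (L w)))"
    proof (rule ghomI)
      show "lin (\<lambda>w. Q' (P (L w)))"
        by (rule lin_comp[OF L'(2) lin_comp[OF P(1) ghom_lin[OF L(1)]]])
      fix w assume w: "w \<in> gvecs W"
      show w': "Q' (P (L w)) \<in> gvecs W'" using w by (simp add: QU' P LU)
      have "L' (Q' (P (L w))) = P (L w)" using w by (simp add: LQ' P LU)
      then show "Q' (P (L (yop W w))) = yop W' (Q' (P (L w)))"
        using ghom_yop[OF L'(1) w'] QL'[OF gm_yclosed[OF W'(1) w']] ghom_yop[OF L(1) w] eq(2)[OF LU[OF w]]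
        by simp
      show "Q' (P (L (gop W h w))) = gop W' h (Q' (P (L w)))" if h: "h \<in> carrier G" for h
        using ghom_gop[OF L'(1) w' h] QL'[OF gm_closed[OF W'(1) h w']] ghom_gop[OF L(1) w h]
          eq(1)[OF h LU[OF w]] \<open>L' (Q' (P (L w))) = P (L w)\<close>
        by simp
    qed
    show "lin (\<lambda>w. Q (P' (L' w)))"
      by (rule lin_comp[OF L(2) lin_comp[OF P'(1) ghom_lin[OF L'(1)]]])
  qed (simp_all add: QU QU' LU LU' P P' QL QL' LQ LQ' inv)
qed

lemma gsub_gsum:
  assumes "gsub M U W" "gsub M' U' W'"
    and S: "S = {f \<in> gvecs (gsum M M'). (\<lambda>i. f (Inl i)) \<in> U \<and> (\<lambda>j. f (Inr j)) \<in> U'}"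
    and UM: "U \<subseteq> gvecs M" "U' \<subseteq> gvecs M'"
  shows "gsub (gsum M M') S (gsum W W')"
proof -
  obtain L Q where L: "ghom W M L" "lin Q" and LU: "\<And>w. w \<in> gvecs W \<Longrightarrow> L w \<in> U"
    and QU: "\<And>f. f \<in> U \<Longrightarrow> Q f \<in> gvecs W"
    and QL: "\<And>w. w \<in> gvecs W \<Longrightarrow> Q (L w) = w" and LQ: "\<And>f. f \<in> U \<Longrightarrow> L (Q f) = f"
    by (rule gsubE[OF assms(1)]) (rule that, assumption+)
  obtain L' Q' where L': "ghom W' M' L'" "lin Q'" and LU': "\<And>w. w \<in> gvecs W' \<Longrightarrow> L' w \<in> U'"
    and QU': "\<And>f. f \<in> U' \<Longrightarrow> Q' f \<in> gvecs W'"
    and QL': "\<And>w. w \<in> gvecs W' \<Longrightarrow> Q' (L' w) = w" and LQ': "\<And>f. f \<in> U' \<Longrightarrow> L' (Q' f) = f"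
    by (rule gsubE[OF assms(2)]) (rule that, assumption+)
  show ?thesis
    unfolding gsub_def
  proof (intro exI conjI ballI image_subsetI)
    show "ghom (gsum W W') (gsum M M') (sum_op L L')"
    proof (rule ghomI)
      show "lin (sum_op L L')" using L L' by (simp add: lin_sum_op ghom_lin)
      fix f assume f: "f \<in> gvecs (gsum W W')"
      note ff = vecs_summands[OF f[simplified]]
      show "sum_op L L' f \<in> gvecs (gsum M M')"
        using sum_op_vecs[OF ghom_image[OF L(1)] ghom_image[OF L'(1)]] f by simp
      show "sum_op L L' (gop (gsum W W') h f) = gop (gsum M M') h (sum_op L L' f)"
        if "h \<in> carrier G" for h
        by (auto simp: sum_op_def fun_eq_iff ghom_gop[OF L(1) ff(1) that] ghom_gop[OF L'(1) ff(2) that]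
            split: sum.split)
      show "sum_op L L' (yop (gsum W W') f) = yop (gsum M M') (sum_op L L' f)"
        by (auto simp: sum_op_def fun_eq_iff ghom_yop[OF L(1) ff(1)] ghom_yop[OF L'(1) ff(2)]
            split: sum.split)
    qed
    show "lin (sum_op Q Q')" using L L' by (simp add: lin_sum_op)
    fix f assume f: "f \<in> gvecs (gsum W W')"
    note ff = vecs_summands[OF f[simplified]]
    show "sum_op L L' f \<in> S"
      using sum_op_vecs[OF ghom_image[OF L(1)] ghom_image[OF L'(1)]] f LU[OF ff(1)] LU'[OF ff(2)]
      by (simp add: S)
    show "sum_op Q Q' (sum_op L L' f) = f"
      using QL[OF ff(1)] QL'[OF ff(2)] by (auto simp: sum_op_def fun_eq_iff split: sum.split)
  next
    fix f assume f: "f \<in> S"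
    then have "Q (\<lambda>i. f (Inl i)) \<in> gvecs W" "Q' (\<lambda>j. f (Inr j)) \<in> gvecs W'"
      using QU QU' by (auto simp: S)
    then show "sum_op Q Q' f \<in> gvecs (gsum W W')"
      by (auto simp: vecs_def sum_op_def split: sum.split)
    show "sum_op L L' (sum_op Q Q' f) = f"
      using f LQ LQ' by (auto simp: S sum_op_def fun_eq_iff split: sum.split)
  qed
qed

section \<open>Twisted images of powers of y as additive invariants\<close>

lemma gtwist_simps [simp]:
  "idx (gtwist_by \<psi> M) = idx M" "gop (gtwist_by \<psi> M) h f = (\<lambda>i. \<psi> h * gop M h f i)"
  "yop (gtwist_by \<psi> M) f = (\<lambda>i. 0)"
  by (simp_all add: gtwist_by_def)

abbreviation gtwist :: "nat \<Rightarrow> ('a, 'i, 'k) gmod \<Rightarrow> ('a, 'i, 'k) gmod"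
  where "gtwist i \<equiv> gtwist_by (\<lambda>h. \<chi> h ^ i)"

lemma gmodule_gtwist:
  assumes M: "gmodule m M"
  shows "gmodule 1 (gtwist i M)"
proof (rule gmoduleI)
  show "lin (gop (gtwist i M) h)" if "h \<in> carrier G" for h
    using gm_lin[OF M that] by (intro linI) (simp_all add: lin_add lin_scale algebra_simps)
  show "gop (gtwist i M) (h \<otimes> k) f = gop (gtwist i M) h (gop (gtwist i M) k f)"
    if "h \<in> carrier G" "k \<in> carrier G" "f \<in> gvecs (gtwist i M)" for h k f
    using that gm_mult[OF M that(1,2)]
    by (simp add: character_mult power_mult_distrib lin_scale[OF gm_lin[OF M that(1)]] mult_ac)
  show "yop (gtwist i M) (gop (gtwist i M) h f) =
      (\<lambda>j. \<chi> h * gop (gtwist i M) h (yop (gtwist i M) f) j)" if "h \<in> carrier G" for h f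
    by (simp add: lin_zero[OF gm_lin[OF M that]])
qed (auto simp: gm_finite[OF M] gm_closed[OF M] vecs_scale vecs_zero gm_one[OF M] character_one
    intro!: linI)

text \<open>\<open>gimage i M W\<close>: the module \<open>W\<close> is the image of \<open>y\<^sup>i\<close> on \<open>M\<close>, with the action twisted so that
  \<open>y\<^sup>i\<close> becomes \<open>G\<close>-linear.\<close>

definition gimage :: "nat \<Rightarrow> ('a, 'i, 'k) gmod \<Rightarrow> ('a, 'j, 'k) gmod \<Rightarrow> bool"
  where "gimage i M W \<longleftrightarrow> gmodule 1 W \<and> gsub (gtwist i M) ((yop M ^^ i) ` gvecs M) W"

lemma ypow_image: "gmodule m M \<Longrightarrow> (yop M ^^ i) ` gvecs M \<subseteq> gvecs M"
  by (auto simp: gm_ypow_closed)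

text \<open>From y^i h = \<chi>(h)^i h y^i, the twisted action of h sends y^i u to y^i (h u), so the
  image is stable.\<close>

lemma gimage_exists:
  assumes M: "gmodule m M"
  shows "\<exists>W :: ('a, nat, 'k) gmod. gimage i M W"
  unfolding gimage_def
proof (rule gsub_exists[OF gmodule_gtwist[OF M]])
  let ?U = "(yop M ^^ i) ` gvecs M"
  show U: "subsp ?U"
    by (rule subsp_image[OF lin_pow[OF gm_ylin[OF M]] subsp_vecs])
  show "?U \<subseteq> gvecs (gtwist i M)"
    using ypow_image[OF M] by simp
  show "gop (gtwist i M) h f \<in> ?U" if h: "h \<in> carrier G" and f: "f \<in> ?U" for h f
  proof -
    obtain u where u: "u \<in> gvecs M" "f = (yop M ^^ i) u" using f by blast
    then have "gop (gtwist i M) h f = (yop M ^^ i) (gop M h u)"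
      using gm_rel_pow[OF M h u(1), of i] by simp
    then show ?thesis using gm_closed[OF M h u(1)] by simp
  qed
  show "yop (gtwist i M) f \<in> ?U" for f
    using U by (simp add: subsp_def)
qed simp

text \<open>An isomorphism commutes with y^i and with the twisted action and hence restricts to the
  images. Thus the image is well defined on isomorphism classes, whatever basis was chosen for
  it.\<close>

lemma gimage_cong:
  assumes M: "gmodule m M" "gmodule m M'" and iso: "giso M M'" and W: "gimage i M W" "gimage i M' W'"
  shows "giso W W'"
proof -
  obtain P Q where P: "ghom M M' P" "ghom M' M Q"
    and inv: "\<And>f. f \<in> gvecs M \<Longrightarrow> Q (P f) = f" "\<And>f. f \<in> gvecs M' \<Longrightarrow> P (Q f) = f"
    using iso unfolding giso_def by blast
  let ?U = "(yop M ^^ i) ` gvecs M" and ?U' = "(yop M' ^^ i) ` gvecs M'"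
  have U: "f \<in> gvecs M" if "f \<in> ?U" for f using that ypow_image[OF M(1)] by blast
  have U': "f \<in> gvecs M'" if "f \<in> ?U'" for f using that ypow_image[OF M(2)] by blast
  show ?thesis
  proof (rule gsub_unique[where P = P and P' = Q])
    show "gmodule 1 W" "gsub (gtwist i M) ?U W" "gmodule 1 W'" "gsub (gtwist i M') ?U' W'"
      using W by (auto simp: gimage_def)
    show "P f \<in> ?U'" if "f \<in> ?U" for f
      using that ghom_ypow[OF M(1) P(1)] ghom_closed[OF P(1)] by auto
    show "Q f \<in> ?U" if "f \<in> ?U'" for f
      using that ghom_ypow[OF M(2) P(2)] ghom_closed[OF P(2)] by auto
    show "P (gop (gtwist i M) h f) = gop (gtwist i M') h (P f)" if "h \<in> carrier G" "f \<in> ?U" for h f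
      using that U by (simp add: lin_scale[OF ghom_lin[OF P(1)]] ghom_gop[OF P(1)])
    show "P (yop (gtwist i M) f) = yop (gtwist i M') (P f)" for f
      by (simp add: lin_zero[OF ghom_lin[OF P(1)]])
  qed (use U U' P inv ghom_lin in auto)
qed

text \<open>The operator y^i acts componentwise on a direct sum. This additivity lets the image
  define a map on the Green ring.\<close>

lemma gimage_gsum:
  assumes M: "gmodule m M" "gmodule m M'" and W: "gimage i M W" "gimage i M' W'"
  shows "gimage i (gsum M M') (gsum W W')"
proof -
  let ?U = "(yop M ^^ i) ` gvecs M" and ?U' = "(yop M' ^^ i) ` gvecs M'"
  have pow: "(sum_op A B ^^ l) f = sum_op (A ^^ l) (B ^^ l) f"
    for A :: "('x \<Rightarrow> 'k) \<Rightarrow> 'x \<Rightarrow> 'k" and B :: "('z \<Rightarrow> 'k) \<Rightarrow> 'z \<Rightarrow> 'k" and l f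
    by (induction l) (auto simp: sum_op_def fun_eq_iff split: sum.split)
  have eq: "(yop (gsum M M') ^^ i) ` gvecs (gsum M M') = {f \<in> gvecs (gsum (gtwist i M) (gtwist i M')).
      (\<lambda>i. f (Inl i)) \<in> ?U \<and> (\<lambda>j. f (Inr j)) \<in> ?U'}" (is "?A = ?B")
  proof (intro equalityI subsetI)
    fix f assume "f \<in> ?A"
    then obtain u where u: "u \<in> gvecs (gsum M M')" "f = sum_op (yop M ^^ i) (yop M' ^^ i) u"
      by (auto simp: pow)
    note uu = vecs_summands[OF u(1)[simplified]]
    have "f \<in> gvecs (gsum M M')"
      using sum_op_vecs[OF ypow_image[OF M(1)] ypow_image[OF M(2)]] u by simp
    then show "f \<in> ?B" using u(2) uu by simp
  next
    fix f assume f: "f \<in> ?B"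
    then obtain u u' where u: "u \<in> gvecs M" "(\<lambda>i. f (Inl i)) = (yop M ^^ i) u"
      and u': "u' \<in> gvecs M'" "(\<lambda>j. f (Inr j)) = (yop M' ^^ i) u'" by blast
    have "f = sum_op (yop M ^^ i) (yop M' ^^ i) (case_sum u u')"
      using u(2) u'(2) by (auto simp: fun_eq_iff sum_op_def split: sum.split)
    moreover have "case_sum u u' \<in> gvecs (gsum M M')"
      using u(1) u'(1) by (auto simp: vecs_def split: sum.split)
    ultimately show "f \<in> ?A" by (auto simp: pow)
  qed
  have "gsub (gsum (gtwist i M) (gtwist i M')) ((yop (gsum M M') ^^ i) ` gvecs (gsum M M')) (gsum W W')"
    by (rule gsub_gsum[OF _ _ eq])
      (use W ypow_image[OF M(1)] ypow_image[OF M(2)] in \<open>auto simp: gimage_def\<close>)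
  moreover have tw: "gsum (gtwist i M) (gtwist i M') = gtwist i (gsum M M')"
    by (auto simp: gsum_def gtwist_by_def sum_op_def fun_eq_iff split: sum.split)
  ultimately show ?thesis
    unfolding gimage_def tw using W by (intro conjI gmodule_gsum) (auto simp only: gimage_def)
qed

text \<open>As \<open>y\<close> is zero on \<open>V\<close>, the summand y \<otimes> g vanishes and
  1 \<otimes> y shifts the uniserial index.\<close>

lemma gtensor_uniserial_yop:
  assumes V: "gmodule 1 V" and F: "F \<in> gvecs (gtensor V (uniserial j))"
  shows "yop (gtensor V (uniserial j)) F (v, l) = (if 0 < l \<and> l < j then F (v, l - 1) else 0)"
proof -
  have "yop V (\<lambda>v. c * F (v, l)) = (\<lambda>_. 0)" for c
    using gm_yzero[OF V vecs_scale[OF vecs_slices(1)[OF F[simplified]]]] by simp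
  then show ?thesis by (simp add: left_op_def right_op_def)
qed

lemma gtensor_uniserial_ypow:
  assumes V: "gmodule 1 V" and F: "F \<in> gvecs (gtensor V (uniserial j))"
  shows "(yop (gtensor V (uniserial j)) ^^ i) F \<in> gvecs (gtensor V (uniserial j)) \<and>
    (yop (gtensor V (uniserial j)) ^^ i) F = (\<lambda>(v, l). if i \<le> l \<and> l < j then F (v, l - i) else 0)"
proof (induction i)
  case 0
  have "F (v, l) = 0" if "\<not> l < j" for v l
    using vecsD[OF F, of "(v, l)"] that by simp
  then have "F = (\<lambda>(v, l). if 0 \<le> l \<and> l < j then F (v, l - 0) else 0)"
    by (auto simp: fun_eq_iff)
  then show ?case using F by simp
next
  case (Suc i)
  let ?Y = "yop (gtensor V (uniserial j))"
  define u where "u = (?Y ^^ i) F"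
  have u: "u \<in> gvecs (gtensor V (uniserial j))"
    and ue: "u = (\<lambda>(v, l). if i \<le> l \<and> l < j then F (v, l - i) else 0)"
    using Suc unfolding u_def[symmetric] by blast+
  have "?Y u (v, l) = (if Suc i \<le> l \<and> l < j then F (v, l - Suc i) else 0)" for v l
    by (rule trans[OF gtensor_uniserial_yop[OF V u]]) (auto simp: ue)
  then have eq: "(?Y ^^ Suc i) F = (\<lambda>(v, l). if Suc i \<le> l \<and> l < j then F (v, l - Suc i) else 0)"
    unfolding funpow.simps comp_apply u_def[symmetric] by (intro ext) (clarify, assumption)
  show ?case
    unfolding eq using F by (auto simp: vecs_def)
qed

text \<open>The image of y^i is the last layer of V \<otimes> U_(i+1), where the uniserial factor
  carries the character \<chi>^(-i). The twist by \<chi>^i cancels it and leaves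
  \<open>V\<close>.\<close>

lemma gimage_gtensor_uniserial:
  assumes V: "gmodule 1 V"
  shows "gimage i (gtensor V (uniserial (Suc i))) V"
proof -
  let ?M = "gtensor V (uniserial (Suc i))"
  let ?L = "\<lambda>w (v, l). if l = i then w v else 0" and ?Q = "\<lambda>f v. f (v, i)"
  have img: "f \<in> (yop ?M ^^ i) ` gvecs ?M \<longleftrightarrow> f \<in> gvecs ?M \<and> (\<forall>v l. l \<noteq> i \<longrightarrow> f (v, l) = 0)" for f
  proof
    assume "f \<in> (yop ?M ^^ i) ` gvecs ?M"
    then obtain F where F: "F \<in> gvecs ?M" "f = (yop ?M ^^ i) F" by blast
    show "f \<in> gvecs ?M \<and> (\<forall>v l. l \<noteq> i \<longrightarrow> f (v, l) = 0)"
      using gtensor_uniserial_ypow[OF V F(1), of i] F(2) by auto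
  next
    assume f: "f \<in> gvecs ?M \<and> (\<forall>v l. l \<noteq> i \<longrightarrow> f (v, l) = 0)"
    \<comment> \<open>The preimage under y^i: layer i moved back to layer 0.\<close>
    define F where "F = (\<lambda>(v, l). if l = (0 :: nat) then f (v, i) else 0)"
    have F: "F \<in> gvecs ?M" using f by (auto simp: vecs_def F_def)
    have "(\<lambda>(v, l). if i \<le> l \<and> l < Suc i then F (v, l - i) else 0) = f"
    proof (rule ext, clarify)
      fix v l
      show "(if i \<le> l \<and> l < Suc i then F (v, l - i) else 0) = f (v, l)"
        using f by (cases "l = i") (auto simp: F_def)
    qed
    then have "(yop ?M ^^ i) F = f"
      using gtensor_uniserial_ypow[OF V F, of i] by metis
    then show "f \<in> (yop ?M ^^ i) ` gvecs ?M" using F by blast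
  qed
  have "gsub (gtwist i ?M) ((yop ?M ^^ i) ` gvecs ?M) V"
    unfolding gsub_def
  proof (intro exI conjI ballI image_subsetI)
    have L: "?L w \<in> gvecs ?M" if "w \<in> gvecs V" for w
      using that by (auto simp: vecs_def)
    show "ghom V (gtwist i ?M) ?L"
    proof (rule ghomI)
      show "lin ?L" by (auto simp: lin_def fun_eq_iff)
      show "?L w \<in> gvecs (gtwist i ?M)" if "w \<in> gvecs V" for w
        using L[OF that] by simp
      show "?L (gop V h w) = gop (gtwist i ?M) h (?L w)" if "h \<in> carrier G" for h w
        using character_nonzero[OF that]
        by (auto simp: fun_eq_iff left_op_def right_op_def lin_zero[OF gm_lin[OF V that]]
            lin_scale[OF gm_lin[OF V that]] power_inverse)
      show "?L (yop V w) = yop (gtwist i ?M) (?L w)" if "w \<in> gvecs V" for w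
        using gm_yzero[OF V that] by auto
    qed
    show "lin ?Q" by (auto simp: lin_def)
    show "?L w \<in> (yop ?M ^^ i) ` gvecs ?M" if "w \<in> gvecs V" for w
      unfolding img using L[OF that] by simp
    show "?Q f \<in> gvecs V" if "f \<in> (yop ?M ^^ i) ` gvecs ?M" for f
      using that unfolding img by (auto simp: vecs_def)
    show "?L (?Q f) = f" if "f \<in> (yop ?M ^^ i) ` gvecs ?M" for f
      using that unfolding img by (auto simp: fun_eq_iff)
  qed simp
  then show ?thesis using V by (simp add: gimage_def)
qed

text \<open>For j \<le> i the operator y^i is zero on V \<otimes> U_j, and the vectors of
  \<open>W\<close> embed into its image.\<close>

lemma gimage_gtensor_uniserial_zero:
  assumes V: "gmodule 1 V" and j: "j \<le> i" and W: "gimage i (gtensor V (uniserial j)) W"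
  shows "gvecs W \<subseteq> {\<lambda>_. 0}"
proof
  fix w assume w: "w \<in> gvecs W"
  let ?M = "gtensor V (uniserial j)"
  obtain L Q where L: "ghom W (gtwist i ?M) L" "lin Q" "\<And>w. w \<in> gvecs W \<Longrightarrow> L w \<in> (yop ?M ^^ i) ` gvecs ?M"
    "\<And>w. w \<in> gvecs W \<Longrightarrow> Q (L w) = w"
    by (rule gsubE[OF conjunct2[OF W[unfolded gimage_def]]]) (rule that, assumption+)
  have "(yop ?M ^^ i) F = (\<lambda>_. 0)" if "F \<in> gvecs ?M" for F
    using gtensor_uniserial_ypow[OF V that, of i] j by (auto simp: fun_eq_iff)
  then have "L w = (\<lambda>_. 0)" using L(3)[OF w] by auto
  then show "w \<in> {\<lambda>_. 0}" using L(4)[OF w] lin_zero[OF L(2)] by auto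
qed

end

section \<open>Maschke's theorem and the splitting of the longest uniserial pieces\<close>

section \<open>Averaging and the decomposition into uniserial pieces\<close>

locale group_datum_char_0 = group_datum G \<chi> g for G (structure)
  and \<chi> :: "'a \<Rightarrow> 'k::field_char_0" and g
begin

text \<open>The average of \<open>h\<^sup>-\<^sup>1 A h\<close> over the group.\<close>

lemma average:
  fixes M :: "('a, 'i, 'k) gmod" and M' :: "('a, 'j, 'k) gmod"
  assumes M: "gmodule m M" and M': "gmodule m' M'"
    and A: "lin A" "\<And>f. f \<in> gvecs M \<Longrightarrow> A f \<in> gvecs M'"
  obtains B where "lin B" "\<And>f. f \<in> gvecs M \<Longrightarrow> B f \<in> gvecs M'"
    "\<And>h f. h \<in> carrier G \<Longrightarrow> f \<in> gvecs M \<Longrightarrow> B (gop M h f) = gop M' h (B f)"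
    "\<And>f v. f \<in> gvecs M \<Longrightarrow> v \<in> gvecs M' \<Longrightarrow>
      \<forall>h\<in>carrier G. A (gop M h f) = gop M' h v \<Longrightarrow> B f = v"
proof -
  define N :: 'k where "N = of_nat (card (carrier G))"
  have N: "N \<noteq> 0"
    using finite_carrier one_closed by (auto simp: N_def)
  define T where "T h f = gop M' (inv h) (A (gop M h f))" for h f
  define B where "B f = (\<lambda>i. (\<Sum>h\<in>carrier G. T h f i) / N)" for f
  have linT: "lin (T h)" if "h \<in> carrier G" for h
  proof -
    have "T h = (\<lambda>f. gop M' (inv h) (A (gop M h f)))"
      by (simp add: T_def fun_eq_iff)
    then show ?thesis
      using lin_comp[OF gm_lin[OF M' inv_closed[OF that]] lin_comp[OF A(1) gm_lin[OF M that]]] by simp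
  qed
  have TM: "T h f \<in> gvecs M'" if "h \<in> carrier G" "f \<in> gvecs M" for h f
    using that by (simp add: T_def gm_closed[OF M'] gm_closed[OF M] A)
  show thesis
  proof (rule that)
    show "lin B"
      by (rule linI) (simp_all add: B_def lin_add[OF linT] lin_scale[OF linT] sum.distrib
          add_divide_distrib sum_distrib_left)
    show "B f \<in> gvecs M'" if "f \<in> gvecs M" for f
      using TM[OF _ that] by (auto simp: B_def vecs_def)
    show "B (gop M k f) = gop M' k (B f)" if k: "k \<in> carrier G" and f: "f \<in> gvecs M" for k f
    proof
      fix i
      have bij: "bij_betw (\<lambda>h. h \<otimes> k) (carrier G) (carrier G)"
        using k by (intro bij_betwI[where g = "\<lambda>h. h \<otimes> inv k"]) (auto simp: m_assoc)
      \<comment> \<open>Conjugation by h applied to k f is k times conjugation by hk applied to f;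
        right translation by k then permutes the summands.\<close>
      have T: "T h (gop M k f) = gop M' k (T (h \<otimes> k) f)" if h: "h \<in> carrier G" for h
      proof -
        have "A (gop M h (gop M k f)) \<in> gvecs M'"
          using h k f by (simp add: gm_closed[OF M] A)
        then have "gop M' (k \<otimes> inv (h \<otimes> k)) (A (gop M h (gop M k f))) =
            gop M' k (gop M' (inv (h \<otimes> k)) (A (gop M h (gop M k f))))"
          using h k by (intro gm_mult[OF M']) auto
        moreover have "k \<otimes> inv (h \<otimes> k) = inv h"
          using h k by (simp add: inv_mult_group m_assoc[symmetric])
        ultimately show ?thesis
          using gm_mult[OF M h k f] by (simp add: T_def)
      qed
      have "B (gop M k f) i = (\<Sum>h\<in>carrier G. gop M' k (T (h \<otimes> k) f) i) / N"
        by (simp add: B_def T)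
      also have "\<dots> = (\<Sum>h\<in>carrier G. gop M' k (T h f) i) / N"
        using sum.reindex_bij_betw[OF bij, of "\<lambda>h. gop M' k (T h f) i"] by simp
      also have "\<dots> = gop M' k (\<lambda>i. inverse N * (\<Sum>h\<in>carrier G. T h f i)) i"
        unfolding lin_scale[OF gm_lin[OF M' k]] lin_sum[OF gm_lin[OF M' k]] by (simp add: field_simps)
      also have "(\<lambda>i. inverse N * (\<Sum>h\<in>carrier G. T h f i)) = B f"
        by (simp add: B_def field_simps)
      finally show "B (gop M k f) i = gop M' k (B f) i" .
    qed
    \<comment> \<open>Where \<open>A\<close> is already equivariant along the orbit of
      \<open>f\<close>, every summand equals \<open>v\<close>. Averaging therefore preserves values
      that are equivariant from the start.\<close>
    show "B f = v" if f: "f \<in> gvecs M" and v: "v \<in> gvecs M'"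
      and Av: "\<forall>h\<in>carrier G. A (gop M h f) = gop M' h v" for f v
    proof -
      have "T h f = v" if "h \<in> carrier G" for h
        using that by (simp add: T_def Av gm_inv[OF M' that v])
      then show ?thesis
        using N by (simp add: B_def N_def)
    qed
  qed
qed

text \<open>Maschke's theorem: averaging a linear projection onto the G-stable subspace
  \<open>U\<close> gives an equivariant projection. Since averages take values in a module,
  \<open>U\<close> is first realized as a module \<open>W\<close> and the result is embedded
  back.\<close>

lemma complement:
  fixes M :: "('a, 'i, 'k) gmod"
  assumes M: "gmodule m M" and U: "subsp U" "U \<subseteq> gvecs M"
    and stable: "\<And>h f. h \<in> carrier G \<Longrightarrow> f \<in> U \<Longrightarrow> gop M h f \<in> U"
  obtains p where "lin p" "\<And>f. f \<in> gvecs M \<Longrightarrow> p f \<in> U" "\<And>f. f \<in> U \<Longrightarrow> p f = f"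
    "\<And>h f. h \<in> carrier G \<Longrightarrow> f \<in> gvecs M \<Longrightarrow> p (gop M h f) = gop M h (p f)"
proof -
  have tw: "gmodule 1 (gtwist 0 M)"
    by (rule gmodule_gtwist[OF M])
  have "\<exists>W :: ('a, nat, 'k) gmod. gmodule 1 W \<and> gsub (gtwist 0 M) U W"
    by (rule gsub_exists[OF tw]) (use U stable in \<open>auto simp: subsp_def\<close>)
  then obtain W :: "('a, nat, 'k) gmod" where W: "gmodule 1 W" "gsub (gtwist 0 M) U W"
    by blast
  obtain L Q where L: "ghom W (gtwist 0 M) L" "lin Q" and LU: "\<And>w. w \<in> gvecs W \<Longrightarrow> L w \<in> U"
    and QU: "\<And>f. f \<in> U \<Longrightarrow> Q f \<in> gvecs W"
    and QL: "\<And>w. w \<in> gvecs W \<Longrightarrow> Q (L w) = w" and LQ: "\<And>f. f \<in> U \<Longrightarrow> L (Q f) = f"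
    by (rule gsubE[OF W(2)]) (rule that, assumption+)
  obtain p0 where p0: "lin p0" "range p0 \<subseteq> U" "\<forall>f\<in>U. p0 f = f"
    using subsp_projection[OF U(1)] by blast
  have p0U: "p0 f \<in> U" for f using p0(2) by blast
  obtain B where B: "lin B" "\<And>f. f \<in> gvecs M \<Longrightarrow> B f \<in> gvecs W"
      "\<And>h f. h \<in> carrier G \<Longrightarrow> f \<in> gvecs M \<Longrightarrow> B (gop M h f) = gop W h (B f)"
      "\<And>f v. f \<in> gvecs M \<Longrightarrow> v \<in> gvecs W \<Longrightarrow>
        \<forall>h\<in>carrier G. Q (p0 (gop M h f)) = gop W h v \<Longrightarrow> B f = v"
    by (rule average[OF M W(1) lin_comp[OF L(2) p0(1)] QU[OF p0U]]) (rule that, assumption+)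
  \<comment> \<open>On \<open>U\<close> the projection is the identity and \<open>U\<close> is
    G-stable, so averaging does not change the value.\<close>
  have BU: "B f = Q f" if f: "f \<in> U" for f
  proof (rule B(4), safe)
    show "f \<in> gvecs M" "Q f \<in> gvecs W" using f U QU by auto
    fix h assume h: "h \<in> carrier G"
    have "L (gop W h (Q f)) = gop M h f"
      using ghom_gop[OF L(1) QU[OF f] h] by (simp add: LQ f)
    then have "Q (gop M h f) = gop W h (Q f)"
      using QL[OF gm_closed[OF W(1) h QU[OF f]]] by simp
    then show "Q (p0 (gop M h f)) = gop W h (Q f)"
      using p0(3) stable[OF h f] by simp
  qed
  show thesis
  proof (rule that)
    show "lin (\<lambda>f. L (B f))" by (rule lin_comp[OF ghom_lin[OF L(1)] B(1)])
    show "L (B f) \<in> U" if "f \<in> gvecs M" for f using that LU B by simp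
    show "L (B f) = f" if "f \<in> U" for f using that BU LQ by simp
    show "L (B (gop M h f)) = gop M h (L (B f))" if "h \<in> carrier G" "f \<in> gvecs M" for h f
      using that B(2,3) ghom_gop[OF L(1) _ that(1)] by simp
  qed
qed

text \<open>A \<open>G\<close>-stable complement \<open>W\<close> of the kernel of \<open>y\<^sup>k\<close> generates the submodule
  \<open>W \<oplus> yW \<oplus> \<dots> \<oplus> y\<^sup>kW\<close>, which is split off by \<open>f \<mapsto> (p (y\<^bsup>k-i\<^esup> f))\<^sub>i\<close> for a \<open>G\<close>-linear \<open>p\<close> that is
  inverse to \<open>y\<^sup>k\<close> on \<open>y\<^sup>kW\<close> and vanishes on the other \<open>y\<^sup>iW\<close>. On the complement \<open>y\<^sup>k = 0\<close>.\<close>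

lemma split_uniserial:
  fixes M :: "('a, 'i, 'k) gmod"
  assumes M: "gmodule (Suc k) M" and k: "Suc k \<le> n" and n: "n = 1 \<or> has_mult_order (\<chi> g) n"
  obtains W M' :: "('a, nat, 'k) gmod" where "gmodule 1 W" "gmodule k M'"
    "giso M (gsum (gtensor W (uniserial (Suc k))) M')"
proof -
  let ?Y = "yop M"
  note lY = gm_ylin[OF M] and Yc = gm_ypow_closed[OF M]
  note lYp = lin_pow[OF lY]
  have Ynil: "(?Y ^^ i) f = (\<lambda>_. 0)" if "f \<in> gvecs M" "Suc k \<le> i" for f i
    using gm_nil[OF gmodule_mono[OF M that(2)] that(1)] .
  define U where "U = {f \<in> gvecs M. (?Y ^^ k) f = (\<lambda>_. 0)}"
  have U: "subsp U" "U \<subseteq> gvecs M"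
    using subsp_ker[OF lYp subsp_vecs] by (auto simp: U_def)
  have Ust: "gop M h f \<in> U" if "h \<in> carrier G" "f \<in> U" for h f
    using that gm_rel_pow[OF M, of h f k]
    by (simp add: U_def gm_closed[OF M] lin_zero[OF gm_lin[OF M]])
  obtain \<pi> where \<pi>: "lin \<pi>" "\<And>f. f \<in> gvecs M \<Longrightarrow> \<pi> f \<in> U" "\<And>f. f \<in> U \<Longrightarrow> \<pi> f = f"
      "\<And>h f. h \<in> carrier G \<Longrightarrow> f \<in> gvecs M \<Longrightarrow> \<pi> (gop M h f) = gop M h (\<pi> f)"
    by (rule complement[OF M U Ust]) (assumption, assumption, rule that, assumption+)
  \<comment> \<open>The G-stable complement of the kernel \<open>U\<close> of y^k, obtained as the
    kernel of the equivariant projection \<pi>.\<close>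
  define U' where "U' = {f \<in> gvecs M. \<pi> f = (\<lambda>_. 0)}"
  have U': "subsp U'" "U' \<subseteq> gvecs M"
    using subsp_ker[OF \<pi>(1) subsp_vecs] by (auto simp: U'_def)
  have "\<exists>W :: ('a, nat, 'k) gmod. gmodule 1 W \<and> gsub (gtwist 0 M) U' W"
  proof (rule gsub_exists[OF gmodule_gtwist[OF M]])
    show "gop (gtwist 0 M) h f \<in> U'" if "h \<in> carrier G" "f \<in> U'" for h f
      using that by (simp add: U'_def gm_closed[OF M] \<pi> lin_zero[OF gm_lin[OF M]])
  qed (use U' in \<open>auto simp: subsp_def\<close>)
  then obtain W :: "('a, nat, 'k) gmod" where W: "gmodule 1 W" "gsub (gtwist 0 M) U' W"
    by blast
  obtain s r where s: "ghom W (gtwist 0 M) s" and r: "lin r" and sU: "\<And>w. w \<in> gvecs W \<Longrightarrow> s w \<in> U'"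
    and rU: "\<And>f. f \<in> U' \<Longrightarrow> r f \<in> gvecs W"
    and rs: "\<And>w. w \<in> gvecs W \<Longrightarrow> r (s w) = w" and sr: "\<And>f. f \<in> U' \<Longrightarrow> s (r f) = f"
    by (rule gsubE[OF W(2)]) (rule that, assumption+)
  note ls = ghom_lin[OF s]
  have sM: "s w \<in> gvecs M" if "w \<in> gvecs W" for w using sU[OF that] U'(2) by blast
  have sg: "s (gop W h w) = gop M h (s w)" if "h \<in> carrier G" "w \<in> gvecs W" for h w
    using ghom_gop[OF s that(2,1)] by simp
  \<comment> \<open>y^k is injective on the complement: a vector it kills lies in both
    \<open>U\<close> and \<open>U'\<close>.\<close>
  have sinj: "w = (\<lambda>_. 0)" if w: "w \<in> gvecs W" and z: "(?Y ^^ k) (s w) = (\<lambda>_. 0)" for w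
  proof -
    have "s w \<in> U" using sM[OF w] z by (simp add: U_def)
    then have "s w = (\<lambda>_. 0)" using \<pi>(3) sU[OF w] by (auto simp: U'_def)
    then show ?thesis using rs[OF w] lin_zero[OF r] by simp
  qed
  let ?I = "idx W \<times> {..<Suc k}"
  \<comment> \<open>Sends w \<otimes> y^i to y^i w; it identifies W \<otimes> U_(k+1) with the
    submodule generated by the complement.\<close>
  define \<Psi> where "\<Psi> F = (\<lambda>x. \<Sum>i<Suc k. (?Y ^^ i) (s (\<lambda>v. F (v, i))) x)" for F
  have l\<Psi>: "lin \<Psi>"
    by (rule linI) (simp_all add: \<Psi>_def lin_add[OF ls] lin_scale[OF ls] lin_add[OF lYp]
        lin_scale[OF lYp] sum.distrib sum_distrib_left del: sum.lessThan_Suc funpow.simps)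
  have \<Psi>M: "\<Psi> F \<in> gvecs M" if "F \<in> vecs ?I" for F
    unfolding \<Psi>_def by (intro vecs_sum Yc sM vecs_slices(1)[OF that])
  have \<Psi>_single: "\<Psi> (\<lambda>(v, l). if l = i then w v else 0) = (?Y ^^ i) (s w)" if "i \<le> k" for i w
  proof -
    have "(?Y ^^ l) (s (\<lambda>v. if l = i then w v else 0)) = (\<lambda>x. if l = i then (?Y ^^ i) (s w) x else 0)"
      for l
      by (cases "l = i") (simp_all add: lin_zero[OF ls] lin_zero[OF lYp])
    then show ?thesis
      using that by (simp add: \<Psi>_def del: sum.lessThan_Suc funpow.simps)
  qed
  have \<Psi>_pow: "(?Y ^^ t) (\<Psi> F) = (\<lambda>x. \<Sum>i<Suc k. (?Y ^^ (t + i)) (s (\<lambda>v. F (v, i))) x)" for t F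
    by (simp add: \<Psi>_def lin_sum[OF lYp] funpow_add del: sum.lessThan_Suc funpow.simps)
  have inj0: "F = (\<lambda>_. 0)" if F: "F \<in> vecs ?I" and z: "\<Psi> F = (\<lambda>_. 0)" for F
  proof -
    \<comment> \<open>Applying y^(k-i) to \<open>\<Psi> F\<close> isolates the component of index i:
      smaller indices vanish by induction, larger ones by y^(k+1) = 0.\<close>
    have "(\<lambda>v. F (v, i)) = (\<lambda>_. 0)" if "i < Suc k" for i
      using that
    proof (induction i rule: less_induct)
      case (less i)
      have "(?Y ^^ (k - i + l)) (s (\<lambda>v. F (v, l))) x =
          (if l = i then (?Y ^^ k) (s (\<lambda>v. F (v, i))) x else 0)" if "l < Suc k" for l x
      proof (cases l i rule: linorder_cases)
        case less
        then show ?thesis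
          using less.IH[OF less] that by (simp add: lin_zero[OF ls] lin_zero[OF lYp])
      next
        case equal
        then show ?thesis using less.prems by simp
      next
        case greater
        then show ?thesis
          using Ynil[OF sM[OF vecs_slices(1)[OF F]], of "k - i + l" l] less.prems by simp
      qed
      then have "(?Y ^^ (k - i)) (\<Psi> F) = (?Y ^^ k) (s (\<lambda>v. F (v, i)))"
        using less.prems unfolding \<Psi>_pow by (simp del: sum.lessThan_Suc funpow.simps)
      then have "(?Y ^^ k) (s (\<lambda>v. F (v, i))) = (\<lambda>_. 0)"
        by (simp add: z lin_zero[OF lYp])
      then show ?case
        by (rule sinj[OF vecs_slices(1)[OF F]])
    qed
    moreover have "F (v, i) = 0" if "\<not> i < Suc k" for v i
      using vecsD[OF F, of "(v, i)"] that by simp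
    ultimately show ?thesis
      by (auto simp: fun_eq_iff)
  qed
  have "inj_on \<Psi> (vecs ?I)"
  proof (rule inj_onI)
    fix F F' assume F: "F \<in> vecs ?I" "F' \<in> vecs ?I" and eq: "\<Psi> F = \<Psi> F'"
    have "(\<lambda>i. F i - F' i) = (\<lambda>_. 0)"
      using inj0[OF vecs_diff[OF F]] eq by (simp add: lin_diff[OF l\<Psi>])
    then show "F = F'" by (simp add: fun_eq_iff)
  qed
  from lin_left_inverse[OF l\<Psi> subsp_vecs this]
  obtain \<Lambda> where \<Lambda>: "lin \<Lambda>" "range \<Lambda> \<subseteq> vecs ?I" "\<forall>F\<in>vecs ?I. \<Lambda> (\<Psi> F) = F"
    by (elim exE conjE) (rule that)
  have \<Lambda>I: "\<Lambda> f \<in> vecs ?I" for f using \<Lambda>(2) by blast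
  \<comment> \<open>The coordinate of index k of a left inverse of \<Psi>. It inverts y^k on y^k W
    and vanishes on the other y^i W, but it need not be equivariant.\<close>
  define p0 where "p0 f = (\<lambda>v. \<Lambda> f (v, k))" for f
  have lp0: "lin p0"
    by (rule linI) (simp_all add: p0_def lin_add[OF \<Lambda>(1)] lin_scale[OF \<Lambda>(1)])
  have p0W: "p0 f \<in> gvecs W" for f
    unfolding p0_def by (rule vecs_slices(1)[OF \<Lambda>I])
  have p0_single: "p0 ((?Y ^^ i) (s w)) = (\<lambda>v. if i = k then w v else 0)" if w: "w \<in> gvecs W" for i w
  proof (cases "i \<le> k")
    case True
    have "(\<lambda>(v, l). if l = i then w v else 0) \<in> vecs ?I"
      using w True by (auto simp: vecs_def)
    then have "\<Lambda> ((?Y ^^ i) (s w)) = (\<lambda>(v, l). if l = i then w v else 0)"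
      using \<Lambda>(3) \<Psi>_single[OF True, of w] by metis
    then show ?thesis by (auto simp: p0_def fun_eq_iff)
  next
    case False
    then show ?thesis
      using Ynil[OF sM[OF w], of i] lin_zero[OF lp0] by simp
  qed
  \<comment> \<open>The average is taken from \<open>M\<close> twisted by \<chi>^k, because y^k from
    W to M is equivariant only for the twisted action.\<close>
  obtain p where p: "lin p" "\<And>f. f \<in> gvecs (gtwist k M) \<Longrightarrow> p f \<in> gvecs W"
      "\<And>h f. h \<in> carrier G \<Longrightarrow> f \<in> gvecs (gtwist k M) \<Longrightarrow> p (gop (gtwist k M) h f) = gop W h (p f)"
      "\<And>f v. f \<in> gvecs (gtwist k M) \<Longrightarrow> v \<in> gvecs W \<Longrightarrow>
        \<forall>h\<in>carrier G. p0 (gop (gtwist k M) h f) = gop W h v \<Longrightarrow> p f = v"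
    by (rule average[OF gmodule_gtwist[OF M] W(1) lp0 p0W]) (rule that, assumption+)
  have pW: "p f \<in> gvecs W" if "f \<in> gvecs M" for f using p(2) that by simp
  have pg: "gop W h (p f) = (\<lambda>v. \<chi> h ^ k * p (gop M h f) v)" if "h \<in> carrier G" "f \<in> gvecs M" for h f
    using p(3)[OF that(1), of f] that by (simp add: lin_scale[OF p(1)])
  have p_single: "p ((?Y ^^ i) (s w)) = (\<lambda>v. if i = k then w v else 0)" if w: "w \<in> gvecs W" for i w
  proof (rule p(4), safe)
    show "(?Y ^^ i) (s w) \<in> gvecs (gtwist k M)" using Yc[OF sM[OF w]] by simp
    show "(\<lambda>v. if i = k then w v else 0) \<in> gvecs W" using w by (auto simp: vecs_def)
    fix h assume h: "h \<in> carrier G"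
    note nz = character_nonzero[OF h]
    have "gop M h ((?Y ^^ i) (s w)) = (\<lambda>x. inverse (\<chi> h ^ i) * (?Y ^^ i) (s (gop W h w)) x)"
      using gm_rel_pow[OF M h sM[OF w], of i] nz
      by (simp add: sg[OF h w] mult.assoc[symmetric])
    then have "p0 (gop (gtwist k M) h ((?Y ^^ i) (s w))) =
        (\<lambda>v. \<chi> h ^ k * (inverse (\<chi> h ^ i) * (if i = k then gop W h w v else 0)))"
      by (simp add: lin_scale[OF lp0] p0_single[OF gm_closed[OF W(1) h w]])
    also have "\<dots> = gop W h (\<lambda>v. if i = k then w v else 0)"
      using nz by (cases "i = k")
        (simp_all add: lin_zero[OF gm_lin[OF W(1) h]] mult.assoc[symmetric])
    finally show "p0 (gop (gtwist k M) h ((?Y ^^ i) (s w))) = gop W h (\<lambda>v. if i = k then w v else 0)" .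
  qed
  let ?T = "gtensor W (uniserial (Suc k))"
  have T: "gmodule n ?T"
    using gmodule_mono[OF W(1), of n] k n by (intro gmodule_gtensor gmodule_uniserial) auto
  \<comment> \<open>A retraction of \<Psi>: the component of index i is moved to the position k by
    y^(k-i) and then read off by \<open>p\<close>.\<close>
  define \<Phi> where "\<Phi> f = (\<lambda>(v, i). if i < Suc k then p ((?Y ^^ (k - i)) f) v else 0)" for f
  have l\<Phi>: "lin \<Phi>"
    by (rule linI) (auto simp: \<Phi>_def lin_add[OF p(1)] lin_scale[OF p(1)] lin_add[OF lYp]
        lin_scale[OF lYp])
  have \<Phi>T: "\<Phi> f \<in> gvecs ?T" if "f \<in> gvecs M" for f
    using vecsD[OF pW[OF Yc[OF that]]] by (auto simp: vecs_def \<Phi>_def)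
  have \<Phi>\<Psi>: "\<Phi> (\<Psi> F) = F" if F: "F \<in> vecs ?I" for F
  proof (rule ext, clarify)
    fix v i
    show "\<Phi> (\<Psi> F) (v, i) = F (v, i)"
    proof (cases "i < Suc k")
      case True
      have "p ((?Y ^^ (k - i)) (\<Psi> F)) v = (\<Sum>l<Suc k. if l = i then F (v, i) else 0)"
        unfolding \<Psi>_pow lin_sum[OF p(1)] p_single[OF vecs_slices(1)[OF F]]
        using True by (intro sum.cong) auto
      then show ?thesis
        using True by (simp add: \<Phi>_def del: sum.lessThan_Suc funpow.simps)
    next
      case False
      then show ?thesis using vecsD[OF F, of "(v, i)"] by (simp add: \<Phi>_def)
    qed
  qed
  have hom\<Phi>: "ghom M ?T \<Phi>"
  proof (rule ghomI[OF l\<Phi> \<Phi>T])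
    fix f assume f: "f \<in> gvecs M"
    show "\<Phi> (?Y f) = yop ?T (\<Phi> f)"
    proof (rule ext, clarify)
      fix v i
      have "k - i + 1 = k - (i - 1)" if "0 < i" "i < Suc k" using that by simp
      then show "\<Phi> (?Y f) (v, i) = yop ?T (\<Phi> f) (v, i)"
        unfolding gtensor_uniserial_yop[OF W(1) \<Phi>T[OF f]]
        using Ynil[OF f, of "Suc k"] lin_zero[OF p(1)] funpow_swap1[of ?Y "k - i" f]
        by (auto simp: \<Phi>_def Suc_diff_le simp flip: funpow_swap1)
    qed
    fix h assume h: "h \<in> carrier G"
    show "\<Phi> (gop M h f) = gop ?T h (\<Phi> f)"
    proof (rule ext, clarify)
      fix v i
      show "\<Phi> (gop M h f) (v, i) = gop ?T h (\<Phi> f) (v, i)"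
      proof (cases "i < Suc k")
        case True
        then have "\<chi> h ^ k = \<chi> h ^ i * \<chi> h ^ (k - i)"
          by (simp add: power_add[symmetric])
        moreover have "inverse (\<chi> h) ^ i * (\<chi> h ^ i * z) = z" for z
          using character_nonzero[OF h] by (simp add: mult.assoc[symmetric] power_mult_distrib[symmetric])
        ultimately show ?thesis
          using True pg[OF h Yc[OF f], of "k - i"]
          by (simp add: \<Phi>_def left_op_def right_op_def gm_rel_pow[OF M h f] lin_scale[OF p(1)]
              lin_scale[OF gm_lin[OF W(1) h]] mult.assoc del: funpow.simps)
      next
        case False
        then show ?thesis
          by (simp add: \<Phi>_def left_op_def right_op_def lin_zero[OF gm_lin[OF W(1) h]])
      qed
    qed
  qed
  have hom\<Psi>: "ghom ?T M \<Psi>"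
  proof (rule ghomI[OF l\<Psi>])
    fix F assume F': "F \<in> gvecs ?T"
    then have F: "F \<in> vecs ?I" by simp
    note Fs = vecs_slices(1)[OF F]
    show "\<Psi> F \<in> gvecs M" by (rule \<Psi>M[OF F])
    show "\<Psi> (yop ?T F) = ?Y (\<Psi> F)"
    proof -
      have "(?Y ^^ i) (s (\<lambda>v. yop ?T F (v, i))) x =
          (if i = 0 then 0 else (?Y ^^ i) (s (\<lambda>v. F (v, i - 1))) x)" if "i < Suc k" for i x
        unfolding gtensor_uniserial_yop[OF W(1) F']
        using that by (cases "i = 0") (simp_all add: lin_zero[OF ls] lin_zero[OF lYp])
      then have "\<Psi> (yop ?T F) x = (\<Sum>i<Suc k. if i = 0 then 0 else (?Y ^^ i) (s (\<lambda>v. F (v, i - 1))) x)" for x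
        unfolding \<Psi>_def by (intro sum.cong) auto
      also have "\<dots> x = (\<Sum>i<k. (?Y ^^ Suc i) (s (\<lambda>v. F (v, i))) x)" for x
        unfolding sum.lessThan_Suc_shift by simp
      also have "\<dots> x = (\<Sum>i<Suc k. (?Y ^^ (1 + i)) (s (\<lambda>v. F (v, i))) x)" for x
        using Ynil[OF sM[OF Fs], of "Suc k" k] by simp
      finally show ?thesis
        using \<Psi>_pow[of 1 F] by (simp add: fun_eq_iff del: sum.lessThan_Suc)
    qed
    fix h assume h: "h \<in> carrier G"
    have "(?Y ^^ i) (s (\<lambda>v. gop ?T h F (v, i))) = gop M h ((?Y ^^ i) (s (\<lambda>v. F (v, i))))" for i
      using character_nonzero[OF h] gm_rel_pow[OF M h sM[OF Fs], of i i]
      by (simp add: left_op_def right_op_def lin_scale[OF gm_lin[OF W(1) h]] lin_scale[OF ls]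
          lin_scale[OF lYp] sg[OF h Fs] power_inverse mult.assoc[symmetric])
    then show "\<Psi> (gop ?T h F) = gop M h (\<Psi> F)"
      by (simp add: \<Psi>_def lin_sum[OF gm_lin[OF M h]] del: sum.lessThan_Suc funpow.simps gtensor_simps)
  qed
  \<comment> \<open>Since \<Phi> is a homomorphism with \<Phi> \<Psi> = id, its kernel is a
    submodule complementary to the image of \<Psi>.\<close>
  define K where "K = {f \<in> gvecs M. \<Phi> f = (\<lambda>_. 0)}"
  have K: "subsp K" "K \<subseteq> gvecs M"
    using subsp_ker[OF l\<Phi> subsp_vecs] by (auto simp: K_def)
  have "\<exists>M' :: ('a, nat, 'k) gmod. gmodule k M' \<and> gsub M K M'"
  proof (rule gsub_exists[OF M K])
    show "gop M h f \<in> K" if "h \<in> carrier G" "f \<in> K" for h f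
      using that ghom_gop[OF hom\<Phi>, of f h] lin_zero[OF gm_lin[OF T that(1)]]
      by (simp add: K_def gm_closed[OF M])
    show "yop M f \<in> K" if "f \<in> K" for f
      using that ghom_yop[OF hom\<Phi>, of f] lin_zero[OF gm_ylin[OF T]]
      by (simp add: K_def gm_yclosed[OF M])
    show "(?Y ^^ k) f = (\<lambda>_. 0)" if "f \<in> K" for f
    proof -
      have f: "f \<in> gvecs M" and \<Phi>0: "\<Phi> f = (\<lambda>_. 0)" using that by (auto simp: K_def)
      \<comment> \<open>The component of \<open>\<Phi> f\<close> with index 0.\<close>
      have pk: "p ((?Y ^^ k) f) = (\<lambda>_. 0)"
        using fun_cong[OF \<Phi>0, of "(_, 0)"] by (auto simp: \<Phi>_def)
      \<comment> \<open>The part of \<open>f\<close> in the complement of the kernel of y^k.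
        \<open>p\<close> recovers its coordinates from y^k f, so it is zero.\<close>
      define u where "u = (\<lambda>x. f x - \<pi> f x)"
      have "\<pi> f \<in> U" using \<pi>(2)[OF f] .
      then have \<pi>f: "\<pi> f \<in> gvecs M" "(?Y ^^ k) (\<pi> f) = (\<lambda>_. 0)" by (auto simp: U_def)
      have "u \<in> U'"
        using f \<pi>f \<pi>(3)[OF \<open>\<pi> f \<in> U\<close>] by (simp add: U'_def u_def vecs_diff lin_diff[OF \<pi>(1)])
      then have u: "r u \<in> gvecs W" "s (r u) = u" using rU sr by auto
      have Yu: "(?Y ^^ k) u = (?Y ^^ k) f"
        by (simp add: u_def lin_diff[OF lYp] \<pi>f)
      have "r u = p ((?Y ^^ k) u)" using p_single[OF u(1), of k] u(2) by simp
      then have "r u = (\<lambda>_. 0)" using Yu pk by simp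
      then have "u = (\<lambda>_. 0)" using u(2) lin_zero[OF ls] by simp
      then show ?thesis using Yu lin_zero[OF lYp] by simp
    qed
  qed
  then obtain M' :: "('a, nat, 'k) gmod" where M': "gmodule k M'" "gsub M K M'" by blast
  obtain L Q where L: "ghom M' M L" and Q: "lin Q" and LK: "\<And>w. w \<in> gvecs M' \<Longrightarrow> L w \<in> K"
    and QK: "\<And>f. f \<in> K \<Longrightarrow> Q f \<in> gvecs M'"
    and QL: "\<And>w. w \<in> gvecs M' \<Longrightarrow> Q (L w) = w" and LQ: "\<And>f. f \<in> K \<Longrightarrow> L (Q f) = f"
    by (rule gsubE[OF M'(2)]) (rule that, assumption+)
  note lL = ghom_lin[OF L]
  let ?S = "gsum ?T M'"
  define P where "P F = (\<lambda>x. \<Psi> (\<lambda>i. F (Inl i)) x + L (\<lambda>j. F (Inr j)) x)" for F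
  define R where "R f = case_sum (\<Phi> f) (Q (\<lambda>x. f x - \<Psi> (\<Phi> f) x))" for f
  have S: "gmodule n ?S"
    using T gmodule_mono[OF M'(1), of n] k by (intro gmodule_gsum) auto
  have fK: "(\<lambda>x. f x - \<Psi> (\<Phi> f) x) \<in> K" if f: "f \<in> gvecs M" for f
    using \<Phi>T[OF f] f \<Phi>\<Psi>[of "\<Phi> f"] \<Psi>M[of "\<Phi> f"]
    by (simp add: K_def vecs_diff lin_diff[OF l\<Phi>])
  have "giso ?S M"
  proof (rule gisoI[OF S, where P = P and Q = R])
    show "ghom ?S M P"
    proof (rule ghomI)
      show "lin P"
        by (rule linI) (simp_all add: P_def lin_add[OF l\<Psi>] lin_add[OF lL] lin_scale[OF l\<Psi>]
            lin_scale[OF lL] algebra_simps)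
      fix F assume F: "F \<in> gvecs ?S"
      have FT: "(\<lambda>i. F (Inl i)) \<in> gvecs ?T" and FM: "(\<lambda>j. F (Inr j)) \<in> gvecs M'"
        using vecs_summands[OF F[unfolded gsum_simps]] by auto
      show "P F \<in> gvecs M"
        unfolding P_def by (intro vecs_add ghom_closed[OF hom\<Psi> FT] ghom_closed[OF L FM])
      show "P (gop ?S h F) = gop M h (P F)" if h: "h \<in> carrier G" for h
        using ghom_gop[OF hom\<Psi> FT h] ghom_gop[OF L FM h]
        by (simp add: P_def lin_add[OF gm_lin[OF M h]] del: gtensor_simps)
      show "P (yop ?S F) = yop M (P F)"
        using ghom_yop[OF hom\<Psi> FT] ghom_yop[OF L FM]
        by (simp add: P_def lin_add[OF lY] del: gtensor_simps)
    qed
    show "lin R"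
    proof (rule linI)
      have "(\<lambda>x. f x + f' x - \<Psi> (\<Phi> (\<lambda>x. f x + f' x)) x) =
          (\<lambda>x. (f x - \<Psi> (\<Phi> f) x) + (f' x - \<Psi> (\<Phi> f') x))" for f f'
        by (simp add: lin_add[OF l\<Phi>] lin_add[OF l\<Psi>] algebra_simps)
      then show "R (\<lambda>i. f i + f' i) j = R f j + R f' j" for f f' j
        by (simp add: R_def lin_add[OF l\<Phi>] lin_add[OF Q] split: sum.split)
      have "(\<lambda>x. c * f x - \<Psi> (\<Phi> (\<lambda>x. c * f x)) x) = (\<lambda>x. c * (f x - \<Psi> (\<Phi> f) x))" for c f
        by (simp add: lin_scale[OF l\<Phi>] lin_scale[OF l\<Psi>] algebra_simps)
      then show "R (\<lambda>i. c * f i) j = c * R f j" for c f j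
        by (simp add: R_def lin_scale[OF l\<Phi>] lin_scale[OF Q] split: sum.split)
    qed
    fix f assume f: "f \<in> gvecs M"
    show "R f \<in> gvecs ?S"
      using vecsD[OF \<Phi>T[OF f]] vecsD[OF QK[OF fK[OF f]]]
      unfolding R_def by (intro vecsI) (auto split: sum.split)
    show "P (R f) = f"
      by (simp add: P_def R_def LQ[OF fK[OF f]])
  next
    fix F assume F: "F \<in> gvecs ?S"
    have FT: "(\<lambda>i. F (Inl i)) \<in> gvecs ?T" and FM: "(\<lambda>j. F (Inr j)) \<in> gvecs M'"
      using vecs_summands[OF F[unfolded gsum_simps]] by auto
    have "\<Phi> (L (\<lambda>j. F (Inr j))) = (\<lambda>_. 0)" using LK[OF FM] by (simp add: K_def)
    then have eq: "\<Phi> (P F) = (\<lambda>i. F (Inl i))"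
      using \<Phi>\<Psi> FT by (simp add: P_def lin_add[OF l\<Phi>])
    have "(\<lambda>x. P F x - \<Psi> (\<lambda>i. F (Inl i)) x) = L (\<lambda>j. F (Inr j))"
      by (simp add: P_def)
    then show "R (P F) = F"
      unfolding R_def eq by (auto simp: QL[OF FM] fun_eq_iff split: sum.split)
  qed
  then show thesis
    using that[OF W(1) M'(1)] giso_sym by blast
qed

end

section \<open>The free ring on isomorphism classes and its ideal of direct sum relations\<close>

section \<open>The Green ring\<close>

lemma frag_extend_fun_diff: "frag_extend (\<lambda>C. F C - F' C) c = frag_extend F c - frag_extend F' c"
  by (induction c rule: frag_induction[OF subset_UNIV]) (auto simp: frag_extend_diff)

lemma free_green_ring_simps [simp]:
  "carrier (free_green_ring A) = {f. Poly_Mapping.keys f \<subseteq> iso_classes A}"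
  "\<one>\<^bsub>free_green_ring A\<^esub> = frag_of (iso_class A (trivial_module A))"
  "\<zero>\<^bsub>free_green_ring A\<^esub> = 0"
  "f \<oplus>\<^bsub>free_green_ring A\<^esub> f' = f + f'"
  by (simp_all add: free_green_ring_def)

text \<open>The bilinear extension as an iterated \<open>frag_extend\<close>, which gives access to
  distributivity and to induction over free abelian groups.\<close>

lemma free_green_ring_mult:
  fixes A :: "('e, 'k::field) hopf"
  shows "f \<otimes>\<^bsub>free_green_ring A\<^esub> f' =
    frag_extend (\<lambda>C. frag_extend (\<lambda>D. frag_of (class_tensor A C D)) f') f"
proof -
  have "frag_cmul c (Poly_Mapping.single x d) = Poly_Mapping.single x (c * d)"
    for x :: "('e, 'k) rep set" and c d
    by (rule poly_mapping_eqI) (simp add: lookup_single when_def)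
  then show ?thesis
    by (simp add: free_green_ring_def frag_extend_def frag_cmul_sum)
qed

text \<open>The whole space is taken as a submodule of itself; the choice of a basis replaces an
  arbitrary index type by an initial segment of the naturals.\<close>

lemma (in group_datum) gmod_initial:
  fixes M :: "('a, 'i, 'k) gmod"
  assumes M: "gmodule n M"
  obtains M' :: "('a, nat, 'k) gmod" and r where "gmodule n M'" "giso M M'" "idx M' = {..<r}"
proof -
  have "\<exists>M' :: ('a, nat, 'k) gmod. gmodule n M' \<and> gsub M (gvecs M) M' \<and> (\<exists>r. idx M' = {..<r})"
    by (rule gsub_exists_initial[OF M subsp_vecs subset_refl])
      (use M in \<open>auto simp: gm_closed gm_yclosed gm_nil\<close>)
  then obtain M' :: "('a, nat, 'k) gmod" and r
    where M': "gmodule n M'" "gsub M (gvecs M) M'" "idx M' = {..<r}"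
    by blast
  obtain L Q where "ghom M' M L" "lin Q" "\<And>w. w \<in> gvecs M' \<Longrightarrow> L w \<in> gvecs M"
    "\<And>f. f \<in> gvecs M \<Longrightarrow> Q f \<in> gvecs M'" "\<And>w. w \<in> gvecs M' \<Longrightarrow> Q (L w) = w"
    "\<And>f. f \<in> gvecs M \<Longrightarrow> L (Q f) = f"
    by (rule gsubE[OF M'(2)]) (rule that, assumption+)
  then have "giso M' M"
    by (intro gisoI[OF M'(1)]) auto
  from that[OF M'(1) giso_sym[OF this] M'(3)] show thesis .
qed

text \<open>A bialgebra whose modules are, via \<open>tm\<close>, the operator modules of nilpotency degree \<open>n\<close>.\<close>

locale green_model = group_datum_char_0 G \<chi> g for G (structure)
  and \<chi> :: "'a \<Rightarrow> 'k::field_char_0" and g +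
  fixes A :: "('e, 'k) hopf" and tm :: "('e, 'k) rep \<Rightarrow> ('a, nat, 'k) gmod" and n :: nat
  assumes n: "1 \<le> n" "n = 1 \<or> has_mult_order (\<chi> g) n"
    and tm_module: "is_module A R \<Longrightarrow> gmodule n (tm R)"
    and tm_surj: "gmodule n (M :: ('a, nat, 'k) gmod) \<Longrightarrow> \<exists>R. is_module A R \<and> giso (tm R) M"
    and tm_iso: "is_module A R \<Longrightarrow> is_module A R' \<Longrightarrow> module_iso A R R' \<longleftrightarrow> giso (tm R) (tm R')"
    and tm_sum: "is_module A R \<Longrightarrow> is_module A R' \<Longrightarrow>
      is_module A (direct_sum R R') \<and> giso (tm (direct_sum R R')) (gsum (tm R) (tm R'))"
    and tm_tensor: "is_module A R \<Longrightarrow> is_module A R' \<Longrightarrow>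
      is_module A (tensor A R R') \<and> giso (tm (tensor A R R')) (gtensor (tm R) (tm R'))"
    and tm_trivial: "is_module A (trivial_module A) \<and> giso (tm (trivial_module A)) (uniserial 1)"
begin

text \<open>The index type of \<open>M\<close> is arbitrary, so direct sums and tensor products,
  which live on other index types, have classes without reindexing.\<close>

definition gclass :: "('a, 'i, 'k) gmod \<Rightarrow> ('e, 'k) rep set"
  where "gclass M = {R. is_module A R \<and> giso M (tm R)}"

lemma gmod_nat:
  fixes M :: "('a, 'i, 'k) gmod"
  assumes M: "gmodule n M"
  obtains M' :: "('a, nat, 'k) gmod" where "gmodule n M'" "giso M M'"
  by (rule gmod_initial[OF M]) (rule that)

lemma tm_surj_any:
  assumes "gmodule n M"
  obtains R where "is_module A R" "giso M (tm R)"
proof -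
  obtain M' :: "('a, nat, 'k) gmod" where M': "gmodule n M'" "giso M M'"
    by (rule gmod_nat[OF assms])
  obtain R where R: "is_module A R" "giso (tm R) M'"
    using tm_surj[OF M'(1)] by blast
  show thesis
    by (rule that[OF R(1) giso_trans[OF M'(2) giso_sym[OF R(2)]]])
qed

lemma gclass_eqI:
  assumes "giso M M'"
  shows "gclass M = gclass M'"
proof -
  have "giso M (tm R) \<longleftrightarrow> giso M' (tm R)" for R
    using giso_trans[OF assms, of "tm R"] giso_trans[OF giso_sym[OF assms], of "tm R"] by blast
  then show ?thesis by (simp add: gclass_def)
qed

lemma gclass_eqD:
  assumes "gmodule n M" "gclass M = gclass M'"
  shows "giso M M'"
proof -
  obtain R where "is_module A R" "giso M (tm R)" by (rule tm_surj_any[OF assms(1)])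
  then have "R \<in> gclass M'" using assms(2) by (auto simp: gclass_def)
  then have "giso M' (tm R)" by (simp add: gclass_def)
  then show ?thesis
    by (rule giso_trans[OF \<open>giso M (tm R)\<close> giso_sym])
qed

lemma iso_class_gclass: "is_module A R \<Longrightarrow> iso_class A R = gclass (tm R)"
  by (auto simp: iso_class_def gclass_def tm_iso)

lemma gclass_closed:
  assumes "gmodule n M"
  shows "gclass M \<in> iso_classes A"
proof -
  obtain R where R: "is_module A R" "giso M (tm R)" by (rule tm_surj_any[OF assms])
  then have "gclass M = iso_class A R" by (simp add: iso_class_gclass gclass_eqI[OF R(2)])
  then show ?thesis unfolding iso_classes_def using R(1) by blast
qed

lemma iso_classesE:
  assumes "C \<in> iso_classes A"
  obtains M :: "('a, nat, 'k) gmod" where "gmodule n M" "C = gclass M"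
proof -
  obtain R where R: "C = iso_class A R" "is_module A R"
    using assms unfolding iso_classes_def by blast
  show thesis
    by (rule that[OF tm_module[OF R(2)]]) (simp add: R iso_class_gclass)
qed

text \<open>Isomorphic factors have isomorphic tensor products, so all members of the union defining
  \<open>class_tensor\<close> are the same class. Surjectivity of \<open>tm\<close> ensures that the
  union is not empty.\<close>

lemma class_tensor_gclass:
  assumes M: "gmodule n M" and M': "gmodule n M'"
  shows "class_tensor A (gclass M) (gclass M') = gclass (gtensor M M')"
proof -
  have *: "iso_class A (tensor A R R') = gclass (gtensor M M')"
    if R: "R \<in> gclass M" and R': "R' \<in> gclass M'" for R R'
  proof -
    have R: "is_module A R" "giso M (tm R)" and R': "is_module A R'" "giso M' (tm R')"
      using R R' by (auto simp: gclass_def)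
    have "giso (gtensor M M') (gtensor (tm R) M')"
      by (rule gtensor_cong_left[OF R(2) M tm_module[OF R(1)] M'])
    moreover have "giso (gtensor (tm R) M') (gtensor (tm R) (tm R'))"
      by (rule gtensor_cong_right[OF R'(2) M' tm_module[OF R'(1)] tm_module[OF R(1)]])
    ultimately have "giso (gtensor M M') (gtensor (tm R) (tm R'))"
      by (rule giso_trans)
    then have "gclass (gtensor M M') = gclass (tm (tensor A R R'))"
      using tm_tensor[OF R(1) R'(1)] by (intro gclass_eqI) (metis giso_trans giso_sym)
    then show ?thesis
      using iso_class_gclass tm_tensor[OF R(1) R'(1)] by simp
  qed
  obtain R where "is_module A R" "giso M (tm R)" by (rule tm_surj_any[OF M])
  then have "R \<in> gclass M" by (simp add: gclass_def)
  moreover obtain R' where "is_module A R'" "giso M' (tm R')" by (rule tm_surj_any[OF M'])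
  then have "R' \<in> gclass M'" by (simp add: gclass_def)
  ultimately show ?thesis
    unfolding class_tensor_def using * by blast
qed

abbreviation "F \<equiv> free_green_ring A"

lemma trivial_gclass: "iso_class A (trivial_module A) = gclass (uniserial 1)"
  using tm_trivial iso_class_gclass[of "trivial_module A"]
    gclass_eqI[of "tm (trivial_module A)" "uniserial 1"] by simp

lemma gmodule_unit: "gmodule n (uniserial 1)"
  by (rule gmodule_uniserial[OF n(1)])

lemma gmodule_tensor: "gmodule n M \<Longrightarrow> gmodule n M' \<Longrightarrow> gmodule n (gtensor M M')"
  by (rule gmodule_gtensor[OF _ _ n(2)])

lemma class_tensor_closed:
  assumes "C \<in> iso_classes A" "D \<in> iso_classes A"
  shows "class_tensor A C D \<in> iso_classes A"
proof -
  obtain M :: "('a, nat, 'k) gmod" where M: "gmodule n M" "C = gclass M"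
    by (rule iso_classesE[OF assms(1)])
  obtain M' :: "('a, nat, 'k) gmod" where M': "gmodule n M'" "D = gclass M'"
    by (rule iso_classesE[OF assms(2)])
  show ?thesis
    using M M' class_tensor_gclass gmodule_tensor gclass_closed by metis
qed

lemma class_tensor_assoc:
  assumes "C \<in> iso_classes A" "D \<in> iso_classes A" "E \<in> iso_classes A"
  shows "class_tensor A (class_tensor A C D) E = class_tensor A C (class_tensor A D E)"
proof -
  obtain M :: "('a, nat, 'k) gmod" where M: "gmodule n M" "C = gclass M"
    by (rule iso_classesE[OF assms(1)])
  obtain M' :: "('a, nat, 'k) gmod" where M': "gmodule n M'" "D = gclass M'"
    by (rule iso_classesE[OF assms(2)])
  obtain M'' :: "('a, nat, 'k) gmod" where M'': "gmodule n M''" "E = gclass M''"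
    by (rule iso_classesE[OF assms(3)])
  have "class_tensor A (class_tensor A C D) E = gclass (gtensor (gtensor M M') M'')"
    using M M' M'' by (simp add: class_tensor_gclass gmodule_tensor)
  also have "\<dots> = gclass (gtensor M (gtensor M' M''))"
    by (rule gclass_eqI[OF gtensor_assoc[OF M(1) M'(1) M''(1) n(2)]])
  also have "\<dots> = class_tensor A C (class_tensor A D E)"
    using M M' M'' by (simp add: class_tensor_gclass gmodule_tensor)
  finally show ?thesis .
qed

lemma class_tensor_unit:
  assumes "C \<in> iso_classes A"
  shows "class_tensor A (gclass (uniserial 1)) C = C" "class_tensor A C (gclass (uniserial 1)) = C"
proof -
  obtain M :: "('a, nat, 'k) gmod" where M: "gmodule n M" "C = gclass M"
    by (rule iso_classesE[OF assms])
  show "class_tensor A (gclass (uniserial 1)) C = C" "class_tensor A C (gclass (uniserial 1)) = C"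
    unfolding M(2) class_tensor_gclass[OF gmodule_unit M(1)] class_tensor_gclass[OF M(1) gmodule_unit]
    by (rule gclass_eqI[OF gtensor_unit_left[OF M(1)]], rule gclass_eqI[OF gtensor_unit_right[OF M(1)]])
qed

lemma mult_frag_of: "frag_of C \<otimes>\<^bsub>F\<^esub> frag_of D = frag_of (class_tensor A C D)"
  by (simp add: free_green_ring_mult)

lemma mult_diff_left: "(a - b) \<otimes>\<^bsub>F\<^esub> c = a \<otimes>\<^bsub>F\<^esub> c - b \<otimes>\<^bsub>F\<^esub> c"
  and mult_diff_right: "c \<otimes>\<^bsub>F\<^esub> (a - b) = c \<otimes>\<^bsub>F\<^esub> a - c \<otimes>\<^bsub>F\<^esub> b"
  by (simp_all add: free_green_ring_mult frag_extend_diff frag_extend_fun_diff)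

lemma mult_zero_free: "0 \<otimes>\<^bsub>F\<^esub> c = 0" "c \<otimes>\<^bsub>F\<^esub> 0 = 0"
  using mult_diff_left[of c c c] mult_diff_right[of c c c] by simp_all

lemma mult_minus_free: "(- a) \<otimes>\<^bsub>F\<^esub> c = - (a \<otimes>\<^bsub>F\<^esub> c)" "c \<otimes>\<^bsub>F\<^esub> (- a) = - (c \<otimes>\<^bsub>F\<^esub> a)"
  using mult_diff_left[of 0 a c] mult_diff_right[of c 0 a] by (simp_all add: mult_zero_free)

lemma mult_add_free: "(a + b) \<otimes>\<^bsub>F\<^esub> c = a \<otimes>\<^bsub>F\<^esub> c + b \<otimes>\<^bsub>F\<^esub> c"
    "c \<otimes>\<^bsub>F\<^esub> (a + b) = c \<otimes>\<^bsub>F\<^esub> a + c \<otimes>\<^bsub>F\<^esub> b"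
  using mult_diff_left[of a "- b" c] mult_diff_right[of c a "- b"] by (simp_all add: mult_minus_free)

lemma keys_subset_diff:
  "Poly_Mapping.keys a \<subseteq> S \<Longrightarrow> Poly_Mapping.keys b \<subseteq> S \<Longrightarrow> Poly_Mapping.keys (a - b :: 'x \<Rightarrow>\<^sub>0 int) \<subseteq> S"
  using keys_diff[of a b] by blast

lemma keys_subset_add:
  "Poly_Mapping.keys a \<subseteq> S \<Longrightarrow> Poly_Mapping.keys b \<subseteq> S \<Longrightarrow> Poly_Mapping.keys (a + b :: 'x \<Rightarrow>\<^sub>0 int) \<subseteq> S"
  using Poly_Mapping.keys_add[of a b] by blast

lemma mult_free_closed:
  assumes "Poly_Mapping.keys a \<subseteq> iso_classes A" "Poly_Mapping.keys b \<subseteq> iso_classes A"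
  shows "Poly_Mapping.keys (a \<otimes>\<^bsub>F\<^esub> b) \<subseteq> iso_classes A"
  using assms(1)
proof (induction a rule: frag_induction)
  case (one C)
  show ?case
    using assms(2)
  proof (induction b rule: frag_induction)
    case (one D)
    then show ?case
      using \<open>C \<in> iso_classes A\<close> by (simp add: mult_frag_of class_tensor_closed)
  qed (simp_all add: mult_zero_free mult_diff_right keys_subset_diff)
qed (simp_all add: mult_zero_free mult_diff_left keys_subset_diff)

text \<open>Both sides are additive in each argument, so induction over the free abelian group
  reduces to single classes, where it is associativity of the tensor product.\<close>

lemma mult_free_assoc:
  assumes "Poly_Mapping.keys a \<subseteq> iso_classes A" "Poly_Mapping.keys b \<subseteq> iso_classes A"
    "Poly_Mapping.keys c \<subseteq> iso_classes A"
  shows "(a \<otimes>\<^bsub>F\<^esub> b) \<otimes>\<^bsub>F\<^esub> c = a \<otimes>\<^bsub>F\<^esub> (b \<otimes>\<^bsub>F\<^esub> c)"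
  using assms(1)
proof (induction a rule: frag_induction)
  case (one C)
  show ?case
    using assms(2)
  proof (induction b rule: frag_induction)
    case (one D)
    show ?case
      using assms(3)
    proof (induction c rule: frag_induction)
      case (one E)
      then show ?case
        using \<open>C \<in> iso_classes A\<close> \<open>D \<in> iso_classes A\<close>
        by (simp add: mult_frag_of class_tensor_assoc)
    qed (simp_all add: mult_zero_free mult_diff_right)
  qed (simp_all add: mult_zero_free mult_diff_right mult_diff_left)
qed (simp_all add: mult_zero_free mult_diff_left)

lemma mult_free_unit:
  assumes "Poly_Mapping.keys a \<subseteq> iso_classes A"
  shows "\<one>\<^bsub>F\<^esub> \<otimes>\<^bsub>F\<^esub> a = a" "a \<otimes>\<^bsub>F\<^esub> \<one>\<^bsub>F\<^esub> = a"
  using assms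
  by (induction a rule: frag_induction)
    (simp_all add: mult_zero_free mult_diff_right mult_diff_left mult_frag_of trivial_gclass
      class_tensor_unit[simplified])

lemma ring_free: "ring F"
proof (rule ringI)
  show "abelian_group F"
  proof (rule abelian_groupI)
    fix x assume "x \<in> carrier F"
    then show "\<exists>y\<in>carrier F. y \<oplus>\<^bsub>F\<^esub> x = \<zero>\<^bsub>F\<^esub>"
      by (intro bexI[of _ "- x"]) (simp_all add: keys_minus)
  qed (auto simp: keys_subset_add algebra_simps)
  show "monoid F"
    by (rule monoidI) (simp_all add: mult_free_closed mult_free_assoc mult_free_unit
      del: free_green_ring_simps(2), simp add: trivial_gclass gclass_closed[OF gmodule_unit, simplified])
qed (simp_all add: mult_add_free)

sublocale F: ring F
  by (rule ring_free)

lemma minus_free: "a \<in> carrier F \<Longrightarrow> \<ominus>\<^bsub>F\<^esub> a = - a"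
  by (rule F.minus_equality) (simp_all add: keys_minus)

lemma diff_free: "a \<in> carrier F \<Longrightarrow> b \<in> carrier F \<Longrightarrow> a \<ominus>\<^bsub>F\<^esub> b = a - b"
  by (simp add: a_minus_def minus_free)

definition relators :: "(('e, 'k) rep set \<Rightarrow>\<^sub>0 int) set"
  where "relators = {frag_of C - (frag_of (gclass M) + frag_of (gclass M')) | C M M'.
    gmodule n (M :: ('a, nat, 'k) gmod) \<and> gmodule n (M' :: ('a, nat, 'k) gmod) \<and>
    C = gclass (gsum M M')}"

text \<open>A generator depends only on isomorphism classes, and \<open>tm\<close> matches matrix
  modules with operator modules up to isomorphism in both directions, respecting direct
  sums.\<close>

lemma green_relations_relators: "green_relations A = generate (add_monoid F) relators"
proof -
  have "{free_class A (direct_sum R R') - (free_class A R + free_class A R') | R R'.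
      is_module A R \<and> is_module A R'} = relators" (is "?L = _")
  proof (intro equalityI subsetI)
    fix x assume "x \<in> ?L"
    then obtain R R' where R: "is_module A R" "is_module A R'"
        and x: "x = free_class A (direct_sum R R') - (free_class A R + free_class A R')" by blast
    have "iso_class A (direct_sum R R') = gclass (gsum (tm R) (tm R'))"
      using tm_sum[OF R] iso_class_gclass[of "direct_sum R R'"]
        gclass_eqI[of "tm (direct_sum R R')" "gsum (tm R) (tm R')"] by simp
    then have "x = frag_of (gclass (gsum (tm R) (tm R'))) -
        (frag_of (gclass (tm R)) + frag_of (gclass (tm R')))"
      using R by (simp add: x free_class_def iso_class_gclass)
    then show "x \<in> relators"
      unfolding relators_def using tm_module[OF R(1)] tm_module[OF R(2)] by blast
  next
    fix x assume "x \<in> relators"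
    then obtain M M' :: "('a, nat, 'k) gmod" where M: "gmodule n M" "gmodule n M'"
      and x: "x = frag_of (gclass (gsum M M')) - (frag_of (gclass M) + frag_of (gclass M'))"
      by (auto simp: relators_def)
    obtain R where R: "is_module A R" "giso M (tm R)" by (rule tm_surj_any[OF M(1)])
    obtain R' where R': "is_module A R'" "giso M' (tm R')" by (rule tm_surj_any[OF M(2)])
    have S: "giso (gsum M M') (tm (direct_sum R R'))"
      using giso_trans[OF gsum_cong[OF R(2) R'(2)] giso_sym] tm_sum[OF R(1) R'(1)] by blast
    then have "x = free_class A (direct_sum R R') - (free_class A R + free_class A R')"
      using R R' tm_sum[OF R(1) R'(1)] gclass_eqI[OF R(2)] gclass_eqI[OF R'(2)] gclass_eqI[OF S]
      by (simp add: x free_class_def iso_class_gclass)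
    then show "x \<in> ?L" using R R' by blast
  qed
  then show ?thesis by (simp add: green_relations_def)
qed

lemma relators_closed: "relators \<subseteq> carrier F"
proof
  fix r assume "r \<in> relators"
  then obtain M M' :: "('a, nat, 'k) gmod" where M: "gmodule n M" "gmodule n M'"
    and r: "r = frag_of (gclass (gsum M M')) - (frag_of (gclass M) + frag_of (gclass M'))"
    by (auto simp: relators_def)
  show "r \<in> carrier F"
    unfolding r free_green_ring_simps mem_Collect_eq
    by (intro keys_subset_diff keys_subset_add)
      (simp_all add: gclass_closed M gmodule_gsum)
qed

lemma relations_subgroup: "subgroup (green_relations A) (add_monoid F)"
  unfolding green_relations_relators
  by (rule group.generate_is_subgroup) (use relators_closed F.a_group in auto)

lemma relations_diff: "a \<in> green_relations A \<Longrightarrow> b \<in> green_relations A \<Longrightarrow> a - b \<in> green_relations A"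
  and relations_zero: "0 \<in> green_relations A"
  and relations_add: "a \<in> green_relations A \<Longrightarrow> b \<in> green_relations A \<Longrightarrow> a + b \<in> green_relations A"
  and relations_minus: "a \<in> green_relations A \<Longrightarrow> - a \<in> green_relations A"
proof -
  interpret S: subgroup "green_relations A" "add_monoid F" by (rule relations_subgroup)
  have N: "- a \<in> green_relations A" if "a \<in> green_relations A" for a
  proof -
    have "a \<in> carrier F" using that S.subset by auto
    then have "\<ominus>\<^bsub>F\<^esub> a = - a" by (rule minus_free)
    then show ?thesis using S.m_inv_closed[OF that] by (simp add: a_inv_def)
  qed
  have P: "a + b \<in> green_relations A" if "a \<in> green_relations A" "b \<in> green_relations A" for a b
    using S.m_closed[OF that] by simp
  show "0 \<in> green_relations A" using S.one_closed by simp
  show "a - b \<in> green_relations A" if "a \<in> green_relations A" "b \<in> green_relations A"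
    using P[OF that(1) N[OF that(2)]] by simp
  show "a + b \<in> green_relations A" if "a \<in> green_relations A" "b \<in> green_relations A"
    using P that by blast
  show "- a \<in> green_relations A" if "a \<in> green_relations A"
    using N that by blast
qed

lemma relations_induct [consumes 1, case_names zero relator minus add]:
  assumes "a \<in> green_relations A" and "P 0" and "\<And>r. r \<in> relators \<Longrightarrow> P r"
    and "\<And>a. a \<in> green_relations A \<Longrightarrow> P a \<Longrightarrow> P (- a)"
    and "\<And>a b. a \<in> green_relations A \<Longrightarrow> b \<in> green_relations A \<Longrightarrow> P a \<Longrightarrow> P b \<Longrightarrow> P (a + b)"
  shows "P a"
  using assms(1) unfolding green_relations_relators
proof (induction rule: generate.induct)
  case one
  then show ?case using assms(2) by simp
next
  case (incl h)
  then show ?case by (rule assms(3))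
next
  case (inv h)
  then have "h \<in> carrier F" using relators_closed by blast
  then have "inv\<^bsub>add_monoid F\<^esub> h = - h" using minus_free by (simp add: a_inv_def)
  then show ?case
    using assms(3,4) inv generate.incl[OF inv, of "add_monoid F"] green_relations_relators by simp
next
  case (eng h1 h2)
  then show ?case using assms(5) green_relations_relators by simp
qed

lemma relator_in:
  assumes "gmodule n M" "gmodule n M'"
  shows "frag_of (gclass (gsum M M')) - (frag_of (gclass M) + frag_of (gclass M')) \<in> green_relations A"
proof -
  obtain M0 :: "('a, nat, 'k) gmod" where M0: "gmodule n M0" "giso M M0"
    by (rule gmod_nat[OF assms(1)])
  obtain M0' :: "('a, nat, 'k) gmod" where M0': "gmodule n M0'" "giso M' M0'"
    by (rule gmod_nat[OF assms(2)])
  have "frag_of (gclass (gsum M M')) - (frag_of (gclass M) + frag_of (gclass M')) \<in> relators"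
    using M0 M0' gclass_eqI[OF M0(2)] gclass_eqI[OF M0'(2)] gclass_eqI[OF gsum_cong[OF M0(2) M0'(2)]]
    by (auto simp: relators_def)
  then show ?thesis
    unfolding green_relations_relators by (rule generate.incl)
qed

text \<open>The tensor product distributes over direct sums on both sides, so multiplying a relator
  by a class gives a relator again. General factors follow by additivity.\<close>

lemma relations_ideal: "ideal (green_relations A) F"
proof (rule idealI)
  show "ring F" by (rule ring_free)
  show "subgroup (green_relations A) (add_monoid F)" by (rule relations_subgroup)
  have "x \<otimes>\<^bsub>F\<^esub> a \<in> green_relations A \<and> a \<otimes>\<^bsub>F\<^esub> x \<in> green_relations A"
    if "a \<in> green_relations A" "Poly_Mapping.keys x \<subseteq> iso_classes A" for a x
    using that
  proof (induction a rule: relations_induct)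
    case (relator r)
    then obtain M M' :: "('a, nat, 'k) gmod" where M: "gmodule n M" and M': "gmodule n M'"
      and r: "r = frag_of (gclass (gsum M M')) - (frag_of (gclass M) + frag_of (gclass M'))"
      by (auto simp: relators_def)
    show ?case
      using relator.prems
    proof (induction x rule: frag_induction)
      case (one C)
      obtain N :: "('a, nat, 'k) gmod" where N: "gmodule n N" "C = gclass N"
        by (rule iso_classesE[OF one])
      note S = gmodule_gsum[OF M M']
      have "frag_of C \<otimes>\<^bsub>F\<^esub> r = frag_of (gclass (gsum (gtensor N M) (gtensor N M'))) -
          (frag_of (gclass (gtensor N M)) + frag_of (gclass (gtensor N M')))"
        using gclass_eqI[OF gtensor_gsum_right[OF M M' N(1) n(2)]]
        by (simp add: r mult_diff_right mult_add_free mult_frag_of N class_tensor_gclass S M M')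
      moreover have "r \<otimes>\<^bsub>F\<^esub> frag_of C = frag_of (gclass (gsum (gtensor M N) (gtensor M' N))) -
          (frag_of (gclass (gtensor M N)) + frag_of (gclass (gtensor M' N)))"
        using gclass_eqI[OF gtensor_gsum_left[OF M M' N(1) n(2)]]
        by (simp add: r mult_diff_left mult_add_free mult_frag_of N class_tensor_gclass S M M')
      ultimately show ?case
        using relator_in[OF gmodule_tensor[OF N(1) M] gmodule_tensor[OF N(1) M']]
          relator_in[OF gmodule_tensor[OF M N(1)] gmodule_tensor[OF M' N(1)]] by metis
    qed (simp_all add: mult_zero_free mult_diff_left mult_diff_right relations_zero relations_diff)
  qed (simp_all add: mult_zero_free mult_minus_free mult_add_free relations_zero relations_minus
      relations_add)
  then show "x \<otimes>\<^bsub>F\<^esub> a \<in> green_relations A" "a \<otimes>\<^bsub>F\<^esub> x \<in> green_relations A"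
    if "a \<in> green_relations A" "x \<in> carrier F" for a x
    using that by auto
qed

sublocale rels: ideal "green_relations A" F
  by (rule relations_ideal)

section \<open>The quotient ring, classes of modules and the universal property\<close>

abbreviation "GR \<equiv> green_ring A"

definition quot :: "(('e, 'k) rep set \<Rightarrow>\<^sub>0 int) \<Rightarrow> (('e, 'k) rep set \<Rightarrow>\<^sub>0 int) set"
  where "quot f = green_relations A +>\<^bsub>F\<^esub> f"

definition cl :: "('a, 'i, 'k) gmod \<Rightarrow> (('e, 'k) rep set \<Rightarrow>\<^sub>0 int) set"
  where "cl M = quot (frag_of (gclass M))"

sublocale GR: ring GR
  unfolding green_ring_def by (rule rels.quotient_is_ring)

lemma quot_hom: "quot \<in> Ring.ring_hom F GR"
  using rels.rcos_ring_hom unfolding quot_def[abs_def] green_ring_def .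

lemma quot_closed: "f \<in> carrier F \<Longrightarrow> quot f \<in> carrier GR"
  using ring_hom_closed[OF quot_hom] .

lemma quot_add: "f \<in> carrier F \<Longrightarrow> f' \<in> carrier F \<Longrightarrow> quot (f + f') = quot f \<oplus>\<^bsub>GR\<^esub> quot f'"
  using ring_hom_add[OF quot_hom, of f f'] by simp

lemma quot_mult: "f \<in> carrier F \<Longrightarrow> f' \<in> carrier F \<Longrightarrow> quot (f \<otimes>\<^bsub>F\<^esub> f') = quot f \<otimes>\<^bsub>GR\<^esub> quot f'"
  using ring_hom_mult[OF quot_hom] .

lemma quot_eq_iff:
  "f \<in> carrier F \<Longrightarrow> f' \<in> carrier F \<Longrightarrow> quot f = quot f' \<longleftrightarrow> f - f' \<in> green_relations A"
  using F.quotient_eq_iff_same_a_r_cos[OF relations_ideal, of f f'] diff_free[of f f']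
  by (auto simp: quot_def)

lemma quot_surj: "x \<in> carrier GR \<Longrightarrow> \<exists>f\<in>carrier F. x = quot f"
  by (auto simp: green_ring_def FactRing_def A_RCOSETS_def' quot_def)

lemma quot_zero: "quot 0 = \<zero>\<^bsub>GR\<^esub>"
  using ring_hom_zero[OF quot_hom F.ring_axioms GR.ring_axioms] by simp

lemma quot_diff:
  assumes "f \<in> carrier F" "f' \<in> carrier F"
  shows "quot (f - f') = quot f \<ominus>\<^bsub>GR\<^esub> quot f'"
proof -
  have "quot f = quot (f - f') \<oplus>\<^bsub>GR\<^esub> quot f'"
    using quot_add[of "f - f'" f'] assms by (simp add: keys_subset_diff)
  moreover have "quot (f - f') \<in> carrier GR" "quot f' \<in> carrier GR"
    using assms by (intro quot_closed; simp add: keys_subset_diff)+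
  ultimately show ?thesis
    by (simp add: a_minus_def GR.a_assoc GR.r_neg)
qed

lemma frag_gclass: "gmodule n M \<Longrightarrow> frag_of (gclass M) \<in> carrier F"
  using gclass_closed by simp

lemma cl_closed: "gmodule n M \<Longrightarrow> cl M \<in> carrier GR"
  unfolding cl_def by (rule quot_closed[OF frag_gclass])

lemma cl_eqI: "giso M M' \<Longrightarrow> cl M = cl M'"
  using gclass_eqI[of M M'] by (simp add: cl_def)

lemma cl_gsum:
  assumes "gmodule n M" "gmodule n M'"
  shows "cl (gsum M M') = cl M \<oplus>\<^bsub>GR\<^esub> cl M'"
proof -
  have "frag_of (gclass M) + frag_of (gclass M') \<in> carrier F"
    using frag_gclass[OF assms(1)] frag_gclass[OF assms(2)] by (simp add: keys_subset_add)
  then have "cl (gsum M M') = quot (frag_of (gclass M) + frag_of (gclass M'))"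
    unfolding cl_def using quot_eq_iff[OF frag_gclass[OF gmodule_gsum[OF assms]]] relator_in[OF assms]
    by blast
  then show ?thesis
    using quot_add[OF frag_gclass[OF assms(1)] frag_gclass[OF assms(2)]] by (simp add: cl_def)
qed

lemma cl_gtensor:
  assumes "gmodule n M" "gmodule n M'"
  shows "cl (gtensor M M') = cl M \<otimes>\<^bsub>GR\<^esub> cl M'"
  using quot_mult[OF frag_gclass[OF assms(1)] frag_gclass[OF assms(2)]]
  by (simp add: cl_def mult_frag_of class_tensor_gclass assms)

lemma cl_unit: "cl (uniserial 1) = \<one>\<^bsub>GR\<^esub>"
  using ring_hom_one[OF quot_hom] by (simp add: cl_def trivial_gclass)

text \<open>A zero module satisfies M \<oplus> M \<cong> M, so its class x satisfies x + x =
  x.\<close>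

lemma cl_zero:
  assumes M: "gmodule n M" and z: "gvecs M \<subseteq> {\<lambda>_. 0}"
  shows "cl M = \<zero>\<^bsub>GR\<^esub>"
proof -
  have z': "f = (\<lambda>_. 0)" if "f \<in> gvecs (gsum M M)" for f
  proof -
    have "f (Inl i) = 0" "f (Inr i) = 0" for i
      using vecs_summands[OF that[unfolded gsum_simps]] z by (auto dest: fun_cong)
    then show ?thesis by (auto simp: fun_eq_iff split_sum_all)
  qed
  have "giso (gsum M M) M"
  proof (rule gisoI[OF gmodule_gsum[OF M M], where P = "\<lambda>_ _. 0" and Q = "\<lambda>_ _. 0"])
    show "ghom (gsum M M) M (\<lambda>_ _. 0)"
      by (rule ghomI) (auto simp: lin_def vecs_zero lin_zero[OF gm_lin[OF M]] lin_zero[OF gm_ylin[OF M]])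
  qed (use z z' in \<open>auto simp: lin_def vecs_zero\<close>)
  then have "cl M \<oplus>\<^bsub>GR\<^esub> cl M = cl M"
    using cl_gsum[OF M M] cl_eqI by metis
  then show ?thesis
    using GR.add.r_cancel_one[OF cl_closed[OF M] cl_closed[OF M]] by simp
qed

lemma green_class_cl: "is_module A R \<Longrightarrow> green_class A R = cl (tm R)"
  by (simp add: green_class_def cl_def quot_def free_class_def iso_class_gclass)

text \<open>Module classes generate the Green ring additively, so a property closed under
  subtraction has to be checked only on modules.\<close>

lemma green_induct [consumes 1, case_names zero cl diff]:
  assumes "x \<in> carrier GR" and "P \<zero>\<^bsub>GR\<^esub>"
    and cl: "\<And>M :: ('a, nat, 'k) gmod. gmodule n M \<Longrightarrow> P (cl M)"
    and diff: "\<And>x y. x \<in> carrier GR \<Longrightarrow> y \<in> carrier GR \<Longrightarrow> P x \<Longrightarrow> P y \<Longrightarrow> P (x \<ominus>\<^bsub>GR\<^esub> y)"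
  shows "P x"
proof -
  obtain f where f: "f \<in> carrier F" "x = quot f"
    using quot_surj[OF assms(1)] by blast
  then have "Poly_Mapping.keys f \<subseteq> iso_classes A" by simp
  then have "f \<in> carrier F \<and> P (quot f)"
  proof (induction f rule: frag_induction)
    case zero
    then show ?case using assms(2) by (simp add: quot_zero)
  next
    case (one C)
    obtain M :: "('a, nat, 'k) gmod" where M: "gmodule n M" "C = gclass M"
      by (rule iso_classesE[OF one])
    show ?case using cl[OF M(1)] frag_gclass[OF M(1)] by (simp add: cl_def M)
  next
    case (diff a b)
    then show ?case
      using assms(4)[OF quot_closed[of a] quot_closed[of b]] quot_diff[of a b]
      by (simp add: keys_subset_diff)
  qed
  then show ?thesis using f by simp
qed

text \<open>The universal property: an isomorphism invariant that is additive on direct sums extends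
  to the Green ring. Additivity is asked for any \<open>M''\<close> isomorphic to the sum, because
  \<open>v\<close> is defined only on modules indexed by naturals.\<close>

lemma green_lift:
  fixes Z (structure) and v :: "('a, nat, 'k) gmod \<Rightarrow> 'z"
  assumes Z: "abelian_group Z" and v: "\<And>M. gmodule n M \<Longrightarrow> v M \<in> carrier Z"
    and iso: "\<And>M M'. gmodule n M \<Longrightarrow> gmodule n M' \<Longrightarrow> giso M M' \<Longrightarrow> v M = v M'"
    and sum: "\<And>M M' M''. gmodule n M \<Longrightarrow> gmodule n M' \<Longrightarrow> gmodule n M'' \<Longrightarrow> giso M'' (gsum M M') \<Longrightarrow>
      v M'' = v M \<oplus>\<^bsub>Z\<^esub> v M'"
  obtains \<phi> where "\<And>x. x \<in> carrier GR \<Longrightarrow> \<phi> x \<in> carrier Z"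
    "\<And>x y. x \<in> carrier GR \<Longrightarrow> y \<in> carrier GR \<Longrightarrow> \<phi> (x \<oplus>\<^bsub>GR\<^esub> y) = \<phi> x \<oplus>\<^bsub>Z\<^esub> \<phi> y"
    "\<And>M. gmodule n M \<Longrightarrow> \<phi> (cl M) = v M"
proof -
  interpret Z: abelian_group Z by (rule Z)
  \<comment> \<open>The choice of representative does not matter, as \<open>v\<close> is an
    isomorphism invariant.\<close>
  define rep :: "('e, 'k) rep set \<Rightarrow> ('a, nat, 'k) gmod"
    where "rep C = (SOME M. gmodule n M \<and> C = gclass M)" for C
  have rep: "gmodule n (rep C) \<and> C = gclass (rep C)" if "C \<in> iso_classes A" for C
    unfolding rep_def using iso_classesE[OF that] by (rule someI2_ex) blast+
  have vrep: "v (rep (gclass M)) = v M" if "gmodule n M" for M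
  proof (rule iso)
    show "gmodule n (rep (gclass M))" "gmodule n M"
      using rep[OF gclass_closed[OF that]] that by auto
    show "giso (rep (gclass M)) M"
      using rep[OF gclass_closed[OF that]] gclass_eqD by metis
  qed
  have im: "(\<lambda>C. v (rep C)) ` iso_classes A \<subseteq> carrier (add_monoid Z)"
    using rep v by auto
  obtain k where k: "k \<in> hom (free_Abelian_group (iso_classes A)) (add_monoid Z)"
      and k_of: "\<And>C. C \<in> iso_classes A \<Longrightarrow> k (frag_of C) = v (rep C)"
    by (rule comm_group.free_Abelian_group_universal[OF Z.a_comm_group im]) (rule that, assumption+)
  have kF: "k f \<in> carrier Z" if "f \<in> carrier F" for f
    using hom_in_carrier[OF k, of f] that by (simp add: free_Abelian_group_def)
  have kadd: "k (f + f') = k f \<oplus>\<^bsub>Z\<^esub> k f'" if "f \<in> carrier F" "f' \<in> carrier F" for f f'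
    using hom_mult[OF k, of f f'] that by (simp add: free_Abelian_group_def)
  have k0: "k 0 = \<zero>\<^bsub>Z\<^esub>"
    using kadd[of 0 0] kF[of 0] Z.add.r_cancel_one[of "k 0" "k 0"] by simp
  have kcl: "k (frag_of (gclass M)) = v M" if "gmodule n M" for M
    using k_of[OF gclass_closed[OF that]] vrep[OF that] by simp
  have sub: "a \<in> carrier F" if "a \<in> green_relations A" for a
    using subgroup.subset[OF relations_subgroup] that by auto
  have kker: "k a = \<zero>\<^bsub>Z\<^esub>" if "a \<in> green_relations A" for a
    using that
  proof (induction a rule: relations_induct)
    case zero
    then show ?case by (rule k0)
  next
    case (relator r)
    then obtain M M' :: "('a, nat, 'k) gmod" where M: "gmodule n M" "gmodule n M'"
      and r: "r = frag_of (gclass (gsum M M')) - (frag_of (gclass M) + frag_of (gclass M'))"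
      by (auto simp: relators_def)
    obtain M'' :: "('a, nat, 'k) gmod" where M'': "gmodule n M''" "giso (gsum M M') M''"
      by (rule gmod_nat[OF gmodule_gsum[OF M]])
    have "r \<in> carrier F" using relator relators_closed by blast
    moreover have "frag_of (gclass M) + frag_of (gclass M') \<in> carrier F"
      using frag_gclass[OF M(1)] frag_gclass[OF M(2)] by (simp add: keys_subset_add)
    ultimately have "k (r + (frag_of (gclass M) + frag_of (gclass M'))) =
        k r \<oplus>\<^bsub>Z\<^esub> k (frag_of (gclass M) + frag_of (gclass M'))"
      by (rule kadd)
    moreover have "r + (frag_of (gclass M) + frag_of (gclass M')) = frag_of (gclass M'')"
      using gclass_eqI[OF M''(2)] by (simp add: r)
    moreover have "k (frag_of (gclass M) + frag_of (gclass M')) = v M \<oplus>\<^bsub>Z\<^esub> v M'"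
      using kadd[OF frag_gclass[OF M(1)] frag_gclass[OF M(2)]] kcl M by simp
    ultimately have "v M'' = k r \<oplus>\<^bsub>Z\<^esub> v M''"
      using kcl[OF M''(1)] sum[OF M M''(1) giso_sym[OF M''(2)]] by simp
    then show ?case
      using Z.add.l_cancel_one'[of "v M''" "k r"] v[OF M''(1)] kF[OF \<open>r \<in> carrier F\<close>] by simp
  next
    case (minus a)
    have "- a \<in> carrier F" using sub[OF relations_minus[OF minus.hyps]] .
    then have "k (a + - a) = k a \<oplus>\<^bsub>Z\<^esub> k (- a)" by (rule kadd[OF sub[OF minus.hyps]])
    then show ?case using minus k0 kF[OF \<open>- a \<in> carrier F\<close>] by simp
  next
    case (add a b)
    then show ?case using kadd[OF sub sub, of a b] by simp
  qed
  \<comment> \<open>Any preimage may be chosen: \<open>k\<close> vanishes on the relations and so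
    factors through the quotient.\<close>
  define \<phi> where "\<phi> x = k (SOME f. f \<in> carrier F \<and> x = quot f)" for x
  have \<phi>: "\<phi> (quot f) = k f" if f: "f \<in> carrier F" for f
  proof -
    define f' where "f' = (SOME f'. f' \<in> carrier F \<and> quot f = quot f')"
    have f': "f' \<in> carrier F" "quot f = quot f'"
      unfolding f'_def by (rule someI2[of _ f]; use f in auto)+
    have r: "f' - f \<in> green_relations A" using quot_eq_iff[OF f'(1) f] f'(2) by simp
    have "k ((f' - f) + f) = \<zero>\<^bsub>Z\<^esub> \<oplus>\<^bsub>Z\<^esub> k f"
      unfolding kadd[OF sub[OF r] f] kker[OF r] ..
    then show ?thesis
      using kF[OF f] by (simp add: \<phi>_def f'_def)
  qed
  show thesis
  proof (rule that[of \<phi>])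
    show "\<phi> x \<in> carrier Z" if "x \<in> carrier GR" for x
      using quot_surj[OF that] \<phi> kF by auto
    show "\<phi> (cl M) = v M" if "gmodule n M" for M :: "('a, nat, 'k) gmod"
      using \<phi>[OF frag_gclass[OF that]] kcl[OF that] by (simp add: cl_def)
    fix x y assume "x \<in> carrier GR" "y \<in> carrier GR"
    then obtain a b where "a \<in> carrier F" "x = quot a" "b \<in> carrier F" "y = quot b"
      using quot_surj by meson
    moreover from this have "a + b \<in> carrier F" by (simp add: keys_subset_add)
    ultimately show "\<phi> (x \<oplus>\<^bsub>GR\<^esub> y) = \<phi> x \<oplus>\<^bsub>Z\<^esub> \<phi> y"
      using \<phi> kadd quot_add by metis
  qed
qed

end

section \<open>Translation between matrix representations and families of operators\<close>

section \<open>Matrices as operators\<close>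

text \<open>The cut-off at \<open>dim_row S\<close> makes every value a function supported on the
  row indices.\<close>

definition mop :: "'k::field mat \<Rightarrow> (nat \<Rightarrow> 'k) \<Rightarrow> nat \<Rightarrow> 'k"
  where "mop S f = (\<lambda>i. if i < dim_row S then \<Sum>j<dim_col S. S $$ (i, j) * f j else 0)"

definition omat :: "nat \<Rightarrow> nat \<Rightarrow> ((nat \<Rightarrow> 'k::field) \<Rightarrow> nat \<Rightarrow> 'k) \<Rightarrow> 'k mat"
  where "omat r c P = mat r c (\<lambda>(i, j). P (delta_fun j) i)"

lemma lin_mop: "lin (mop S)"
  by (rule linI) (simp_all add: mop_def algebra_simps sum.distrib sum_distrib_left)

lemma mop_vecs: "S \<in> carrier_mat r c \<Longrightarrow> mop S f \<in> vecs {..<r}"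
  by (auto simp: mop_def vecs_def)

lemma mop_delta: "S \<in> carrier_mat r c \<Longrightarrow> i < r \<Longrightarrow> j < c \<Longrightarrow> mop S (delta_fun j) i = S $$ (i, j)"
proof -
  assume S: "S \<in> carrier_mat r c" "i < r" "j < c"
  have "(\<Sum>l<c. S $$ (i, l) * delta_fun j l) = (\<Sum>l<c. if l = j then S $$ (i, j) else 0)"
    by (intro sum.cong) (auto simp: delta_fun_def)
  then show ?thesis using S by (simp add: mop_def)
qed

lemma mop_eqI:
  assumes "S \<in> carrier_mat r c" "S' \<in> carrier_mat r c"
    and "\<And>f. f \<in> vecs {..<c} \<Longrightarrow> mop S f = mop S' f"
  shows "S = S'"
proof (rule eq_matI)
  fix i j assume "i < dim_row S'" "j < dim_col S'"
  then have ij: "i < r" "j < c" using assms by auto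
  then show "S $$ (i, j) = S' $$ (i, j)"
    using mop_delta[OF assms(1) ij] mop_delta[OF assms(2) ij] assms(3)[OF delta_fun_vecs] by simp
qed (use assms in auto)

lemma mop_mult:
  assumes "S \<in> carrier_mat r m" "S' \<in> carrier_mat m c"
  shows "mop (S * S') f = mop S (mop S' f)"
proof
  fix i
  show "mop (S * S') f i = mop S (mop S' f) i"
  proof (cases "i < r")
    case True
    have "mop (S * S') f i = (\<Sum>j<c. (\<Sum>l<m. S $$ (i, l) * S' $$ (l, j)) * f j)"
      using assms True by (simp add: mop_def scalar_prod_def atLeast0LessThan)
    also have "\<dots> = (\<Sum>l<m. \<Sum>j<c. S $$ (i, l) * S' $$ (l, j) * f j)"
      by (simp add: sum_distrib_right sum.swap[of _ "{..<m}"])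
    also have "\<dots> = mop S (mop S' f) i"
      using assms True by (simp add: mop_def sum_distrib_left mult.assoc)
    finally show ?thesis .
  qed (use assms in \<open>simp add: mop_def\<close>)
qed

lemma mop_one: "f \<in> vecs {..<d} \<Longrightarrow> mop (1\<^sub>m d) f = f"
proof
  fix i assume f: "f \<in> vecs {..<d}"
  have "(\<Sum>j<d. 1\<^sub>m d $$ (i, j) * f j) = (\<Sum>j<d. if j = i then f i else 0)" if "i < d"
    using that by (intro sum.cong) auto
  then show "mop (1\<^sub>m d) f i = f i"
    using vecsD[OF f, of i] by (simp add: mop_def)
qed

lemma omat_carrier: "omat r c P \<in> carrier_mat r c"
  by (simp add: omat_def)

lemma mop_omat:
  assumes "lin P" "P ` vecs {..<c} \<subseteq> vecs {..<r}" "f \<in> vecs {..<c}"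
  shows "mop (omat r c P) f = P f"
proof
  fix i
  have "P f i = 0" if "\<not> i < r" using assms(2,3) that by (auto simp: vecs_def)
  then show "mop (omat r c P) f i = P f i"
    using lin_expand[OF _ assms(3,1), of i] by (simp add: mop_def omat_def mult.commute)
qed

text \<open>The traces of \<open>S * S'\<close> and \<open>S' * S\<close> agree, and in
  characteristic zero the trace of an identity matrix determines its size.\<close>

lemma square_of_inverses:
  fixes S :: "'k::field_char_0 mat"
  assumes "S \<in> carrier_mat r c" "S' \<in> carrier_mat c r" "S * S' = 1\<^sub>m r" "S' * S = 1\<^sub>m c"
  shows "r = c"
proof -
  have "(of_nat r :: 'k) = (\<Sum>i<r. (S * S') $$ (i, i))"
    by (simp add: assms(3))
  also have "\<dots> = (\<Sum>i<r. \<Sum>j<c. S $$ (i, j) * S' $$ (j, i))"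
    using assms(1,2) by (intro sum.cong) (auto simp: scalar_prod_def atLeast0LessThan)
  also have "\<dots> = (\<Sum>j<c. \<Sum>i<r. S' $$ (j, i) * S $$ (i, j))"
    by (subst sum.swap) (simp add: mult.commute)
  also have "\<dots> = (\<Sum>j<c. (S' * S) $$ (j, j))"
    using assms(1,2) by (intro sum.cong) (auto simp: scalar_prod_def atLeast0LessThan)
  also have "\<dots> = of_nat c"
    by (simp add: assms(4))
  finally show ?thesis by simp
qed

text \<open>A family \<open>\<tau>\<close> of operators on the functions on \<open>I\<close>, indexed by the basis of \<open>A\<close>, that satisfies
  the module laws.\<close>

definition opfamily :: "('b, 'k::field, 'm) alg_scheme \<Rightarrow> 'i set \<Rightarrow> ('b \<Rightarrow> ('i \<Rightarrow> 'k) \<Rightarrow> 'i \<Rightarrow> 'k) \<Rightarrow> bool"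
  where "opfamily A I \<tau> \<longleftrightarrow> finite I \<and> (\<forall>b\<in>basis A. lin (\<tau> b) \<and> \<tau> b ` vecs I \<subseteq> vecs I)"

definition opmodule :: "('b, 'k::field, 'm) alg_scheme \<Rightarrow> 'i set \<Rightarrow> ('b \<Rightarrow> ('i \<Rightarrow> 'k) \<Rightarrow> 'i \<Rightarrow> 'k) \<Rightarrow> bool"
  where "opmodule A I \<tau> \<longleftrightarrow> opfamily A I \<tau> \<and>
    (\<forall>f\<in>vecs I. (\<lambda>i. \<Sum>b\<in>basis A. alg_unit A b * \<tau> b f i) = f \<and>
      (\<forall>b\<in>basis A. \<forall>c\<in>basis A. (\<lambda>i. \<Sum>e\<in>basis A. table A b c e * \<tau> e f i) = \<tau> b (\<tau> c f)))"

abbreviation rop :: "('b, 'k::field) rep \<Rightarrow> 'b \<Rightarrow> (nat \<Rightarrow> 'k) \<Rightarrow> nat \<Rightarrow> 'k"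
  where "rop R b \<equiv> mop (snd R b)"

lemma opfamilyD:
  assumes "opfamily A I \<tau>"
  shows "finite I" "b \<in> basis A \<Longrightarrow> lin (\<tau> b)" "b \<in> basis A \<Longrightarrow> f \<in> vecs I \<Longrightarrow> \<tau> b f \<in> vecs I"
    "b \<in> basis A \<Longrightarrow> \<tau> b ` vecs I \<subseteq> vecs I"
  using assms by (auto simp: opfamily_def)

lemma opmoduleD:
  assumes "opmodule A I \<tau>"
  shows "opfamily A I \<tau>" "f \<in> vecs I \<Longrightarrow> (\<lambda>i. \<Sum>b\<in>basis A. alg_unit A b * \<tau> b f i) = f"
    "f \<in> vecs I \<Longrightarrow> b \<in> basis A \<Longrightarrow> c \<in> basis A \<Longrightarrow>
      (\<lambda>i. \<Sum>e\<in>basis A. table A b c e * \<tau> e f i) = \<tau> b (\<tau> c f)"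
  using assms by (auto simp: opmodule_def)

definition opact :: "('b, 'k::field, 'm) alg_scheme \<Rightarrow> ('b \<Rightarrow> ('i \<Rightarrow> 'k) \<Rightarrow> 'i \<Rightarrow> 'k) \<Rightarrow> ('b \<Rightarrow> 'k) \<Rightarrow>
    ('i \<Rightarrow> 'k) \<Rightarrow> 'i \<Rightarrow> 'k"
  where "opact A \<tau> x f = (\<lambda>i. \<Sum>b\<in>basis A. x b * \<tau> b f i)"

lemma opact_indicator:
  assumes "finite (basis A)" "b \<in> basis A"
  shows "opact A \<tau> (indicator {b}) f = \<tau> b f"
proof
  fix i
  have "opact A \<tau> (indicator {b}) f i = (\<Sum>c\<in>basis A. if c = b then \<tau> b f i else 0)"
    unfolding opact_def by (intro sum.cong) auto
  then show "opact A \<tau> (indicator {b}) f i = \<tau> b f i" using assms by simp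
qed

lemma opact_times:
  assumes "finite (basis A)" "opmodule A I \<tau>" "f \<in> vecs I"
  shows "opact A \<tau> (alg_times A x y) f = opact A \<tau> x (opact A \<tau> y f)"
proof
  fix i
  note \<tau> = opmoduleD[OF assms(2)]
  have "opact A \<tau> x (opact A \<tau> y f) i = (\<Sum>b\<in>basis A. x b * (\<Sum>c\<in>basis A. y c * \<tau> b (\<tau> c f) i))"
    unfolding opact_def
    by (intro sum.cong refl) (simp add: lin_sum[OF opfamilyD(2)[OF \<tau>(1)]] lin_scale[OF opfamilyD(2)[OF \<tau>(1)]])
  also have "\<dots> = (\<Sum>b\<in>basis A. \<Sum>c\<in>basis A. \<Sum>e\<in>basis A. x b * y c * table A b c e * \<tau> e f i)"
    unfolding sum_distrib_left
    by (intro sum.cong refl)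
      (simp add: fun_cong[OF \<tau>(3)[OF assms(3)], symmetric] sum_distrib_left mult.assoc)
  also have "\<dots> = (\<Sum>b\<in>basis A. \<Sum>e\<in>basis A. \<Sum>c\<in>basis A. x b * y c * table A b c e * \<tau> e f i)"
    by (intro sum.cong refl sum.swap)
  also have "\<dots> = (\<Sum>e\<in>basis A. \<Sum>b\<in>basis A. \<Sum>c\<in>basis A. x b * y c * table A b c e * \<tau> e f i)"
    by (rule sum.swap)
  also have "\<dots> = opact A \<tau> (alg_times A x y) f i"
    by (simp add: opact_def alg_times_def sum_distrib_right)
  finally show "opact A \<tau> (alg_times A x y) f i = opact A \<tau> x (opact A \<tau> y f) i" by simp
qed

lemma opact_unit: "opmodule A I \<tau> \<Longrightarrow> f \<in> vecs I \<Longrightarrow> opact A \<tau> (alg_unit A) f = f"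
  unfolding opact_def by (rule opmoduleD(2))

lemma opact_vecs: "opfamily A I \<tau> \<Longrightarrow> f \<in> vecs I \<Longrightarrow> opact A \<tau> x f \<in> vecs I"
  unfolding opact_def by (rule vecs_sum, rule vecs_scale, rule opfamilyD(3))

lemma opact_pow:
  assumes "finite (basis A)" "opmodule A I \<tau>" "f \<in> vecs I"
  shows "opact A \<tau> (alg_pow A x i) f = (opact A \<tau> x ^^ i) f"
  using assms(3)
proof (induction i arbitrary: f)
  case 0
  then show ?case by (simp add: opact_unit[OF assms(2)])
next
  case (Suc i)
  have "opact A \<tau> (alg_pow A x (Suc i)) f = opact A \<tau> (alg_pow A x i) (opact A \<tau> x f)"
    using opact_times[OF assms(1,2) Suc.prems] by simp
  also have "\<dots> = (opact A \<tau> x ^^ i) (opact A \<tau> x f)"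
    by (rule Suc.IH[OF opact_vecs[OF opmoduleD(1)[OF assms(2)] Suc.prems]])
  finally show ?case by (simp add: funpow_swap1)
qed

lemma mop_act:
  assumes "\<forall>b\<in>basis A. snd R b \<in> carrier_mat (fst R) (fst R)"
  shows "mop (act A R x) f = opact A (rop R) x f"
proof
  fix i
  have "(\<Sum>b\<in>basis A. x b * rop R b f i) = (\<Sum>b\<in>basis A. x b * (\<Sum>j<fst R. snd R b $$ (i, j) * f j))"
    if "i < fst R"
    using assms that by (intro sum.cong) (auto simp: mop_def)
  also have "\<dots> = (\<Sum>j<fst R. (\<Sum>b\<in>basis A. x b * snd R b $$ (i, j)) * f j)"
    unfolding sum_distrib_left sum_distrib_right by (subst sum.swap) (simp add: mult.assoc)
  finally have "(\<Sum>b\<in>basis A. x b * rop R b f i) = mop (act A R x) f i" if "i < fst R"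
    using that by (simp add: mop_def act_def)
  moreover have "(\<Sum>b\<in>basis A. x b * rop R b f i) = 0" if "\<not> i < fst R"
    using assms that by (intro sum.neutral) (auto simp: mop_def)
  ultimately show "mop (act A R x) f i = opact A (rop R) x f i"
    by (cases "i < fst R") (auto simp: opact_def mop_def act_def)
qed

lemma act_carrier: "act A R x \<in> carrier_mat (fst R) (fst R)"
  by (simp add: act_def)

text \<open>Both sides of the multiplication law are bilinear in the algebra elements, so it
  suffices to have it on basis vectors, where it reads off the structure constants.\<close>

lemma is_module_iff:
  assumes fin: "finite (basis A)"
  shows "is_module A R \<longleftrightarrow> (\<forall>b\<in>basis A. snd R b \<in> carrier_mat (fst R) (fst R)) \<and>
    opmodule A {..<fst R} (rop R)"
proof (cases "\<forall>b\<in>basis A. snd R b \<in> carrier_mat (fst R) (fst R)")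
  case True
  note mop_act = mop_act[OF True]
  have fam: "opfamily A {..<fst R} (rop R)"
    using True by (auto simp: opfamily_def lin_mop mop_vecs)
  show ?thesis
  proof (intro iffI conjI)
    assume R: "is_module A R"
    have "mop (act A R (alg_unit A)) f = f" if "f \<in> vecs {..<fst R}" for f
      using R mop_one[OF that] by (simp add: is_module_def)
    moreover have "opact A (rop R) (table A b c) f = rop R b (rop R c f)"
      if bc: "b \<in> basis A" "c \<in> basis A" for b c f
    proof -
      have e: "indicator {d} \<in> alg_elems A" if "d \<in> basis A" for d
        using that by (auto simp: alg_elems_def indicator_def)
      have "act A R (alg_times A (indicator {b}) (indicator {c})) =
          act A R (indicator {b}) * act A R (indicator {c})"
        using R e bc by (simp add: is_module_def)
      then have "mop (act A R (table A b c)) f = mop (act A R (indicator {b})) (mop (act A R (indicator {c})) f)"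
        using mop_mult[OF act_carrier act_carrier] by (simp add: alg_times_indicator[OF fin bc])
      then show ?thesis
        by (simp add: mop_act opact_indicator[OF fin] bc)
    qed
    ultimately show "opmodule A {..<fst R} (rop R)"
      using fam by (simp add: opmodule_def mop_act opact_def)
  next
    assume R: "(\<forall>b\<in>basis A. snd R b \<in> carrier_mat (fst R) (fst R)) \<and> opmodule A {..<fst R} (rop R)"
    have "act A R (alg_unit A) = 1\<^sub>m (fst R)"
      using R by (intro mop_eqI[OF act_carrier]) (auto simp: mop_act opact_unit mop_one)
    moreover have "act A R (alg_times A x y) = act A R x * act A R y" for x y
    proof (rule mop_eqI[OF act_carrier])
      show "act A R x * act A R y \<in> carrier_mat (fst R) (fst R)"
        using act_carrier by (rule mult_carrier_mat) (rule act_carrier)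
      show "mop (act A R (alg_times A x y)) f = mop (act A R x * act A R y) f"
        if "f \<in> vecs {..<fst R}" for f
        using R opact_times[OF fin _ that] by (simp add: mop_mult[OF act_carrier act_carrier] mop_act)
    qed
    ultimately show "is_module A R"
      using R by (simp add: is_module_def)
  qed (use True in auto)
qed (auto simp: is_module_def)

text \<open>An isomorphism between the operators of a representation by matrices and a family \<open>\<tau>\<close>.\<close>

definition presents :: "('b, 'k::field, 'm) alg_scheme \<Rightarrow> 'i set \<Rightarrow> ('b \<Rightarrow> ('i \<Rightarrow> 'k) \<Rightarrow> 'i \<Rightarrow> 'k) \<Rightarrow>
    'j set \<Rightarrow> ('b \<Rightarrow> ('j \<Rightarrow> 'k) \<Rightarrow> 'j \<Rightarrow> 'k) \<Rightarrow> bool"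
  where "presents A I \<tau> J \<sigma> \<longleftrightarrow> (\<exists>P Q. lin P \<and> lin Q \<and> P ` vecs I \<subseteq> vecs J \<and> Q ` vecs J \<subseteq> vecs I \<and>
    (\<forall>f\<in>vecs I. Q (P f) = f \<and> (\<forall>b\<in>basis A. P (\<tau> b f) = \<sigma> b (P f))) \<and> (\<forall>f\<in>vecs J. P (Q f) = f))"

text \<open>Transport of structure: each law holds after applying the injective map
  \<open>P\<close>, hence holds already on \<open>I\<close>.\<close>

lemma presents_opmodule:
  fixes A :: "('b, 'k::field, 'm) alg_scheme" and I :: "'i set"
  assumes P: "presents A I \<tau> J \<sigma>" and \<sigma>: "opmodule A J \<sigma>" and \<tau>: "opfamily A I \<tau>"
  shows "opmodule A I \<tau>"
proof -
  obtain P Q where P: "lin P" "lin Q" "P ` vecs I \<subseteq> vecs J" "Q ` vecs J \<subseteq> vecs I"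
    and QP: "\<And>f. f \<in> vecs I \<Longrightarrow> Q (P f) = f" and PQ: "\<And>f. f \<in> vecs J \<Longrightarrow> P (Q f) = f"
    and eq: "\<And>f b. f \<in> vecs I \<Longrightarrow> b \<in> basis A \<Longrightarrow> P (\<tau> b f) = \<sigma> b (P f)"
    using P unfolding presents_def by blast
  have PJ: "P f \<in> vecs J" if "f \<in> vecs I" for f using that P by blast
  have inj: "u = w" if "u \<in> vecs I" "w \<in> vecs I" "P u = P w" for u w
    using that QP by metis
  show ?thesis
    unfolding opmodule_def
  proof (intro conjI ballI \<tau>)
    fix f :: "'i \<Rightarrow> 'k" assume f: "f \<in> vecs I"
    have *: "P (\<lambda>i. \<Sum>b\<in>basis A. x b * \<tau> b f i) = (\<lambda>i. \<Sum>b\<in>basis A. x b * \<sigma> b (P f) i)" for x :: "'b \<Rightarrow> 'k"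
      by (simp add: lin_sum[OF P(1)] lin_scale[OF P(1)] eq[OF f])
    have **: "(\<lambda>i. \<Sum>b\<in>basis A. x b * \<tau> b f i) \<in> vecs I" for x :: "'b \<Rightarrow> 'k"
      by (rule vecs_sum, rule vecs_scale, rule opfamilyD(3)[OF \<tau> _ f])
    show "(\<lambda>i. \<Sum>b\<in>basis A. alg_unit A b * \<tau> b f i) = f"
      by (rule inj[OF ** f]) (simp add: * opmoduleD(2)[OF \<sigma> PJ[OF f]])
    fix b c assume bc: "b \<in> basis A" "c \<in> basis A"
    note c = opfamilyD(3)[OF \<tau> bc(2) f]
    show "(\<lambda>i. \<Sum>e\<in>basis A. table A b c e * \<tau> e f i) = \<tau> b (\<tau> c f)"
      by (rule inj[OF ** opfamilyD(3)[OF \<tau> bc(1) c]])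
        (simp add: * opmoduleD(3)[OF \<sigma> PJ[OF f] bc] eq[OF c bc(1)] eq[OF f bc(2)])
  qed
qed

text \<open>Matrices and linear maps between the coordinate spaces determine each other. Since
  \<open>invertible_mat\<close> speaks of square matrices, equality of the dimensions has to be
  derived first, by the trace argument of \<open>square_of_inverses\<close>.\<close>

lemma module_iso_iff:
  fixes A :: "('b, 'k::field_char_0, 'm) alg_scheme"
  assumes fin: "finite (basis A)" and R: "is_module A R" and R': "is_module A R'"
  shows "module_iso A R R' \<longleftrightarrow> presents A {..<fst R} (rop R) {..<fst R'} (rop R')"
proof
  let ?d = "fst R" and ?d' = "fst R'"
  have cR: "\<forall>b\<in>basis A. snd R b \<in> carrier_mat ?d ?d" and cR': "\<forall>b\<in>basis A. snd R' b \<in> carrier_mat ?d' ?d'"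
    using R R' by (auto simp: is_module_def)
  {
    assume "module_iso A R R'"
    then obtain P where P: "P \<in> carrier_mat ?d' ?d" "invertible_mat P"
      and PA: "\<forall>x\<in>alg_elems A. P * act A R x = act A R' x * P"
      by (auto simp: module_iso_def)
    have d: "?d' = ?d" using P by (auto simp: invertible_mat_def)
    obtain Q where Q: "inverts_mat P Q" "inverts_mat Q P" using P(2) by (auto simp: invertible_mat_def)
    have PQ: "P * Q = 1\<^sub>m ?d" using Q(1) P(1) d by (simp add: inverts_mat_def)
    then have "dim_col Q = ?d" by (metis index_mult_mat(3) index_one_mat(3))
    moreover have QP: "Q * P = 1\<^sub>m (dim_row Q)" using Q(2) by (simp add: inverts_mat_def)
    then have "dim_row Q = ?d" using P(1) by (metis carrier_matD(2) index_mult_mat(3) index_one_mat(3))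
    ultimately have Qc: "Q \<in> carrier_mat ?d ?d" by auto
    have Pc: "P \<in> carrier_mat ?d ?d" using P(1) d by simp
    show "presents A {..<?d} (rop R) {..<?d'} (rop R')"
      unfolding presents_def
    proof (intro exI conjI ballI image_subsetI)
      show "lin (mop P)" "lin (mop Q)" by (rule lin_mop)+
      show "mop P f \<in> vecs {..<?d'}" for f by (rule mop_vecs[OF P(1)])
      show "mop Q f \<in> vecs {..<?d}" for f by (rule mop_vecs[OF Qc])
      show "mop Q (mop P f) = f" if "f \<in> vecs {..<?d}" for f
        using mop_mult[OF Qc Pc] QP Qc mop_one[OF that] by simp
      show "mop P (mop Q f) = f" if "f \<in> vecs {..<?d'}" for f
        using mop_mult[OF Pc Qc] PQ that mop_one[of f ?d] d by simp
      fix f :: "nat \<Rightarrow> 'k" and b assume "f \<in> vecs {..<?d}" and b: "b \<in> basis A"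
      have "indicator {b} \<in> alg_elems A" using b by (auto simp: alg_elems_def indicator_def)
      then have "mop (P * act A R (indicator {b})) f = mop (act A R' (indicator {b}) * P) f"
        using PA by simp
      then show "mop P (rop R b f) = rop R' b (mop P f)"
        by (simp add: mop_mult[OF P(1) act_carrier] mop_mult[OF act_carrier P(1)] mop_act[OF cR]
            mop_act[OF cR'] opact_indicator[OF fin b])
    qed
  }
  assume "presents A {..<?d} (rop R) {..<?d'} (rop R')"
  then obtain P Q where P: "lin P" "lin Q" "P ` vecs {..<?d} \<subseteq> vecs {..<?d'}" "Q ` vecs {..<?d'} \<subseteq> vecs {..<?d}"
    and QP: "\<And>f. f \<in> vecs {..<?d} \<Longrightarrow> Q (P f) = f" and PQ: "\<And>f. f \<in> vecs {..<?d'} \<Longrightarrow> P (Q f) = f"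
    and eq: "\<And>f b. f \<in> vecs {..<?d} \<Longrightarrow> b \<in> basis A \<Longrightarrow> P (rop R b f) = rop R' b (P f)"
    unfolding presents_def by blast
  define S where "S = omat ?d' ?d P"
  define S' where "S' = omat ?d ?d' Q"
  have Sc: "S \<in> carrier_mat ?d' ?d" "S' \<in> carrier_mat ?d ?d'" by (simp_all add: S_def S'_def omat_carrier)
  have mS: "mop S f = P f" if "f \<in> vecs {..<?d}" for f
    unfolding S_def by (rule mop_omat[OF P(1,3) that])
  have mS': "mop S' f = Q f" if "f \<in> vecs {..<?d'}" for f
    unfolding S'_def by (rule mop_omat[OF P(2,4) that])
  have PV: "P f \<in> vecs {..<?d'}" if "f \<in> vecs {..<?d}" for f using that P by blast
  have QV: "Q f \<in> vecs {..<?d}" if "f \<in> vecs {..<?d'}" for f using that P by blast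
  have SS': "S * S' = 1\<^sub>m ?d'"
    by (rule mop_eqI[OF mult_carrier_mat[OF Sc] one_carrier_mat])
      (simp add: mop_mult[OF Sc] mS mS' QV PQ mop_one)
  have S'S: "S' * S = 1\<^sub>m ?d"
    by (rule mop_eqI[OF mult_carrier_mat[OF Sc(2,1)] one_carrier_mat])
      (simp add: mop_mult[OF Sc(2,1)] mS mS' PV QP mop_one)
  have d: "?d' = ?d"
    by (rule square_of_inverses[OF Sc SS' S'S])
  have "invertible_mat S"
    using SS' S'S Sc d by (auto simp: invertible_mat_def inverts_mat_def intro!: exI[of _ S'])
  moreover have "S * act A R x = act A R' x * S" for x
  proof (rule mop_eqI[OF mult_carrier_mat[OF Sc(1) act_carrier] mult_carrier_mat[OF act_carrier Sc(1)]])
    fix f :: "nat \<Rightarrow> 'k" assume f: "f \<in> vecs {..<?d}"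
    have "opact A (rop R) x f \<in> vecs {..<?d}"
      by (rule opact_vecs[OF opmoduleD(1) f]) (use R is_module_iff[OF fin] in auto)
    moreover have "P (opact A (rop R) x f) = opact A (rop R') x (P f)"
      by (simp add: opact_def lin_sum[OF P(1)] lin_scale[OF P(1)] eq[OF f])
    ultimately show "mop (S * act A R x) f = mop (act A R' x * S) f"
      by (simp add: mop_mult[OF Sc(1) act_carrier] mop_mult[OF act_carrier Sc(1)] mop_act[OF cR]
          mop_act[OF cR'] mS f)
  qed
  ultimately show "module_iso A R R'"
    using Sc by (auto simp: module_iso_def)
qed

lemma opfamily_rop:
  "\<forall>b\<in>basis A. snd R b \<in> carrier_mat (fst R) (fst R) \<Longrightarrow> opfamily A {..<fst R} (rop R)"
  by (auto simp: opfamily_def lin_mop mop_vecs)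

lemma is_module_presents:
  assumes "finite (basis A)" "\<forall>b\<in>basis A. snd R b \<in> carrier_mat (fst R) (fst R)"
    and "presents A {..<fst R} (rop R) I \<sigma>" "opmodule A I \<sigma>"
  shows "is_module A R"
  using presents_opmodule[OF assms(3,4) opfamily_rop[OF assms(2)]] assms is_module_iff by blast

section \<open>Direct sums and Kronecker products as operators\<close>

lemma opmodule_sum:
  fixes A :: "('b, 'k::field, 'm) alg_scheme" and I :: "'i set" and J :: "'j set"
  assumes "opmodule A I \<tau>" "opmodule A J \<sigma>"
  shows "opmodule A (Sum_Type.Plus I J) (\<lambda>b. sum_op (\<tau> b) (\<sigma> b))"
proof -
  note \<tau> = opmoduleD[OF assms(1)] and \<sigma> = opmoduleD[OF assms(2)]
  show ?thesis
    unfolding opmodule_def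
  proof (intro conjI ballI)
    show "opfamily A (Sum_Type.Plus I J) (\<lambda>b. sum_op (\<tau> b) (\<sigma> b))"
      unfolding opfamily_def
    proof (intro conjI ballI image_subsetI)
      show "finite (Sum_Type.Plus I J)"
        using opfamilyD(1)[OF \<tau>(1)] opfamilyD(1)[OF \<sigma>(1)] by simp
      fix b assume b: "b \<in> basis A"
      show "lin (sum_op (\<tau> b) (\<sigma> b))"
        by (rule lin_sum_op[OF opfamilyD(2)[OF \<tau>(1) b] opfamilyD(2)[OF \<sigma>(1) b]])
      show "sum_op (\<tau> b) (\<sigma> b) f \<in> vecs (Sum_Type.Plus I J)" if "f \<in> vecs (Sum_Type.Plus I J)" for f
        by (rule sum_op_vecs[OF opfamilyD(4)[OF \<tau>(1) b] opfamilyD(4)[OF \<sigma>(1) b] that])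
    qed
    fix f :: "'i + 'j \<Rightarrow> 'k" assume f: "f \<in> vecs (Sum_Type.Plus I J)"
    note ff = vecs_summands[OF f]
    show "(\<lambda>i. \<Sum>b\<in>basis A. alg_unit A b * sum_op (\<tau> b) (\<sigma> b) f i) = f"
    proof
      fix p
      show "(\<Sum>b\<in>basis A. alg_unit A b * sum_op (\<tau> b) (\<sigma> b) f p) = f p"
        using fun_cong[OF \<tau>(2)[OF ff(1)]] fun_cong[OF \<sigma>(2)[OF ff(2)]] by (cases p) simp_all
    qed
    fix b c assume bc: "b \<in> basis A" "c \<in> basis A"
    show "(\<lambda>i. \<Sum>e\<in>basis A. table A b c e * sum_op (\<tau> e) (\<sigma> e) f i) =
        sum_op (\<tau> b) (\<sigma> b) (sum_op (\<tau> c) (\<sigma> c) f)"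
    proof
      fix p
      show "(\<Sum>e\<in>basis A. table A b c e * sum_op (\<tau> e) (\<sigma> e) f p) =
          sum_op (\<tau> b) (\<sigma> b) (sum_op (\<tau> c) (\<sigma> c) f) p"
        using fun_cong[OF \<tau>(3)[OF ff(1) bc]] fun_cong[OF \<sigma>(3)[OF ff(2) bc]] by (cases p) simp_all
    qed
  qed
qed

lemma sum_lessThan_add: "(\<Sum>j<a + b. F j) = (\<Sum>j<a. F j) + (\<Sum>j<b. F (a + j))"
  for F :: "nat \<Rightarrow> 'k::field"
  by (induction b) (simp_all add: add.assoc)

lemma sum_lessThan_mult: "(\<Sum>l<a * b. F l) = (\<Sum>i<a. \<Sum>j<b. F (i * b + j))"
  for F :: "nat \<Rightarrow> 'k::field"
proof (induction a)
  case (Suc a)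
  have "(\<Sum>l<Suc a * b. F l) = (\<Sum>l<a * b + b. F l)" by (simp add: add.commute)
  then show ?case unfolding sum_lessThan_add Suc by simp
qed simp

lemma presents_direct_sum:
  fixes A :: "('b, 'k::field, 'm) alg_scheme"
  assumes R: "is_module A R" "is_module A R'"
  shows "\<forall>b\<in>basis A. snd (direct_sum R R') b \<in> carrier_mat (fst (direct_sum R R')) (fst (direct_sum R R'))"
    "presents A {..<fst (direct_sum R R')} (rop (direct_sum R R'))
      (Sum_Type.Plus {..<fst R} {..<fst R'}) (\<lambda>b. sum_op (rop R b) (rop R' b))"
proof -
  let ?d = "fst R" and ?d' = "fst R'"
  have c: "snd R b \<in> carrier_mat ?d ?d" "snd R' b \<in> carrier_mat ?d' ?d'" if "b \<in> basis A" for b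
    using R that by (auto simp: is_module_def)
  have d: "fst (direct_sum R R') = ?d + ?d'" by (simp add: direct_sum_def)
  show "\<forall>b\<in>basis A. snd (direct_sum R R') b \<in> carrier_mat (fst (direct_sum R R')) (fst (direct_sum R R'))"
    using c by (auto simp: direct_sum_def)
  let ?P = "\<lambda>f. case_sum (\<lambda>i. if i < ?d then f i else 0) (\<lambda>j. if j < ?d' then f (?d + j) else 0)"
  let ?Q = "\<lambda>f k. if k < ?d then f (Inl k) else if k < ?d + ?d' then f (Inr (k - ?d)) else 0"
  show "presents A {..<fst (direct_sum R R')} (rop (direct_sum R R'))
      (Sum_Type.Plus {..<fst R} {..<fst R'}) (\<lambda>b. sum_op (rop R b) (rop R' b))"
    unfolding presents_def d
  proof (intro exI[of _ ?P] exI[of _ ?Q] conjI ballI image_subsetI)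
    show "lin ?P" "lin ?Q" by (auto simp: lin_def fun_eq_iff split: sum.split)
    show "?P f \<in> vecs (Sum_Type.Plus {..<?d} {..<?d'})" for f
      by (rule vecsI) (auto split: sum.split)
    show "?Q f \<in> vecs {..<?d + ?d'}" for f
      by (rule vecsI) auto
    show "?Q (?P f) = f" if "f \<in> vecs {..<?d + ?d'}" for f
      using that by (auto simp: fun_eq_iff vecs_def)
    show "?P (?Q f) = f" if "f \<in> vecs (Sum_Type.Plus {..<?d} {..<?d'})" for f
      using vecsD[OF that] by (auto simp: fun_eq_iff split: sum.split)
    fix f :: "nat \<Rightarrow> 'k" and b assume b: "b \<in> basis A"
    show "?P (rop (direct_sum R R') b f) = sum_op (rop R b) (rop R' b) (?P f)"
      using c[OF b]
      by (auto simp: fun_eq_iff mop_def direct_sum_def sum_lessThan_add split: sum.split)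
  qed
qed

text \<open>The action of \<open>A \<otimes> A\<close> on a tensor product.\<close>

definition tensor_op :: "('b \<Rightarrow> ('i \<Rightarrow> 'k::field) \<Rightarrow> 'i \<Rightarrow> 'k) \<Rightarrow> ('b \<Rightarrow> ('j \<Rightarrow> 'k) \<Rightarrow> 'j \<Rightarrow> 'k) \<Rightarrow>
    'b \<times> 'b \<Rightarrow> ('i \<times> 'j \<Rightarrow> 'k) \<Rightarrow> 'i \<times> 'j \<Rightarrow> 'k"
  where "tensor_op \<tau> \<sigma> p f = left_op (\<tau> (fst p)) (right_op (\<sigma> (snd p)) f)"

lemma opfamily_tensor:
  assumes "opfamily A I \<tau>" "opfamily A J \<sigma>"
  shows "opfamily (tensor_square A) (I \<times> J) (tensor_op \<tau> \<sigma>)"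
  unfolding opfamily_def
proof (intro conjI ballI)
  note \<tau> = opfamilyD[OF assms(1)] and \<sigma> = opfamilyD[OF assms(2)]
  show "finite (I \<times> J)" using \<tau>(1) \<sigma>(1) by simp
  fix p assume "p \<in> basis (tensor_square A)"
  then have p: "fst p \<in> basis A" "snd p \<in> basis A" by (auto simp: tensor_square_def)
  have "tensor_op \<tau> \<sigma> p = (\<lambda>f. left_op (\<tau> (fst p)) (right_op (\<sigma> (snd p)) f))"
    by (simp add: tensor_op_def fun_eq_iff)
  then show "lin (tensor_op \<tau> \<sigma> p)"
    using lin_comp[OF lin_left_op[OF \<tau>(2)[OF p(1)]] lin_right_op[OF \<sigma>(2)[OF p(2)]]] by simp
  show "tensor_op \<tau> \<sigma> p ` vecs (I \<times> J) \<subseteq> vecs (I \<times> J)"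
    using left_op_vecs[OF \<tau>(2,4)[OF p(1)] right_op_vecs[OF \<sigma>(2,4)[OF p(2)]]]
    by (auto simp: tensor_op_def)
qed

text \<open>The product in A \<otimes> A is componentwise, and operators on different factors
  commute, so the laws of the two modules combine.\<close>

lemma opmodule_tensor:
  fixes A :: "('b, 'k::field, 'm) alg_scheme" and I :: "'i set" and J :: "'j set"
  assumes "opmodule A I \<tau>" "opmodule A J \<sigma>"
  shows "opmodule (tensor_square A) (I \<times> J) (tensor_op \<tau> \<sigma>)"
proof -
  note \<tau> = opmoduleD[OF assms(1)] and \<sigma> = opmoduleD[OF assms(2)]
  note \<tau>f = opfamilyD[OF \<tau>(1)] and \<sigma>f = opfamilyD[OF \<sigma>(1)]
  \<comment> \<open>Coefficients that are products of one factor for each component turn the sum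
    over pairs into two nested actions; unit and structure constants of A \<otimes> A have this
    form.\<close>
  have sums: "(\<Sum>p\<in>basis A \<times> basis A. (x (fst p) * y (snd p)) * tensor_op \<tau> \<sigma> p f (i, j)) =
      (\<Sum>b\<in>basis A. x b * \<tau> b (\<lambda>i. \<Sum>c\<in>basis A. y c * \<sigma> c (\<lambda>j. f (i, j)) j) i)"
    for x y :: "_ \<Rightarrow> _" and f i j
    by (simp add: tensor_op_def left_op_def right_op_def lin_sum[OF \<tau>f(2)]
        lin_scale[OF \<tau>f(2)] sum_distrib_left mult.assoc sum.cartesian_product split_def)
  show ?thesis
    unfolding opmodule_def
  proof (intro conjI ballI)
    show "opfamily (tensor_square A) (I \<times> J) (tensor_op \<tau> \<sigma>)"
      by (rule opfamily_tensor[OF \<tau>(1) \<sigma>(1)])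
    fix f :: "'i \<times> 'j \<Rightarrow> 'k" assume f: "f \<in> vecs (I \<times> J)"
    note fs = vecs_slices[OF f]
    show "(\<lambda>i. \<Sum>b\<in>basis (tensor_square A). alg_unit (tensor_square A) b * tensor_op \<tau> \<sigma> b f i) = f"
    proof (rule ext, clarify)
      fix i j
      have "(\<Sum>b\<in>basis (tensor_square A). alg_unit (tensor_square A) b * tensor_op \<tau> \<sigma> b f (i, j)) =
          (\<Sum>p\<in>basis A \<times> basis A. (alg_unit A (fst p) * alg_unit A (snd p)) * tensor_op \<tau> \<sigma> p f (i, j))"
        by (simp add: tensor_square_def split_def)
      then show "(\<Sum>b\<in>basis (tensor_square A). alg_unit (tensor_square A) b * tensor_op \<tau> \<sigma> b f (i, j)) = f (i, j)"
        unfolding sums using fun_cong[OF \<sigma>(2)[OF fs(2)]] fun_cong[OF \<tau>(2)[OF fs(1)]] by simp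
    qed
    fix b c assume "b \<in> basis (tensor_square A)" "c \<in> basis (tensor_square A)"
    then have b: "fst b \<in> basis A" "snd b \<in> basis A" and c: "fst c \<in> basis A" "snd c \<in> basis A"
      by (auto simp: tensor_square_def)
    show "(\<lambda>i. \<Sum>e\<in>basis (tensor_square A). table (tensor_square A) b c e * tensor_op \<tau> \<sigma> e f i) =
        tensor_op \<tau> \<sigma> b (tensor_op \<tau> \<sigma> c f)"
    proof (rule ext, clarify)
      fix i j
      have R: "right_op (\<sigma> (snd c)) f \<in> vecs (I \<times> J)"
        by (rule right_op_vecs[OF \<sigma>f(2,4)[OF c(2)] f])
      have "(\<Sum>e\<in>basis (tensor_square A). table (tensor_square A) b c e * tensor_op \<tau> \<sigma> e f (i, j)) =
          (\<Sum>p\<in>basis A \<times> basis A. (table A (fst b) (fst c) (fst p) * table A (snd b) (snd c) (snd p)) *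
            tensor_op \<tau> \<sigma> p f (i, j))"
        by (simp add: tensor_square_def split_def)
      also have "\<dots> = \<tau> (fst b) (\<tau> (fst c) (\<lambda>i. \<sigma> (snd b) (\<sigma> (snd c) (\<lambda>j. f (i, j))) j)) i"
      proof -
        have "right_op (\<sigma> (snd b)) (right_op (\<sigma> (snd c)) f) \<in> vecs (I \<times> J)"
          by (rule right_op_vecs[OF \<sigma>f(2,4)[OF b(2)] R])
        from vecs_slices(1)[OF this, of j]
        have "(\<lambda>i. \<sigma> (snd b) (\<sigma> (snd c) (\<lambda>j. f (i, j))) j) \<in> vecs I"
          by (simp add: right_op_def)
        then show ?thesis
          unfolding sums using fun_cong[OF \<sigma>(3)[OF fs(2) b(2) c(2)]] fun_cong[OF \<tau>(3)[OF _ b(1) c(1)]]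
          by simp
      qed
      also have "\<dots> = tensor_op \<tau> \<sigma> b (tensor_op \<tau> \<sigma> c f) (i, j)"
        using left_right_commute[OF \<sigma>f(1) \<tau>f(2)[OF c(1)] \<sigma>f(2)[OF b(2)] R]
        by (simp add: tensor_op_def left_op_def right_op_def fun_eq_iff)
      finally show "(\<Sum>e\<in>basis (tensor_square A). table (tensor_square A) b c e * tensor_op \<tau> \<sigma> e f (i, j)) =
        tensor_op \<tau> \<sigma> b (tensor_op \<tau> \<sigma> c f) (i, j)" .
    qed
  qed
qed

text \<open>The pair (i, j) corresponds to the index \<open>i * d' + j\<close>, with d' the
  dimension of \<open>R'\<close>. This is the numbering in \<open>kronecker\<close>, whose entries
  at such positions are products of entries of the factors.\<close>

lemma presents_tensor:
  fixes A :: "('b, 'k::field, 'm) hopf_scheme"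
  assumes R: "is_module A R" "is_module A R'"
  shows "\<forall>b\<in>basis A. snd (tensor A R R') b \<in> carrier_mat (fst (tensor A R R')) (fst (tensor A R R'))"
    "presents A {..<fst (tensor A R R')} (rop (tensor A R R')) ({..<fst R} \<times> {..<fst R'})
      (\<lambda>b. opact (tensor_square A) (tensor_op (rop R) (rop R')) (comult A b))"
proof -
  let ?d = "fst R" and ?d' = "fst R'"
  have c: "snd R b \<in> carrier_mat ?d ?d" "snd R' b \<in> carrier_mat ?d' ?d'" if "b \<in> basis A" for b
    using R that by (auto simp: is_module_def)
  have d: "fst (tensor A R R') = ?d * ?d'" by (simp add: tensor_def)
  show "\<forall>b\<in>basis A. snd (tensor A R R') b \<in> carrier_mat (fst (tensor A R R')) (fst (tensor A R R'))"
    by (auto simp: tensor_def)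
  let ?P = "\<lambda>f (i, j). if i < ?d \<and> j < ?d' then f (i * ?d' + j) else 0"
  let ?Q = "\<lambda>f k. if k < ?d * ?d' then f (k div ?d', k mod ?d') else 0"
  have lt: "i * ?d' + j < ?d * ?d'" if "i < ?d" "j < ?d'" for i j
  proof -
    have "i * ?d' + j < Suc i * ?d'" using that by simp
    also have "\<dots> \<le> ?d * ?d'" using that by (intro mult_le_mono1) simp
    finally show ?thesis .
  qed
  show "presents A {..<fst (tensor A R R')} (rop (tensor A R R')) ({..<fst R} \<times> {..<fst R'})
      (\<lambda>b. opact (tensor_square A) (tensor_op (rop R) (rop R')) (comult A b))"
    unfolding presents_def d
  proof (intro exI[of _ ?P] exI[of _ ?Q] conjI ballI image_subsetI)
    show "lin ?P" "lin ?Q" by (auto simp: lin_def fun_eq_iff)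
    show "?P f \<in> vecs ({..<?d} \<times> {..<?d'})" for f
      by (rule vecsI) (auto split: if_splits)
    show "?Q f \<in> vecs {..<?d * ?d'}" for f
      by (rule vecsI) auto
    show "?Q (?P f) = f" if "f \<in> vecs {..<?d * ?d'}" for f
    proof
      fix k
      have "k div ?d' < ?d" "k mod ?d' < ?d'" if "k < ?d * ?d'"
      proof -
        have "0 < ?d'" using that by (cases ?d') auto
        then show "k div ?d' < ?d" "k mod ?d' < ?d'"
          using that by (simp_all add: less_mult_imp_div_less)
      qed
      then show "?Q (?P f) k = f k"
        using vecsD[OF that, of k] by auto
    qed
    show "?P (?Q f) = f" if "f \<in> vecs ({..<?d} \<times> {..<?d'})" for f
      using vecsD[OF that] lt by (auto simp: fun_eq_iff)
    fix f :: "nat \<Rightarrow> 'k" and b assume "f \<in> vecs {..<?d * ?d'}" and b: "b \<in> basis A"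
    show "?P (rop (tensor A R R') b f) =
        opact (tensor_square A) (tensor_op (rop R) (rop R')) (comult A b) (?P f)"
    proof
      fix p :: "nat \<times> nat"
      obtain i j where p: "p = (i, j)" by force
      have op: "tensor_op (rop R) (rop R') (b', c') (?P f) (i, j) =
          (if i < ?d \<and> j < ?d' then \<Sum>i'<?d. \<Sum>j'<?d'. snd R b' $$ (i, i') * snd R' c' $$ (j, j') *
            f (i' * ?d' + j') else 0)"
        if "b' \<in> basis A" "c' \<in> basis A" for b' c'
        using c(1)[OF that(1)] c(2)[OF that(2)]
        by (simp add: tensor_op_def left_op_def right_op_def mop_def sum_distrib_left mult.assoc)
      show "?P (rop (tensor A R R') b f) p =
          opact (tensor_square A) (tensor_op (rop R) (rop R')) (comult A b) (?P f) p"
      proof (cases "i < ?d \<and> j < ?d'")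
        case True
        have kr: "kronecker (snd R b') (snd R' c') $$ (i * ?d' + j, i' * ?d' + j') =
            snd R b' $$ (i, i') * snd R' c' $$ (j, j')"
          if "b' \<in> basis A" "c' \<in> basis A" "i' < ?d" "j' < ?d'" for b' c' i' j'
          using c(1)[OF that(1)] c(2)[OF that(2)] lt[of i j] lt[of i' j'] True that
          by (simp add: kronecker_def)
        have "?P (rop (tensor A R R') b f) (i, j) = (\<Sum>i'<?d. \<Sum>j'<?d'.
            (\<Sum>(b', c')\<in>basis A \<times> basis A. comult A b (b', c') *
              (snd R b' $$ (i, i') * snd R' c' $$ (j, j'))) * f (i' * ?d' + j'))"
        proof -
          have "?P (rop (tensor A R R') b f) (i, j) = (\<Sum>l<?d * ?d'.
              (\<Sum>(b', c')\<in>basis A \<times> basis A. comult A b (b', c') *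
                kronecker (snd R b') (snd R' c') $$ (i * ?d' + j, l)) * f l)"
            using True lt[of i j] by (simp add: mop_def tensor_def)
          also have "\<dots> = (\<Sum>i'<?d. \<Sum>j'<?d'.
            (\<Sum>(b', c')\<in>basis A \<times> basis A. comult A b (b', c') *
              (snd R b' $$ (i, i') * snd R' c' $$ (j, j'))) * f (i' * ?d' + j'))"
            unfolding sum_lessThan_mult
            by (intro sum.cong refl arg_cong2[where f = "(*)"]) (auto simp: kr)
          finally show ?thesis .
        qed
        also have "\<dots> = (\<Sum>i'<?d. \<Sum>p\<in>basis A \<times> basis A. \<Sum>j'<?d'. comult A b p *
              (snd R (fst p) $$ (i, i') * snd R' (snd p) $$ (j, j')) * f (i' * ?d' + j'))"
          unfolding sum_distrib_right split_def prod.collapse by (intro sum.cong refl sum.swap)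
        also have "\<dots> = (\<Sum>p\<in>basis A \<times> basis A. \<Sum>i'<?d. \<Sum>j'<?d'. comult A b p *
              (snd R (fst p) $$ (i, i') * snd R' (snd p) $$ (j, j')) * f (i' * ?d' + j'))"
          by (rule sum.swap)
        also have "\<dots> = (\<Sum>(b', c')\<in>basis A \<times> basis A. comult A b (b', c') *
            (\<Sum>i'<?d. \<Sum>j'<?d'. snd R b' $$ (i, i') * snd R' c' $$ (j, j') * f (i' * ?d' + j')))"
          unfolding sum_distrib_left split_def prod.collapse by (simp add: mult.assoc)
        also have "\<dots> = opact (tensor_square A) (tensor_op (rop R) (rop R')) (comult A b) (?P f) (i, j)"
          unfolding opact_def using True by (auto simp: tensor_square_def op intro!: sum.cong)
        finally show ?thesis unfolding p .
      next
        case False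
        then show ?thesis unfolding p
          by (auto simp: opact_def tensor_square_def op intro!: sum.neutral)
      qed
    qed
  qed
qed

lemma lin_opact:
  fixes A :: "('b, 'k::field, 'm) alg_scheme" and I :: "'i set"
  assumes "opfamily A I \<tau>"
  shows "lin (opact A \<tau> x)"
proof (rule linI)
  fix f f' :: "'i \<Rightarrow> 'k" and i and c
  have "\<tau> b (\<lambda>i. f i + f' i) i = \<tau> b f i + \<tau> b f' i" "\<tau> b (\<lambda>i. c * f i) i = c * \<tau> b f i"
    if "b \<in> basis A" for b
    using opfamilyD(2)[OF assms that] by (simp_all add: lin_def)
  then show "opact A \<tau> x (\<lambda>i. f i + f' i) i = opact A \<tau> x f i + opact A \<tau> x f' i"
    and "opact A \<tau> x (\<lambda>i. c * f i) i = c * opact A \<tau> x f i"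
    by (simp_all add: opact_def algebra_simps sum.distrib sum_distrib_left)
qed

lemma presents_refl:
  assumes "\<And>b f. b \<in> basis A \<Longrightarrow> f \<in> vecs I \<Longrightarrow> \<tau> b f = \<sigma> b f"
  shows "presents A I \<tau> I \<sigma>"
  unfolding presents_def using assms lin_id by (intro exI[of _ "\<lambda>f. f"]) auto

context group_datum
begin

lemma giso_ident:
  assumes "gmodule m M" "idx M' = idx M"
    and "\<And>h f. h \<in> carrier G \<Longrightarrow> f \<in> gvecs M \<Longrightarrow> gop M' h f = gop M h f"
    and "\<And>f. f \<in> gvecs M \<Longrightarrow> yop M' f = yop M f"
  shows "giso M M'"
  by (rule gisoI[OF assms(1), where P = "\<lambda>f. f" and Q = "\<lambda>f. f"])
    (use assms in \<open>auto simp: ghom_def lin_id\<close>)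

lemma gmodule_cong:
  assumes M: "gmodule m M" and idx: "idx M' = idx M"
    and gop: "\<And>h. h \<in> carrier G \<Longrightarrow> gop M' h = gop M h" and yop: "yop M' = yop M"
  shows "gmodule m M'"
proof (rule gmoduleI)
  fix f assume "f \<in> gvecs M'"
  then have f: "f \<in> gvecs M" using idx by simp
  show "gop M' h f \<in> gvecs M'" if "h \<in> carrier G" for h
    using gm_closed[OF M that f] that by (simp add: gop idx)
  show "yop M' f \<in> gvecs M'" using gm_yclosed[OF M f] by (simp add: yop idx)
  show "gop M' \<one> f = f" using gm_one[OF M f] by (simp add: gop)
  show "gop M' (h \<otimes> k) f = gop M' h (gop M' k f)" if "h \<in> carrier G" "k \<in> carrier G" for h k
    using gm_mult[OF M that f] that by (simp add: gop)
  show "yop M' (gop M' h f) = (\<lambda>i. \<chi> h * gop M' h (yop M' f) i)" if "h \<in> carrier G" for h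
    using gm_rel[OF M that f] that by (simp add: gop yop)
  show "(yop M' ^^ m) f = (\<lambda>_. 0)" using gm_nil[OF M f] by (simp add: yop)
qed (use M in \<open>simp_all add: idx gop yop gm_finite gm_lin gm_ylin\<close>)

section \<open>The group algebra as the case of nilpotency degree one\<close>

section \<open>Modules over the group algebra\<close>

definition group_gmod :: "'i set \<Rightarrow> ('a \<Rightarrow> ('i \<Rightarrow> 'k) \<Rightarrow> 'i \<Rightarrow> 'k) \<Rightarrow> ('a, 'i, 'k) gmod"
  where "group_gmod I \<tau> = \<lparr>idx = I, gop = \<tau>, yop = (\<lambda>_ _. 0)\<rparr>"

abbreviation "KG \<equiv> group_hopf G :: ('a, 'k) hopf"

lemma group_gmod_simps [simp]:
  "idx (group_gmod I \<tau>) = I" "gop (group_gmod I \<tau>) = \<tau>" "yop (group_gmod I \<tau>) = (\<lambda>_ _. 0)"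
  by (simp_all add: group_gmod_def)

lemma group_hopf_simps [simp]:
  "basis KG = carrier G" "table KG h k = indicator {h \<otimes> k}" "alg_unit KG = indicator {\<one>}"
  "comult KG h = indicator {(h, h)}" "counit KG h = 1"
  by (simp_all add: group_hopf_def)

lemma sum_indicator_mult:
  assumes "finite S" "b \<in> S"
  shows "(\<Sum>e\<in>S. indicator {b} e * F e) = (F b :: 'k)"
proof -
  have "(\<Sum>e\<in>S. indicator {b} e * F e) = (\<Sum>e\<in>S. if e = b then F b else 0)"
    by (intro sum.cong) auto
  then show ?thesis using assms by simp
qed

text \<open>The structure constants are indicator functions, so the sums in the module laws collapse
  to the laws of a group action.\<close>

lemma opmodule_group_iff:
  "opmodule KG I \<tau> \<longleftrightarrow> opfamily KG I \<tau> \<and> gmodule 1 (group_gmod I \<tau>)"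
proof (cases "opfamily KG I \<tau>")
  case True
  note fam = opfamilyD[OF True]
  have "opmodule KG I \<tau> \<longleftrightarrow> (\<forall>f\<in>vecs I. \<tau> \<one> f = f \<and>
      (\<forall>h\<in>carrier G. \<forall>k\<in>carrier G. \<tau> (h \<otimes> k) f = \<tau> h (\<tau> k f)))"
    using True by (simp add: opmodule_def sum_indicator_mult finite_carrier)
  also have "\<dots> \<longleftrightarrow> gmodule 1 (group_gmod I \<tau>)"
    using fam lin_zero[OF fam(2)] by (auto simp: gmodule_def vecs_zero intro!: linI)
  finally show ?thesis using True by simp
qed (simp add: opmodule_def)

lemma presents_group_iff:
  assumes "gmodule 1 (group_gmod I \<tau>)"
  shows "presents KG I \<tau> J \<sigma> \<longleftrightarrow> giso (group_gmod I \<tau>) (group_gmod J \<sigma>)"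
proof
  assume "presents KG I \<tau> J \<sigma>"
  then obtain P Q where P: "lin P" "lin Q" "P ` vecs I \<subseteq> vecs J" "Q ` vecs J \<subseteq> vecs I"
      "\<forall>f\<in>vecs I. Q (P f) = f \<and> (\<forall>h\<in>carrier G. P (\<tau> h f) = \<sigma> h (P f))" "\<forall>f\<in>vecs J. P (Q f) = f"
    unfolding presents_def by auto
  show "giso (group_gmod I \<tau>) (group_gmod J \<sigma>)"
    by (rule gisoI[OF assms, where P = P and Q = Q])
      (use P in \<open>auto simp: ghom_def lin_zero\<close>)
next
  assume "giso (group_gmod I \<tau>) (group_gmod J \<sigma>)"
  then obtain P Q where "ghom (group_gmod I \<tau>) (group_gmod J \<sigma>) P"
      "ghom (group_gmod J \<sigma>) (group_gmod I \<tau>) Q" "\<forall>f\<in>vecs I. Q (P f) = f" "\<forall>f\<in>vecs J. P (Q f) = f"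
    unfolding giso_def by auto
  then show "presents KG I \<tau> J \<sigma>"
    unfolding presents_def by (intro exI[of _ P] exI[of _ Q]) (auto simp: ghom_def)
qed

abbreviation group_tm :: "('a, 'k) rep \<Rightarrow> ('a, nat, 'k) gmod"
  where "group_tm R \<equiv> group_gmod {..<fst R} (rop R)"

lemma finite_basis_KG: "finite (basis KG)"
  by (simp add: finite_carrier)

lemma is_module_KG_iff: "is_module KG R \<longleftrightarrow>
    (\<forall>h\<in>carrier G. snd R h \<in> carrier_mat (fst R) (fst R)) \<and> gmodule 1 (group_tm R)"
  using is_module_iff[OF finite_basis_KG, of R] opmodule_group_iff[of "{..<fst R}" "rop R"]
    opfamily_rop[of KG R] by auto

end

context group_datum_char_0
begin

text \<open>Operators are read off from matrices and conversely. Since \<Delta>(h) = h \<otimes> h,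
  the matrix tensor product is \<open>gtensor\<close>, on which \<open>y\<close> is zero because it
  is zero on both factors.\<close>

lemma green_model_KG: "green_model G \<chi> g KG group_tm 1"
proof unfold_locales
  fix R :: "('a, 'k) rep" assume R: "is_module KG R"
  then show gR: "gmodule 1 (group_tm R)" by (simp add: is_module_KG_iff)
  fix R' :: "('a, 'k) rep" assume R': "is_module KG R'"
  then have gR': "gmodule 1 (group_tm R')" by (simp add: is_module_KG_iff)
  have om: "opmodule KG {..<fst R} (rop R)" "opmodule KG {..<fst R'} (rop R')"
    using R R' is_module_iff[OF finite_basis_KG] by auto
  show "module_iso KG R R' \<longleftrightarrow> giso (group_tm R) (group_tm R')"
    by (simp add: module_iso_iff[OF finite_basis_KG R R'] presents_group_iff[OF gR])
  show "is_module KG (direct_sum R R') \<and>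
      giso (group_tm (direct_sum R R')) (gsum (group_tm R) (group_tm R'))"
  proof
    show s: "is_module KG (direct_sum R R')"
      by (rule is_module_presents[OF finite_basis_KG presents_direct_sum[OF R R'] opmodule_sum[OF om]])
    have eq: "gsum (group_tm R) (group_tm R') = group_gmod (Sum_Type.Plus {..<fst R} {..<fst R'})
        (\<lambda>b. sum_op (rop R b) (rop R' b))"
      by (auto simp: gsum_def group_gmod_def sum_op_def fun_eq_iff split: sum.split)
    have "gmodule 1 (group_tm (direct_sum R R'))"
      using s is_module_KG_iff by blast
    from iffD1[OF presents_group_iff[OF this] presents_direct_sum(2)[OF R R']]
    show "giso (group_tm (direct_sum R R')) (gsum (group_tm R) (group_tm R'))"
      unfolding eq .
  qed
  let ?\<tau> = "\<lambda>b. opact (tensor_square KG) (tensor_op (rop R) (rop R')) (comult KG b)"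
  let ?I = "{..<fst R} \<times> {..<fst R'}"
  have famT: "opfamily (tensor_square KG) ?I (tensor_op (rop R) (rop R'))"
    by (rule opfamily_tensor[OF opmoduleD(1)[OF om(1)] opmoduleD(1)[OF om(2)]])
  have \<tau>: "?\<tau> h = (\<lambda>f. left_op (rop R h) (right_op (rop R' h) f))" if "h \<in> carrier G" for h
    using that finite_carrier by (auto simp: opact_indicator tensor_square_def tensor_op_def fun_eq_iff)
  have T: "gmodule 1 (gtensor (group_tm R) (group_tm R'))"
    by (rule gmodule_gtensor[OF gR gR']) simp
  have T\<tau>: "gmodule 1 (group_gmod ?I ?\<tau>)"
  proof (rule gmodule_cong[OF T])
    show "gop (group_gmod ?I ?\<tau>) h = gop (gtensor (group_tm R) (group_tm R')) h"
      if "h \<in> carrier G" for h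
      using \<tau>[OF that] by (simp add: fun_eq_iff)
    show "yop (group_gmod ?I ?\<tau>) = yop (gtensor (group_tm R) (group_tm R'))"
      by (simp add: fun_eq_iff left_op_def right_op_def)
  qed simp
  have "opfamily KG ?I ?\<tau>"
    using lin_opact[OF famT] opact_vecs[OF famT] by (auto simp: opfamily_def)
  then have om\<tau>: "opmodule KG ?I ?\<tau>"
    using opmodule_group_iff T\<tau> by blast
  show "is_module KG (tensor KG R R') \<and>
      giso (group_tm (tensor KG R R')) (gtensor (group_tm R) (group_tm R'))"
  proof
    show s: "is_module KG (tensor KG R R')"
      by (rule is_module_presents[OF finite_basis_KG presents_tensor[OF R R'] om\<tau>])
    have "gmodule 1 (group_tm (tensor KG R R'))"
      using s is_module_KG_iff by blast
    from iffD1[OF presents_group_iff[OF this] presents_tensor(2)[OF R R']]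
    have "giso (group_tm (tensor KG R R')) (group_gmod ?I ?\<tau>)" .
    moreover have "giso (group_gmod ?I ?\<tau>) (gtensor (group_tm R) (group_tm R'))"
      by (rule giso_ident[OF T\<tau>]) (simp_all add: \<tau> left_op_def right_op_def del: group_hopf_simps)
    ultimately show "giso (group_tm (tensor KG R R')) (gtensor (group_tm R) (group_tm R'))"
      by (rule giso_trans)
  qed
next
  fix M :: "('a, nat, 'k) gmod" assume M: "gmodule 1 M"
  obtain W :: "('a, nat, 'k) gmod" and r where W: "gmodule 1 W" "giso M W" "idx W = {..<r}"
    by (rule gmod_initial[OF M])
  define R where "R = (r, \<lambda>h. omat r r (gop W h))"
  have rop: "rop R h f = gop W h f" if "h \<in> carrier G" "f \<in> vecs {..<r}" for h f
    using mop_omat[OF gm_lin[OF W(1) that(1)] _ that(2)] gm_image[OF W(1) that(1)] W(3) by (simp add: R_def)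
  \<comment> \<open>Degree 1 forces \<open>y\<close> to vanish only on vectors of \<open>W\<close>;
    the trivial twist replaces it by the zero operator.\<close>
  have "gmodule 1 (group_gmod {..<r} (gop W))"
  proof -
    have "gmodule 1 (gtwist 0 W)" by (rule gmodule_gtwist[OF W(1)])
    then show ?thesis by (rule gmodule_cong) (simp_all add: W(3) fun_eq_iff)
  qed
  moreover have fam: "opfamily KG {..<r} (gop W)"
    using gm_lin[OF W(1)] gm_closed[OF W(1)] W(3) by (auto simp: opfamily_def)
  ultimately have om: "opmodule KG {..<r} (gop W)"
    by (simp add: opmodule_group_iff)
  have R: "is_module KG R"
  proof (rule is_module_presents[OF finite_basis_KG _ _ om])
    show "\<forall>b\<in>basis KG. snd R b \<in> carrier_mat (fst R) (fst R)" by (simp add: R_def omat_carrier)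
    show "presents KG {..<fst R} (rop R) {..<r} (gop W)"
    proof -
      have "fst R = r" by (simp add: R_def)
      then show ?thesis using rop by (auto intro: presents_refl)
    qed
  qed
  have "giso W (group_tm R)"
    by (rule giso_ident[OF W(1)]) (use rop W(3) gm_yzero[OF W(1)] in \<open>simp_all add: R_def\<close>)
  then show "\<exists>R. is_module KG R \<and> giso (group_tm R) M"
    using R giso_sym[OF giso_trans[OF W(2), of "group_tm R"]] by blast
next
  let ?R = "trivial_module KG"
  have rop: "rop ?R h f = f" if "f \<in> vecs {..<Suc 0}" for h f
    using vecsD[OF that] by (auto simp: trivial_module_def mop_def fun_eq_iff)
  have g: "gmodule 1 (group_tm ?R)"
  proof (rule gmoduleI)
    have d: "idx (group_tm ?R) = {..<Suc 0}" by (simp add: trivial_module_def)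
    show "lin (yop (group_tm ?R))" by (rule linI) simp_all
    fix f assume "f \<in> gvecs (group_tm ?R)"
    then have f: "f \<in> vecs {..<Suc 0}" unfolding d .
    show "gop (group_tm ?R) h f \<in> gvecs (group_tm ?R)"
      "gop (group_tm ?R) \<one> f = f" "gop (group_tm ?R) (h \<otimes> k) f = gop (group_tm ?R) h (gop (group_tm ?R) k f)"
      "yop (group_tm ?R) (gop (group_tm ?R) h f) = (\<lambda>i. \<chi> h * gop (group_tm ?R) h (yop (group_tm ?R) f) i)"
      for h k
      unfolding d using f by (simp_all add: rop vecs_zero)
  qed (simp_all add: lin_mop vecs_zero)
  show "is_module KG (trivial_module KG) \<and> giso (group_tm (trivial_module KG)) (uniserial 1)"
  proof
    show "is_module KG ?R"
      using g by (simp add: is_module_KG_iff trivial_module_def)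
    show "giso (group_tm ?R) (uniserial 1)"
    proof (rule giso_ident[OF g])
      have d: "idx (group_tm ?R) = {..<Suc 0}" by (simp add: trivial_module_def)
      show "idx (uniserial 1) = idx (group_tm ?R)" unfolding d by simp
      fix f assume "f \<in> gvecs (group_tm ?R)"
      then have f: "f \<in> vecs {..<Suc 0}" unfolding d .
      have f0: "f i = 0" if "0 < i" for i using vecsD[OF f, of i] that by simp
      show "gop (uniserial 1) h f = gop (group_tm ?R) h f" for h
      proof
        fix i
        show "gop (uniserial 1) h f i = gop (group_tm ?R) h f i"
          using f0[of i] rop[OF f, of h] by (cases i) simp_all
      qed
      show "yop (uniserial 1) f = yop (group_tm ?R) f" by (simp add: fun_eq_iff)
    qed
  qed
qed simp_all

end

section \<open>Modules over H in terms of the actions of the group and of y\<close>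

section \<open>Modules over the rank one Hopf algebra\<close>

context group_datum
begin

definition rank_one_gmod :: "'i set \<Rightarrow> (nat \<times> 'a \<Rightarrow> ('i \<Rightarrow> 'k) \<Rightarrow> 'i \<Rightarrow> 'k) \<Rightarrow> ('a, 'i, 'k) gmod"
  where "rank_one_gmod I \<tau> = \<lparr>idx = I, gop = (\<lambda>h. \<tau> (0, h)), yop = \<tau> (1, \<one>)\<rparr>"

lemma rank_one_gmod_simps [simp]:
  "idx (rank_one_gmod I \<tau>) = I" "gop (rank_one_gmod I \<tau>) h = \<tau> (0, h)"
  "yop (rank_one_gmod I \<tau>) = \<tau> (1, \<one>)"
  by (simp_all add: rank_one_gmod_def)

lemma basis_H: "basis (H m) = {..<m} \<times> carrier G"
  by (simp add: rank_one_hopf_def rank_one_alg_def)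

lemma finite_basis_H: "finite (basis (H m))"
  using finite_carrier by (simp add: basis_H)

lemma unit_H: "alg_unit (H m) = indicator {(0, \<one>)}"
  by (simp add: rank_one_hopf_def rank_one_alg_def)

lemma table_H: "table (H m) (i, h) (j, k) =
    (\<lambda>b. if i + j < m then inverse (\<chi> h ^ j) * indicator {(i + j, h \<otimes> k)} b else 0)"
  by (simp add: rank_one_hopf_def rank_one_alg_def fun_eq_iff)

lemma table_H_sum:
  assumes "h \<in> carrier G" "k \<in> carrier G"
  shows "(\<Sum>e\<in>basis (H m). table (H m) (i, h) (j, k) e * F e) =
    (if i + j < m then inverse (\<chi> h ^ j) * F (i + j, h \<otimes> k) else (0 :: 'k))"
proof (cases "i + j < m")
  case True
  then have "(i + j, h \<otimes> k) \<in> basis (H m)" using assms by (simp add: basis_H)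
  from sum_indicator_mult[OF finite_basis_H this, of "\<lambda>e. inverse (\<chi> h ^ j) * F e"] show ?thesis
    using True by (simp add: table_H mult_ac)
qed (simp add: table_H)

text \<open>The basis vector y^i h must act as the i-th power of \<open>y\<close> after h. Given
  this, the multiplication table amounts to the group laws, the relation between y and h, and y^m =
  0: products of small basis vectors give these relations, and moving y^j past h with a factor
  \<chi>(h)^j recovers the table.\<close>

lemma opmodule_H_iff:
  fixes I :: "'i set"
  assumes m: "2 \<le> m"
  shows "opmodule (H m) I \<tau> \<longleftrightarrow> opfamily (H m) I \<tau> \<and> gmodule m (rank_one_gmod I \<tau>) \<and>
    (\<forall>i<m. \<forall>h\<in>carrier G. \<forall>f\<in>vecs I. \<tau> (i, h) f = (\<tau> (1, \<one>) ^^ i) (\<tau> (0, h) f))"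
proof (cases "opfamily (H m) I \<tau>")
  case True
  have closed: "\<tau> (i, h) f \<in> vecs I" if "i < m" "h \<in> carrier G" "f \<in> vecs I" for i h f
    using opfamilyD(3)[OF True _ that(3)] that by (simp add: basis_H)
  have lin: "lin (\<tau> (i, h))" if "i < m" "h \<in> carrier G" for i h
    using opfamilyD(2)[OF True] that by (simp add: basis_H)
  have unit_sum: "(\<Sum>b\<in>basis (H m). alg_unit (H m) b * F b) = F (0, \<one>)" for F :: "_ \<Rightarrow> 'k"
    unfolding unit_H using m by (intro sum_indicator_mult[OF finite_basis_H]) (simp add: basis_H)
  show ?thesis
  proof
    assume om: "opmodule (H m) I \<tau>"
    have one: "\<tau> (0, \<one>) f = f" if "f \<in> vecs I" for f
      using opmoduleD(2)[OF om that] unfolding unit_sum by simp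
    have mult: "\<tau> (i, h) (\<tau> (j, k) f) =
        (\<lambda>x. if i + j < m then inverse (\<chi> h ^ j) * \<tau> (i + j, h \<otimes> k) f x else 0)"
      if "i < m" "j < m" "h \<in> carrier G" "k \<in> carrier G" "f \<in> vecs I" for i j h k f
    proof -
      have "(i, h) \<in> basis (H m)" "(j, k) \<in> basis (H m)" using that by (simp_all add: basis_H)
      from opmoduleD(3)[OF om that(5) this] show ?thesis
        unfolding table_H_sum[OF that(3,4)] by simp
    qed
    have pow: "(\<tau> (1, \<one>) ^^ i) f = \<tau> (i, \<one>) f" if "i < m" "f \<in> vecs I" for i f
      using that(1)
    proof (induction i)
      case 0
      then show ?case using one[OF that(2)] by simp
    next
      case (Suc i)
      then show ?case
        using mult[of 1 i \<one> \<one> f] m that(2) by (simp add: character_one)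
    qed
    have nil: "(\<tau> (1, \<one>) ^^ m) f = (\<lambda>_. 0)" if "f \<in> vecs I" for f
    proof -
      obtain l where l: "m = Suc l" using m by (cases m) auto
      show ?thesis
        using pow[of l f] mult[of 1 l \<one> \<one> f] m that by (simp add: l)
    qed
    have "gmodule m (rank_one_gmod I \<tau>)"
    proof (rule gmoduleI)
      show "finite (idx (rank_one_gmod I \<tau>))" using opfamilyD(1)[OF True] by simp
      show "lin (gop (rank_one_gmod I \<tau>) h)" if "h \<in> carrier G" for h
        using lin[OF _ that, of 0] m by simp
      show "lin (yop (rank_one_gmod I \<tau>))"
        using lin[of 1 \<one>] m by simp
      fix f assume "f \<in> gvecs (rank_one_gmod I \<tau>)"
      then have f: "f \<in> vecs I" by simp
      show "gop (rank_one_gmod I \<tau>) h f \<in> gvecs (rank_one_gmod I \<tau>)" if "h \<in> carrier G" for h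
        using closed[OF _ that f, of 0] m by simp
      show "yop (rank_one_gmod I \<tau>) f \<in> gvecs (rank_one_gmod I \<tau>)"
        using closed[OF _ one_closed f, of 1] m by simp
      show "gop (rank_one_gmod I \<tau>) \<one> f = f" using one[OF f] by simp
      show "gop (rank_one_gmod I \<tau>) (h \<otimes> k) f =
          gop (rank_one_gmod I \<tau>) h (gop (rank_one_gmod I \<tau>) k f)"
        if "h \<in> carrier G" "k \<in> carrier G" for h k
        using mult[of 0 0 h k f] m that f by simp
      show "yop (rank_one_gmod I \<tau>) (gop (rank_one_gmod I \<tau>) h f) =
          (\<lambda>i. \<chi> h * gop (rank_one_gmod I \<tau>) h (yop (rank_one_gmod I \<tau>) f) i)"
        if "h \<in> carrier G" for h
        using mult[of 1 0 \<one> h f] mult[of 0 1 h \<one> f] m that f character_nonzero[OF that]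
        by (simp add: mult.assoc[symmetric])
      show "(yop (rank_one_gmod I \<tau>) ^^ m) f = (\<lambda>_. 0)" using nil[OF f] by simp
    qed
    moreover have "\<tau> (i, h) f = (\<tau> (1, \<one>) ^^ i) (\<tau> (0, h) f)"
      if "i < m" "h \<in> carrier G" "f \<in> vecs I" for i h f
    proof -
      have "\<tau> (0, h) f \<in> vecs I" using closed[of 0 h f] m that by simp
      from pow[OF that(1) this] show ?thesis
        using mult[of i 0 \<one> h f] m that by (simp add: character_one)
    qed
    ultimately show "opfamily (H m) I \<tau> \<and> gmodule m (rank_one_gmod I \<tau>) \<and>
        (\<forall>i<m. \<forall>h\<in>carrier G. \<forall>f\<in>vecs I. \<tau> (i, h) f = (\<tau> (1, \<one>) ^^ i) (\<tau> (0, h) f))"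
      using True by blast
  next
    assume *: "opfamily (H m) I \<tau> \<and> gmodule m (rank_one_gmod I \<tau>) \<and>
        (\<forall>i<m. \<forall>h\<in>carrier G. \<forall>f\<in>vecs I. \<tau> (i, h) f = (\<tau> (1, \<one>) ^^ i) (\<tau> (0, h) f))"
    let ?M = "rank_one_gmod I \<tau>"
    let ?Y = "\<tau> (1, \<one>)"
    have M: "gmodule m ?M" using * by blast
    have Mf: "f \<in> gvecs ?M" if "f \<in> vecs I" for f using that by simp
    have \<tau>: "\<tau> (i, h) f = (?Y ^^ i) (\<tau> (0, h) f)" if "i < m" "h \<in> carrier G" "f \<in> vecs I" for i h f
      using * that by blast
    have lY: "lin (?Y ^^ i)" for i by (rule lin_pow) (use gm_ylin[OF M] in simp)
    show "opmodule (H m) I \<tau>"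
      unfolding opmodule_def
    proof (intro conjI ballI True)
      fix f :: "'i \<Rightarrow> 'k" assume f: "f \<in> vecs I"
      show "(\<lambda>i. \<Sum>b\<in>basis (H m). alg_unit (H m) b * \<tau> b f i) = f"
        unfolding unit_sum using gm_one[OF M Mf[OF f]] by simp
      fix b c assume "b \<in> basis (H m)" "c \<in> basis (H m)"
      then obtain i h j k where bc: "b = (i, h)" "c = (j, k)"
        and i: "i < m" "h \<in> carrier G" and j: "j < m" "k \<in> carrier G"
        by (auto simp: basis_H)
      have kf: "\<tau> (0, k) f \<in> vecs I" using closed[of 0 k f] m j f by simp
      have Ykf: "(?Y ^^ j) (\<tau> (0, k) f) \<in> vecs I"
        using gm_ypow_closed[OF M Mf[OF kf], of j] by simp
      have "(?Y ^^ j) (\<tau> (0, h) (\<tau> (0, k) f)) = (\<lambda>x. \<chi> h ^ j * \<tau> (0, h) ((?Y ^^ j) (\<tau> (0, k) f)) x)"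
        using gm_rel_pow[OF M i(2) Mf[OF kf], of j] by simp
      then have "\<tau> (0, h) ((?Y ^^ j) (\<tau> (0, k) f)) =
          (\<lambda>x. inverse (\<chi> h ^ j) * (?Y ^^ j) (\<tau> (0, h) (\<tau> (0, k) f)) x)"
        using character_nonzero[OF i(2)] by (simp add: mult.assoc[symmetric])
      moreover have "\<tau> b (\<tau> c f) = (?Y ^^ i) (\<tau> (0, h) ((?Y ^^ j) (\<tau> (0, k) f)))"
        unfolding bc \<tau>[OF j f] by (rule \<tau>[OF i Ykf])
      moreover have "\<tau> (0, h) (\<tau> (0, k) f) = \<tau> (0, h \<otimes> k) f"
        using gm_mult[OF M i(2) j(2) Mf[OF f]] by simp
      ultimately have "\<tau> b (\<tau> c f) = (\<lambda>x. inverse (\<chi> h ^ j) * (?Y ^^ (i + j)) (\<tau> (0, h \<otimes> k) f) x)"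
        by (simp add: lin_scale[OF lY[unfolded One_nat_def]] funpow_add)
      moreover have "(?Y ^^ (i + j)) (\<tau> (0, h \<otimes> k) f) =
          (if i + j < m then \<tau> (i + j, h \<otimes> k) f else (\<lambda>_. 0))"
      proof (cases "i + j < m")
        case True
        then show ?thesis using \<tau>[of "i + j" "h \<otimes> k" f] i j f by simp
      next
        case False
        have "\<tau> (0, h \<otimes> k) f \<in> vecs I" using closed[of 0 "h \<otimes> k" f] m i j f by simp
        then show ?thesis
          using gm_nil[OF gmodule_mono[OF M, of "i + j"] Mf] False by simp
      qed
      ultimately show "(\<lambda>x. \<Sum>e\<in>basis (H m). table (H m) b c e * \<tau> e f x) = \<tau> b (\<tau> c f)"
        unfolding bc table_H_sum[OF i(2) j(2)] by (auto simp: fun_eq_iff)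
    qed
  qed
qed (simp add: opmodule_def)

text \<open>A linear map that commutes with \<open>y\<close> and the group commutes with every basis
  vector y^i h.\<close>

lemma presents_H_iff:
  assumes m: "2 \<le> m" and \<tau>: "opmodule (H m) I \<tau>" and \<sigma>: "opmodule (H m) J \<sigma>"
  shows "presents (H m) I \<tau> J \<sigma> \<longleftrightarrow> giso (rank_one_gmod I \<tau>) (rank_one_gmod J \<sigma>)"
proof
  have M: "gmodule m (rank_one_gmod I \<tau>)" using \<tau> opmodule_H_iff[OF m] by blast
  {
    assume "presents (H m) I \<tau> J \<sigma>"
    then obtain P Q where P: "lin P" "lin Q" "P ` vecs I \<subseteq> vecs J" "Q ` vecs J \<subseteq> vecs I"
        "\<forall>f\<in>vecs I. Q (P f) = f \<and> (\<forall>b\<in>basis (H m). P (\<tau> b f) = \<sigma> b (P f))" "\<forall>f\<in>vecs J. P (Q f) = f"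
      unfolding presents_def by blast
    have "(0, h) \<in> basis (H m)" if "h \<in> carrier G" for h using that m by (simp add: basis_H)
    moreover have "(1, \<one>) \<in> basis (H m)" using m by (simp add: basis_H)
    ultimately have "ghom (rank_one_gmod I \<tau>) (rank_one_gmod J \<sigma>) P"
      using P by (auto simp: ghom_def)
    then show "giso (rank_one_gmod I \<tau>) (rank_one_gmod J \<sigma>)"
      by (rule gisoI[OF M _ P(2)]) (use P in auto)
  }
  assume "giso (rank_one_gmod I \<tau>) (rank_one_gmod J \<sigma>)"
  then obtain P Q where P: "ghom (rank_one_gmod I \<tau>) (rank_one_gmod J \<sigma>) P"
      and Q: "ghom (rank_one_gmod J \<sigma>) (rank_one_gmod I \<tau>) Q"
      and inv: "\<forall>f\<in>vecs I. Q (P f) = f" "\<forall>f\<in>vecs J. P (Q f) = f"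
    unfolding giso_def by auto
  have eq: "P (\<tau> b f) = \<sigma> b (P f)" if f: "f \<in> vecs I" and b: "b \<in> basis (H m)" for b f
  proof -
    obtain i h where b: "b = (i, h)" "i < m" "h \<in> carrier G" using b by (auto simp: basis_H)
    have f': "f \<in> gvecs (rank_one_gmod I \<tau>)" using f by simp
    have Pf: "P f \<in> vecs J" using ghom_closed[OF P f'] by simp
    have "\<tau> b f = (\<tau> (1, \<one>) ^^ i) (\<tau> (0, h) f)"
      using \<tau> opmodule_H_iff[OF m] b f by blast
    moreover have "\<sigma> b (P f) = (\<sigma> (1, \<one>) ^^ i) (\<sigma> (0, h) (P f))"
      using \<sigma> opmodule_H_iff[OF m] b Pf by blast
    moreover have "P ((\<tau> (1, \<one>) ^^ i) (\<tau> (0, h) f)) = (\<sigma> (1, \<one>) ^^ i) (P (\<tau> (0, h) f))"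
      using ghom_ypow[OF M P gm_closed[OF M b(3) f'], of i] by simp
    ultimately show ?thesis
      using ghom_gop[OF P f' b(3)] by simp
  qed
  show "presents (H m) I \<tau> J \<sigma>"
    unfolding presents_def
    using ghom_lin[OF P] ghom_lin[OF Q] ghom_image[OF P] ghom_image[OF Q] inv eq
    by (intro exI[of _ P] exI[of _ Q]) simp
qed

abbreviation rank_one_tm :: "(nat \<times> 'a, 'k) rep \<Rightarrow> ('a, nat, 'k) gmod"
  where "rank_one_tm R \<equiv> rank_one_gmod {..<fst R} (rop R)"

text \<open>The comultiplication of y^i h is defined as \<Delta>(y)^i \<Delta>(h), and A \<otimes> A
  acts multiplicatively. So on tensors each basis vector acts as the product of the generators that
  compose it.\<close>

lemma opact_comult_H:
  assumes m: "2 \<le> m" and \<tau>: "opmodule (H m) I \<tau>" and \<sigma>: "opmodule (H m) J \<sigma>" and f: "f \<in> vecs (I \<times> J)"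
  defines "\<theta> \<equiv> \<lambda>b. opact (tensor_square (H m)) (tensor_op \<tau> \<sigma>) (comult (H m) b)"
  shows "h \<in> carrier G \<Longrightarrow> \<theta> (0, h) f = gop (gtensor (rank_one_gmod I \<tau>) (rank_one_gmod J \<sigma>)) h f"
    and "\<theta> (1, \<one>) f = yop (gtensor (rank_one_gmod I \<tau>) (rank_one_gmod J \<sigma>)) f"
    and "i < m \<Longrightarrow> h \<in> carrier G \<Longrightarrow> \<theta> (i, h) f = (\<theta> (1, \<one>) ^^ i) (\<theta> (0, h) f)"
proof -
  let ?T = "tensor_square (H m)" and ?E = "opact (tensor_square (H m)) (tensor_op \<tau> \<sigma>)"
  have finT: "finite (basis ?T)" using finite_basis_H by (simp add: tensor_square_def)
  have omT: "opmodule ?T (I \<times> J) (tensor_op \<tau> \<sigma>)" by (rule opmodule_tensor[OF \<tau> \<sigma>])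
  have TT: "tensor_square (rank_one_alg G \<chi> m) = ?T"
    by (simp add: tensor_square_def rank_one_hopf_def)
  have bT: "((i, h), (j, k)) \<in> basis ?T" if "i < m" "j < m" "h \<in> carrier G" "k \<in> carrier G" for i j h k
    using that by (simp add: tensor_square_def basis_H)
  have grp: "\<theta> (0, h) u = tensor_op \<tau> \<sigma> ((0, h), (0, h)) u" if "h \<in> carrier G" for h u
    unfolding \<theta>_def using m that comult_group[of m h] opact_indicator[OF finT bT[of 0 0 h h]] by simp
  show "\<theta> (0, h) f = gop (gtensor (rank_one_gmod I \<tau>) (rank_one_gmod J \<sigma>)) h f" if "h \<in> carrier G"
    using grp[OF that] by (simp add: tensor_op_def)
  have y: "\<theta> (1, \<one>) u = (\<lambda>p. tensor_op \<tau> \<sigma> ((1, \<one>), (0, g)) u p + tensor_op \<tau> \<sigma> ((0, \<one>), (1, \<one>)) u p)" for u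
  proof -
    have "\<theta> (1, \<one>) u = (\<lambda>p. ?E (indicator {((1, \<one>), (0, g))}) u p + ?E (indicator {((0, \<one>), (1, \<one>))}) u p)"
      unfolding \<theta>_def comult_generator[OF m] comult_y_def
      by (simp add: opact_def distrib_right sum.distrib)
    moreover have "((1, \<one>), (0, g)) \<in> basis ?T" "((0, \<one>), (1, \<one>)) \<in> basis ?T"
      using bT[of 1 0 \<one> g] bT[of 0 1 \<one> \<one>] m g_closed by simp_all
    ultimately show ?thesis
      by (simp only: opact_indicator[OF finT])
  qed
  have one: "\<tau> (0, \<one>) u = u" if "u \<in> vecs I" for u
    using gm_one[of m "rank_one_gmod I \<tau>" u] \<tau> opmodule_H_iff[OF m] that by auto
  have "right_op (\<sigma> (1, \<one>)) f \<in> vecs (I \<times> J)"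
    using opfamilyD(2,4)[OF opmoduleD(1)[OF \<sigma>], of "(1, \<one>)"] m f
    by (intro right_op_vecs) (auto simp: basis_H)
  from left_op_cong[where A = "\<tau> (0, \<one>)" and B = "\<lambda>u. u", OF one this]
  have "tensor_op \<tau> \<sigma> ((0, \<one>), (1, \<one>)) f = right_op (\<sigma> (1, \<one>)) f"
    by (simp add: tensor_op_def left_op_def)
  then show "\<theta> (1, \<one>) f = yop (gtensor (rank_one_gmod I \<tau>) (rank_one_gmod J \<sigma>)) f"
    unfolding y by (simp add: tensor_op_def)
  show "\<theta> (i, h) f = (\<theta> (1, \<one>) ^^ i) (\<theta> (0, h) f)" if i: "i < m" "h \<in> carrier G"
  proof -
    have c: "comult (H m) (i, h) = alg_times ?T (alg_pow ?T (comult_y G g) i) (indicator {((0, h), (0, h))})"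
      by (simp add: rank_one_hopf_def tensor_square_def)
    have hf: "?E (indicator {((0, h), (0, h))}) f \<in> vecs (I \<times> J)"
      by (rule opact_vecs[OF opmoduleD(1)[OF omT] f])
    have "\<theta> (i, h) f = ?E (alg_pow ?T (comult_y G g) i) (?E (indicator {((0, h), (0, h))}) f)"
      unfolding \<theta>_def c by (rule opact_times[OF finT omT f])
    also have "\<dots> = (?E (comult_y G g) ^^ i) (?E (indicator {((0, h), (0, h))}) f)"
      by (rule opact_pow[OF finT omT hf])
    also have "?E (indicator {((0, h), (0, h))}) f = \<theta> (0, h) f"
      using m i comult_group[of m h] by (simp add: \<theta>_def)
    also have "?E (comult_y G g) = \<theta> (1, \<one>)"
      by (simp only: \<theta>_def comult_generator[OF m])
    finally show ?thesis .
  qed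
qed

end

context group_datum_char_0
begin

text \<open>By \<open>opmodule_H_iff\<close> a module over \<open>H\<close> is an operator module of
  degree m. For tensor products the comultiplication yields the operators of \<open>gtensor\<close>,
  and \<open>gmodule_gtensor\<close> supplies y^m = 0, so the matrix tensor product is again a
  module.\<close>

lemma green_model_H:
  assumes ord: "has_mult_order (\<chi> g) m" and m: "2 \<le> m"
  shows "green_model G \<chi> g (H m) rank_one_tm m"
proof unfold_locales
  note fin = finite_basis_H
  note is_mod = is_module_iff[OF fin]
  show "1 \<le> m" "m = 1 \<or> has_mult_order (\<chi> g) m" using ord m by auto
  fix R :: "(nat \<times> 'a, 'k) rep" assume R: "is_module (H m) R"
  then have omR: "opmodule (H m) {..<fst R} (rop R)" using is_mod by blast
  then show gR: "gmodule m (rank_one_tm R)" using opmodule_H_iff[OF m] by blast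
  fix R' :: "(nat \<times> 'a, 'k) rep" assume R': "is_module (H m) R'"
  then have omR': "opmodule (H m) {..<fst R'} (rop R')" using is_mod by blast
  then have gR': "gmodule m (rank_one_tm R')" using opmodule_H_iff[OF m] by blast
  show "module_iso (H m) R R' \<longleftrightarrow> giso (rank_one_tm R) (rank_one_tm R')"
    unfolding module_iso_iff[OF fin R R'] by (rule presents_H_iff[OF m omR omR'])
  show "is_module (H m) (direct_sum R R') \<and>
      giso (rank_one_tm (direct_sum R R')) (gsum (rank_one_tm R) (rank_one_tm R'))"
  proof
    note omS = opmodule_sum[OF omR omR']
    show s: "is_module (H m) (direct_sum R R')"
      by (rule is_module_presents[OF fin presents_direct_sum[OF R R'] omS])
    have eq: "gsum (rank_one_tm R) (rank_one_tm R') = rank_one_gmod (Sum_Type.Plus {..<fst R} {..<fst R'})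
        (\<lambda>b. sum_op (rop R b) (rop R' b))"
      by (simp add: gsum_def rank_one_gmod_def)
    have "opmodule (H m) {..<fst (direct_sum R R')} (rop (direct_sum R R'))"
      using s is_mod by blast
    from iffD1[OF presents_H_iff[OF m this omS] presents_direct_sum(2)[OF R R']]
    show "giso (rank_one_tm (direct_sum R R')) (gsum (rank_one_tm R) (rank_one_tm R'))"
      unfolding eq .
  qed
  let ?\<theta> = "\<lambda>b. opact (tensor_square (H m)) (tensor_op (rop R) (rop R')) (comult (H m) b)"
  let ?I = "{..<fst R} \<times> {..<fst R'}"
  let ?T = "gtensor (rank_one_tm R) (rank_one_tm R')"
  have famT: "opfamily (tensor_square (H m)) ?I (tensor_op (rop R) (rop R'))"
    by (rule opfamily_tensor[OF opmoduleD(1)[OF omR] opmoduleD(1)[OF omR']])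
  have T: "gmodule m ?T"
    by (rule gmodule_gtensor[OF gR gR']) (use ord in simp)
  note \<theta> = opact_comult_H[OF m omR omR']
  have fam: "opfamily (H m) ?I ?\<theta>"
    using lin_opact[OF famT] opact_vecs[OF famT] by (auto simp: opfamily_def)
  have gvT: "gvecs ?T = vecs ?I" by simp
  \<comment> \<open>The two operators agree only on functions supported on \<open>?I\<close>, so
    their powers are compared step by step inside that space.\<close>
  have pow: "(?\<theta> (1, \<one>) ^^ i) f = (yop ?T ^^ i) f" if "f \<in> vecs ?I" for i f
  proof (induction i)
    case (Suc i)
    have "(yop ?T ^^ i) f \<in> vecs ?I"
      using gm_ypow_closed[OF T, of f i] that unfolding gvT by blast
    from \<theta>(2)[OF this] Suc show ?case
      by (simp only: funpow.simps comp_apply)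
  qed simp
  have T\<theta>: "gmodule m (rank_one_gmod ?I ?\<theta>)"
  proof (rule gmoduleI)
    show "lin (gop (rank_one_gmod ?I ?\<theta>) h)" for h using lin_opact[OF famT] by simp
    show "lin (yop (rank_one_gmod ?I ?\<theta>))" using lin_opact[OF famT] by simp
    fix f assume "f \<in> gvecs (rank_one_gmod ?I ?\<theta>)"
    then have f: "f \<in> vecs ?I" and fT: "f \<in> gvecs ?T" by simp_all
    show "gop (rank_one_gmod ?I ?\<theta>) h f \<in> gvecs (rank_one_gmod ?I ?\<theta>)"
      "yop (rank_one_gmod ?I ?\<theta>) f \<in> gvecs (rank_one_gmod ?I ?\<theta>)" for h
      using opact_vecs[OF famT f] by simp_all
    have gv: "gop ?T h f \<in> vecs ?I" if "h \<in> carrier G" for h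
      using gm_closed[OF T that fT] by simp
    have yv: "yop ?T f \<in> vecs ?I"
      using gm_yclosed[OF T fT] by simp
    show "gop (rank_one_gmod ?I ?\<theta>) \<one> f = f"
      using \<theta>(1)[OF f one_closed] gm_one[OF T fT] by simp
    show "gop (rank_one_gmod ?I ?\<theta>) (h \<otimes> k) f =
        gop (rank_one_gmod ?I ?\<theta>) h (gop (rank_one_gmod ?I ?\<theta>) k f)"
      if "h \<in> carrier G" "k \<in> carrier G" for h k
      unfolding rank_one_gmod_simps \<theta>(1)[OF f m_closed[OF that]] \<theta>(1)[OF f that(2)]
        \<theta>(1)[OF gv[OF that(2)] that(1)] by (rule gm_mult[OF T that fT])
    show "yop (rank_one_gmod ?I ?\<theta>) (gop (rank_one_gmod ?I ?\<theta>) h f) =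
        (\<lambda>i. \<chi> h * gop (rank_one_gmod ?I ?\<theta>) h (yop (rank_one_gmod ?I ?\<theta>) f) i)"
      if "h \<in> carrier G" for h
      unfolding rank_one_gmod_simps \<theta>(1)[OF f that] \<theta>(2)[OF f] \<theta>(2)[OF gv[OF that]]
        \<theta>(1)[OF yv that] by (rule gm_rel[OF T that fT])
    show "(yop (rank_one_gmod ?I ?\<theta>) ^^ m) f = (\<lambda>_. 0)"
      unfolding rank_one_gmod_simps pow[OF f] by (rule gm_nil[OF T fT])
  qed simp
  have om\<theta>: "opmodule (H m) ?I ?\<theta>"
    unfolding opmodule_H_iff[OF m]
  proof (intro conjI fam T\<theta> allI impI ballI)
    show "?\<theta> (i, h) f = (?\<theta> (1, \<one>) ^^ i) (?\<theta> (0, h) f)"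
      if "i < m" "h \<in> carrier G" "f \<in> vecs ?I" for i h f
      by (rule \<theta>(3)[OF that(3,1,2)])
  qed
  show "is_module (H m) (tensor (H m) R R') \<and>
      giso (rank_one_tm (tensor (H m) R R')) (gtensor (rank_one_tm R) (rank_one_tm R'))"
  proof
    show s: "is_module (H m) (tensor (H m) R R')"
      by (rule is_module_presents[OF fin presents_tensor[OF R R'] om\<theta>])
    have "opmodule (H m) {..<fst (tensor (H m) R R')} (rop (tensor (H m) R R'))"
      using s is_mod by blast
    from iffD1[OF presents_H_iff[OF m this om\<theta>] presents_tensor(2)[OF R R']]
    have "giso (rank_one_tm (tensor (H m) R R')) (rank_one_gmod ?I ?\<theta>)" .
    moreover have "giso (rank_one_gmod ?I ?\<theta>) ?T"
    proof (rule giso_ident[OF T\<theta>])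
      show "gop ?T h f = gop (rank_one_gmod ?I ?\<theta>) h f"
        if "h \<in> carrier G" "f \<in> gvecs (rank_one_gmod ?I ?\<theta>)" for h f
        using \<theta>(1)[of f h] that by simp
      show "yop ?T f = yop (rank_one_gmod ?I ?\<theta>) f" if "f \<in> gvecs (rank_one_gmod ?I ?\<theta>)" for f
        using \<theta>(2)[of f] that by simp
    qed simp
    ultimately show "giso (rank_one_tm (tensor (H m) R R')) ?T"
      by (rule giso_trans)
  qed
next
  fix M :: "('a, nat, 'k) gmod" assume M: "gmodule m M"
  obtain W :: "('a, nat, 'k) gmod" and r where W: "gmodule m W" "giso M W" "idx W = {..<r}"
    by (rule gmod_initial[OF M])
  \<comment> \<open>The action forced on the basis vector y^i h.\<close>
  define \<tau> where "\<tau> = (\<lambda>(i, h) f. (yop W ^^ i) (gop W h f))"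
  have \<tau>_lin: "lin (\<tau> (i, h))" if "h \<in> carrier G" for i h
    unfolding \<tau>_def prod.case by (rule lin_comp[OF lin_pow[OF gm_ylin[OF W(1)]] gm_lin[OF W(1) that]])
  have \<tau>_vecs: "\<tau> (i, h) f \<in> vecs {..<r}" if "h \<in> carrier G" "f \<in> vecs {..<r}" for i h f
    using gm_ypow_closed[OF W(1) gm_closed[OF W(1) that(1)], of f i] that W(3) by (simp add: \<tau>_def)
  have fam: "opfamily (H m) {..<r} \<tau>"
    using \<tau>_lin \<tau>_vecs by (auto simp: opfamily_def basis_H)
  have y1: "\<tau> (1, \<one>) f = yop W f" if "f \<in> vecs {..<r}" for f
    using gm_one[OF W(1), of f] that W(3) by (simp add: \<tau>_def)
  have ypow: "(\<tau> (1, \<one>) ^^ i) f = (yop W ^^ i) f" if "f \<in> vecs {..<r}" for i f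
  proof (induction i)
    case (Suc i)
    have "(yop W ^^ i) f \<in> vecs {..<r}"
      using gm_ypow_closed[OF W(1), of f i] that W(3) by simp
    from y1[OF this] show ?case using Suc by simp
  qed simp
  have g: "gmodule m (rank_one_gmod {..<r} \<tau>)"
  proof (rule gmoduleI)
    show "lin (gop (rank_one_gmod {..<r} \<tau>) h)" if "h \<in> carrier G" for h using \<tau>_lin[OF that] by simp
    show "lin (yop (rank_one_gmod {..<r} \<tau>))" using \<tau>_lin by simp
    fix f assume "f \<in> gvecs (rank_one_gmod {..<r} \<tau>)"
    then have f: "f \<in> vecs {..<r}" and fW: "f \<in> gvecs W" using W(3) by simp_all
    have g0: "\<tau> (0, h) u = gop W h u" for h u by (simp add: \<tau>_def)
    have gv: "gop W h f \<in> vecs {..<r}" if "h \<in> carrier G" for h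
      using gm_closed[OF W(1) that fW] W(3) by simp
    show "gop (rank_one_gmod {..<r} \<tau>) h f \<in> gvecs (rank_one_gmod {..<r} \<tau>)" if "h \<in> carrier G" for h
      using \<tau>_vecs[OF that f] by simp
    show "yop (rank_one_gmod {..<r} \<tau>) f \<in> gvecs (rank_one_gmod {..<r} \<tau>)"
      using \<tau>_vecs[OF one_closed f] by simp
    show "gop (rank_one_gmod {..<r} \<tau>) \<one> f = f"
      using gm_one[OF W(1) fW] by (simp add: g0)
    show "gop (rank_one_gmod {..<r} \<tau>) (h \<otimes> k) f =
        gop (rank_one_gmod {..<r} \<tau>) h (gop (rank_one_gmod {..<r} \<tau>) k f)"
      if "h \<in> carrier G" "k \<in> carrier G" for h k
      using gm_mult[OF W(1) that fW] by (simp add: g0)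
    show "yop (rank_one_gmod {..<r} \<tau>) (gop (rank_one_gmod {..<r} \<tau>) h f) =
        (\<lambda>i. \<chi> h * gop (rank_one_gmod {..<r} \<tau>) h (yop (rank_one_gmod {..<r} \<tau>) f) i)"
      if "h \<in> carrier G" for h
      unfolding rank_one_gmod_simps g0 y1[OF f] y1[OF gv[OF that]] by (rule gm_rel[OF W(1) that fW])
    show "(yop (rank_one_gmod {..<r} \<tau>) ^^ m) f = (\<lambda>_. 0)"
      unfolding rank_one_gmod_simps ypow[OF f] by (rule gm_nil[OF W(1) fW])
  qed simp
  have om: "opmodule (H m) {..<r} \<tau>"
    unfolding opmodule_H_iff[OF m]
  proof (intro conjI fam g allI impI ballI)
    show "\<tau> (i, h) f = (\<tau> (1, \<one>) ^^ i) (\<tau> (0, h) f)"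
      if "i < m" "h \<in> carrier G" "f \<in> vecs {..<r}" for i h f
      unfolding ypow[OF \<tau>_vecs[OF that(2,3)]] by (simp add: \<tau>_def)
  qed
  define R where "R = (r, \<lambda>b. omat r r (\<tau> b))"
  have rop: "rop R b f = \<tau> b f" if "b \<in> basis (H m)" "f \<in> vecs {..<r}" for b f
    using mop_omat[OF opfamilyD(2,4)[OF fam that(1)] that(2)] by (simp add: R_def)
  have fR: "fst R = r" by (simp add: R_def)
  have R: "is_module (H m) R"
  proof (rule is_module_presents[OF finite_basis_H _ _ om])
    show "\<forall>b\<in>basis (H m). snd R b \<in> carrier_mat (fst R) (fst R)" by (simp add: R_def omat_carrier)
    show "presents (H m) {..<fst R} (rop R) {..<r} \<tau>"
      unfolding fR using rop by (rule presents_refl)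
  qed
  have "giso W (rank_one_tm R)"
  proof (rule giso_ident[OF W(1)])
    show "idx (rank_one_tm R) = idx W" by (simp add: fR W(3))
    fix f assume "f \<in> gvecs W"
    then have f: "f \<in> vecs {..<r}" using W(3) by simp
    show "gop (rank_one_tm R) h f = gop W h f" if "h \<in> carrier G" for h
      using rop[OF _ f, of "(0, h)"] that m by (simp add: basis_H \<tau>_def)
    show "yop (rank_one_tm R) f = yop W f"
      using rop[OF _ f, of "(1, \<one>)"] y1[OF f] m by (simp add: basis_H)
  qed
  then show "\<exists>R. is_module (H m) R \<and> giso (rank_one_tm R) M"
    using R giso_sym[OF giso_trans[OF W(2), of "rank_one_tm R"]] by blast
next
  let ?R = "trivial_module (H m)"
  define \<tau> where "\<tau> = (\<lambda>(i, h :: 'a) (f :: nat \<Rightarrow> 'k) x. if i = (0 :: nat) then f x else 0)"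
  have d: "fst ?R = Suc 0" by (simp add: trivial_module_def)
  have rop: "rop ?R b f = \<tau> b f" if "f \<in> vecs {..<Suc 0}" for b f
  proof -
    have "counit (H m) (i, h) = (if i = 0 then 1 else 0)" for i h by (simp add: rank_one_hopf_def)
    then show ?thesis
      using vecsD[OF that] by (cases b) (auto simp: trivial_module_def mop_def fun_eq_iff \<tau>_def)
  qed
  have \<tau>_lin: "lin (\<tau> b)" for b by (rule linI) (auto simp: \<tau>_def split: prod.split)
  have fam: "opfamily (H m) {..<Suc 0} \<tau>"
    using \<tau>_lin by (auto simp: opfamily_def \<tau>_def vecs_def)
  have ypow: "(\<tau> (1, \<one>) ^^ i) f = (if i = 0 then f else (\<lambda>_. 0))" for i f
    by (induction i) (auto simp: \<tau>_def)
  have g: "gmodule m (rank_one_gmod {..<Suc 0} \<tau>)"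
  proof (rule gmoduleI)
    show "lin (gop (rank_one_gmod {..<Suc 0} \<tau>) h)" "lin (yop (rank_one_gmod {..<Suc 0} \<tau>))" for h
      using \<tau>_lin by simp_all
    show "(yop (rank_one_gmod {..<Suc 0} \<tau>) ^^ m) f = (\<lambda>_. 0)" for f
      unfolding rank_one_gmod_simps ypow using m by simp
  qed (auto simp: \<tau>_def vecs_def)
  have om: "opmodule (H m) {..<Suc 0} \<tau>"
    unfolding opmodule_H_iff[OF m]
  proof (intro conjI fam g allI impI ballI)
    show "\<tau> (i, h) f = (\<tau> (1, \<one>) ^^ i) (\<tau> (0, h) f)" for i h f
      unfolding ypow by (auto simp: \<tau>_def)
  qed
  have pr: "presents (H m) {..<fst ?R} (rop ?R) {..<Suc 0} \<tau>"
    unfolding d using rop by (rule presents_refl)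
  have c: "\<forall>b\<in>basis (H m). snd ?R b \<in> carrier_mat (fst ?R) (fst ?R)"
    by (simp add: trivial_module_def)
  show "is_module (H m) ?R \<and> giso (rank_one_tm ?R) (uniserial 1)"
  proof
    show s: "is_module (H m) ?R"
      by (rule is_module_presents[OF finite_basis_H c pr om])
    have "opmodule (H m) {..<fst ?R} (rop ?R)" using s is_module_iff[OF finite_basis_H] by blast
    from iffD1[OF presents_H_iff[OF m this om] pr]
    have "giso (rank_one_tm ?R) (rank_one_gmod {..<Suc 0} \<tau>)" .
    moreover have "giso (rank_one_gmod {..<Suc 0} \<tau>) (uniserial 1)"
    proof (rule giso_ident[OF g])
      fix f assume "f \<in> gvecs (rank_one_gmod {..<Suc 0} \<tau>)"
      then have f: "f i = 0" if "0 < i" for i using vecsD[of f "{..<Suc 0}" i] that by simp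
      show "gop (uniserial 1) h f = gop (rank_one_gmod {..<Suc 0} \<tau>) h f" for h
      proof
        fix i
        show "gop (uniserial 1) h f i = gop (rank_one_gmod {..<Suc 0} \<tau>) h f i"
          using f[of i] by (cases i) (simp_all add: \<tau>_def)
      qed
      show "yop (uniserial 1) f = yop (rank_one_gmod {..<Suc 0} \<tau>) f"
        by (simp add: fun_eq_iff \<tau>_def)
    qed simp
    ultimately show "giso (rank_one_tm ?R) (uniserial 1)" by (rule giso_trans)
  qed
qed

end

section \<open>Dickson polynomials as a basis modulo the defining relation\<close>

section \<open>Presentation by a Dickson polynomial\<close>

lemma (in cring) dickson_closed:
  assumes "y \<in> carrier R" "z \<in> carrier R"
  shows "dickson R y z j \<in> carrier R"
proof -
  have "dickson R y z j \<in> carrier R \<and> dickson R y z (Suc j) \<in> carrier R"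
  proof (induction j)
    case (Suc j)
    then show ?case using assms by (cases j) simp_all
  qed simp
  then show ?thesis ..
qed

text \<open>The value 0 at index 0 makes the recursion valid one step earlier, as z F_1 - y F_0 = z
  = F_2.\<close>

lemma (in cring) dickson_Suc_Suc:
  assumes "y \<in> carrier R" "z \<in> carrier R"
  shows "dickson R y z (Suc (Suc j)) = z \<otimes> dickson R y z (Suc j) \<ominus> y \<otimes> dickson R y z j"
  using assms by (cases j) (simp_all add: minus_eq)

lemma (in cring) dickson_times:
  assumes "y \<in> carrier R" "z \<in> carrier R"
  shows "z \<otimes> dickson R y z (Suc j) = dickson R y z (Suc (Suc j)) \<oplus> y \<otimes> dickson R y z j"
proof -
  have "u = (u \<ominus> v) \<oplus> v" if "u \<in> carrier R" "v \<in> carrier R" for u v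
    using that by algebra
  from this[of "z \<otimes> dickson R y z (Suc j)" "y \<otimes> dickson R y z j"] show ?thesis
    unfolding dickson_Suc_Suc[OF assms] using assms dickson_closed[OF assms] m_closed by metis
qed

lemma (in ring_hom_cring) hom_dickson:
  assumes "y \<in> carrier R" "z \<in> carrier R"
  shows "h (dickson R y z j) = dickson S (h y) (h z) j"
proof -
  have "h (dickson R y z j) = dickson S (h y) (h z) j \<and>
      h (dickson R y z (Suc j)) = dickson S (h y) (h z) (Suc j)"
  proof (induction j)
    case (Suc j)
    have "h (dickson R y z (Suc (Suc j))) =
        h z \<otimes>\<^bsub>S\<^esub> h (dickson R y z (Suc j)) \<ominus>\<^bsub>S\<^esub> h y \<otimes>\<^bsub>S\<^esub> h (dickson R y z j)"
      unfolding R.dickson_Suc_Suc[OF assms] R.minus_eq S.minus_eq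
      using assms R.dickson_closed[OF assms, of j] R.dickson_closed[OF assms, of "Suc j"]
      by (simp del: dickson.simps)
    also have "\<dots> = dickson S (h y) (h z) (Suc (Suc j))"
      unfolding S.dickson_Suc_Suc[OF hom_closed[OF assms(1)] hom_closed[OF assms(2)]]
      using Suc by metis
    finally show ?case using Suc by blast
  qed simp
  then show ?thesis ..
qed

text \<open>Evaluation at \<open>z\<close> is onto by \<open>span\<close> and kills the generator by
  \<open>top\<close>. Conversely, modulo the ideal every polynomial is an R-combination of F_1, ...,
  F_n: such combinations are stable under multiplication by the variable, by the recursion below
  index n and by t F_n = (1 + a) F_n at the top. A polynomial in the kernel thus reduces to a
  combination with vanishing value, whose coefficients are zero by \<open>indep\<close>.\<close>

lemma (in UP_cring) presentation_by_dickson: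
  fixes S (structure)
  assumes S: "cring S" and \<iota>: "\<iota> \<in> Ring.ring_hom R S" and a: "a \<in> carrier R" and z: "z \<in> carrier S"
    and n: "1 \<le> n"
    and top: "(\<one>\<^bsub>S\<^esub> \<oplus>\<^bsub>S\<^esub> \<iota> a \<ominus>\<^bsub>S\<^esub> z) \<otimes>\<^bsub>S\<^esub> dickson S (\<iota> a) z n = \<zero>\<^bsub>S\<^esub>"
    and span: "\<And>x. x \<in> carrier S \<Longrightarrow> \<exists>c\<in>{1..n} \<rightarrow> carrier R.
      x = (\<Oplus>\<^bsub>S\<^esub>j\<in>{1..n}. \<iota> (c j) \<otimes>\<^bsub>S\<^esub> dickson S (\<iota> a) z j)"
    and indep: "\<And>c j. c \<in> {1..n} \<rightarrow> carrier R \<Longrightarrow>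
      (\<Oplus>\<^bsub>S\<^esub>j\<in>{1..n}. \<iota> (c j) \<otimes>\<^bsub>S\<^esub> dickson S (\<iota> a) z j) = \<zero>\<^bsub>S\<^esub> \<Longrightarrow> j \<in> {1..n} \<Longrightarrow> c j = \<zero>\<^bsub>R\<^esub>"
  defines "ca \<equiv> up_ring.monom P a 0" and "t \<equiv> up_ring.monom P \<one>\<^bsub>R\<^esub> 1"
  shows "S \<simeq> P Quot (Idl\<^bsub>P\<^esub> {(\<one>\<^bsub>P\<^esub> \<oplus>\<^bsub>P\<^esub> ca \<ominus>\<^bsub>P\<^esub> t) \<otimes>\<^bsub>P\<^esub> dickson P ca t n})"
proof -
  interpret S: cring S by (rule S)
  interpret \<iota>: ring_hom_cring R S \<iota>
    by (intro ring_hom_cring.intro ring_hom_cring_axioms.intro R_cring S \<iota>)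
  interpret ev: UP_pre_univ_prop R S \<iota> P
    by unfold_locales (simp add: P_def)
  let ?\<Theta> = "UnivPoly.eval R S \<iota> z"
  interpret \<Theta>: ring_hom_cring P S ?\<Theta>
    by (intro ring_hom_cring.intro ring_hom_cring_axioms.intro is_UP_cring S ev.eval_ring_hom z)
      (rule UP_cring)
  have \<Theta>r: "ring_hom_ring P S ?\<Theta>"
    by (rule ring_hom_ringI2) (rule P.ring_axioms S.ring_axioms \<Theta>.homh)+
  let ?D = "dickson P ca t" and ?E = "dickson S (\<iota> a) z"
  let ?w = "(\<one>\<^bsub>P\<^esub> \<oplus>\<^bsub>P\<^esub> ca \<ominus>\<^bsub>P\<^esub> t) \<otimes>\<^bsub>P\<^esub> ?D n"
  let ?I = "Idl\<^bsub>P\<^esub> {?w}"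
  have ca: "ca \<in> carrier P" and t: "t \<in> carrier P"
    using a by (simp_all add: ca_def t_def)
  have D: "?D j \<in> carrier P" for j by (rule P.dickson_closed[OF ca t])
  have E: "?E j \<in> carrier S" for j using a z by (simp add: S.dickson_closed)
  have \<Theta>c: "?\<Theta> (up_ring.monom P c 0) = \<iota> c" if "c \<in> carrier R" for c
    using ev.eval_const[OF z that] .
  have \<Theta>D: "?\<Theta> (?D j) = ?E j" for j
    unfolding \<Theta>.hom_dickson[OF ca t]
    using ev.eval_monom1[OF z] \<Theta>c[OF a] by (simp add: ca_def t_def)
  have w: "?w \<in> carrier P" using ca t D by simp
  interpret I: ideal ?I P by (rule P.genideal_ideal) (use w in simp)
  have wI: "?w \<in> ?I" using P.genideal_self'[OF w] .
  have \<Theta>w: "?\<Theta> ?w = \<zero>\<^bsub>S\<^esub>"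
    using top ca t D \<Theta>D ev.eval_monom1[OF z] \<Theta>c[OF a]
    by (simp add: P.minus_eq S.minus_eq ca_def t_def)
  define comb where "comb c = (\<Oplus>\<^bsub>P\<^esub>j\<in>{1..n}. up_ring.monom P (c j) 0 \<otimes>\<^bsub>P\<^esub> ?D j)" for c
  have comb_closed: "comb c \<in> carrier P" if "c \<in> {1..n} \<rightarrow> carrier R" for c
    unfolding comb_def using that D by (intro P.finsum_closed) (auto simp: Pi_iff)
  have \<Theta>comb: "?\<Theta> (comb c) = (\<Oplus>\<^bsub>S\<^esub>j\<in>{1..n}. \<iota> (c j) \<otimes>\<^bsub>S\<^esub> ?E j)" if "c \<in> {1..n} \<rightarrow> carrier R" for c
  proof -
    have "?\<Theta> (comb c) = (\<Oplus>\<^bsub>S\<^esub>j\<in>{1..n}. (?\<Theta> \<circ> (\<lambda>j. up_ring.monom P (c j) 0 \<otimes>\<^bsub>P\<^esub> ?D j)) j)"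
      unfolding comb_def using that D by (subst \<Theta>.hom_finsum) (auto simp: Pi_iff comp_def)
    also have "\<dots> = (\<Oplus>\<^bsub>S\<^esub>j\<in>{1..n}. \<iota> (c j) \<otimes>\<^bsub>S\<^esub> ?E j)"
      using that D \<Theta>c \<Theta>D E by (intro S.finsum_cong') (auto simp: Pi_iff)
    finally show ?thesis .
  qed
  \<comment> \<open>The polynomials that reduce, modulo the ideal, to a combination of F_1, ...,
    F_n; the aim is that these are all.\<close>
  define T where "T = {comb c \<oplus>\<^bsub>P\<^esub> i |c i. c \<in> {1..n} \<rightarrow> carrier R \<and> i \<in> ?I}"
  have T_add: "p \<oplus>\<^bsub>P\<^esub> p' \<in> T" if pp: "p \<in> T" "p' \<in> T" for p p'
  proof -
    obtain c i c' i' where c: "c \<in> {1..n} \<rightarrow> carrier R" "i \<in> ?I" "p = comb c \<oplus>\<^bsub>P\<^esub> i"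
      and c': "c' \<in> {1..n} \<rightarrow> carrier R" "i' \<in> ?I" "p' = comb c' \<oplus>\<^bsub>P\<^esub> i'"
      using pp unfolding T_def by blast
    let ?c = "\<lambda>j. c j \<oplus>\<^bsub>R\<^esub> c' j"
    have "comb ?c = (\<Oplus>\<^bsub>P\<^esub>j\<in>{1..n}. up_ring.monom P (c j) 0 \<otimes>\<^bsub>P\<^esub> ?D j \<oplus>\<^bsub>P\<^esub> up_ring.monom P (c' j) 0 \<otimes>\<^bsub>P\<^esub> ?D j)"
      unfolding comb_def using c(1) c'(1) D
      by (intro P.finsum_cong') (auto simp: Pi_iff P.l_distr)
    also have "\<dots> = comb c \<oplus>\<^bsub>P\<^esub> comb c'"
      unfolding comb_def using c(1) c'(1) D by (intro P.finsum_addf) (auto simp: Pi_iff)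
    finally have "p \<oplus>\<^bsub>P\<^esub> p' = comb ?c \<oplus>\<^bsub>P\<^esub> (i \<oplus>\<^bsub>P\<^esub> i')"
      using comb_closed[OF c(1)] comb_closed[OF c'(1)] I.Icarr[OF c(2)] I.Icarr[OF c'(2)]
      by (simp add: c(3) c'(3) P.a_ac)
    moreover have "?c \<in> {1..n} \<rightarrow> carrier R" using c(1) c'(1) by (auto simp: Pi_iff)
    ultimately show ?thesis
      unfolding T_def using I.a_closed[OF c(2) c'(2)] by blast
  qed
  have comb_zero: "comb (\<lambda>_. \<zero>\<^bsub>R\<^esub>) = \<zero>\<^bsub>P\<^esub>"
    unfolding comb_def using D by (intro P.add.finprod_one_eqI) simp
  have T_ideal: "i \<in> T" if "i \<in> ?I" for i
  proof -
    have "i = comb (\<lambda>_. \<zero>\<^bsub>R\<^esub>) \<oplus>\<^bsub>P\<^esub> i" using comb_zero I.Icarr[OF that] by simp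
    then show ?thesis unfolding T_def using that by blast
  qed
  have T_basis: "up_ring.monom P b 0 \<otimes>\<^bsub>P\<^esub> ?D j \<in> T" if b: "b \<in> carrier R" and j: "j \<in> {1..n}" for b j
  proof -
    let ?c = "\<lambda>k. if k = j then b else \<zero>\<^bsub>R\<^esub>"
    have "comb ?c = (\<Oplus>\<^bsub>P\<^esub>k\<in>{1..n}. if j = k then up_ring.monom P b 0 \<otimes>\<^bsub>P\<^esub> ?D k else \<zero>\<^bsub>P\<^esub>)"
      unfolding comb_def using b D by (intro P.finsum_cong') (auto simp: Pi_iff)
    also have "\<dots> = up_ring.monom P b 0 \<otimes>\<^bsub>P\<^esub> ?D j"
      using b D j by (intro P.add.finprod_singleton) (auto simp: Pi_iff)
    finally have "up_ring.monom P b 0 \<otimes>\<^bsub>P\<^esub> ?D j = comb ?c \<oplus>\<^bsub>P\<^esub> \<zero>\<^bsub>P\<^esub>"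
      using b D by simp
    moreover have "?c \<in> {1..n} \<rightarrow> carrier R" using b by auto
    ultimately show ?thesis unfolding T_def using I.zero_closed by blast
  qed
  \<comment> \<open>Index 0 is included because t F_1 produces the term a F_0 = 0.\<close>
  have T_basis': "up_ring.monom P b 0 \<otimes>\<^bsub>P\<^esub> ?D j \<in> T" if "b \<in> carrier R" "j \<le> n" for b j
  proof (cases "j = 0")
    case True
    then show ?thesis using that T_ideal[OF I.zero_closed] by simp
  qed (use T_basis that in simp)
  have T_times: "t \<otimes>\<^bsub>P\<^esub> p \<in> T" if p: "p \<in> T" for p
  proof -
    obtain c i where c: "c \<in> {1..n} \<rightarrow> carrier R" "i \<in> ?I" "p = comb c \<oplus>\<^bsub>P\<^esub> i"
      using p unfolding T_def by blast
    have step: "t \<otimes>\<^bsub>P\<^esub> (up_ring.monom P b 0 \<otimes>\<^bsub>P\<^esub> ?D j) \<in> T" if b: "b \<in> carrier R" and j: "j \<in> {1..n}" for b j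
    proof -
      obtain k where k: "j = Suc k" using j by (cases j) auto
      have mb: "up_ring.monom P b 0 \<in> carrier P" using b by simp
      have mba: "up_ring.monom P b 0 \<otimes>\<^bsub>P\<^esub> (ca \<otimes>\<^bsub>P\<^esub> q) = up_ring.monom P (b \<otimes>\<^bsub>R\<^esub> a) 0 \<otimes>\<^bsub>P\<^esub> q" if "q \<in> carrier P" for q
        using that a b monom_mult[of b a 0 0] by (simp add: ca_def P.m_assoc)
      show ?thesis
      proof (cases "j < n")
        case True
        have "t \<otimes>\<^bsub>P\<^esub> (up_ring.monom P b 0 \<otimes>\<^bsub>P\<^esub> ?D j) = up_ring.monom P b 0 \<otimes>\<^bsub>P\<^esub> (t \<otimes>\<^bsub>P\<^esub> ?D j)"
          using mb t D by (simp add: P.m_lcomm)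
        also have "\<dots> = up_ring.monom P b 0 \<otimes>\<^bsub>P\<^esub> ?D (Suc j) \<oplus>\<^bsub>P\<^esub> up_ring.monom P (b \<otimes>\<^bsub>R\<^esub> a) 0 \<otimes>\<^bsub>P\<^esub> ?D k"
          unfolding k P.dickson_times[OF ca t] using mb ca D mba[OF D[of k]] by (simp add: P.r_distr)
        finally show ?thesis
          using T_add T_basis'[of b "Suc j"] T_basis'[of "b \<otimes>\<^bsub>R\<^esub> a" k] a b True k by simp
      next
        case False
        then have jn: "j = n" using j by simp
        \<comment> \<open>At the top index, t d = d + a d - (1 + a - t) d, whose last term lies in
          the ideal for d = F_n.\<close>
        have eq: "t \<otimes>\<^bsub>P\<^esub> (u \<otimes>\<^bsub>P\<^esub> d) = u \<otimes>\<^bsub>P\<^esub> d \<oplus>\<^bsub>P\<^esub> u \<otimes>\<^bsub>P\<^esub> (ca \<otimes>\<^bsub>P\<^esub> d) \<oplus>\<^bsub>P\<^esub>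
            (\<ominus>\<^bsub>P\<^esub> u) \<otimes>\<^bsub>P\<^esub> ((\<one>\<^bsub>P\<^esub> \<oplus>\<^bsub>P\<^esub> ca \<ominus>\<^bsub>P\<^esub> t) \<otimes>\<^bsub>P\<^esub> d)"
          if "u \<in> carrier P" "d \<in> carrier P" for u d
          using that ca t by algebra
        have "(\<ominus>\<^bsub>P\<^esub> up_ring.monom P b 0) \<otimes>\<^bsub>P\<^esub> ?w \<in> T"
          by (rule T_ideal[OF I.I_l_closed[OF wI]]) (use mb in simp)
        then show ?thesis
          unfolding jn eq[OF mb D] mba[OF D]
          using T_add T_basis'[of b n] T_basis'[of "b \<otimes>\<^bsub>R\<^esub> a" n] a b by simp
      qed
    qed
    have fin: "(\<Oplus>\<^bsub>P\<^esub>j\<in>A. f j) \<in> T" if "finite A" "\<forall>j\<in>A. f j \<in> T \<inter> carrier P" for A and f :: "nat \<Rightarrow> _"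
      using that
    proof (induction A rule: finite_induct)
      case empty
      then show ?case using T_ideal[OF I.zero_closed] by simp
    next
      case (insert j A)
      then have "(\<Oplus>\<^bsub>P\<^esub>j\<in>insert j A. f j) = f j \<oplus>\<^bsub>P\<^esub> (\<Oplus>\<^bsub>P\<^esub>j\<in>A. f j)"
        by (intro P.finsum_insert) auto
      then show ?case using insert T_add by simp
    qed
    have "t \<otimes>\<^bsub>P\<^esub> comb c = (\<Oplus>\<^bsub>P\<^esub>j\<in>{1..n}. t \<otimes>\<^bsub>P\<^esub> (up_ring.monom P (c j) 0 \<otimes>\<^bsub>P\<^esub> ?D j))"
      unfolding comb_def using c(1) t D by (intro P.finsum_rdistr) (auto simp: Pi_iff)
    also have "\<dots> \<in> T"
      using step c(1) t D by (intro fin) (auto simp: Pi_iff)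
    finally have "t \<otimes>\<^bsub>P\<^esub> comb c \<oplus>\<^bsub>P\<^esub> t \<otimes>\<^bsub>P\<^esub> i \<in> T"
      using T_add T_ideal[OF I.I_l_closed[OF c(2) t]] by blast
    then show ?thesis
      using t comb_closed[OF c(1)] I.Icarr[OF c(2)] by (simp add: c(3) P.r_distr)
  qed
  \<comment> \<open>Constants are multiples of F_1 = 1, and multiplication by t reaches the higher
    powers.\<close>
  have T_monom: "up_ring.monom P b k \<in> T" if b: "b \<in> carrier R" for b k
  proof (induction k)
    case 0
    then show ?case using T_basis[OF b, of 1] n b by simp
  next
    case (Suc k)
    have "t \<otimes>\<^bsub>P\<^esub> up_ring.monom P b k = up_ring.monom P b (Suc k)"
      using monom_mult[of "\<one>\<^bsub>R\<^esub>" b 1 k] b by (simp add: t_def)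
    then show ?case using T_times[OF Suc] by simp
  qed
  have T_all: "p \<in> T" if p: "p \<in> carrier P" for p
  proof -
    have cp: "up_ring.coeff P p i \<in> carrier R" for i using p by simp
    have "(\<Oplus>\<^bsub>P\<^esub>i\<in>{..k}. up_ring.monom P (up_ring.coeff P p i) i) \<in> T" for k
    proof (induction k)
      case 0
      then show ?case using T_monom[OF cp] p by (simp add: P.finsum_insert)
    next
      case (Suc k)
      then show ?case
        using T_add[OF T_monom[OF cp, of "Suc k" "Suc k"] Suc] cp by (subst P.finsum_Suc) auto
    qed
    then show ?thesis using up_repr[OF p] by metis
  qed
  have "a_kernel P S ?\<Theta> = ?I"
  proof
    show "?I \<subseteq> a_kernel P S ?\<Theta>"
      by (rule P.genideal_minimal[OF ring_hom_ring.kernel_is_ideal[OF \<Theta>r]]) (use w \<Theta>w in \<open>unfold a_kernel_def', blast\<close>)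
    show "a_kernel P S ?\<Theta> \<subseteq> ?I"
    proof
      fix p assume "p \<in> a_kernel P S ?\<Theta>"
      then have p: "p \<in> carrier P" "?\<Theta> p = \<zero>\<^bsub>S\<^esub>" unfolding a_kernel_def' by blast+
      obtain c i where c: "c \<in> {1..n} \<rightarrow> carrier R" "i \<in> ?I" "p = comb c \<oplus>\<^bsub>P\<^esub> i"
        using T_all[OF p(1)] unfolding T_def by blast
      have "?\<Theta> i = \<zero>\<^bsub>S\<^esub>"
        using c(2) \<open>?I \<subseteq> a_kernel P S ?\<Theta>\<close> unfolding a_kernel_def' by blast
      then have "(\<Oplus>\<^bsub>S\<^esub>j\<in>{1..n}. \<iota> (c j) \<otimes>\<^bsub>S\<^esub> ?E j) = \<zero>\<^bsub>S\<^esub>"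
        using p(2) \<Theta>comb[OF c(1)] comb_closed[OF c(1)] I.Icarr[OF c(2)] \<Theta>.hom_closed[OF comb_closed[OF c(1)]]
        by (simp add: c(3))
      then have "c j = \<zero>\<^bsub>R\<^esub>" if "j \<in> {1..n}" for j using indep[OF c(1)] that by blast
      then have "comb c = comb (\<lambda>_. \<zero>\<^bsub>R\<^esub>)"
        unfolding comb_def using D by (intro P.finsum_cong') auto
      then show "p \<in> ?I"
        using c comb_zero I.Icarr[OF c(2)] by simp
    qed
  qed
  moreover have "?\<Theta> ` carrier P = carrier S"
  proof
    show "?\<Theta> ` carrier P \<subseteq> carrier S" using \<Theta>.hom_closed by auto
    show "carrier S \<subseteq> ?\<Theta> ` carrier P"
    proof
      fix x assume "x \<in> carrier S"
      then obtain c where c: "c \<in> {1..n} \<rightarrow> carrier R"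
        and x: "x = (\<Oplus>\<^bsub>S\<^esub>j\<in>{1..n}. \<iota> (c j) \<otimes>\<^bsub>S\<^esub> ?E j)"
        using span by blast
      show "x \<in> ?\<Theta> ` carrier P"
        unfolding x \<Theta>comb[OF c, symmetric] by (rule imageI[OF comb_closed[OF c]])
    qed
  qed
  ultimately have "P Quot ?I \<simeq> S"
    using ring_hom_ring.FactRing_iso[OF \<Theta>r] by metis
  then show ?thesis
    by (rule ring_iso_sym[rotated]) (rule I.quotient_is_ring)
qed

section \<open>r(H) as a commutative ring that is free over r(KG)\<close>

section \<open>The Green ring of the rank one Hopf algebra\<close>

lemma (in ring) diff_add_cancel: "x \<in> carrier R \<Longrightarrow> y \<in> carrier R \<Longrightarrow> (x \<ominus> y) \<oplus> y = x"
  by (simp add: minus_eq a_assoc l_neg)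

lemma (in ring) commute_diff:
  assumes "x \<in> carrier R" "y \<in> carrier R" "u \<in> carrier R" "x \<otimes> u = u \<otimes> x" "y \<otimes> u = u \<otimes> y"
  shows "(x \<ominus> y) \<otimes> u = u \<otimes> (x \<ominus> y)"
  using assms by (simp add: minus_eq l_distr r_distr l_minus r_minus)

lemma (in ring) commute_mult:
  assumes "x \<in> carrier R" "y \<in> carrier R" "u \<in> carrier R" "x \<otimes> u = u \<otimes> x" "y \<otimes> u = u \<otimes> y"
  shows "(x \<otimes> y) \<otimes> u = u \<otimes> (x \<otimes> y)"
  using assms by (metis m_assoc m_closed)

text \<open>Covers the inclusion of r(KG) before it is known to be multiplicative, and the
  coefficient maps, for which only additivity is asserted.\<close>

locale additive_map = dom: abelian_group R + cod: abelian_group S for R (structure) and S (structure) +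
  fixes \<phi>
  assumes closed: "x \<in> carrier R \<Longrightarrow> \<phi> x \<in> carrier S"
    and add: "x \<in> carrier R \<Longrightarrow> y \<in> carrier R \<Longrightarrow> \<phi> (x \<oplus>\<^bsub>R\<^esub> y) = \<phi> x \<oplus>\<^bsub>S\<^esub> \<phi> y"
begin

lemma zero: "\<phi> \<zero>\<^bsub>R\<^esub> = \<zero>\<^bsub>S\<^esub>"
  using add[of "\<zero>\<^bsub>R\<^esub>" "\<zero>\<^bsub>R\<^esub>"] closed[of "\<zero>\<^bsub>R\<^esub>"] cod.add.r_cancel_one[of "\<phi> \<zero>\<^bsub>R\<^esub>" "\<phi> \<zero>\<^bsub>R\<^esub>"] by simp

lemma diff:
  assumes "x \<in> carrier R" "y \<in> carrier R"
  shows "\<phi> (x \<ominus>\<^bsub>R\<^esub> y) = \<phi> x \<ominus>\<^bsub>S\<^esub> \<phi> y"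
proof -
  have "x = (x \<ominus>\<^bsub>R\<^esub> y) \<oplus>\<^bsub>R\<^esub> y"
    using assms by (simp add: dom.minus_eq dom.a_assoc dom.l_neg)
  then have "\<phi> x = \<phi> (x \<ominus>\<^bsub>R\<^esub> y) \<oplus>\<^bsub>S\<^esub> \<phi> y"
    using add[of "x \<ominus>\<^bsub>R\<^esub> y" y] assms by simp
  then show ?thesis
    using assms closed[of "x \<ominus>\<^bsub>R\<^esub> y"] closed[of y]
    by (simp add: cod.minus_eq cod.a_assoc cod.r_neg)
qed

lemma finsum:
  assumes "finite A" "f \<in> A \<rightarrow> carrier R"
  shows "\<phi> (finsum R f A) = finsum S (\<lambda>j. \<phi> (f j)) A"
  using assms
proof (induction A rule: finite_induct)
  case empty
  then show ?case by (simp add: zero)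
next
  case (insert j A)
  then have "f j \<in> carrier R" "f \<in> A \<rightarrow> carrier R" "(\<lambda>j. \<phi> (f j)) \<in> A \<rightarrow> carrier S"
    using closed by auto
  then show ?case using insert by (simp add: dom.finsum_insert cod.finsum_insert closed add)
qed

end

locale rank_one_datum = group_datum_char_0 G \<chi> g for G (structure)
  and \<chi> :: "'a \<Rightarrow> 'k::field_char_0" and g +
  fixes n :: nat
  assumes order_n: "has_mult_order (\<chi> g) n" and two_le_n: "2 \<le> n"

sublocale rank_one_datum \<subseteq> K: green_model G \<chi> g KG group_tm 1
  by (rule green_model_KG)

sublocale rank_one_datum \<subseteq> S: green_model G \<chi> g "H n" rank_one_tm n
  by (rule green_model_H[OF order_n two_le_n])

context rank_one_datum
begin

abbreviation "r_KG \<equiv> green_ring KG"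
abbreviation "r_H \<equiv> green_ring (H n)"

lemma gmodule_n: "gmodule 1 M \<Longrightarrow> gmodule n M"
  using gmodule_mono[of 1 M n] two_le_n by simp

lemma cring_KG: "cring r_KG"
proof -
  have "x \<otimes>\<^bsub>r_KG\<^esub> y = y \<otimes>\<^bsub>r_KG\<^esub> x" if x: "x \<in> carrier r_KG" and y: "y \<in> carrier r_KG" for x y
    using x
  proof (induction x rule: K.green_induct)
    case (cl M)
    note M = cl
    show ?case
      using y
    proof (induction y rule: K.green_induct)
      case (cl M')
      note M' = cl
      show ?case
        unfolding K.cl_gtensor[OF M M', symmetric] K.cl_gtensor[OF M' M, symmetric]
        by (rule K.cl_eqI[OF gtensor_comm[OF M M']])
    next
      case (diff y y')
      show ?case
        by (rule K.GR.commute_diff[OF diff(1,2) K.cl_closed[OF M] diff(3)[symmetric] diff(4)[symmetric],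
              symmetric])
    qed (simp add: K.cl_closed[OF M])
  next
    case (diff x x')
    show ?case by (rule K.GR.commute_diff[OF diff(1,2) y diff(3,4)])
  qed (simp add: y)
  then show ?thesis
    by (rule cring.intro[OF K.GR.ring_axioms comm_monoid.intro[OF K.GR.monoid_axioms comm_monoid_axioms.intro]])
qed

text \<open>Pullback along the projection of \<open>H\<close> onto \<open>KG\<close> that kills
  \<open>y\<close>. A module of degree 1 is also one of degree n with the same sums and tensor
  products, so sending its class to its class is additive and multiplicative.\<close>

lemma inclusion_exists: "\<exists>\<iota>. \<iota> \<in> Ring.ring_hom r_KG r_H \<and>
    (\<forall>M :: ('a, nat, 'k) gmod. gmodule 1 M \<longrightarrow> \<iota> (K.cl M) = S.cl M)"
proof -
  obtain \<iota> where \<iota>: "\<And>x. x \<in> carrier r_KG \<Longrightarrow> \<iota> x \<in> carrier r_H"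
      "\<And>x y. x \<in> carrier r_KG \<Longrightarrow> y \<in> carrier r_KG \<Longrightarrow> \<iota> (x \<oplus>\<^bsub>r_KG\<^esub> y) = \<iota> x \<oplus>\<^bsub>r_H\<^esub> \<iota> y"
      and \<iota>_cl: "\<And>M :: ('a, nat, 'k) gmod. gmodule 1 M \<Longrightarrow> \<iota> (K.cl M) = S.cl M"
  proof (rule K.green_lift[OF S.GR.abelian_group_axioms, where v = "S.cl :: ('a, nat, 'k) gmod \<Rightarrow> _"])
    show "S.cl M = S.cl M'" if "giso M M'" for M M' :: "('a, nat, 'k) gmod"
      by (rule S.cl_eqI[OF that])
    show "S.cl M'' = S.cl M \<oplus>\<^bsub>r_H\<^esub> S.cl M'"
      if "gmodule 1 M" "gmodule 1 M'" "giso M'' (gsum M M')" for M M' M'' :: "('a, nat, 'k) gmod"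
      using S.cl_eqI[OF that(3)] S.cl_gsum[OF that(1,2)[THEN gmodule_n]] by simp
    show "S.cl M \<in> carrier r_H" if "gmodule 1 M" for M :: "('a, nat, 'k) gmod"
      by (rule S.cl_closed[OF gmodule_n[OF that]])
  qed (rule that, assumption+)
  interpret \<iota>: additive_map r_KG r_H \<iota>
    by unfold_locales (use \<iota> in auto)
  have mult: "\<iota> (x \<otimes>\<^bsub>r_KG\<^esub> y) = \<iota> x \<otimes>\<^bsub>r_H\<^esub> \<iota> y" if x: "x \<in> carrier r_KG" and y: "y \<in> carrier r_KG" for x y
    using x
  proof (induction x rule: K.green_induct)
    case (cl M)
    note M = cl
    show ?case
      using y
    proof (induction y rule: K.green_induct)
      case (cl M')
      obtain W :: "('a, nat, 'k) gmod" where W: "gmodule 1 W" "giso (gtensor M M') W"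
        by (rule K.gmod_nat[OF K.gmodule_tensor[OF M cl]])
      have "K.cl M \<otimes>\<^bsub>r_KG\<^esub> K.cl M' = K.cl W"
        using K.cl_gtensor[OF M cl] K.cl_eqI[OF W(2)] by simp
      moreover have "S.cl M \<otimes>\<^bsub>r_H\<^esub> S.cl M' = S.cl W"
        using S.cl_gtensor[OF M[THEN gmodule_n] cl[THEN gmodule_n]] S.cl_eqI[OF W(2)] by simp
      ultimately show ?case
        using \<iota>_cl M cl W(1) by simp
    next
      case (diff y y')
      have Mc: "K.cl M \<in> carrier r_KG" by (rule K.cl_closed[OF M])
      have "K.cl M \<otimes>\<^bsub>r_KG\<^esub> (y \<ominus>\<^bsub>r_KG\<^esub> y') = K.cl M \<otimes>\<^bsub>r_KG\<^esub> y \<ominus>\<^bsub>r_KG\<^esub> K.cl M \<otimes>\<^bsub>r_KG\<^esub> y'"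
        using Mc diff(1,2) by (simp add: K.GR.minus_eq K.GR.r_distr K.GR.r_minus)
      moreover have "\<iota> (K.cl M) \<otimes>\<^bsub>r_H\<^esub> (\<iota> y \<ominus>\<^bsub>r_H\<^esub> \<iota> y') =
          \<iota> (K.cl M) \<otimes>\<^bsub>r_H\<^esub> \<iota> y \<ominus>\<^bsub>r_H\<^esub> \<iota> (K.cl M) \<otimes>\<^bsub>r_H\<^esub> \<iota> y'"
        using \<iota>.closed Mc diff(1,2) by (simp add: S.GR.minus_eq S.GR.r_distr S.GR.r_minus)
      ultimately show ?case
        using diff Mc by (simp add: \<iota>.diff)
    qed (simp add: \<iota>.zero \<iota>.closed K.cl_closed[OF M])
  next
    case (diff x x')
    have "(x \<ominus>\<^bsub>r_KG\<^esub> x') \<otimes>\<^bsub>r_KG\<^esub> y = x \<otimes>\<^bsub>r_KG\<^esub> y \<ominus>\<^bsub>r_KG\<^esub> x' \<otimes>\<^bsub>r_KG\<^esub> y"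
      using y diff(1,2) by (simp add: K.GR.minus_eq K.GR.l_distr K.GR.l_minus)
    moreover have "(\<iota> x \<ominus>\<^bsub>r_H\<^esub> \<iota> x') \<otimes>\<^bsub>r_H\<^esub> \<iota> y = \<iota> x \<otimes>\<^bsub>r_H\<^esub> \<iota> y \<ominus>\<^bsub>r_H\<^esub> \<iota> x' \<otimes>\<^bsub>r_H\<^esub> \<iota> y"
      using \<iota>.closed y diff(1,2) by (simp add: S.GR.minus_eq S.GR.l_distr S.GR.l_minus)
    ultimately show ?case
      using diff y by (simp add: \<iota>.diff)
  qed (simp add: \<iota>.zero \<iota>.closed y)
  have "\<iota> \<one>\<^bsub>r_KG\<^esub> = \<one>\<^bsub>r_H\<^esub>"
    using \<iota>_cl[OF gmodule_uniserial[OF order_refl]] K.cl_unit S.cl_unit by simp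
  then have "\<iota> \<in> Ring.ring_hom r_KG r_H"
    using \<iota>.closed \<iota>.add mult by (intro ring_hom_memI)
  then show ?thesis using \<iota>_cl by blast
qed

definition incl where "incl = (SOME \<iota>. \<iota> \<in> Ring.ring_hom r_KG r_H \<and>
    (\<forall>M :: ('a, nat, 'k) gmod. gmodule 1 M \<longrightarrow> \<iota> (K.cl M) = S.cl M))"

lemma incl_hom: "incl \<in> Ring.ring_hom r_KG r_H"
  and incl_cl: "gmodule 1 M \<Longrightarrow> incl (K.cl M) = S.cl M" for M :: "('a, nat, 'k) gmod"
  using someI_ex[OF inclusion_exists] unfolding incl_def[symmetric] by blast+

lemma incl_closed: "x \<in> carrier r_KG \<Longrightarrow> incl x \<in> carrier r_H"
  by (rule ring_hom_closed[OF incl_hom])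

abbreviation cu :: "nat \<Rightarrow> _" where "cu j \<equiv> S.cl (uniserial j)"

lemma cu_closed: "j \<le> n \<Longrightarrow> cu j \<in> carrier r_H"
  by (rule S.cl_closed[OF gmodule_uniserial])

text \<open>The uniserial module of length 0 is zero. It plays the part of F_0 in the recursion for
  j = 1.\<close>

lemma cu_0: "cu 0 = \<zero>\<^bsub>r_H\<^esub>"
  by (rule S.cl_zero[OF gmodule_uniserial]) (auto simp: vecs_def fun_eq_iff)

lemma cl_gtensor_uniserial:
  "gmodule 1 V \<Longrightarrow> j \<le> n \<Longrightarrow> S.cl (gtensor V (uniserial j)) = incl (K.cl V) \<otimes>\<^bsub>r_H\<^esub> cu j"
  for V :: "('a, nat, 'k) gmod"
  by (simp add: incl_cl S.cl_gtensor gmodule_n gmodule_uniserial)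

lemma cu_2_times:
  assumes "1 \<le> j" "j < n"
  shows "cu 2 \<otimes>\<^bsub>r_H\<^esub> cu j = cu (Suc j) \<oplus>\<^bsub>r_H\<^esub> incl (K.cl inv_char) \<otimes>\<^bsub>r_H\<^esub> cu (j - 1)"
proof -
  have m: "gmodule n (uniserial (Suc j))" "gmodule n (gtensor inv_char (uniserial (j - 1)))"
    using assms by (auto intro!: S.gmodule_tensor gmodule_n[OF gmodule_inv_char] gmodule_uniserial)
  show ?thesis
    using S.cl_gtensor[OF gmodule_uniserial gmodule_uniserial, of 2 j] two_le_n assms
      S.cl_eqI[OF uniserial_two_tensor[OF order_n assms]] S.cl_gsum[OF m]
      cl_gtensor_uniserial[OF gmodule_inv_char, of "j - 1"] by simp
qed

lemma cu_2_times_top: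
  "cu 2 \<otimes>\<^bsub>r_H\<^esub> cu n = cu n \<oplus>\<^bsub>r_H\<^esub> incl (K.cl inv_char) \<otimes>\<^bsub>r_H\<^esub> cu n"
proof -
  have m: "gmodule n (uniserial n)" "gmodule n (gtensor inv_char (uniserial n))"
    by (auto intro!: S.gmodule_tensor gmodule_n[OF gmodule_inv_char] gmodule_uniserial)
  show ?thesis
    using S.cl_gtensor[OF gmodule_uniserial gmodule_uniserial, of 2 n] two_le_n
      S.cl_eqI[OF uniserial_two_tensor_top[OF order_n two_le_n]] S.cl_gsum[OF m]
      cl_gtensor_uniserial[OF gmodule_inv_char, of n] by simp
qed

text \<open>Splitting off the pieces of length k + 1 leaves a module of degree k, so by induction
  each module class is a sum of terms [W] [U_j].\<close>

lemma uniserial_induct [consumes 1, case_names basis diff]: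
  assumes x: "x \<in> carrier r_H"
    and basis: "\<And>b j. b \<in> carrier r_KG \<Longrightarrow> 1 \<le> j \<Longrightarrow> j \<le> n \<Longrightarrow> Q (incl b \<otimes>\<^bsub>r_H\<^esub> cu j)"
    and diff: "\<And>x y. x \<in> carrier r_H \<Longrightarrow> y \<in> carrier r_H \<Longrightarrow> Q x \<Longrightarrow> Q y \<Longrightarrow> Q (x \<ominus>\<^bsub>r_H\<^esub> y)"
  shows "Q x"
proof -
  have bc: "incl b \<otimes>\<^bsub>r_H\<^esub> cu j \<in> carrier r_H" if "b \<in> carrier r_KG" "j \<le> n" for b j
    using that by (simp add: incl_closed cu_closed)
  \<comment> \<open>Zero and sums are recovered from differences: 0 = x - x and x + y = x - (0 -
    y).\<close>
  have zero: "Q \<zero>\<^bsub>r_H\<^esub>"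
    using diff[OF bc bc basis basis, of "\<zero>\<^bsub>r_KG\<^esub>" 1 "\<zero>\<^bsub>r_KG\<^esub>" 1] two_le_n bc[of "\<zero>\<^bsub>r_KG\<^esub>" 1]
    by (simp add: S.GR.minus_eq S.GR.r_neg)
  have add: "Q (x \<oplus>\<^bsub>r_H\<^esub> y)" if "x \<in> carrier r_H" "y \<in> carrier r_H" "Q x" "Q y" for x y
    using diff[OF that(1) _ that(3) diff[OF _ that(2) zero that(4)]] that(1,2)
    by (simp add: S.GR.minus_eq)
  have gm: "Q (S.cl M)" if "gmodule k M" "k \<le> n" for k and M :: "('a, nat, 'k) gmod"
    using that
  proof (induction k arbitrary: M)
    \<comment> \<open>Degree 0 says that every vector f = y^0 f is zero.\<close>
    case 0
    then have "gvecs M \<subseteq> {\<lambda>_. 0}"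
      using gm_nil[OF 0(1)] by auto
    then show ?case
      using S.cl_zero[OF gmodule_mono[OF 0]] zero by simp
  next
    case (Suc k)
    obtain W M' :: "('a, nat, 'k) gmod" where W: "gmodule 1 W" and M': "gmodule k M'"
        and iso: "giso M (gsum (gtensor W (uniserial (Suc k))) M')"
      by (rule split_uniserial[OF Suc.prems disjI2[OF order_n]])
    have kn: "k \<le> n" using Suc.prems(2) by simp
    have T: "gmodule n (gtensor W (uniserial (Suc k)))" and M'n: "gmodule n M'"
      using S.gmodule_tensor[OF gmodule_n[OF W] gmodule_uniserial[OF Suc.prems(2)]]
        gmodule_mono[OF M' kn] by auto
    have "S.cl M = incl (K.cl W) \<otimes>\<^bsub>r_H\<^esub> cu (Suc k) \<oplus>\<^bsub>r_H\<^esub> S.cl M'"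
      using S.cl_eqI[OF iso] S.cl_gsum[OF T M'n] cl_gtensor_uniserial[OF W Suc.prems(2)] by simp
    then show ?case
      using add[OF bc S.cl_closed[OF M'n] basis Suc.IH[OF M' kn], of "K.cl W" "Suc k"]
        K.cl_closed[OF W] Suc.prems(2) by simp
  qed
  show ?thesis
    using x by (induction x rule: S.green_induct) (simp_all add: zero gm diff)
qed

text \<open>r(H) is generated by r(KG) and [U_2], so an element commuting with these is central.
  r(KG) commutes with itself by the flip and with [U_2] by the flip corrected by powers of g, so
  both are central, and then every element is.\<close>

lemma cring_H: "cring r_H"
proof -
  \<comment> \<open>The recursion \<open>cu_2_times\<close> expresses each [U_j] through [U_2] and
    r(KG), so whatever commutes with those commutes with [U_j] and with all of r(H).\<close>
  have central: "x \<otimes>\<^bsub>r_H\<^esub> u = u \<otimes>\<^bsub>r_H\<^esub> x"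
    if u: "u \<in> carrier r_H" and b: "\<And>b. b \<in> carrier r_KG \<Longrightarrow> incl b \<otimes>\<^bsub>r_H\<^esub> u = u \<otimes>\<^bsub>r_H\<^esub> incl b"
      and z: "cu 2 \<otimes>\<^bsub>r_H\<^esub> u = u \<otimes>\<^bsub>r_H\<^esub> cu 2" and x: "x \<in> carrier r_H" for u x
  proof -
    let ?a = "incl (K.cl inv_char)"
    have a: "K.cl inv_char \<in> carrier r_KG" by (rule K.cl_closed[OF gmodule_inv_char])
    have cu2: "cu 2 \<in> carrier r_H" using two_le_n by (rule cu_closed)
    have cu: "cu j \<otimes>\<^bsub>r_H\<^esub> u = u \<otimes>\<^bsub>r_H\<^esub> cu j" if "j \<le> n" for j
      using that
    proof (induction j rule: less_induct)
      case (less j)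
      consider "j = 0" | "j = 1" | k where "j = Suc (Suc k)"
        by (cases j; cases "j - 1") auto
      then show ?case
      proof cases
        case (3 k)
        have c: "cu k \<in> carrier r_H" "cu (Suc k) \<in> carrier r_H" "cu j \<in> carrier r_H"
          using less.prems 3 by (simp_all add: cu_closed)
        have "cu 2 \<otimes>\<^bsub>r_H\<^esub> cu (Suc k) = cu j \<oplus>\<^bsub>r_H\<^esub> ?a \<otimes>\<^bsub>r_H\<^esub> cu k"
          using cu_2_times[of "Suc k"] less.prems 3 by simp
        then have eq: "cu j = cu 2 \<otimes>\<^bsub>r_H\<^esub> cu (Suc k) \<ominus>\<^bsub>r_H\<^esub> ?a \<otimes>\<^bsub>r_H\<^esub> cu k"
          using c incl_closed[OF a] by (simp add: S.GR.minus_eq S.GR.a_assoc S.GR.r_neg)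
        have "cu k \<otimes>\<^bsub>r_H\<^esub> u = u \<otimes>\<^bsub>r_H\<^esub> cu k" "cu (Suc k) \<otimes>\<^bsub>r_H\<^esub> u = u \<otimes>\<^bsub>r_H\<^esub> cu (Suc k)"
          using less 3 by simp_all
        then show ?thesis
          unfolding eq using c cu2 incl_closed[OF a]
          by (intro S.GR.commute_diff S.GR.commute_mult u z b[OF a] S.GR.m_closed)
      qed (use u S.cl_unit in \<open>simp_all add: cu_0\<close>)
    qed
    show ?thesis
      using x
    proof (induction x rule: uniserial_induct)
      case (basis b j)
      then show ?case
        by (intro S.GR.commute_mult u b cu incl_closed cu_closed)
    next
      case (diff x y)
      then show ?case by (intro S.GR.commute_diff u)
    qed
  qed
  have z_incl: "cu 2 \<otimes>\<^bsub>r_H\<^esub> incl b = incl b \<otimes>\<^bsub>r_H\<^esub> cu 2" if "b \<in> carrier r_KG" for b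
    using that
  proof (induction b rule: K.green_induct)
    case zero
    have "incl \<zero>\<^bsub>r_KG\<^esub> = \<zero>\<^bsub>r_H\<^esub>"
      by (rule ring_hom_zero[OF incl_hom K.GR.ring_axioms S.GR.ring_axioms])
    then show ?case using cu_closed[OF two_le_n] by simp
  next
    case (cl M)
    then show ?case
      using S.cl_eqI[OF gtensor_uniserial_comm[OF cl two_le_n S.n]]
        cl_gtensor_uniserial[OF cl two_le_n]
        S.cl_gtensor[OF gmodule_uniserial[OF two_le_n] gmodule_n[OF cl]] by (simp add: incl_cl)
  next
    case (diff x y)
    interpret \<iota>: additive_map r_KG r_H incl
      by unfold_locales (use incl_closed ring_hom_add[OF incl_hom] in auto)
    show ?case
      unfolding \<iota>.diff[OF diff(1,2)]
      by (rule S.GR.commute_diff[symmetric])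
        (use diff cu_closed[OF two_le_n] in \<open>simp_all add: incl_closed\<close>)
  qed
  \<comment> \<open>The criterion \<open>central\<close> is used three times: for elements of r(KG),
    then for [U_2], then for arbitrary elements.\<close>
  have incl_central: "x \<otimes>\<^bsub>r_H\<^esub> incl b = incl b \<otimes>\<^bsub>r_H\<^esub> x" if "b \<in> carrier r_KG" "x \<in> carrier r_H" for b x
  proof (rule central[OF incl_closed[OF that(1)] _ z_incl[OF that(1)] that(2)])
    show "incl b' \<otimes>\<^bsub>r_H\<^esub> incl b = incl b \<otimes>\<^bsub>r_H\<^esub> incl b'" if "b' \<in> carrier r_KG" for b'
      using that \<open>b \<in> carrier r_KG\<close> ring_hom_mult[OF incl_hom] cring.cring_simprules(14)[OF cring_KG]
      by metis
  qed
  have z_central: "x \<otimes>\<^bsub>r_H\<^esub> cu 2 = cu 2 \<otimes>\<^bsub>r_H\<^esub> x" if "x \<in> carrier r_H" for x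
    by (rule central[OF cu_closed[OF two_le_n] _ refl that])
      (use incl_central cu_closed[OF two_le_n] in simp)
  have "x \<otimes>\<^bsub>r_H\<^esub> y = y \<otimes>\<^bsub>r_H\<^esub> x" if "x \<in> carrier r_H" "y \<in> carrier r_H" for x y
    by (rule central[OF that(2) _ _ that(1)]) (use that incl_central z_central in simp_all)
  then show ?thesis
    by (rule cring.intro[OF S.GR.ring_axioms comm_monoid.intro[OF S.GR.monoid_axioms comm_monoid_axioms.intro]])
qed

text \<open>Solved for [U_(j+1)], the rule for [U_2] [U_j] is the Dickson recursion with a =
  [\<chi>^(-1)], and it holds as long as j < n.\<close>

lemma cu_dickson:
  assumes "1 \<le> j" "j \<le> n"
  shows "dickson r_H (incl (K.cl inv_char)) (cu 2) j = cu j"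
proof -
  interpret cring r_H by (rule cring_H)
  have a: "incl (K.cl inv_char) \<in> carrier r_H"
    by (rule incl_closed[OF K.cl_closed[OF gmodule_inv_char]])
  have "Suc i \<le> n \<Longrightarrow> dickson r_H (incl (K.cl inv_char)) (cu 2) i = cu i \<and>
      dickson r_H (incl (K.cl inv_char)) (cu 2) (Suc i) = cu (Suc i)" for i
  proof (induction i)
    case 0
    then show ?case using cu_0 S.cl_unit by simp
  next
    case (Suc i)
    have c: "cu i \<in> carrier r_H" "cu (Suc (Suc i)) \<in> carrier r_H"
      using Suc.prems by (simp_all add: cu_closed)
    have "dickson r_H (incl (K.cl inv_char)) (cu 2) (Suc (Suc i)) =
        cu 2 \<otimes>\<^bsub>r_H\<^esub> cu (Suc i) \<ominus>\<^bsub>r_H\<^esub> incl (K.cl inv_char) \<otimes>\<^bsub>r_H\<^esub> cu i"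
      using Suc by (simp only: dickson_Suc_Suc[OF a cu_closed[OF two_le_n]])
    also have "\<dots> = cu (Suc (Suc i))"
      using cu_2_times[of "Suc i"] Suc.prems c a by (simp add: S.GR.minus_eq S.GR.a_assoc S.GR.r_neg)
    finally show ?case using Suc by simp
  qed
  from this[of "j - 1"] show ?thesis using assms by simp
qed

text \<open>\<open>gimage i\<close> reads off the coefficient of \<open>M[i + 1]\<close> and kills the shorter uniserial modules.\<close>

lemma coefficient_map:
  assumes i: "i < n"
  obtains \<phi> where "additive_map r_H r_KG \<phi>"
    "\<And>b j. b \<in> carrier r_KG \<Longrightarrow> j \<le> Suc i \<Longrightarrow>
      \<phi> (incl b \<otimes>\<^bsub>r_H\<^esub> cu j) = (if j = Suc i then b else \<zero>\<^bsub>r_KG\<^esub>)"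
proof -
  \<comment> \<open>The image is determined up to isomorphism only, so one is chosen; its class does
    not depend on the choice.\<close>
  define im where "im M = (SOME W :: ('a, nat, 'k) gmod. gimage i M W)" for M :: "('a, nat, 'k) gmod"
  have im: "gimage i M (im M)" if "gmodule n M" for M
    unfolding im_def by (rule someI_ex[OF gimage_exists[OF that]])
  have im1: "gmodule 1 (im M)" if "gmodule n M" for M
    using im[OF that] by (simp add: gimage_def)
  obtain \<phi> where \<phi>: "\<And>x. x \<in> carrier r_H \<Longrightarrow> \<phi> x \<in> carrier r_KG"
      "\<And>x y. x \<in> carrier r_H \<Longrightarrow> y \<in> carrier r_H \<Longrightarrow> \<phi> (x \<oplus>\<^bsub>r_H\<^esub> y) = \<phi> x \<oplus>\<^bsub>r_KG\<^esub> \<phi> y"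
      and \<phi>_cl: "\<And>M :: ('a, nat, 'k) gmod. gmodule n M \<Longrightarrow> \<phi> (S.cl M) = K.cl (im M)"
  proof (rule S.green_lift[OF K.GR.abelian_group_axioms, where v = "\<lambda>M. K.cl (im M)"])
    show "K.cl (im M) \<in> carrier r_KG" if "gmodule n M" for M
      by (rule K.cl_closed[OF im1[OF that]])
    show "K.cl (im M) = K.cl (im M')" if "gmodule n M" "gmodule n M'" "giso M M'" for M M'
      by (rule K.cl_eqI[OF gimage_cong[OF that im[OF that(1)] im[OF that(2)]]])
    show "K.cl (im M'') = K.cl (im M) \<oplus>\<^bsub>r_KG\<^esub> K.cl (im M')"
      if "gmodule n M" "gmodule n M'" "gmodule n M''" "giso M'' (gsum M M')" for M M' M''
    proof -
      have "giso (im M'') (gsum (im M) (im M'))"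
        by (rule gimage_cong[OF that(3) gmodule_gsum[OF that(1,2)] that(4) im[OF that(3)]
              gimage_gsum[OF that(1,2) im[OF that(1)] im[OF that(2)]]])
      from K.cl_eqI[OF this] show ?thesis
        unfolding K.cl_gsum[OF im1[OF that(1)] im1[OF that(2)]] .
    qed
  qed (rule that, assumption+)
  have add: "additive_map r_H r_KG \<phi>"
    by unfold_locales (use \<phi> in auto)
  interpret \<phi>: additive_map r_H r_KG \<phi> by (rule add)
  interpret \<iota>: additive_map r_KG r_H incl
    by unfold_locales (use incl_closed ring_hom_add[OF incl_hom] in auto)
  have "\<phi> (incl b \<otimes>\<^bsub>r_H\<^esub> cu j) = (if j = Suc i then b else \<zero>\<^bsub>r_KG\<^esub>)"
    if b: "b \<in> carrier r_KG" and j: "j \<le> Suc i" for b j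
    using b
  proof (induction b rule: K.green_induct)
    case zero
    then show ?case using cu_closed[of j] i j by (simp add: \<iota>.zero \<phi>.zero)
  next
    case (cl V)
    have jn: "j \<le> n" using i j by simp
    have T: "gmodule n (gtensor V (uniserial j))"
      by (rule S.gmodule_tensor[OF gmodule_n[OF cl] gmodule_uniserial[OF jn]])
    obtain M :: "('a, nat, 'k) gmod" where M: "gmodule n M" "giso (gtensor V (uniserial j)) M"
      by (rule S.gmod_nat[OF T])
    have eq: "\<phi> (incl (K.cl V) \<otimes>\<^bsub>r_H\<^esub> cu j) = K.cl (im M)"
      using cl_gtensor_uniserial[OF cl jn] S.cl_eqI[OF M(2)] \<phi>_cl[OF M(1)] by simp
    show ?case
    proof (cases "j = Suc i")
      case True
      have "giso V (im M)"
        by (rule gimage_cong[OF T M(1) M(2) _ im[OF M(1)]])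
          (use gimage_gtensor_uniserial[OF cl] True in simp)
      from K.cl_eqI[OF this] show ?thesis using eq True by simp
    next
      case False
      obtain W :: "('a, nat, 'k) gmod" where W: "gimage i (gtensor V (uniserial j)) W"
        using gimage_exists[OF T] by blast
      have "giso W (im M)"
        by (rule gimage_cong[OF T M(1) M(2) W im[OF M(1)]])
      moreover have "K.cl W = \<zero>\<^bsub>r_KG\<^esub>"
        by (rule K.cl_zero) (use W gimage_gtensor_uniserial_zero[OF cl _ W] False j in \<open>simp_all add: gimage_def\<close>)
      ultimately show ?thesis using eq K.cl_eqI[of W "im M"] False by simp
    qed
  next
    case (diff x y)
    have c: "cu j \<in> carrier r_H" using cu_closed i j by simp
    have "incl (x \<ominus>\<^bsub>r_KG\<^esub> y) \<otimes>\<^bsub>r_H\<^esub> cu j = incl x \<otimes>\<^bsub>r_H\<^esub> cu j \<ominus>\<^bsub>r_H\<^esub> incl y \<otimes>\<^bsub>r_H\<^esub> cu j"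
      unfolding \<iota>.diff[OF diff(1,2)] using c diff(1,2)[THEN incl_closed]
      by (simp add: S.GR.minus_eq S.GR.l_distr S.GR.l_minus)
    then show ?case
      using \<phi>.diff[of "incl x \<otimes>\<^bsub>r_H\<^esub> cu j" "incl y \<otimes>\<^bsub>r_H\<^esub> cu j"] diff c
      by (auto simp: incl_closed K.GR.minus_eq)
  qed
  with add show thesis by (rule that)
qed

lemma uniserial_span:
  assumes "x \<in> carrier r_H"
  shows "\<exists>c\<in>{1..n} \<rightarrow> carrier r_KG. x = (\<Oplus>\<^bsub>r_H\<^esub>j\<in>{1..n}. incl (c j) \<otimes>\<^bsub>r_H\<^esub> cu j)"
  using assms
proof (induction x rule: uniserial_induct)
  case (basis b j)
  let ?c = "\<lambda>k. if k = j then b else \<zero>\<^bsub>r_KG\<^esub>"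
  have i0: "incl \<zero>\<^bsub>r_KG\<^esub> = \<zero>\<^bsub>r_H\<^esub>"
    by (rule ring_hom_zero[OF incl_hom K.GR.ring_axioms S.GR.ring_axioms])
  have "(\<Oplus>\<^bsub>r_H\<^esub>k\<in>{1..n}. incl (?c k) \<otimes>\<^bsub>r_H\<^esub> cu k) =
      (\<Oplus>\<^bsub>r_H\<^esub>k\<in>{1..n}. if j = k then incl b \<otimes>\<^bsub>r_H\<^esub> cu k else \<zero>\<^bsub>r_H\<^esub>)"
    using basis by (intro S.GR.finsum_cong') (auto simp: incl_closed cu_closed i0)
  also have "\<dots> = incl b \<otimes>\<^bsub>r_H\<^esub> cu j"
    using basis by (intro S.GR.finsum_singleton) (auto simp: incl_closed cu_closed)
  finally show ?case using basis by (intro bexI[of _ ?c]) auto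
next
  case (diff x y)
  obtain c d where c: "c \<in> {1..n} \<rightarrow> carrier r_KG" "x = (\<Oplus>\<^bsub>r_H\<^esub>j\<in>{1..n}. incl (c j) \<otimes>\<^bsub>r_H\<^esub> cu j)"
    and d: "d \<in> {1..n} \<rightarrow> carrier r_KG" "y = (\<Oplus>\<^bsub>r_H\<^esub>j\<in>{1..n}. incl (d j) \<otimes>\<^bsub>r_H\<^esub> cu j)"
    using diff(3,4) by blast
  let ?e = "\<lambda>j. c j \<ominus>\<^bsub>r_KG\<^esub> d j"
  let ?s = "\<Oplus>\<^bsub>r_H\<^esub>j\<in>{1..n}. incl (?e j) \<otimes>\<^bsub>r_H\<^esub> cu j"
  have cc: "c j \<in> carrier r_KG" and dd: "d j \<in> carrier r_KG" if "j \<in> {1..n}" for j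
    using c(1) d(1) that by auto
  have "x = (\<Oplus>\<^bsub>r_H\<^esub>j\<in>{1..n}. incl (?e j) \<otimes>\<^bsub>r_H\<^esub> cu j \<oplus>\<^bsub>r_H\<^esub> incl (d j) \<otimes>\<^bsub>r_H\<^esub> cu j)"
    unfolding c(2)
  proof (rule S.GR.finsum_cong')
    fix j assume j: "j \<in> {1..n}"
    have "c j = ?e j \<oplus>\<^bsub>r_KG\<^esub> d j" using K.GR.diff_add_cancel[OF cc[OF j] dd[OF j]] by simp
    then have "incl (c j) = incl (?e j) \<oplus>\<^bsub>r_H\<^esub> incl (d j)"
      using ring_hom_add[OF incl_hom, of "?e j" "d j"] cc[OF j] dd[OF j] by simp
    then show "incl (c j) \<otimes>\<^bsub>r_H\<^esub> cu j = incl (?e j) \<otimes>\<^bsub>r_H\<^esub> cu j \<oplus>\<^bsub>r_H\<^esub> incl (d j) \<otimes>\<^bsub>r_H\<^esub> cu j"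
      using cc[OF j] dd[OF j] j by (simp add: S.GR.l_distr incl_closed cu_closed)
  qed (use cc dd in \<open>auto simp: incl_closed cu_closed\<close>)
  also have "\<dots> = ?s \<oplus>\<^bsub>r_H\<^esub> y"
    unfolding d(2) using cc dd by (intro S.GR.finsum_addf) (auto simp: incl_closed cu_closed)
  finally have "x = ?s \<oplus>\<^bsub>r_H\<^esub> y" .
  moreover have "?s \<in> carrier r_H"
    using cc dd by (intro S.GR.finsum_closed) (auto simp: incl_closed cu_closed)
  ultimately have "x \<ominus>\<^bsub>r_H\<^esub> y = ?s"
    using diff(2) by (simp add: S.GR.minus_eq S.GR.a_assoc S.GR.r_neg)
  moreover have "?e \<in> {1..n} \<rightarrow> carrier r_KG" using cc dd by auto
  ultimately show ?case by (intro bexI[of _ ?e])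
qed

text \<open>Downward induction on j: the coefficients beyond j are already zero, and the map reading
  off the coefficient of [U_j] kills all shorter uniserial modules.\<close>

lemma uniserial_independent:
  assumes c: "c \<in> {1..n} \<rightarrow> carrier r_KG"
    and sum: "(\<Oplus>\<^bsub>r_H\<^esub>j\<in>{1..n}. incl (c j) \<otimes>\<^bsub>r_H\<^esub> cu j) = \<zero>\<^bsub>r_H\<^esub>"
    and j: "j \<in> {1..n}"
  shows "c j = \<zero>\<^bsub>r_KG\<^esub>"
  using j
proof (induction "n - j" arbitrary: j rule: less_induct)
  case less
  obtain i where i: "j = Suc i" using less.prems by (cases j) auto
  obtain \<phi> where \<phi>: "additive_map r_H r_KG \<phi>"
    and \<phi>_basis: "\<And>b j. b \<in> carrier r_KG \<Longrightarrow> j \<le> Suc i \<Longrightarrow>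
      \<phi> (incl b \<otimes>\<^bsub>r_H\<^esub> cu j) = (if j = Suc i then b else \<zero>\<^bsub>r_KG\<^esub>)"
    by (rule coefficient_map[of i]) (use less.prems i that in auto)
  interpret \<phi>: additive_map r_H r_KG \<phi> by (rule \<phi>)
  have i0: "incl \<zero>\<^bsub>r_KG\<^esub> = \<zero>\<^bsub>r_H\<^esub>"
    by (rule ring_hom_zero[OF incl_hom K.GR.ring_axioms S.GR.ring_axioms])
  have cc: "c k \<in> carrier r_KG" if "k \<in> {1..n}" for k using c that by auto
  have "\<zero>\<^bsub>r_KG\<^esub> = \<phi> (\<Oplus>\<^bsub>r_H\<^esub>k\<in>{1..n}. incl (c k) \<otimes>\<^bsub>r_H\<^esub> cu k)"
    unfolding sum \<phi>.zero ..
  also have "\<dots> = (\<Oplus>\<^bsub>r_KG\<^esub>k\<in>{1..n}. \<phi> (incl (c k) \<otimes>\<^bsub>r_H\<^esub> cu k))"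
    using cc by (intro \<phi>.finsum) (auto simp: incl_closed cu_closed)
  also have "\<dots> = (\<Oplus>\<^bsub>r_KG\<^esub>k\<in>{1..n}. if j = k then c k else \<zero>\<^bsub>r_KG\<^esub>)"
  proof (rule K.GR.finsum_cong')
    fix k assume k: "k \<in> {1..n}"
    show "\<phi> (incl (c k) \<otimes>\<^bsub>r_H\<^esub> cu k) = (if j = k then c k else \<zero>\<^bsub>r_KG\<^esub>)"
    proof (cases "k \<le> j")
      case True
      then show ?thesis using \<phi>_basis[OF cc[OF k], of k] i by auto
    next
      case False
      then have "c k = \<zero>\<^bsub>r_KG\<^esub>" using less.hyps[of k] k by auto
      then show ?thesis using False k by (simp add: i0 cu_closed \<phi>.zero)
    qed
  qed (use cc in auto)
  also have "\<dots> = c j"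
    using cc less.prems by (intro K.GR.finsum_singleton) auto
  finally show ?case by simp
qed

lemma character_module_class: "green_class KG (character_module (\<lambda>h. inverse (\<chi> h))) = K.cl inv_char"
proof -
  let ?R = "character_module (\<lambda>h. inverse (\<chi> h)) :: ('a, 'k) rep"
  have idx: "idx (group_tm ?R) = {..<Suc 0}" by (simp add: character_module_def)
  have rop: "rop ?R h f = gop inv_char h f" if f: "f \<in> vecs {..<Suc 0}" for h f
    using vecsD[OF f] by (auto simp: character_module_def mop_def fun_eq_iff gchar_def)
  have g: "gmodule 1 (group_tm ?R)"
  proof (rule gmoduleI)
    show "lin (yop (group_tm ?R))" by (rule linI) simp_all
    fix f assume "f \<in> gvecs (group_tm ?R)"
    then have f: "f \<in> vecs {..<Suc 0}" unfolding idx .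
    have s: "(\<lambda>i. inverse (\<chi> h) * f i) \<in> vecs {..<Suc 0}" for h
      using f by (auto simp: vecs_def)
    show "gop (group_tm ?R) h f \<in> gvecs (group_tm ?R)"
      "yop (group_tm ?R) (gop (group_tm ?R) h f) = (\<lambda>i. \<chi> h * gop (group_tm ?R) h (yop (group_tm ?R) f) i)" for h
      unfolding idx using s[of h] by (simp_all add: rop[OF f] rop vecs_zero gchar_def)
    show "gop (group_tm ?R) \<one> f = f"
      using rop[OF f] by (simp add: gchar_def character_one)
    show "gop (group_tm ?R) (h \<otimes> k) f = gop (group_tm ?R) h (gop (group_tm ?R) k f)"
      if "h \<in> carrier G" "k \<in> carrier G" for h k
      using rop[OF f] rop[OF s] that by (simp add: gchar_def character_mult mult.assoc)
  qed (simp_all add: lin_mop vecs_zero)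
  then have "is_module KG ?R"
    by (simp add: is_module_KG_iff character_module_def)
  moreover have "giso (group_tm ?R) inv_char"
  proof (rule giso_ident[OF g])
    show "idx inv_char = idx (group_tm ?R)" unfolding idx by (auto simp: gchar_def)
    show "gop inv_char h f = gop (group_tm ?R) h f" if "f \<in> gvecs (group_tm ?R)" for h f
      using rop[of f h] that unfolding idx by simp
    show "yop inv_char f = yop (group_tm ?R) f" for f by (simp add: gchar_def)
  qed
  ultimately show ?thesis
    using K.green_class_cl[of ?R] K.cl_eqI[of "group_tm ?R" inv_char] by simp
qed

end

theorem theorem4p3:
  fixes G :: "('g, 'm) monoid_scheme"
    and \<chi> :: "'g \<Rightarrow> 'k::{alg_closed_field, field_char_0}"
    and g :: 'g and n :: nat
  assumes "group_datum G \<chi> g"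
    and "has_mult_order (\<chi> g) n"
    and "n \<ge> 2"
  shows "let KG = group_hopf G;
             R = green_ring KG;
             a = green_class KG (character_module (\<lambda>h. inverse (\<chi> h)));
             P = UP R;
             ca = up_ring.monom P a 0;
             z = up_ring.monom P \<one>\<^bsub>R\<^esub> 1;
             I = Idl\<^bsub>P\<^esub> {((\<one>\<^bsub>P\<^esub> \<oplus>\<^bsub>P\<^esub> ca) \<ominus>\<^bsub>P\<^esub> z) \<otimes>\<^bsub>P\<^esub> dickson P ca z n}
         in green_ring (rank_one_hopf G \<chi> g n) \<simeq> P Quot I"
proof -
  interpret rank_one_datum G \<chi> g n
    by (intro rank_one_datum.intro group_datum_char_0.intro rank_one_datum_axioms.intro assms)
  interpret P: UP_cring r_KG "UP r_KG"
    by (intro UP_cring.intro cring_KG)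
  let ?a = "K.cl inv_char"
  have a: "?a \<in> carrier r_KG" by (rule K.cl_closed[OF gmodule_inv_char])
  have ia: "incl ?a \<in> carrier r_H" by (rule incl_closed[OF a])
  have z: "cu 2 \<in> carrier r_H" by (rule cu_closed) (rule assms(3))
  have sum: "(\<Oplus>\<^bsub>r_H\<^esub>j\<in>{1..n}. incl (c j) \<otimes>\<^bsub>r_H\<^esub> dickson r_H (incl ?a) (cu 2) j) =
      (\<Oplus>\<^bsub>r_H\<^esub>j\<in>{1..n}. incl (c j) \<otimes>\<^bsub>r_H\<^esub> cu j)" if "c \<in> {1..n} \<rightarrow> carrier r_KG" for c
    using that by (intro S.GR.finsum_cong') (auto simp: cu_dickson incl_closed cu_closed Pi_iff)
  show ?thesis
    unfolding Let_def character_module_class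
  \<comment> \<open>The variable is evaluated at [U_2], the class \<open>cu 2\<close>; by
    \<open>cu_dickson\<close> the values of F_1, ..., F_n are then [U_1], ..., [U_n].\<close>
  proof (rule P.presentation_by_dickson[OF cring_H incl_hom a z])
    \<comment> \<open>Expanded so that \<open>cu_2_times_top\<close>, that is [U_2] [U_n] = [U_n] +
      a [U_n], makes the two parts cancel.\<close>
    have e: "(\<one>\<^bsub>r_H\<^esub> \<oplus>\<^bsub>r_H\<^esub> u \<ominus>\<^bsub>r_H\<^esub> v) \<otimes>\<^bsub>r_H\<^esub> w = (w \<oplus>\<^bsub>r_H\<^esub> u \<otimes>\<^bsub>r_H\<^esub> w) \<ominus>\<^bsub>r_H\<^esub> v \<otimes>\<^bsub>r_H\<^esub> w"
      if "u \<in> carrier r_H" "v \<in> carrier r_H" "w \<in> carrier r_H" for u v w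
      using that by (simp add: S.GR.minus_eq S.GR.l_distr S.GR.l_minus)
    have cn: "cu n \<in> carrier r_H" by (rule cu_closed) simp
    show "(\<one>\<^bsub>r_H\<^esub> \<oplus>\<^bsub>r_H\<^esub> incl ?a \<ominus>\<^bsub>r_H\<^esub> cu 2) \<otimes>\<^bsub>r_H\<^esub> dickson r_H (incl ?a) (cu 2) n = \<zero>\<^bsub>r_H\<^esub>"
      using assms(3) cu_dickson[of n] e[OF ia z cn] cu_2_times_top ia cn by (simp add: S.GR.minus_eq S.GR.r_neg)
    show "\<exists>c\<in>{1..n} \<rightarrow> carrier r_KG.
        x = (\<Oplus>\<^bsub>r_H\<^esub>j\<in>{1..n}. incl (c j) \<otimes>\<^bsub>r_H\<^esub> dickson r_H (incl ?a) (cu 2) j)"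
      if x: "x \<in> carrier r_H" for x
    proof -
      obtain c where c: "c \<in> {1..n} \<rightarrow> carrier r_KG"
        and eq: "x = (\<Oplus>\<^bsub>r_H\<^esub>j\<in>{1..n}. incl (c j) \<otimes>\<^bsub>r_H\<^esub> cu j)"
        using uniserial_span[OF x] by blast
      show ?thesis
        by (rule bexI[OF _ c]) (simp only: sum[OF c] eq)
    qed
    show "c j = \<zero>\<^bsub>r_KG\<^esub>"
      if "c \<in> {1..n} \<rightarrow> carrier r_KG"
        "(\<Oplus>\<^bsub>r_H\<^esub>j\<in>{1..n}. incl (c j) \<otimes>\<^bsub>r_H\<^esub> dickson r_H (incl ?a) (cu 2) j) = \<zero>\<^bsub>r_H\<^esub>"
        "j \<in> {1..n}" for c j
      using uniserial_independent[OF that(1) _ that(3)] that(2) sum[OF that(1)] by simp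
  qed (use assms(3) in simp)
qed

end
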